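(* Let $M$ and $N$ be loopless matroids. There is an isomorphism of graded $\underline{\mathrm{CH}}(M)\otimes\underline{\mathrm{CH}}(N)$-modules $$\underline{\mathrm{CH}}(M\oplus N)\;\simeq\;\underline{\mathrm{CH}}(M)\otimes\underline{\mathrm{CH}}(N)\;\oplus\;\bigoplus_{F,G}\underline{\mathrm{CH}}(M^F\oplus N^G)\otimes\underline{\mathrm{CH}}(M_F)\otimes\underline{\mathrm{CH}}(N_G)[-1],$$ where the direct sum is over all pairs $(F,G)$ of flats $F\subsetneq M$ and $G\subsetneq N$ (including $F=\emptyset$ and $G=\emptyset$).
   Context: Matroids are finite and loopless (i.e. $\emptyset$ is a flat); a matroid's name also denotes its ground set. For a flat $F$ of $M$: the restriction $M^F$ is the matroid on $F$ whose flats are the flats of $M$ contained in $F$; the contraction $M_F$ is the matroid on $M\setminus F$ whose flats are $K\setminus F$ for flats $K\supseteq F$ of $M$. $M\oplus N$ is the matroid on the disjoint union of the ground sets whose flats are $F\cup G$ with $F$ a flat of $M$, $G$ a flat of $N$. Chow ring: $\underline{\mathrm{CH}}(M)=\mathbb{Q}[x_F : F \text{ a nonempty proper flat of } M]/(I+J)$, where $I$ is generated by $\sum_{F\not\ni i}x_F-\sum_{F\not\ni j}x_F$ for $i,j$ in the ground set, and $J$ by $x_Fx_{F'}$ for incomparable flats $F,F'$. It is graded by $\deg x_F=1$; if the ground set is empty, $\underline{\mathrm{CH}}(M)=\mathbb{Q}$. Tensor products are over $\mathbb{Q}$, and $A[-1]$ is the graded module with $A[-1]^k=A^{k-1}$.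 Ring map $\iota_{M,N}:\underline{\mathrm{CH}}(M)\otimes\underline{\mathrm{CH}}(N)\hookrightarrow\underline{\mathrm{CH}}(M\oplus N)$: $x_F\otimes 1\mapsto\sum_{G'}x_{F\cup G'}$ and $1\otimes x_G\mapsto\sum_{F'}x_{F'\cup G}$, sums over all flats $G'$ of $N$, resp. $F'$ of $M$ (including the empty flat and the whole ground set). This makes $\underline{\mathrm{CH}}(M\oplus N)$ a $\underline{\mathrm{CH}}(M)\otimes\underline{\mathrm{CH}}(N)$-module. Pullback: for a nonempty proper flat $F$ of $M$, $\underline{\varphi}_M^F:\underline{\mathrm{CH}}(M)\to\underline{\mathrm{CH}}(M_F)\otimes\underline{\mathrm{CH}}(M^F)$ is the graded ring homomorphism with $x_K\mapsto 1\otimes x_K$ if $K\subsetneq F$, $x_K\mapsto x_{K\setminus F}\otimes1$ if $K\supsetneq F$, $x_K\mapsto 0$ if $K,F$ are incomparable, and $x_F\mapsto-1\otimes\sum_{i\in K}x_K-\sum_{j\notin L}x_L\otimes1$, where $i\in F$ and $j\in M\setminus F$ are any fixed elements, $K$ runs over nonempty proper flats of $M^F$ containing $i$ and $L$ over nonempty proper flats of $M_F$ not containing $j$. For $F=\emptyset$, $\underline{\varphi}^F_M$ is the identity (one tensor factor being $\mathbb{Q}$). Module structure on the summand indexed by $(F,G)$: via the ring homomorphism obtained by composing $\underline{\varphi}_M^F\otimes\underline{\varphi}_N^G$, the permutation of tensor factors to $\underline{\mathrm{CH}}(M^F)\otimes\underline{\mathrm{CH}}(N^G)\otimes\underline{\mathrm{CH}}(M_F)\otimes\underline{\mathrm{CH}}(N_G)$,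 and $\iota_{M^F,N^G}\otimes\mathrm{id}\otimes\mathrm{id}$. For $(F,G)=(\emptyset,\emptyset)$ this summand is $\underline{\mathrm{CH}}(M)\otimes\underline{\mathrm{CH}}(N)[-1]$ with its usual module structure. *)

theory Defs
  imports
    Complex_Main
    "HOL-Algebra.QuotRing"
    "HOL-Algebra.Module"
    "HOL-Library.Poly_Mapping"
begin

section \<open>Matroids given by their flats\<close>

record 'a matroid =
  ground :: "'a set"
  flats :: "'a set set"

text \<open>The last axiom says that the minimal flats strictly containing a flat \<open>F\<close>
  partition the complement of \<open>F\<close>.\<close>

locale matroid =
  fixes M :: "'a matroid"
  assumes finite_ground: "finite (ground M)"
    and flats_subset: "flats M \<subseteq> Pow (ground M)"
    and ground_flat: "ground M \<in> flats M"
    and inter_flat: "F \<in> flats M \<Longrightarrow> G \<in> flats M \<Longrightarrow> F \<inter> G \<in> flats M"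
    and cover_flat: "F \<in> flats M \<Longrightarrow> i \<in> ground M - F \<Longrightarrow>
      \<exists>!G. G \<in> flats M \<and> i \<in> G \<and> F \<subset> G \<and> \<not> (\<exists>H\<in>flats M. F \<subset> H \<and> H \<subset> G)"

locale loopless_matroid = matroid +
  assumes empty_flat: "{} \<in> flats M"

definition restriction :: "'a matroid \<Rightarrow> 'a set \<Rightarrow> 'a matroid" where
  "restriction M F = \<lparr>ground = F, flats = {K \<in> flats M. K \<subseteq> F}\<rparr>"

definition contraction :: "'a matroid \<Rightarrow> 'a set \<Rightarrow> 'a matroid" where
  "contraction M F = \<lparr>ground = ground M - F, flats = {K - F | K. K \<in> flats M \<and> F \<subseteq> K}\<rparr>"

definition matroid_sum :: "'a matroid \<Rightarrow> 'b matroid \<Rightarrow> ('a + 'b) matroid" where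
  "matroid_sum M N = \<lparr>ground = ground M <+> ground N,
     flats = {F <+> G | F G. F \<in> flats M \<and> G \<in> flats N}\<rparr>"

definition proper_flats :: "'a matroid \<Rightarrow> 'a set set" where
  "proper_flats M = {F \<in> flats M. F \<noteq> {} \<and> F \<noteq> ground M}"


section \<open>Graded rings and modules\<close>

text \<open>A graded module, with \<open>homog A k\<close> its part of degree \<open>k\<close> (all gradings here are
  concentrated in degrees \<open>k \<ge> 0\<close>). The same record type serves for graded
  \<open>\<rat>\<close>-algebras, with scalars of type \<^typ>\<open>rat\<close>. When a record is used merely as a module,
  its fields \<open>mult\<close> and \<open>one\<close> are meaningless, as for \<^locale>\<open>module\<close>.\<close>

record ('r, 'm) graded = "('r, 'm) module" +
  homog :: "nat \<Rightarrow> 'm set"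

locale graded_group = abelian_group M for M :: "('r, 'm) graded" (structure) +
  assumes homog_subgroup: "additive_subgroup (homog M k) M"
    and homog_decomp: "x \<in> carrier M \<Longrightarrow>
      \<exists>!c. (\<forall>k. c k \<in> homog M k) \<and> finite {k. c k \<noteq> \<zero>} \<and> x = (\<Oplus>k\<in>{k. c k \<noteq> \<zero>}. c k)"

locale graded_ring = cring R + graded_group R for R :: "('q, 'r) graded" (structure) +
  assumes one_homog: "\<one> \<in> homog R 0"
    and mult_homog: "a \<in> homog R i \<Longrightarrow> b \<in> homog R j \<Longrightarrow> a \<otimes> b \<in> homog R (i + j)"

locale graded_module = R?: graded_ring R + M?: module R M + M?: graded_group M
  for R :: "('q, 'r) graded" (structure) and M :: "('r, 'm) graded" (structure) +
  assumes smult_homog: "a \<in> homog R i \<Longrightarrow> x \<in> homog M j \<Longrightarrow> a \<odot>\<^bsub>M\<^esub> x \<in> homog M (i + j)"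

locale graded_module_iso = A: graded_module R A + B: graded_module R B
  for R :: "('q, 'r) graded" and A :: "('r, 'm) graded" and B :: "('r, 'n) graded" +
  fixes f :: "'m \<Rightarrow> 'n"
  assumes bij: "bij_betw f (carrier A) (carrier B)"
    and map_add: "x \<in> carrier A \<Longrightarrow> y \<in> carrier A \<Longrightarrow> f (x \<oplus>\<^bsub>A\<^esub> y) = f x \<oplus>\<^bsub>B\<^esub> f y"
    and map_smult: "a \<in> carrier R \<Longrightarrow> x \<in> carrier A \<Longrightarrow> f (a \<odot>\<^bsub>A\<^esub> x) = a \<odot>\<^bsub>B\<^esub> f x"
    and map_homog: "f ` homog A k = homog B k"

definition restrict_scalars :: "('s \<Rightarrow> 'r) \<Rightarrow> ('q, 'r) graded \<Rightarrow> ('s, 'r) graded" where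
  "restrict_scalars h A = \<lparr>carrier = carrier A, mult = mult A, one = one A,
     zero = zero A, add = add A, smult = (\<lambda>s x. h s \<otimes>\<^bsub>A\<^esub> x), homog = homog A\<rparr>"

text \<open>The shift \<open>A[-1]\<close>.\<close>

definition shift :: "('r, 'm) graded \<Rightarrow> ('r, 'm) graded" where
  "shift A = A\<lparr>homog := (\<lambda>k. if k = 0 then {\<zero>\<^bsub>A\<^esub>} else homog A (k - 1))\<rparr>"

definition sum_module ::
  "('r, 'm) graded \<Rightarrow> ('r, 'n) graded \<Rightarrow> ('r, 'm \<times> 'n) graded" where
  "sum_module A B = \<lparr>carrier = carrier A \<times> carrier B, mult = undefined, one = undefined,
     zero = (\<zero>\<^bsub>A\<^esub>, \<zero>\<^bsub>B\<^esub>),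
     add = (\<lambda>(a, b) (a', b'). (a \<oplus>\<^bsub>A\<^esub> a', b \<oplus>\<^bsub>B\<^esub> b')),
     smult = (\<lambda>r (a, b). (r \<odot>\<^bsub>A\<^esub> a, r \<odot>\<^bsub>B\<^esub> b)),
     homog = (\<lambda>k. homog A k \<times> homog B k)\<rparr>"

text \<open>The direct sum over a finite index set.\<close>

definition big_sum_module ::
  "'i set \<Rightarrow> ('i \<Rightarrow> ('r, 'm) graded) \<Rightarrow> ('r, 'i \<Rightarrow> 'm) graded" where
  "big_sum_module I A = \<lparr>carrier = (\<Pi>\<^sub>E i\<in>I. carrier (A i)), mult = undefined, one = undefined,
     zero = (\<lambda>i\<in>I. \<zero>\<^bsub>A i\<^esub>),
     add = (\<lambda>x y. \<lambda>i\<in>I. x i \<oplus>\<^bsub>A i\<^esub> y i),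
     smult = (\<lambda>r x. \<lambda>i\<in>I. r \<odot>\<^bsub>A i\<^esub> x i),
     homog = (\<lambda>k. \<Pi>\<^sub>E i\<in>I. homog (A i) k)\<rparr>"


section \<open>Quotients, polynomial rings and tensor products over the rationals\<close>

definition quotient_graded :: "(rat, 'p) graded \<Rightarrow> 'p set \<Rightarrow> (rat, 'p set) graded" where
  "quotient_graded P I = \<lparr>carrier = carrier (P Quot I), mult = mult (P Quot I), one = one (P Quot I),
     zero = zero (P Quot I), add = add (P Quot I),
     smult = (\<lambda>q X. \<Union>x\<in>X. I +>\<^bsub>P\<^esub> (q \<odot>\<^bsub>P\<^esub> x)),
     homog = (\<lambda>k. (\<lambda>x. I +>\<^bsub>P\<^esub> x) ` homog P k)\<rparr>"

text \<open>\<open>\<rat>[x\<^sub>v : v \<in> V]\<close>: a monomial is a finitely supported exponent function, and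
  multiplication of polynomials is the convolution product of \<^theory>\<open>HOL-Library.Poly_Mapping\<close>.\<close>

type_synonym 'v rat_poly = "('v \<Rightarrow>\<^sub>0 nat) \<Rightarrow>\<^sub>0 rat"

definition poly_ring :: "'v set \<Rightarrow> (rat, 'v rat_poly) graded" where
  "poly_ring V = \<lparr>carrier = {p. \<forall>m\<in>Poly_Mapping.keys p. Poly_Mapping.keys m \<subseteq> V},
     mult = (*), one = 1, zero = 0, add = (+),
     smult = (\<lambda>q. Poly_Mapping.map ((*) q)),
     homog = (\<lambda>k. {p. \<forall>m\<in>Poly_Mapping.keys p. Poly_Mapping.keys m \<subseteq> V \<and>
       (\<Sum>v\<in>Poly_Mapping.keys m. Poly_Mapping.lookup m v) = k})\<rparr>"

definition Var :: "'v \<Rightarrow> 'v rat_poly" where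
  "Var v = Poly_Mapping.single (Poly_Mapping.single v 1) 1"

definition poly_eval :: "(rat, 'c) graded \<Rightarrow> ('v \<Rightarrow> 'c) \<Rightarrow> 'v rat_poly \<Rightarrow> 'c" where
  "poly_eval C a p = (\<Oplus>\<^bsub>C\<^esub>m\<in>Poly_Mapping.keys p. Poly_Mapping.lookup p m \<odot>\<^bsub>C\<^esub>
     (\<Otimes>\<^bsub>C\<^esub>v\<in>Poly_Mapping.keys m. a v [^]\<^bsub>C\<^esub> Poly_Mapping.lookup m v))"

text \<open>The tensor product \<open>A \<otimes> B\<close> is the free \<open>\<rat>\<close>-vector space on the pairs \<open>(a, b)\<close>, with the
  multiplication extending \<open>(a, b) (a', b') = (aa', bb')\<close>, modulo the bilinearity relations.
  These relations are stable under multiplication by pairs, so the ideal they generate is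
  just their \<open>\<rat>\<close>-span. In \<open>pairs_ring\<close> the sets \<open>homog\<close> do not form a grading (the pairs
  \<open>(a, 0)\<close> lie in several of them); only their images in the quotient do.\<close>

type_synonym ('a, 'b) tens = "('a \<times> 'b \<Rightarrow>\<^sub>0 rat) set"

definition pairs_ring ::
  "(rat, 'a) graded \<Rightarrow> (rat, 'b) graded \<Rightarrow> (rat, 'a \<times> 'b \<Rightarrow>\<^sub>0 rat) graded" where
  "pairs_ring A B = \<lparr>carrier = {p. Poly_Mapping.keys p \<subseteq> carrier A \<times> carrier B},
     mult = (\<lambda>p p'. \<Sum>(a, b)\<in>Poly_Mapping.keys p. \<Sum>(a', b')\<in>Poly_Mapping.keys p'.
       Poly_Mapping.single (a \<otimes>\<^bsub>A\<^esub> a', b \<otimes>\<^bsub>B\<^esub> b')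
         (Poly_Mapping.lookup p (a, b) * Poly_Mapping.lookup p' (a', b'))),
     one = Poly_Mapping.single (\<one>\<^bsub>A\<^esub>, \<one>\<^bsub>B\<^esub>) 1, zero = 0, add = (+),
     smult = (\<lambda>q. Poly_Mapping.map ((*) q)),
     homog = (\<lambda>k. {p. \<forall>(a, b)\<in>Poly_Mapping.keys p.
       \<exists>i j. i + j = k \<and> a \<in> homog A i \<and> b \<in> homog B j})\<rparr>"

definition bilinear_rels ::
  "(rat, 'a) graded \<Rightarrow> (rat, 'b) graded \<Rightarrow> ('a \<times> 'b \<Rightarrow>\<^sub>0 rat) set" where
  "bilinear_rels A B =
     {Poly_Mapping.single (a \<oplus>\<^bsub>A\<^esub> a', b) 1 - Poly_Mapping.single (a, b) 1
        - Poly_Mapping.single (a', b) 1 | a a' b.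
        a \<in> carrier A \<and> a' \<in> carrier A \<and> b \<in> carrier B} \<union>
     {Poly_Mapping.single (a, b \<oplus>\<^bsub>B\<^esub> b') 1 - Poly_Mapping.single (a, b) 1
        - Poly_Mapping.single (a, b') 1 | a b b'.
        a \<in> carrier A \<and> b \<in> carrier B \<and> b' \<in> carrier B} \<union>
     {Poly_Mapping.single (q \<odot>\<^bsub>A\<^esub> a, b) 1 - Poly_Mapping.single (a, b) q | q a b.
        a \<in> carrier A \<and> b \<in> carrier B} \<union>
     {Poly_Mapping.single (a, q \<odot>\<^bsub>B\<^esub> b) 1 - Poly_Mapping.single (a, b) q | q a b.
        a \<in> carrier A \<and> b \<in> carrier B}"

definition tensor_ideal ::
  "(rat, 'a) graded \<Rightarrow> (rat, 'b) graded \<Rightarrow> ('a \<times> 'b \<Rightarrow>\<^sub>0 rat) set" where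
  "tensor_ideal A B = Idl\<^bsub>pairs_ring A B\<^esub> (bilinear_rels A B)"

definition tensor ::
  "(rat, 'a) graded \<Rightarrow> (rat, 'b) graded \<Rightarrow> (rat, ('a, 'b) tens) graded" where
  "tensor A B = quotient_graded (pairs_ring A B) (tensor_ideal A B)"

text \<open>The element \<open>a \<otimes> b\<close>.\<close>

definition tens :: "(rat, 'a) graded \<Rightarrow> (rat, 'b) graded \<Rightarrow> 'a \<Rightarrow> 'b \<Rightarrow> ('a, 'b) tens" where
  "tens A B a b = tensor_ideal A B +>\<^bsub>pairs_ring A B\<^esub> Poly_Mapping.single (a, b) 1"

text \<open>The ring homomorphism into \<open>C\<close> with \<open>a \<otimes> b \<mapsto> h a \<cdot> k b\<close>, for algebra
  homomorphisms \<open>h\<close> and \<open>k\<close> into \<open>C\<close>. The value does not depend on the representative,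
  so the image of a coset is a singleton.\<close>

definition tensor_lift ::
  "(rat, 'c) graded \<Rightarrow> ('a \<Rightarrow> 'c) \<Rightarrow> ('b \<Rightarrow> 'c) \<Rightarrow> ('a, 'b) tens \<Rightarrow> 'c" where
  "tensor_lift C h k X = the_elem ((\<lambda>p. \<Oplus>\<^bsub>C\<^esub>x\<in>Poly_Mapping.keys p.
     Poly_Mapping.lookup p x \<odot>\<^bsub>C\<^esub> (h (fst x) \<otimes>\<^bsub>C\<^esub> k (snd x))) ` X)"

text \<open>\<open>h \<otimes> k\<close>, for \<open>h\<close> and \<open>k\<close> with values in \<open>C\<close> and \<open>D\<close>.\<close>

definition tensor_map ::
  "(rat, 'c) graded \<Rightarrow> (rat, 'd) graded \<Rightarrow> ('a \<Rightarrow> 'c) \<Rightarrow> ('b \<Rightarrow> 'd) \<Rightarrow>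
    ('a, 'b) tens \<Rightarrow> ('c, 'd) tens" where
  "tensor_map C D h k =
     tensor_lift (tensor C D) (\<lambda>a. tens C D (h a) \<one>\<^bsub>D\<^esub>) (\<lambda>b. tens C D \<one>\<^bsub>C\<^esub> (k b))"

text \<open>\<open>(a \<otimes> b) \<otimes> (c \<otimes> d) \<mapsto> (b \<otimes> d) \<otimes> (a \<otimes> c)\<close>.\<close>

definition tensor_perm ::
  "(rat, 'a) graded \<Rightarrow> (rat, 'b) graded \<Rightarrow> (rat, 'c) graded \<Rightarrow> (rat, 'd) graded \<Rightarrow>
    (('a, 'b) tens, ('c, 'd) tens) tens \<Rightarrow> (('b, 'd) tens, ('a, 'c) tens) tens" where
  "tensor_perm A B C D =
     (let X = tensor B D; Y = tensor A C; T = tensor X Y in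
      tensor_lift T
        (tensor_lift T (\<lambda>a. tens X Y \<one>\<^bsub>X\<^esub> (tens A C a \<one>\<^bsub>C\<^esub>)) (\<lambda>b. tens X Y (tens B D b \<one>\<^bsub>D\<^esub>) \<one>\<^bsub>Y\<^esub>))
        (tensor_lift T (\<lambda>c. tens X Y \<one>\<^bsub>X\<^esub> (tens A C \<one>\<^bsub>A\<^esub> c)) (\<lambda>d. tens X Y (tens B D \<one>\<^bsub>B\<^esub> d) \<one>\<^bsub>Y\<^esub>)))"


section \<open>Chow rings\<close>

type_synonym 'a chow = "'a set rat_poly set"

definition linear_rels :: "'a matroid \<Rightarrow> 'a set rat_poly set" where
  "linear_rels M =
     {(\<Sum>F\<in>{F \<in> proper_flats M. i \<notin> F}. Var F) - (\<Sum>F\<in>{F \<in> proper_flats M. j \<notin> F}. Var F) | i j.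
        i \<in> ground M \<and> j \<in> ground M}"

definition incomparable_rels :: "'a matroid \<Rightarrow> 'a set rat_poly set" where
  "incomparable_rels M =
     {Var F * Var F' | F F'. F \<in> proper_flats M \<and> F' \<in> proper_flats M \<and> \<not> F \<subseteq> F' \<and> \<not> F' \<subseteq> F}"

definition chow_ideal :: "'a matroid \<Rightarrow> 'a set rat_poly set" where
  "chow_ideal M = Idl\<^bsub>poly_ring (proper_flats M)\<^esub> (linear_rels M \<union> incomparable_rels M)"

definition CH :: "'a matroid \<Rightarrow> (rat, 'a chow) graded" where
  "CH M = quotient_graded (poly_ring (proper_flats M)) (chow_ideal M)"

definition xgen :: "'a matroid \<Rightarrow> 'a set \<Rightarrow> 'a chow" where
  "xgen M F = chow_ideal M +>\<^bsub>poly_ring (proper_flats M)\<^esub> Var F"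

text \<open>The ring homomorphism from a Chow ring to \<open>C\<close> with \<open>x\<^sub>F \<mapsto> a F\<close>, for \<open>a\<close> respecting the
  relations.\<close>

definition chow_lift :: "(rat, 'c) graded \<Rightarrow> ('a set \<Rightarrow> 'c) \<Rightarrow> 'a chow \<Rightarrow> 'c" where
  "chow_lift C a X = the_elem (poly_eval C a ` X)"

definition iota ::
  "'a matroid \<Rightarrow> 'b matroid \<Rightarrow> ('a chow, 'b chow) tens \<Rightarrow> ('a + 'b) chow" where
  "iota M N =
     (let S = matroid_sum M N; C = CH S in
      tensor_lift C
        (chow_lift C (\<lambda>F. \<Oplus>\<^bsub>C\<^esub>G'\<in>flats N. xgen S (F <+> G')))
        (chow_lift C (\<lambda>G. \<Oplus>\<^bsub>C\<^esub>F'\<in>flats M. xgen S (F' <+> G))))"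

text \<open>The pullback \<open>CH(M) \<rightarrow> CH(M\<^sub>F) \<otimes> CH(M\<^sup>F)\<close>; its value on \<open>x\<^sub>F\<close> does not depend on the
  choice of \<open>i\<close> and \<open>j\<close>. For \<open>F = {}\<close> it is the canonical identification
  \<open>CH(M) \<rightarrow> CH(M) \<otimes> CH(\<emptyset>)\<close>, \<open>\<xi> \<mapsto> \<xi> \<otimes> 1\<close>, where \<open>CH(\<emptyset>) = \<rat>\<close>: every
  nonempty flat \<open>K\<close> strictly contains \<open>F\<close>, so only the second case occurs.\<close>

definition pullback :: "'a matroid \<Rightarrow> 'a set \<Rightarrow> 'a chow \<Rightarrow> ('a chow, 'a chow) tens" where
  "pullback M F =
     (let C = contraction M F; R = restriction M F; T = tensor (CH C) (CH R);
          i = (SOME i. i \<in> F); j = (SOME j. j \<in> ground M - F) in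
      chow_lift T (\<lambda>K.
        if K \<subset> F then tens (CH C) (CH R) \<one>\<^bsub>CH C\<^esub> (xgen R K)
        else if F \<subset> K then tens (CH C) (CH R) (xgen C (K - F)) \<one>\<^bsub>CH R\<^esub>
        else if K = F then
          (\<ominus>\<^bsub>T\<^esub> tens (CH C) (CH R) \<one>\<^bsub>CH C\<^esub> (\<Oplus>\<^bsub>CH R\<^esub>K'\<in>{K' \<in> proper_flats R. i \<in> K'}. xgen R K'))
          \<ominus>\<^bsub>T\<^esub> tens (CH C) (CH R) (\<Oplus>\<^bsub>CH C\<^esub>L\<in>{L \<in> proper_flats C. j \<notin> L}. xgen C L) \<one>\<^bsub>CH R\<^esub>
        else \<zero>\<^bsub>T\<^esub>))"

definition summand_ring ::
  "'a matroid \<Rightarrow> 'b matroid \<Rightarrow> 'a set \<Rightarrow> 'b set \<Rightarrow>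
    (rat, (('a + 'b) chow, ('a chow, 'b chow) tens) tens) graded" where
  "summand_ring M N F G =
     tensor (CH (matroid_sum (restriction M F) (restriction N G)))
       (tensor (CH (contraction M F)) (CH (contraction N G)))"

definition summand_action ::
  "'a matroid \<Rightarrow> 'b matroid \<Rightarrow> 'a set \<Rightarrow> 'b set \<Rightarrow>
    ('a chow, 'b chow) tens \<Rightarrow> (('a + 'b) chow, ('a chow, 'b chow) tens) tens" where
  "summand_action M N F G =
     (let A = CH (contraction M F); B = CH (restriction M F);
          C = CH (contraction N G); D = CH (restriction N G) in
      tensor_map (CH (matroid_sum (restriction M F) (restriction N G))) (tensor A C)
        (iota (restriction M F) (restriction N G)) id
      \<circ> tensor_perm A B C D
      \<circ> tensor_map (tensor A B) (tensor C D) (pullback M F) (pullback N G))"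

definition summand ::
  "'a matroid \<Rightarrow> 'b matroid \<Rightarrow> 'a set \<Rightarrow> 'b set \<Rightarrow>
    (('a chow, 'b chow) tens, (('a + 'b) chow, ('a chow, 'b chow) tens) tens) graded" where
  "summand M N F G = shift (restrict_scalars (summand_action M N F G) (summand_ring M N F G))"

end

theory Submission
  imports
    Defs
    "HOL-Library.Product_Order"
    "HOL-Library.Multiset"
begin

text \<open>
  Adjoin to each Chow ring the generator \<open>x\<^sub>\<emptyset> = - (\<Sum>F \<noteq> {}, i \<notin> F. x\<^sub>F)\<close>, so that the linear
  relations read \<open>(\<Sum>F. i \<notin> F. x\<^sub>F) = 0\<close>. Put \<open>X\<^sub>F = (\<Sum>G. x\<^sub>F\<^sub>G)\<close> and \<open>Y\<^sub>G = (\<Sum>F. x\<^sub>F\<^sub>G)\<close> in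
  \<open>CH(M \<oplus> N)\<close>. These are the images of \<open>x\<^sub>F\<close> and \<open>x\<^sub>G\<close> under \<open>\<iota>\<close>, and the linear relations of
  \<open>CH(M \<oplus> N)\<close> are those of \<open>CH(M)\<close> in the \<open>X\<^sub>F\<close> and those of \<open>CH(N)\<close> in the \<open>Y\<^sub>G\<close>. The
  decomposition therefore comes from one of the Stanley--Reisner ring of the pairs \<open>(F, G)\<close>, which
  has a basis consisting of the products \<open>\<Prod>X\<^sub>F\<^sub>i \<cdot> \<Prod>Y\<^sub>G\<^sub>j\<close> over multichains and, for each
  \<open>H = (F, G)\<close> with \<open>F \<noteq> M\<close> and \<open>G \<noteq> N\<close>, of the products \<open>x\<^sub>H \<cdot> \<Prod>x\<^sub>K \<cdot> \<Prod>X\<^sub>F\<^sub>i \<cdot> \<Prod>Y\<^sub>G\<^sub>j\<close> with a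
  multichain of \<open>K < H\<close> and multichains of \<open>F\<^sub>i \<ge> F\<close> and \<open>G\<^sub>j \<ge> G\<close>. The products span because
  \<open>x\<^sub>H\<^sup>2\<close> can be eliminated, and they are independent because they inject, degree by degree, into
  the monomials on multichains of pairs. The coordinates with respect to this basis are linear
  over the polynomials in the \<open>X\<^sub>F\<close> and \<open>Y\<^sub>G\<close> modulo the relations of the summands, so they descend
  to \<open>CH(M \<oplus> N)\<close>. In the part with label \<open>H\<close> the \<open>x\<^sub>K\<close> generate \<open>CH(M\<^sup>F \<oplus> N\<^sup>G)\<close>, and the
  \<open>X\<^sub>F\<^sub>i\<close> and \<open>Y\<^sub>G\<^sub>j\<close> generate \<open>CH(M\<^sub>F)\<close> and \<open>CH(N\<^sub>G)\<close>.
\<close>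

text \<open>The module structure on a summand reflects what multiplication by x_H, with H = (F, G),
  does to X_K. If K is incomparable to F, the product vanishes. If K is strictly below F, only the
  x_(K,L) with L inside G survive, and their sum is the image of x_K under iota for the
  restrictions. If K strictly contains F, X_K stays a generator for the contraction. The case K = F
  is then dictated by the linear relations, which yields the value of the pullback at x_F. The
  factor x_H in each basis element with label H accounts for the shift by one degree. Descent is
  possible because the linear relations of CH(M + N) are polynomials in the X_F and Y_G. The
  coordinates are linear over these polynomials only modulo the ideal of \<open>rels h\<close>, so
  they are polynomials in formal variables that are evaluated in the summand afterwards. The rings
  involved have different sets of generators.\<close>

hide_const (open) Multiset.mult

abbreviation "supp \<equiv> Poly_Mapping.keys"
abbreviation "coef \<equiv> Poly_Mapping.lookup"
abbreviation "sgl \<equiv> Poly_Mapping.single"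

section \<open>Commutative algebras over the rationals\<close>

text \<open>The scalars are the values of type \<open>rat\<close>, so the axioms mention no scalar
  ring with a carrier, unlike those of \<open>module\<close>.\<close>

locale rat_algebra = cring C for C :: "(rat, 'c) graded" (structure) +
  assumes smult_closed [simp]: "x \<in> carrier C \<Longrightarrow> q \<odot> x \<in> carrier C"
    and smult_add_left: "x \<in> carrier C \<Longrightarrow> (q + r) \<odot> x = q \<odot> x \<oplus> r \<odot> x"
    and smult_add_right: "x \<in> carrier C \<Longrightarrow> y \<in> carrier C \<Longrightarrow> q \<odot> (x \<oplus> y) = q \<odot> x \<oplus> q \<odot> y"
    and smult_smult: "x \<in> carrier C \<Longrightarrow> (q * r) \<odot> x = q \<odot> (r \<odot> x)"
    and smult_one [simp]: "x \<in> carrier C \<Longrightarrow> 1 \<odot> x = x"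
    and smult_mult: "x \<in> carrier C \<Longrightarrow> y \<in> carrier C \<Longrightarrow> (q \<odot> x) \<otimes> y = q \<odot> (x \<otimes> y)"
begin

lemma minus_eq_zeroD: "x \<ominus> y = \<zero> \<Longrightarrow> x \<in> carrier C \<Longrightarrow> y \<in> carrier C \<Longrightarrow> x = y"
  using minus_equality[of x "\<ominus> y"] by (simp add: a_minus_def)

lemma smult_zero_left [simp]: "x \<in> carrier C \<Longrightarrow> 0 \<odot> x = \<zero>"
  using smult_add_left[of x 0 0] by (metis add.r_cancel_one' add_0 smult_closed)

lemma smult_zero_right [simp]: "q \<odot> \<zero> = \<zero>"
  using smult_add_right[of "\<zero>" "\<zero>" q] by (metis add.r_cancel_one' smult_closed zero_closed l_zero)

lemma mult_smult: "x \<in> carrier C \<Longrightarrow> y \<in> carrier C \<Longrightarrow> x \<otimes> (q \<odot> y) = q \<odot> (x \<otimes> y)"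
  by (metis m_comm smult_closed smult_mult)

lemma smult_mult_smult:
  assumes "x \<in> carrier C" "y \<in> carrier C"
  shows "(q \<odot> x) \<otimes> (r \<odot> y) = (q * r) \<odot> (x \<otimes> y)"
  using assms by (simp add: smult_mult mult_smult mult.commute[of q] smult_smult)

lemma smult_eq_mult: "x \<in> carrier C \<Longrightarrow> q \<odot> x = (q \<odot> \<one>) \<otimes> x"
  by (simp add: smult_mult)

end

text \<open>Both \<open>poly_eval\<close> (on monomials) and \<open>tensor_lift\<close> (on pairs)
  have this shape, so linearity and multiplicativity are proved once for both.\<close>

definition lin_ext :: "(rat, 'c) graded \<Rightarrow> ('x \<Rightarrow> 'c) \<Rightarrow> ('x \<Rightarrow>\<^sub>0 rat) \<Rightarrow> 'c" where
  "lin_ext C \<phi> p = (\<Oplus>\<^bsub>C\<^esub>x\<in>supp p. coef p x \<odot>\<^bsub>C\<^esub> \<phi> x)"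

context rat_algebra
begin

lemma finsum_mono_neutral:
  assumes "finite K" "L \<subseteq> K" "\<And>k. k \<in> K - L \<Longrightarrow> f k = \<zero>" "f \<in> K \<rightarrow> carrier C"
  shows "(\<Oplus>k\<in>L. f k) = (\<Oplus>k\<in>K. f k)"
  using assms(3,4) by (intro add.finprod_mono_neutral_cong_left[OF assms(1,2)]) auto

lemma lin_ext_superset:
  assumes "finite K" "supp p \<subseteq> K" "\<phi> \<in> K \<rightarrow> carrier C"
  shows "lin_ext C \<phi> p = (\<Oplus>x\<in>K. coef p x \<odot> \<phi> x)"
  unfolding lin_ext_def
  using assms by (intro add.finprod_mono_neutral_cong_left[OF assms(1,2)]) (auto simp: in_keys_iff Pi_def)

lemma lin_ext_closed:
  assumes "\<phi> \<in> supp p \<rightarrow> carrier C"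
  shows "lin_ext C \<phi> p \<in> carrier C"
  unfolding lin_ext_def using assms by (auto intro!: finsum_closed simp: Pi_def)

lemma lin_ext_add:
  assumes "\<phi> \<in> supp p \<union> supp q \<rightarrow> carrier C"
  shows "lin_ext C \<phi> (p + q) = lin_ext C \<phi> p \<oplus> lin_ext C \<phi> q"
proof -
  let ?K = "supp p \<union> supp q"
  have fin: "finite ?K" by simp
  have "lin_ext C \<phi> (p + q) = (\<Oplus>x\<in>?K. coef (p + q) x \<odot> \<phi> x)"
    using assms fin Poly_Mapping.keys_add[of p q] by (intro lin_ext_superset) auto
  also have "\<dots> = (\<Oplus>x\<in>?K. coef p x \<odot> \<phi> x \<oplus> coef q x \<odot> \<phi> x)"
    using assms by (intro finsum_cong') (auto simp: lookup_add smult_add_left Pi_def)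
  also have "\<dots> = (\<Oplus>x\<in>?K. coef p x \<odot> \<phi> x) \<oplus> (\<Oplus>x\<in>?K. coef q x \<odot> \<phi> x)"
    using assms by (intro finsum_addf) (auto simp: Pi_def)
  also have "\<dots> = lin_ext C \<phi> p \<oplus> lin_ext C \<phi> q"
    using assms fin lin_ext_superset[of ?K p] lin_ext_superset[of ?K q] by simp
  finally show ?thesis .
qed

lemma lin_ext_zero [simp]: "lin_ext C \<phi> 0 = \<zero>"
  by (simp add: lin_ext_def)

lemma lin_ext_single:
  assumes "\<phi> x \<in> carrier C"
  shows "lin_ext C \<phi> (sgl x c) = c \<odot> \<phi> x"
  using assms lin_ext_superset[of "{x}" "sgl x c" \<phi>] by simp

lemma lin_ext_scale:
  assumes "\<phi> \<in> supp p \<rightarrow> carrier C"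
  shows "lin_ext C \<phi> (Poly_Mapping.map ((*) q) p) = q \<odot> lin_ext C \<phi> p"
proof -
  have s: "q \<odot> (\<Oplus>x\<in>K. f x) = (\<Oplus>x\<in>K. q \<odot> f x)" if "f \<in> K \<rightarrow> carrier C" "finite K" for f and K :: "'x set"
    using that(2,1) by (induction K rule: finite_induct) (auto simp: smult_add_right Pi_def)
  have k: "supp (Poly_Mapping.map ((*) q) p) \<subseteq> supp p"
    by (auto simp: in_keys_iff Poly_Mapping.map.rep_eq when_def)
  have "lin_ext C \<phi> (Poly_Mapping.map ((*) q) p) = (\<Oplus>x\<in>supp p. q \<odot> (coef p x \<odot> \<phi> x))"
    using assms k by (subst lin_ext_superset[of "supp p"])
      (auto intro!: finsum_cong' simp: Pi_def Poly_Mapping.map.rep_eq when_def smult_smult)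
  also have "\<dots> = q \<odot> lin_ext C \<phi> p"
    unfolding lin_ext_def using assms by (intro s[symmetric]) (auto simp: Pi_def)
  finally show ?thesis .
qed

end

text \<open>The product that extends an operation on basis elements bilinearly: addition of
  exponents gives polynomial multiplication, componentwise products give the multiplication of
  \<open>pairs_ring\<close>.\<close>

definition conv :: "('x \<Rightarrow> 'x \<Rightarrow> 'x) \<Rightarrow> ('x \<Rightarrow>\<^sub>0 rat) \<Rightarrow> ('x \<Rightarrow>\<^sub>0 rat) \<Rightarrow> 'x \<Rightarrow>\<^sub>0 rat" where
  "conv f p q = (\<Sum>x\<in>supp p. \<Sum>y\<in>supp q. sgl (f x y) (coef p x * coef q y))"

lemma conv_superset:
  assumes "finite K" "finite L" "supp p \<subseteq> K" "supp q \<subseteq> L"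
  shows "conv f p q = (\<Sum>x\<in>K. \<Sum>y\<in>L. sgl (f x y) (coef p x * coef q y))"
proof -
  have "conv f p q = (\<Sum>x\<in>supp p. \<Sum>y\<in>L. sgl (f x y) (coef p x * coef q y))"
    unfolding conv_def by (intro sum.cong refl sum.mono_neutral_left) (use assms in \<open>auto simp: in_keys_iff\<close>)
  also have "\<dots> = (\<Sum>x\<in>K. \<Sum>y\<in>L. sgl (f x y) (coef p x * coef q y))"
    by (intro sum.mono_neutral_left) (use assms in \<open>auto simp: in_keys_iff\<close>)
  finally show ?thesis .
qed

lemma conv_add_left: "conv f (p + p') q = conv f p q + conv f p' q"
proof -
  let ?K = "supp p \<union> supp p'"
  show ?thesis
    using Poly_Mapping.keys_add[of p p']
    by (simp add: conv_superset[of ?K "supp q"] lookup_add single_add distrib_right sum.distrib)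
qed

lemma conv_add_right: "conv f p (q + q') = conv f p q + conv f p q'"
proof -
  let ?K = "supp q \<union> supp q'"
  show ?thesis
    using Poly_Mapping.keys_add[of q q']
    by (simp add: conv_superset[of "supp p" ?K] lookup_add single_add distrib_left sum.distrib)
qed

lemma conv_zero [simp]: "conv f 0 q = 0" "conv f p 0 = 0"
  by (simp_all add: conv_def)

lemma conv_single: "conv f (sgl x a) (sgl y b) = sgl (f x y) (a * b)"
  by (simp add: conv_superset[of "{x}" "{y}"])

lemma supp_conv:
  assumes "supp p \<subseteq> D" "supp q \<subseteq> D" "\<And>x y. x \<in> D \<Longrightarrow> y \<in> D \<Longrightarrow> f x y \<in> D"
  shows "supp (conv f p q) \<subseteq> D"
proof -
  have "supp (conv f p q) \<subseteq> (\<Union>x\<in>supp p. supp (\<Sum>y\<in>supp q. sgl (f x y) (coef p x * coef q y)))"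
    unfolding conv_def by (rule Poly_Mapping.keys_sum)
  also have "\<dots> \<subseteq> (\<Union>x\<in>supp p. \<Union>y\<in>supp q. supp (sgl (f x y) (coef p x * coef q y)))"
    by (intro UN_mono order_refl Poly_Mapping.keys_sum)
  also have "\<dots> \<subseteq> D" using assms by (auto split: if_splits)
  finally show ?thesis .
qed

text \<open>The support conditions are kept in the \<open>add\<close> case, so that closure facts on
  \<open>D\<close> remain available for both summands.\<close>

lemma free_induct [consumes 1, case_names zero single add]:
  fixes p :: "'x \<Rightarrow>\<^sub>0 'b::comm_monoid_add"
  assumes "supp p \<subseteq> D"
    and "P 0" "\<And>x c. x \<in> D \<Longrightarrow> P (sgl x c)"
    and "\<And>p q. supp p \<subseteq> D \<Longrightarrow> supp q \<subseteq> D \<Longrightarrow> P p \<Longrightarrow> P q \<Longrightarrow> P (p + q)"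
  shows "P p"
proof -
  have s: "P (\<Sum>x\<in>K. sgl x (coef p x)) \<and> supp (\<Sum>x\<in>K. sgl x (coef p x)) \<subseteq> D"
    if "finite K" "K \<subseteq> D" for K
    using that
  proof (induction K rule: finite_induct)
    case (insert x K)
    have "supp (sgl x (coef p x)) \<subseteq> D" using insert.prems by auto
    moreover have "P (sgl x (coef p x))" using insert.prems assms(3) by auto
    moreover have "P (\<Sum>x\<in>K. sgl x (coef p x))" "supp (\<Sum>x\<in>K. sgl x (coef p x)) \<subseteq> D"
      using insert by auto
    ultimately show ?case
      using insert.hyps assms(4)[of "sgl x (coef p x)" "\<Sum>x\<in>K. sgl x (coef p x)"]
        subset_trans[OF Poly_Mapping.keys_add[of "sgl x (coef p x)" "\<Sum>x\<in>K. sgl x (coef p x)"], of D]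
      by simp
  qed (use assms in auto)
  have "(\<Sum>x\<in>supp p. sgl x (coef p x)) = p"
    by (rule poly_mapping_eqI)
      (auto simp: lookup_sum lookup_single when_def in_keys_iff sum.delta'
        not_in_keys_iff_lookup_eq_zero)
  then show ?thesis using s[of "supp p"] assms(1) by simp
qed

lemma free_induct_UNIV [case_names single add]:
  fixes p :: "'x \<Rightarrow>\<^sub>0 'b::comm_monoid_add"
  assumes "\<And>x c. P (sgl x c)" "\<And>p q. P p \<Longrightarrow> P q \<Longrightarrow> P (p + q)"
  shows "P p"
proof (rule free_induct[where D = UNIV])
  show "P 0" using assms(1)[of undefined 0] by simp
qed (use assms in auto)

lemma poly_mult_conv: "p * q = conv (+) p (q :: 'v rat_poly)"
proof (induction p rule: free_induct_UNIV)
  case (single x c)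
  show ?case
    by (induction q rule: free_induct_UNIV)
      (simp_all add: conv_single mult_single conv_add_right distrib_left)
qed (simp add: conv_add_left distrib_right)

text \<open>Both sides are bilinear in p and q, so the identity reduces to single basis elements,
  where it is \<open>hom\<close>.\<close>

lemma (in rat_algebra) lin_ext_conv:
  assumes "\<phi> \<in> D \<rightarrow> carrier C" "supp p \<subseteq> D" "supp q \<subseteq> D"
    and f: "\<And>x y. x \<in> D \<Longrightarrow> y \<in> D \<Longrightarrow> f x y \<in> D"
    and hom: "\<And>x y. x \<in> D \<Longrightarrow> y \<in> D \<Longrightarrow> \<phi> (f x y) = \<phi> x \<otimes> \<phi> y"
  shows "lin_ext C \<phi> (conv f p q) = lin_ext C \<phi> p \<otimes> lin_ext C \<phi> q"
proof -
  have cl: "lin_ext C \<phi> p \<in> carrier C" if "supp p \<subseteq> D" for p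
    using that assms(1) by (intro lin_ext_closed) (auto simp: Pi_def subset_iff)
  have ladd: "lin_ext C \<phi> (p + q) = lin_ext C \<phi> p \<oplus> lin_ext C \<phi> q"
    if "supp p \<subseteq> D" "supp q \<subseteq> D" for p q
    using that assms(1) by (intro lin_ext_add) (auto simp: Pi_def subset_iff)
  have phi: "\<phi> x \<in> carrier C" if "x \<in> D" for x using that assms(1) by auto
  note sc = supp_conv[OF _ _ f]
  show ?thesis
    using assms(2)
  proof (induction rule: free_induct)
    case zero
    then show ?case using cl assms(3) by simp
  next
    case (single x c)
    have sx: "supp (sgl x c) \<subseteq> D" using single by auto
    show ?case
      using assms(3)
    proof (induction rule: free_induct)
      case zero
      then show ?case using cl[OF sx] by simp
    next
      case (single y d)
      then show ?case
        using \<open>x \<in> D\<close> by (simp add: conv_single lin_ext_single phi f hom smult_mult_smult)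
    next
      case (add p q)
      then show ?case
        using sx by (simp add: conv_add_right ladd sc r_distr cl)
    qed
  next
    case (add p p')
    then show ?case
      using assms(3) by (simp add: conv_add_left ladd sc l_distr cl)
  qed
qed

locale alg_hom = A: rat_algebra A + B: rat_algebra B
  for A :: "(rat, 'a) graded" and B :: "(rat, 'b) graded" and h :: "'a \<Rightarrow> 'b" +
  assumes closed [simp]: "x \<in> carrier A \<Longrightarrow> h x \<in> carrier B"
    and add [simp]: "x \<in> carrier A \<Longrightarrow> y \<in> carrier A \<Longrightarrow> h (x \<oplus>\<^bsub>A\<^esub> y) = h x \<oplus>\<^bsub>B\<^esub> h y"
    and mult [simp]: "x \<in> carrier A \<Longrightarrow> y \<in> carrier A \<Longrightarrow> h (x \<otimes>\<^bsub>A\<^esub> y) = h x \<otimes>\<^bsub>B\<^esub> h y"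
    and one [simp]: "h \<one>\<^bsub>A\<^esub> = \<one>\<^bsub>B\<^esub>"
    and smult [simp]: "x \<in> carrier A \<Longrightarrow> h (q \<odot>\<^bsub>A\<^esub> x) = q \<odot>\<^bsub>B\<^esub> h x"
begin

sublocale ring_hom_cring A B h
  by unfold_locales (auto simp: ring_hom_def)

lemma zero [simp]: "h \<zero>\<^bsub>A\<^esub> = \<zero>\<^bsub>B\<^esub>"
  by simp

lemma sum: "f \<in> K \<rightarrow> carrier A \<Longrightarrow> h (\<Oplus>\<^bsub>A\<^esub>k\<in>K. f k) = (\<Oplus>\<^bsub>B\<^esub>k\<in>K. h (f k))"
  using hom_finsum[of f K] by (simp add: o_def)

lemma uminus: "x \<in> carrier A \<Longrightarrow> h (\<ominus>\<^bsub>A\<^esub> x) = \<ominus>\<^bsub>B\<^esub> h x"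
  by simp

lemma minus: "x \<in> carrier A \<Longrightarrow> y \<in> carrier A \<Longrightarrow> h (x \<ominus>\<^bsub>A\<^esub> y) = h x \<ominus>\<^bsub>B\<^esub> h y"
  by (simp add: a_minus_def)

end

lemma alg_homI:
  assumes "rat_algebra A" "rat_algebra B"
    and "\<And>x. x \<in> carrier A \<Longrightarrow> h x \<in> carrier B"
    and "\<And>x y. x \<in> carrier A \<Longrightarrow> y \<in> carrier A \<Longrightarrow> h (x \<oplus>\<^bsub>A\<^esub> y) = h x \<oplus>\<^bsub>B\<^esub> h y"
    and "\<And>x y. x \<in> carrier A \<Longrightarrow> y \<in> carrier A \<Longrightarrow> h (x \<otimes>\<^bsub>A\<^esub> y) = h x \<otimes>\<^bsub>B\<^esub> h y"
    and "h \<one>\<^bsub>A\<^esub> = \<one>\<^bsub>B\<^esub>"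
    and "\<And>x q. x \<in> carrier A \<Longrightarrow> h (q \<odot>\<^bsub>A\<^esub> x) = q \<odot>\<^bsub>B\<^esub> h x"
  shows "alg_hom A B h"
  using assms by (simp add: alg_hom_def alg_hom_axioms_def)

lemma alg_hom_comp:
  assumes "alg_hom A B h" "alg_hom B C k"
  shows "alg_hom A C (k \<circ> h)"
proof -
  interpret h: alg_hom A B h by fact
  interpret k: alg_hom B C k by fact
  show ?thesis by (rule alg_homI) (auto intro: h.A.rat_algebra_axioms k.B.rat_algebra_axioms)
qed

lemma alg_hom_id: "rat_algebra A \<Longrightarrow> alg_hom A A id"
  by (rule alg_homI) auto

section \<open>Quotients\<close>

text \<open>\<open>quotient_graded\<close> copies the operations of \<open>P Quot I\<close> into a
  record of another type, and the ring axioms have to follow them.\<close>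

lemma cring_cong:
  assumes "cring A" "carrier B = carrier A" "mult B = mult A" "one B = one A" "zero B = zero A" "add B = add A"
  shows "cring B"
proof -
  interpret A: cring A by fact
  show ?thesis
  proof (intro cringI abelian_groupI comm_monoidI)
    fix x assume "x \<in> carrier B"
    then show "\<exists>y\<in>carrier B. y \<oplus>\<^bsub>B\<^esub> x = \<zero>\<^bsub>B\<^esub>"
      using assms A.l_neg[of x] by (intro bexI[of _ "\<ominus>\<^bsub>A\<^esub> x"]) auto
  qed (auto simp: assms A.a_ac intro: A.m_assoc A.m_comm A.l_distr)
qed

locale quotient_alg = P: rat_algebra P + ideal I P
  for P :: "(rat, 'p) graded" and I :: "'p set"
begin

abbreviation "Q \<equiv> quotient_graded P I"
abbreviation "cls \<equiv> (+>\<^bsub>P\<^esub>) I"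

lemma quotient_simps:
  "carrier Q = carrier (P Quot I)" "mult Q = mult (P Quot I)" "one Q = one (P Quot I)"
  "zero Q = zero (P Quot I)" "add Q = add (P Quot I)"
  by (simp_all add: quotient_graded_def)

lemma cls_hom: "ring_hom_ring P (P Quot I) cls"
  by (rule rcos_ring_hom_ring)

lemma carrier_Q: "carrier Q = cls ` carrier P"
  by (auto simp: quotient_simps FactRing_simps)

lemma cls_eq_iff:
  assumes "x \<in> carrier P" "y \<in> carrier P"
  shows "cls x = cls y \<longleftrightarrow> x \<ominus>\<^bsub>P\<^esub> y \<in> I"
  using P.quotient_eq_iff_same_a_r_cos[OF ideal_axioms assms] by simp

lemma cls_zero_iff:
  assumes "x \<in> carrier P"
  shows "cls x = \<zero>\<^bsub>Q\<^esub> \<longleftrightarrow> x \<in> I"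
proof -
  interpret ring_hom_ring P "P Quot I" cls by (rule cls_hom)
  show ?thesis using assms cls_eq_iff[of x "\<zero>\<^bsub>P\<^esub>"] by (simp add: quotient_simps a_minus_def)
qed

lemma cls_memD: "x \<in> carrier P \<Longrightarrow> y \<in> cls x \<Longrightarrow> y \<in> carrier P \<and> cls y = cls x"
  using a_elemrcos_carrier[of x y] a_repr_independence'[of y x] by auto

lemma cls_self: "x \<in> carrier P \<Longrightarrow> x \<in> cls x"
  by (simp add: a_rcos_self)

lemma smult_I: "x \<in> I \<Longrightarrow> q \<odot>\<^bsub>P\<^esub> x \<in> I"
  by (metis Icarr I_l_closed P.smult_eq_mult P.smult_closed P.one_closed)

text \<open>The scalar multiple of a coset is defined as a union over all representatives; two
  representatives differ by an element of \<open>I\<close>, which is closed under scalars, so all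
  the cosets in the union coincide.\<close>

lemma smult_cls:
  assumes "x \<in> carrier P"
  shows "q \<odot>\<^bsub>Q\<^esub> cls x = cls (q \<odot>\<^bsub>P\<^esub> x)"
proof -
  have "cls (q \<odot>\<^bsub>P\<^esub> y) = cls (q \<odot>\<^bsub>P\<^esub> x)" if "y \<in> cls x" for y
  proof -
    have y: "y \<in> carrier P" "cls y = cls x" using cls_memD[OF assms that] by auto
    then have "y \<ominus>\<^bsub>P\<^esub> x \<in> I" using assms cls_eq_iff by blast
    then have "q \<odot>\<^bsub>P\<^esub> (y \<ominus>\<^bsub>P\<^esub> x) \<in> I" by (rule smult_I)
    moreover have "q \<odot>\<^bsub>P\<^esub> (y \<ominus>\<^bsub>P\<^esub> x) = q \<odot>\<^bsub>P\<^esub> y \<ominus>\<^bsub>P\<^esub> q \<odot>\<^bsub>P\<^esub> x"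
      using y assms P.smult_eq_mult[of "y \<ominus>\<^bsub>P\<^esub> x" q] P.smult_eq_mult[of y q] P.smult_eq_mult[of x q]
      by (simp add: a_minus_def P.r_distr P.r_minus)
    ultimately show ?thesis using y assms cls_eq_iff by simp
  qed
  moreover have "x \<in> cls x" by (rule cls_self[OF assms])
  ultimately have "(\<Union>y\<in>cls x. cls (q \<odot>\<^bsub>P\<^esub> y)) = cls (q \<odot>\<^bsub>P\<^esub> x)" by blast
  then show ?thesis by (simp add: quotient_graded_def)
qed

sublocale Q: rat_algebra Q
proof -
  have cr: "cring Q"
    by (rule cring_cong[OF quotient_is_cring[OF P.is_cring]]) (simp_all add: quotient_simps)
  have cm: "cls x \<otimes>\<^bsub>Q\<^esub> cls y = cls (x \<otimes>\<^bsub>P\<^esub> y)" "cls x \<oplus>\<^bsub>Q\<^esub> cls y = cls (x \<oplus>\<^bsub>P\<^esub> y)"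
    if "x \<in> carrier P" "y \<in> carrier P" for x y
    using that ring_hom_ring.homh[OF cls_hom] by (auto simp: quotient_simps ring_hom_def)
  show "rat_algebra Q"
  proof (intro rat_algebra.intro rat_algebra_axioms.intro cr)
  qed (auto simp: carrier_Q smult_cls cm P.smult_add_left P.smult_add_right P.smult_smult P.smult_mult)
qed

lemma cls_alg_hom: "alg_hom P Q cls"
proof -
  interpret c: ring_hom_ring P "P Quot I" cls by (rule cls_hom)
  show ?thesis
    by (rule alg_homI) (auto intro: P.rat_algebra_axioms Q.rat_algebra_axioms simp: quotient_simps smult_cls[symmetric])
qed

text \<open>A homomorphism that kills \<open>I\<close> is constant on cosets, so the image of a
  coset is a singleton and \<open>the_elem\<close> reads off its value.\<close>

lemma lift:
  assumes "alg_hom P C \<theta>" and kill: "\<And>x. x \<in> I \<Longrightarrow> \<theta> x = \<zero>\<^bsub>C\<^esub>"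
  shows "alg_hom Q C (\<lambda>X. the_elem (\<theta> ` X))"
    and "\<And>x. x \<in> carrier P \<Longrightarrow> the_elem (\<theta> ` cls x) = \<theta> x"
proof -
  interpret t: alg_hom P C \<theta> by fact
  interpret c: alg_hom P Q cls by (rule cls_alg_hom)
  show val: "the_elem (\<theta> ` cls x) = \<theta> x" if x: "x \<in> carrier P" for x
  proof -
    have "\<theta> y = \<theta> x" if "y \<in> cls x" for y
    proof -
      have y: "y \<in> carrier P" "cls y = cls x" using cls_memD[OF x that] by auto
      then have "y \<ominus>\<^bsub>P\<^esub> x \<in> I" using x cls_eq_iff by blast
      then have "\<theta> (y \<ominus>\<^bsub>P\<^esub> x) = \<zero>\<^bsub>C\<^esub>" by (rule kill)
      then have "\<theta> y \<ominus>\<^bsub>C\<^esub> \<theta> x = \<zero>\<^bsub>C\<^esub>" unfolding t.minus[OF y(1) x] .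
      then show ?thesis by (rule t.B.minus_eq_zeroD[OF _ t.closed[OF y(1)] t.closed[OF x]])
    qed
    then have "\<theta> ` cls x = {\<theta> x}" using cls_self[OF x] by blast
    then show ?thesis by simp
  qed
  show "alg_hom Q C (\<lambda>X. the_elem (\<theta> ` X))"
  proof (rule alg_homI)
    fix X Y q assume "X \<in> carrier Q" "Y \<in> carrier Q"
    then obtain x y where xy: "X = cls x" "Y = cls y" "x \<in> carrier P" "y \<in> carrier P"
      by (auto simp: carrier_Q)
    show "the_elem (\<theta> ` X) \<in> carrier C" using xy val by simp
    show "the_elem (\<theta> ` (X \<oplus>\<^bsub>Q\<^esub> Y)) = the_elem (\<theta> ` X) \<oplus>\<^bsub>C\<^esub> the_elem (\<theta> ` Y)"
      using xy val by (simp flip: c.add)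
    show "the_elem (\<theta> ` (X \<otimes>\<^bsub>Q\<^esub> Y)) = the_elem (\<theta> ` X) \<otimes>\<^bsub>C\<^esub> the_elem (\<theta> ` Y)"
      using xy val by (simp flip: c.mult)
    show "the_elem (\<theta> ` (q \<odot>\<^bsub>Q\<^esub> X)) = q \<odot>\<^bsub>C\<^esub> the_elem (\<theta> ` X)"
      using xy val by (simp flip: c.smult)
  next
    show "the_elem (\<theta> ` \<one>\<^bsub>Q\<^esub>) = \<one>\<^bsub>C\<^esub>"
      using val[of "\<one>\<^bsub>P\<^esub>"] by (simp flip: c.one)
  qed (rule Q.rat_algebra_axioms t.B.rat_algebra_axioms)+
qed

end

lemma (in rat_algebra) quotient_alg_genideal:
  "S \<subseteq> carrier C \<Longrightarrow> quotient_alg C (Idl S)"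
  by (simp add: quotient_alg_def rat_algebra_axioms genideal_ideal)

text \<open>The kernel is an ideal containing \<open>S\<close>, and the generated ideal is the
  smallest such.\<close>

lemma alg_hom_kill_genideal:
  assumes "alg_hom P C \<theta>" "S \<subseteq> carrier P" "\<And>x. x \<in> S \<Longrightarrow> \<theta> x = \<zero>\<^bsub>C\<^esub>" "x \<in> Idl\<^bsub>P\<^esub> S"
  shows "\<theta> x = \<zero>\<^bsub>C\<^esub>"
proof -
  interpret t: alg_hom P C \<theta> by fact
  have "S \<subseteq> a_kernel P C \<theta>"
    unfolding a_kernel_def' using assms(2,3) by blast
  then have "Idl\<^bsub>P\<^esub> S \<subseteq> a_kernel P C \<theta>"
    by (rule t.A.genideal_minimal[OF t.ring.kernel_is_ideal])
  then show ?thesis using assms(4) unfolding a_kernel_def' by blast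
qed

section \<open>Polynomial rings\<close>

abbreviation Const :: "rat \<Rightarrow> 'v rat_poly" where "Const \<equiv> sgl 0"

lemma supp_add_nat: "supp (m + n) = supp m \<union> supp (n :: 'v \<Rightarrow>\<^sub>0 nat)"
  by (auto simp: in_keys_iff lookup_add)

lemma poly_ring_simps:
  "carrier (poly_ring V) = {p. \<forall>m\<in>supp p. supp m \<subseteq> V}"
  "mult (poly_ring V) = (*)" "one (poly_ring V) = 1" "zero (poly_ring V) = 0" "add (poly_ring V) = (+)"
  "smult (poly_ring V) q p = Const q * p"
  by (simp_all add: poly_ring_def mult_map_scale_conv_mult)

lemma poly_ring_mult_closed:
  assumes "p \<in> carrier (poly_ring V)" "q \<in> carrier (poly_ring V)"
  shows "p * q \<in> carrier (poly_ring V)"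
  using assms Poly_Mapping.keys_mult[of p q] by (fastforce simp: poly_ring_simps supp_add_nat)

lemma rat_algebra_poly_ring: "rat_algebra (poly_ring V)"
proof (rule rat_algebra.intro)
  show "cring (poly_ring V)"
  proof (intro cringI abelian_groupI comm_monoidI)
    fix p q assume pq: "p \<in> carrier (poly_ring V)" "q \<in> carrier (poly_ring V)"
    show "p \<oplus>\<^bsub>poly_ring V\<^esub> q \<in> carrier (poly_ring V)"
      using pq Poly_Mapping.keys_add[of p q] by (auto simp: poly_ring_simps)
    show "p \<otimes>\<^bsub>poly_ring V\<^esub> q \<in> carrier (poly_ring V)"
      using poly_ring_mult_closed[OF pq] by (simp add: poly_ring_simps)
    show "\<exists>q\<in>carrier (poly_ring V). q \<oplus>\<^bsub>poly_ring V\<^esub> p = \<zero>\<^bsub>poly_ring V\<^esub>"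
      using pq by (intro bexI[of _ "- p"]) (auto simp: poly_ring_simps in_keys_iff)
  qed (auto simp: poly_ring_simps algebra_simps)
  have c: "Const q \<in> carrier (poly_ring V)" for q :: rat by (simp add: poly_ring_simps)
  show "rat_algebra_axioms (poly_ring V)"
  proof (intro rat_algebra_axioms.intro)
    fix p q and x y :: rat
    show "(x * y) \<odot>\<^bsub>poly_ring V\<^esub> p = x \<odot>\<^bsub>poly_ring V\<^esub> (y \<odot>\<^bsub>poly_ring V\<^esub> p)"
      by (simp add: poly_ring_simps mult_single flip: mult.assoc)
  qed (use poly_ring_mult_closed[OF c] in \<open>auto simp: poly_ring_simps algebra_simps single_add\<close>)
qed

definition monom_eval :: "(rat, 'c) graded \<Rightarrow> ('v \<Rightarrow> 'c) \<Rightarrow> ('v \<Rightarrow>\<^sub>0 nat) \<Rightarrow> 'c" where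
  "monom_eval C a m = (\<Otimes>\<^bsub>C\<^esub>v\<in>supp m. a v [^]\<^bsub>C\<^esub> coef m v)"

lemma poly_eval_lin_ext: "poly_eval C a = lin_ext C (monom_eval C a)"
  by (simp add: fun_eq_iff poly_eval_def lin_ext_def monom_eval_def)

context rat_algebra
begin

lemma monom_eval_superset:
  assumes "finite K" "supp m \<subseteq> K" "a \<in> K \<rightarrow> carrier C"
  shows "monom_eval C a m = (\<Otimes>v\<in>K. a v [^] coef m v)"
  unfolding monom_eval_def using assms
  by (intro finprod_mono_neutral_cong_left[OF assms(1,2)]) (auto simp: in_keys_iff Pi_def)

lemma monom_eval_closed:
  assumes "a \<in> supp m \<rightarrow> carrier C"
  shows "monom_eval C a m \<in> carrier C"
  unfolding monom_eval_def using assms by (auto intro!: finprod_closed simp: Pi_def)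

lemma monom_eval_add:
  assumes "a \<in> supp m \<union> supp n \<rightarrow> carrier C"
  shows "monom_eval C a (m + n) = monom_eval C a m \<otimes> monom_eval C a n"
proof -
  let ?K = "supp m \<union> supp n"
  have "monom_eval C a (m + n) = (\<Otimes>v\<in>?K. a v [^] coef m v \<otimes> a v [^] coef n v)"
    unfolding monom_eval_def supp_add_nat
    using assms by (intro finprod_cong') (auto simp: lookup_add nat_pow_mult Pi_def)
  also have "\<dots> = (\<Otimes>v\<in>?K. a v [^] coef m v) \<otimes> (\<Otimes>v\<in>?K. a v [^] coef n v)"
    using assms by (intro finprod_multf) (auto simp: Pi_def)
  also have "\<dots> = monom_eval C a m \<otimes> monom_eval C a n"
    using assms monom_eval_superset[of ?K m a] monom_eval_superset[of ?K n a] by simp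
  finally show ?thesis .
qed

lemma alg_hom_poly_eval:
  assumes a: "a \<in> V \<rightarrow> carrier C"
  shows "alg_hom (poly_ring V) C (poly_eval C a)"
proof -
  let ?D = "{m. supp m \<subseteq> V}"
  have ev: "monom_eval C a \<in> ?D \<rightarrow> carrier C"
    using a by (auto intro!: monom_eval_closed)
  have D: "p \<in> carrier (poly_ring V) \<longleftrightarrow> supp p \<subseteq> ?D" for p :: "'a rat_poly"
    by (auto simp: poly_ring_simps)
  have ev': "monom_eval C a \<in> supp p \<rightarrow> carrier C" if "p \<in> carrier (poly_ring V)" for p
    using ev that unfolding D by blast
  show ?thesis
    unfolding poly_eval_lin_ext
  proof (rule alg_homI)
    fix p q assume pq: "p \<in> carrier (poly_ring V)" "q \<in> carrier (poly_ring V)"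
    show "lin_ext C (monom_eval C a) (p \<oplus>\<^bsub>poly_ring V\<^esub> q) = lin_ext C (monom_eval C a) p \<oplus> lin_ext C (monom_eval C a) q"
      using pq[THEN ev'] by (simp add: poly_ring_simps lin_ext_add)
    show "lin_ext C (monom_eval C a) (p \<otimes>\<^bsub>poly_ring V\<^esub> q) = lin_ext C (monom_eval C a) p \<otimes> lin_ext C (monom_eval C a) q"
      unfolding poly_ring_simps poly_mult_conv
      by (rule lin_ext_conv[OF ev]) (use pq a in \<open>auto simp: D supp_add_nat Pi_def intro!: monom_eval_add\<close>)
  next
    have "monom_eval C a 0 = \<one>" by (simp add: monom_eval_def)
    then show "lin_ext C (monom_eval C a) \<one>\<^bsub>poly_ring V\<^esub> = \<one>"
      using lin_ext_single[of "monom_eval C a" 0 1] by (simp add: poly_ring_simps)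
  next
    fix p q assume "p \<in> carrier (poly_ring V)"
    from lin_ext_scale[OF ev'[OF this]]
    show "lin_ext C (monom_eval C a) (q \<odot>\<^bsub>poly_ring V\<^esub> p) = q \<odot> lin_ext C (monom_eval C a) p"
      by (simp add: poly_ring_simps mult_map_scale_conv_mult)
  qed (use ev' in \<open>auto intro: lin_ext_closed rat_algebra_axioms rat_algebra_poly_ring\<close>)
qed

lemma poly_eval_Var: "a v \<in> carrier C \<Longrightarrow> poly_eval C a (Var v) = a v"
  unfolding poly_eval_lin_ext Var_def
  by (subst lin_ext_single) (simp_all add: monom_eval_def)

end

text \<open>Allows a family that is controlled only on \<open>V\<close> to be replaced by one with
  values in the carrier everywhere.\<close>

lemma poly_eval_cong:
  assumes "\<And>v. v \<in> V \<Longrightarrow> a v = b v" "p \<in> carrier (poly_ring V)" "rat_algebra C" "a \<in> V \<rightarrow> carrier C"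
  shows "poly_eval C a p = poly_eval C b p"
proof -
  interpret rat_algebra C by fact
  have s: "supp m \<subseteq> V" if "m \<in> supp p" for m using that assms(2) by (auto simp: poly_ring_simps)
  have "monom_eval C a m = monom_eval C b m" if "m \<in> supp p" for m
    unfolding monom_eval_def using s[OF that] assms(1,4) by (intro finprod_cong') (auto simp: Pi_def subset_iff)
  moreover have "monom_eval C b m \<in> carrier C" if "m \<in> supp p" for m
    using s[OF that] assms(1,4) by (intro monom_eval_closed) (auto simp: Pi_def subset_iff)
  ultimately show ?thesis
    unfolding poly_eval_lin_ext lin_ext_def by (intro finsum_cong') auto
qed

lemma monom_factor:
  fixes m :: "'v \<Rightarrow>\<^sub>0 nat"
  assumes "m \<noteq> 0"
  obtains v m' where "v \<in> supp m" "m = Poly_Mapping.single v 1 + m'"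
proof -
  obtain v where v: "v \<in> supp m" using assms by (metis keys_eq_empty equals0I)
  have "m = Poly_Mapping.single v 1 + (m - Poly_Mapping.single v 1)"
    using v by (intro poly_mapping_eqI) (auto simp: lookup_add lookup_minus lookup_single when_def in_keys_iff)
  then show ?thesis using v that by blast
qed

definition mdeg :: "('v \<Rightarrow>\<^sub>0 nat) \<Rightarrow> nat" where
  "mdeg m = (\<Sum>v\<in>supp m. coef m v)"

lemma mdeg_superset: "finite K \<Longrightarrow> supp m \<subseteq> K \<Longrightarrow> mdeg m = (\<Sum>v\<in>K. coef m v)"
  unfolding mdeg_def by (intro sum.mono_neutral_left) (auto simp: in_keys_iff)

lemma mdeg_add [simp]: "mdeg (m + n) = mdeg m + mdeg n"
  by (simp add: mdeg_superset[of "supp m \<union> supp n"] supp_add_nat lookup_add sum.distrib)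

lemma mdeg_zero [simp]: "mdeg 0 = 0"
  by (simp add: mdeg_def)

lemma mdeg_single [simp]: "mdeg (Poly_Mapping.single v k) = k"
  by (simp add: mdeg_def)

lemma poly_induct_on [consumes 1, case_names Const Var add mult]:
  fixes p :: "'v rat_poly"
  assumes "p \<in> carrier (poly_ring V)"
    and "\<And>c. P (Const c)" "\<And>v. v \<in> V \<Longrightarrow> P (Var v)"
    and "\<And>p q. p \<in> carrier (poly_ring V) \<Longrightarrow> q \<in> carrier (poly_ring V) \<Longrightarrow> P p \<Longrightarrow> P q \<Longrightarrow> P (p + q)"
    and "\<And>p q. p \<in> carrier (poly_ring V) \<Longrightarrow> q \<in> carrier (poly_ring V) \<Longrightarrow> P p \<Longrightarrow> P q \<Longrightarrow> P (p * q)"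
  shows "P p"
proof -
  have mono: "P (sgl m 1)" if "supp m \<subseteq> V" for m :: "'v \<Rightarrow>\<^sub>0 nat"
    using that
  proof (induction "mdeg m" arbitrary: m rule: less_induct)
    case less
    show ?case
    proof (cases "m = 0")
      case True
      then show ?thesis using assms(2)[of 1] by simp
    next
      case False
      then obtain v m' where m: "v \<in> supp m" "m = Poly_Mapping.single v 1 + m'" by (rule monom_factor)
      have "P (sgl m' 1)" using less.hyps[of m'] less.prems m(2) by (simp add: supp_add_nat)
      moreover have "sgl m 1 = Var v * sgl m' (1::rat)" by (simp add: Var_def mult_single m(2))
      moreover have "v \<in> V" using m(1) less.prems by auto
      ultimately show ?thesis using assms(3)[of v] less.prems m(2)
        by (auto intro!: assms(5) simp: poly_ring_simps Var_def supp_add_nat)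
    qed
  qed
  have "supp p \<subseteq> {m. supp m \<subseteq> V}" using assms(1) by (auto simp: poly_ring_simps)
  then show ?thesis
  proof (induction rule: free_induct)
    case zero
    then show ?case using assms(2)[of 0] by simp
  next
    case (single m c)
    have "sgl m c = Const c * sgl m 1" by (simp add: mult_single)
    then show ?case using single mono[of m] by (auto intro!: assms(2,5) simp: poly_ring_simps)
  next
    case (add p q)
    then show ?case by (intro assms(4)) (auto simp: poly_ring_simps)
  qed
qed

lemma carrier_poly_UNIV [simp]: "carrier (poly_ring UNIV) = UNIV"
  by (simp add: poly_ring_simps)

lemma poly_induct [case_names Const Var add mult]:
  fixes p :: "'v rat_poly"
  assumes "\<And>c. P (Const c)" "\<And>v. P (Var v)" "\<And>p q. P p \<Longrightarrow> P q \<Longrightarrow> P (p + q)"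
    and "\<And>p q. P p \<Longrightarrow> P q \<Longrightarrow> P (p * q)"
  shows "P p"
  by (rule poly_induct_on[of p UNIV]) (use assms in simp_all)

abbreviation poly_hom :: "(rat, 'c) graded \<Rightarrow> ('v rat_poly \<Rightarrow> 'c) \<Rightarrow> bool" where
  "poly_hom C \<equiv> alg_hom (poly_ring UNIV) C"

text \<open>Every polynomial over the whole type lies in the carrier of
  \<open>poly_ring UNIV\<close>, so these rules hold without side conditions.\<close>

locale poly_alg_hom = alg_hom "poly_ring UNIV" C h for C :: "(rat, 'c) graded" and h :: "'v rat_poly \<Rightarrow> 'c"
begin

lemma p_closed [simp]: "h p \<in> carrier C"
  using closed[of p] by simp

lemma p_add [simp]: "h (p + q) = h p \<oplus>\<^bsub>C\<^esub> h q"
  using add[of p q] by (simp add: poly_ring_simps)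

lemma p_mult [simp]: "h (p * q) = h p \<otimes>\<^bsub>C\<^esub> h q"
  using mult[of p q] by (simp add: poly_ring_simps)

lemma p_one [simp]: "h 1 = \<one>\<^bsub>C\<^esub>"
  using one by (simp add: poly_ring_simps)

lemma p_zero [simp]: "h 0 = \<zero>\<^bsub>C\<^esub>"
  using zero by (simp add: poly_ring_simps)

lemma p_smult: "h (Const c * p) = c \<odot>\<^bsub>C\<^esub> h p"
  using smult[of p c] by (simp add: poly_ring_simps)

lemma p_Const [simp]: "h (Const c) = c \<odot>\<^bsub>C\<^esub> \<one>\<^bsub>C\<^esub>"
  using p_smult[of c 1] by (simp del: p_mult)

lemma p_uminus [simp]: "h (- p) = \<ominus>\<^bsub>C\<^esub> h p"
  using p_add[of "- p" p] by (simp add: B.minus_equality del: p_add)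

lemma p_minus [simp]: "h (p - q) = h p \<ominus>\<^bsub>C\<^esub> h q"
  using p_add[of p "- q"] by (simp add: a_minus_def)

lemma p_sum: "h (\<Sum>k\<in>K. f k) = (\<Oplus>\<^bsub>C\<^esub>k\<in>K. h (f k))"
proof (induction K rule: infinite_finite_induct)
  case (infinite K)
  then show ?case by (simp add: B.finsum_infinite)
qed (auto simp: Pi_def)

end

lemma poly_hom_eqI:
  assumes "poly_hom C h" "poly_hom C k" "\<And>v. h (Var v) = k (Var v)"
  shows "h p = k p"
proof -
  interpret h: poly_alg_hom C h by (rule poly_alg_hom.intro) fact
  interpret k: poly_alg_hom C k by (rule poly_alg_hom.intro) fact
  show ?thesis by (induction p rule: poly_induct) (simp_all add: assms(3))
qed

definition subst :: "('v \<Rightarrow> 'w rat_poly) \<Rightarrow> 'v rat_poly \<Rightarrow> 'w rat_poly" where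
  "subst = poly_eval (poly_ring UNIV)"

lemma subst_hom: "poly_hom (poly_ring UNIV) (subst a)"
  unfolding subst_def by (intro rat_algebra.alg_hom_poly_eval rat_algebra_poly_ring) simp

lemma subst_Var [simp]: "subst a (Var v) = a v"
  unfolding subst_def by (rule rat_algebra.poly_eval_Var[OF rat_algebra_poly_ring]) simp

lemma subst_simps [simp]:
  "subst a (p + q) = subst a p + subst a q"
  "subst a (p * q) = subst a p * subst a q"
  "subst a 1 = 1" "subst a 0 = 0"
  "subst a (Const c) = Const c"
  using poly_alg_hom.p_add[OF poly_alg_hom.intro[OF subst_hom], of a p q]
    poly_alg_hom.p_mult[OF poly_alg_hom.intro[OF subst_hom], of a p q]
    poly_alg_hom.p_one[OF poly_alg_hom.intro[OF subst_hom], of a]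
    poly_alg_hom.p_zero[OF poly_alg_hom.intro[OF subst_hom], of a]
    poly_alg_hom.p_Const[OF poly_alg_hom.intro[OF subst_hom], of a c]
  by (simp_all add: poly_ring_simps)

lemma subst_uminus [simp]: "subst a (- p) = - subst a p"
  using subst_simps(1)[of a p "- p"] by (simp add: add_eq_0_iff del: subst_simps(1))

lemma subst_minus [simp]: "subst a (p - q) = subst a p - subst a q"
  using subst_simps(1)[of a p "- q"] by simp

lemma subst_sum [simp]: "subst a (\<Sum>k\<in>K. f k) = (\<Sum>k\<in>K. subst a (f k))"
  by (induction K rule: infinite_finite_induct) simp_all

lemma subst_subst: "subst a (subst b p) = subst (\<lambda>v. subst a (b v)) p"
  by (induction p rule: poly_induct) simp_all

lemma subst_ident: "(\<And>v. a v = Var v) \<Longrightarrow> subst a p = p"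
  by (induction p rule: poly_induct) simp_all

lemma subst_closed:
  assumes "\<And>v. a v \<in> carrier (poly_ring V)"
  shows "subst a p \<in> carrier (poly_ring V)"
proof -
  interpret rat_algebra "poly_ring V" by (rule rat_algebra_poly_ring)
  show ?thesis
  proof (induction p rule: poly_induct)
    case (add p q)
    then show ?case using a_closed[of "subst a p" "subst a q"] by (simp add: poly_ring_simps(5))
  next
    case (mult p q)
    then show ?case by (simp add: poly_ring_mult_closed)
  qed (use assms in \<open>auto simp: poly_ring_simps\<close>)
qed

section \<open>Ideals and homogeneous components\<close>

text \<open>Ideals in the type of polynomials, built by adding one multiple of a generator at a
  time. Membership then has an induction rule in which only the generators need inspection.\<close>

inductive_set idl :: "'r::comm_ring_1 set \<Rightarrow> 'r set" for S where
  zero [simp, intro]: "0 \<in> idl S"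
| step: "s \<in> S \<Longrightarrow> p \<in> idl S \<Longrightarrow> a * s + p \<in> idl S"

lemma idl_mult_gen: "s \<in> S \<Longrightarrow> a * s \<in> idl S"
  using idl.step[of s S 0 a] by simp

lemma idl_gen: "s \<in> S \<Longrightarrow> s \<in> idl S"
  using idl_mult_gen[of s S 1] by simp

lemma idl_add: "p \<in> idl S \<Longrightarrow> q \<in> idl S \<Longrightarrow> p + q \<in> idl S"
  by (induction rule: idl.induct) (auto simp: add.assoc intro: idl.step)

lemma idl_mult: "p \<in> idl S \<Longrightarrow> a * p \<in> idl S"
  by (induction rule: idl.induct) (auto simp: distrib_left mult.assoc[symmetric] intro: idl.step)

lemma idl_mult_right: "p \<in> idl S \<Longrightarrow> p * a \<in> idl S"
  using idl_mult[of p S a] by (simp add: mult.commute)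

lemma idl_uminus: "p \<in> idl S \<Longrightarrow> - p \<in> idl S"
  using idl_mult[of p S "- 1"] by simp

lemma idl_minus: "p \<in> idl S \<Longrightarrow> q \<in> idl S \<Longrightarrow> p - q \<in> idl S"
  using idl_add[of p S "- q"] idl_uminus[of q S] by simp

lemma idl_sum: "(\<And>k. k \<in> K \<Longrightarrow> f k \<in> idl S) \<Longrightarrow> (\<Sum>k\<in>K. f k) \<in> idl S"
  by (induction K rule: infinite_finite_induct) (auto intro: idl_add)

lemma idl_trans: "p - q \<in> idl S \<Longrightarrow> q - r \<in> idl S \<Longrightarrow> p - r \<in> idl S"
  using idl_add[of "p - q" S "q - r"] by simp

lemma idl_sym: "p - q \<in> idl S \<Longrightarrow> q - p \<in> idl S"
  using idl_uminus[of "p - q" S] by simp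

text \<open>The factor \<open>x\<close> serves for substitutions that respect the relations only
  after multiplication by x_H.\<close>

lemma idl_mult_subst:
  assumes "p \<in> idl S" "\<And>s. s \<in> S \<Longrightarrow> x * subst a s \<in> idl T"
  shows "x * subst a p \<in> idl T"
  using assms(1)
proof (induction rule: idl.induct)
  case (step s p b)
  have "x * subst a (b * s + p) = subst a b * (x * subst a s) + x * subst a p"
    by (simp add: algebra_simps)
  then show ?case using step assms(2)[of s] by (auto intro: idl_add idl_mult)
qed simp

lemma idl_subst:
  assumes "p \<in> idl S" "\<And>s. s \<in> S \<Longrightarrow> subst a s \<in> idl T"
  shows "subst a p \<in> idl T"
  using idl_mult_subst[of p S 1 a T] assms by simp

lemma idl_subset:
  assumes "p \<in> idl S" "\<And>s. s \<in> S \<Longrightarrow> s \<in> idl T"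
  shows "p \<in> idl T"
  using assms by (induction rule: idl.induct) (auto intro: idl_add idl_mult)

lemma idl_mono: "S \<subseteq> T \<Longrightarrow> p \<in> idl S \<Longrightarrow> p \<in> idl T"
  by (rule idl_subset[of p S T]) (auto intro: idl_gen)

lemma (in poly_alg_hom) idl_kill:
  assumes "p \<in> idl S" "\<And>s. s \<in> S \<Longrightarrow> h s = \<zero>\<^bsub>C\<^esub>"
  shows "h p = \<zero>\<^bsub>C\<^esub>"
  using assms by (induction rule: idl.induct) auto

text \<open>A difference of products telescopes into differences of the factors, so congruence
  modulo the ideal, even up to a factor \<open>x\<close>, need only be known for variables.\<close>

lemma subst_cong_idl:
  assumes "\<And>v. x * (subst a (Var v) - subst b (Var v)) \<in> idl T"
  shows "x * (subst a p - subst b p) \<in> idl T"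
proof (induction p rule: poly_induct)
  case (add p q)
  have "x * (subst a (p + q) - subst b (p + q)) =
    x * (subst a p - subst b p) + x * (subst a q - subst b q)"
    by (simp add: algebra_simps)
  then show ?case using add by (simp add: idl_add)
next
  case (mult p q)
  have "x * (subst a (p * q) - subst b (p * q)) =
    subst a q * (x * (subst a p - subst b p)) + subst b p * (x * (subst a q - subst b q))"
    by (simp add: algebra_simps)
  then show ?case using mult by (simp add: idl_add idl_mult)
qed (use assms in simp_all)

text \<open>Used with two predicates: fixed degree, for homogeneous components, and support on a
  chain, for normal forms modulo a monomial ideal.\<close>

definition filt :: "('x \<Rightarrow> bool) \<Rightarrow> ('x \<Rightarrow>\<^sub>0 rat) \<Rightarrow> 'x \<Rightarrow>\<^sub>0 rat" where
  "filt P = Poly_Mapping.mapp (\<lambda>m c. if P m then c else 0)"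

lemma coef_filt: "coef (filt P p) m = (if P m then coef p m else 0)"
  by (auto simp: filt_def lookup_mapp when_def in_keys_iff)

lemma supp_filt: "supp (filt P p) = {m \<in> supp p. P m}"
  by (auto simp: in_keys_iff coef_filt split: if_splits)

lemma filt_add: "filt P (p + q) = filt P p + filt P q"
  by (rule poly_mapping_eqI) (simp add: coef_filt lookup_add)

lemma filt_zero [simp]: "filt P 0 = 0"
  by (rule poly_mapping_eqI) (simp add: coef_filt)

lemma filt_minus: "filt P (p - q) = filt P p - filt P q"
  by (rule poly_mapping_eqI) (simp add: coef_filt lookup_minus)

lemma filt_sum: "filt P (\<Sum>k\<in>K. f k) = (\<Sum>k\<in>K. filt P (f k))"
  by (induction K rule: infinite_finite_induct) (auto simp: filt_add)

lemma filt_single: "filt P (sgl m c) = (if P m then sgl m c else 0)"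
  by (rule poly_mapping_eqI) (auto simp: coef_filt lookup_single when_def)

lemma filt_ident: "(\<And>m. m \<in> supp p \<Longrightarrow> P m) \<Longrightarrow> filt P p = p"
  by (rule poly_mapping_eqI) (auto simp: coef_filt in_keys_iff)

lemma filt_eq_zero: "(\<And>m. m \<in> supp p \<Longrightarrow> \<not> P m) \<Longrightarrow> filt P p = 0"
  by (rule poly_mapping_eqI) (auto simp: coef_filt in_keys_iff)

definition homp :: "nat \<Rightarrow> 'v rat_poly set" where
  "homp k = {p. \<forall>m\<in>supp p. mdeg m = k}"

abbreviation part :: "nat \<Rightarrow> 'v rat_poly \<Rightarrow> 'v rat_poly" where
  "part k \<equiv> filt (\<lambda>m. mdeg m = k)"

lemma homog_poly_ring: "homog (poly_ring V) k = homp k \<inter> carrier (poly_ring V)"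
  by (auto simp: poly_ring_def homp_def mdeg_def)

lemma homp_add: "p \<in> homp k \<Longrightarrow> q \<in> homp k \<Longrightarrow> p + q \<in> homp k"
  using Poly_Mapping.keys_add[of p q] by (auto simp: homp_def)

lemma homp_zero [simp]: "0 \<in> homp k"
  by (simp add: homp_def)

lemma homp_uminus: "p \<in> homp k \<Longrightarrow> - p \<in> homp k"
  by (auto simp: homp_def in_keys_iff)

lemma homp_minus: "p \<in> homp k \<Longrightarrow> q \<in> homp k \<Longrightarrow> p - q \<in> homp k"
  using homp_add[of p k "- q"] homp_uminus[of q k] by simp

lemma homp_sum: "(\<And>j. j \<in> K \<Longrightarrow> f j \<in> homp k) \<Longrightarrow> (\<Sum>j\<in>K. f j) \<in> homp k"
  by (induction K rule: infinite_finite_induct) (auto intro: homp_add)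

lemma homp_mult: "p \<in> homp i \<Longrightarrow> q \<in> homp j \<Longrightarrow> p * q \<in> homp (i + j)"
  using Poly_Mapping.keys_mult[of p q] by (fastforce simp: homp_def)

lemma homp_Const [simp]: "Const c \<in> homp 0"
  by (simp add: homp_def)

lemma homp_one [simp]: "1 \<in> homp 0"
  by (simp add: homp_def)

lemma homp_Var [simp]: "Var v \<in> homp 1"
  by (simp add: homp_def Var_def)

lemma homp_Var_Suc [simp]: "Var v \<in> homp (Suc 0)"
  using homp_Var by simp

lemma homp_scale: "p \<in> homp k \<Longrightarrow> Const c * p \<in> homp k"
  using homp_mult[OF homp_Const] by fastforce

lemma part_homp: "part k p \<in> homp k"
  by (auto simp: homp_def supp_filt)

lemma part_of_homp: "p \<in> homp j \<Longrightarrow> part k p = (if j = k then p else 0)"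
  by (auto simp: homp_def intro!: filt_ident filt_eq_zero)

lemma sum_parts: "finite K \<Longrightarrow> mdeg ` supp p \<subseteq> K \<Longrightarrow> (\<Sum>k\<in>K. part k p) = p"
proof (rule poly_mapping_eqI)
  fix m assume K: "finite K" "mdeg ` supp p \<subseteq> K"
  have "coef (\<Sum>k\<in>K. part k p) m = (\<Sum>k\<in>K. if mdeg m = k then coef p m else 0)"
    by (simp add: lookup_sum coef_filt)
  also have "\<dots> = coef p m"
    using K by (auto simp: image_subset_iff not_in_keys_iff_lookup_eq_zero[symmetric])
  finally show "coef (\<Sum>k\<in>K. part k p) m = coef p m" .
qed

lemma part_mult_homp:
  assumes "s \<in> homp d"
  shows "part k (a * s) = (if d \<le> k then part (k - d) a * s else 0)"
proof (induction a rule: free_induct_UNIV)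
  case (single m c)
  have "supp s \<subseteq> {m. mdeg m = d}" using assms by (auto simp: homp_def)
  then show ?case
    by (induction rule: free_induct) (auto simp: mult_single filt_single distrib_left filt_add)
next
  case (add p q)
  then show ?case by (simp add: filt_add distrib_right)
qed

text \<open>For homogeneous \<open>s\<close>, the component of \<open>a * s\<close> in degree k is a
  component of \<open>a\<close> times \<open>s\<close>, again a multiple of the generator.\<close>

lemma part_idl:
  assumes "\<And>s. s \<in> S \<Longrightarrow> \<exists>d. s \<in> homp d" "p \<in> idl S"
  shows "part k p \<in> idl S"
  using assms(2)
proof (induction rule: idl.induct)
  case (step s p a)
  then obtain d where "s \<in> homp d" using assms(1) by blast
  then show ?case
    using step by (auto simp: filt_add part_mult_homp intro: idl_add idl_mult_gen)
qed simp

lemma subst_homp: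
  assumes "\<And>v. a v \<in> homp 1" "p \<in> homp k"
  shows "subst a p \<in> homp k"
proof -
  have mono: "subst a (sgl m 1) \<in> homp (mdeg m)" for m :: "'a \<Rightarrow>\<^sub>0 nat"
  proof (induction "mdeg m" arbitrary: m rule: less_induct)
    case less
    show ?case
    proof (cases "m = 0")
      case False
      then obtain v m' where m: "m = Poly_Mapping.single v 1 + m'" by (rule monom_factor)
      have "sgl m 1 = Var v * sgl m' (1::rat)" by (simp add: Var_def mult_single m)
      then show ?thesis
        using homp_mult[OF assms(1)[of v] less.hyps[of m']] by (simp add: m)
    qed simp
  qed
  have "supp p \<subseteq> {m. mdeg m = k}" using assms(2) by (auto simp: homp_def)
  then show ?thesis
  proof (induction rule: free_induct)
    case (single m c)
    have "sgl m c = Const c * sgl m 1" by (simp add: mult_single)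
    moreover have "Const c * subst a (sgl m 1) \<in> homp k" using single homp_scale[OF mono[of m]] by auto
    ultimately show ?case by (metis subst_simps(2,5))
  qed (auto intro: homp_add)
qed

section \<open>Graded algebras presented by generators and relations\<close>

text \<open>A graded presentation: every statement about the algebra, its grading and its equality
  becomes one about polynomials and membership in \<open>idl S\<close>.\<close>

locale pres = poly_alg_hom C h for C :: "(rat, 'c) graded" and h :: "'v rat_poly \<Rightarrow> 'c" +
  fixes S :: "'v rat_poly set"
  assumes surj: "carrier C = range h"
    and homog_eq: "homog C k = h ` homp k"
    and kernel: "h p = \<zero>\<^bsub>C\<^esub> \<longleftrightarrow> p \<in> idl S"
    and gens_homp: "s \<in> S \<Longrightarrow> \<exists>k. s \<in> homp k"
begin

lemma eq_iff: "h p = h q \<longleftrightarrow> p - q \<in> idl S"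
  using B.minus_eq_zeroD[of "h p" "h q"] B.minus_equality
  by (auto simp: kernel[symmetric] a_minus_def B.r_neg)

lemma graded_ring: "graded_ring C"
proof (intro graded_ring.intro graded_group.intro graded_group_axioms.intro graded_ring_axioms.intro)
  show "cring C" "abelian_group C" by (rule B.is_cring B.abelian_group_axioms)+
  show "additive_subgroup (homog C k) C" for k
  proof (rule additive_subgroup.intro, rule subgroup.intro)
    show "homog C k \<subseteq> carrier (add_monoid C)" by (auto simp: homog_eq surj)
    show "\<one>\<^bsub>add_monoid C\<^esub> \<in> homog C k"
      using p_zero by (auto simp: homog_eq intro!: image_eqI[of _ _ 0])
  next
    fix x y assume "x \<in> homog C k" "y \<in> homog C k"
    then show "x \<otimes>\<^bsub>add_monoid C\<^esub> y \<in> homog C k"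
      by (auto simp: homog_eq simp flip: p_add intro!: imageI homp_add)
  next
    fix x assume "x \<in> homog C k"
    then obtain p where p: "x = h p" "p \<in> homp k" by (auto simp: homog_eq)
    then have "inv\<^bsub>add_monoid C\<^esub> x = h (- p)" by (simp add: a_inv_def)
    then show "inv\<^bsub>add_monoid C\<^esub> x \<in> homog C k" using homp_uminus[OF p(2)] unfolding homog_eq by blast
  qed
next
  fix x assume "x \<in> carrier C"
  then obtain p where p: "x = h p" by (auto simp: surj)
  let ?c = "\<lambda>k. h (part k p)"
  have "?c k = \<zero>\<^bsub>C\<^esub>" if "k \<notin> mdeg ` supp p" for k
  proof -
    have "part k p = 0" using that by (intro filt_eq_zero) auto
    then show ?thesis by simp
  qed
  then have "{k. ?c k \<noteq> \<zero>\<^bsub>C\<^esub>} \<subseteq> mdeg ` supp p" by blast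
  then have fin: "finite {k. ?c k \<noteq> \<zero>\<^bsub>C\<^esub>}" by (rule finite_subset) simp
  show "\<exists>!c. (\<forall>k. c k \<in> homog C k) \<and> finite {k. c k \<noteq> \<zero>\<^bsub>C\<^esub>} \<and> x = (\<Oplus>\<^bsub>C\<^esub>k\<in>{k. c k \<noteq> \<zero>\<^bsub>C\<^esub>}. c k)"
  proof (rule ex1I[of _ ?c])
    let ?K = "mdeg ` supp p \<union> {k. ?c k \<noteq> \<zero>\<^bsub>C\<^esub>}"
    have "(\<Oplus>\<^bsub>C\<^esub>k\<in>{k. ?c k \<noteq> \<zero>\<^bsub>C\<^esub>}. ?c k) = (\<Oplus>\<^bsub>C\<^esub>k\<in>?K. ?c k)"
    proof (rule B.finsum_mono_neutral)
      show "finite ?K" using fin by simp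
    qed (blast | simp)+
    also have "\<dots> = h (\<Sum>k\<in>?K. part k p)" by (simp add: p_sum)
    also have "\<dots> = x" using fin p by (subst sum_parts) auto
    finally show "(\<forall>k. ?c k \<in> homog C k) \<and> finite {k. ?c k \<noteq> \<zero>\<^bsub>C\<^esub>} \<and> x = (\<Oplus>\<^bsub>C\<^esub>k\<in>{k. ?c k \<noteq> \<zero>\<^bsub>C\<^esub>}. ?c k)"
      using fin by (auto simp: homog_eq part_homp)
  next
    fix c assume c: "(\<forall>k. c k \<in> homog C k) \<and> finite {k. c k \<noteq> \<zero>\<^bsub>C\<^esub>} \<and> x = (\<Oplus>\<^bsub>C\<^esub>k\<in>{k. c k \<noteq> \<zero>\<^bsub>C\<^esub>}. c k)"
    let ?K = "{k. c k \<noteq> \<zero>\<^bsub>C\<^esub>}"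
    have "\<exists>q. \<forall>k. q k \<in> homp k \<and> c k = h (q k)"
      using c by (intro choice) (auto simp: homog_eq)
    then obtain q where q: "\<And>k. q k \<in> homp k" "\<And>k. c k = h (q k)" by blast
    have "h (\<Sum>k\<in>?K. q k) = x" using c q(2) by (simp add: p_sum)
    then have "p - (\<Sum>k\<in>?K. q k) \<in> idl S" using p eq_iff by metis
    \<comment> \<open>The relations are homogeneous, so comparing components of the two
      representatives gives uniqueness of the decomposition.\<close>
    then have "part j (p - (\<Sum>k\<in>?K. q k)) \<in> idl S" for j
      by (intro part_idl gens_homp)
    then have *: "h (part j p) = h (part j (\<Sum>k\<in>?K. q k))" for j
      by (simp add: eq_iff filt_minus)
    have "part j (\<Sum>k\<in>?K. q k) = (\<Sum>k\<in>?K. if k = j then q k else 0)" for j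
      by (simp add: filt_sum part_of_homp[OF q(1)])
    then have "part j (\<Sum>k\<in>?K. q k) = (if j \<in> ?K then q j else 0)" for j
      using c by simp
    then show "c = ?c" using * q(2) by (auto simp: fun_eq_iff)
  qed
next
  show "\<one>\<^bsub>C\<^esub> \<in> homog C 0"
    unfolding homog_eq using p_one homp_one by (metis image_eqI)
next
  fix a b i j assume "a \<in> homog C i" "b \<in> homog C j"
  then show "a \<otimes>\<^bsub>C\<^esub> b \<in> homog C (i + j)"
    by (auto simp: homog_eq simp flip: p_mult intro!: imageI homp_mult)
qed

end

section \<open>Tensor products\<close>

locale alg_pair = A: rat_algebra A + B: rat_algebra B
  for A :: "(rat, 'a) graded" and B :: "(rat, 'b) graded"
begin

abbreviation "P \<equiv> pairs_ring A B"
abbreviation "D \<equiv> carrier A \<times> carrier B"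

definition pair_mult :: "'a \<times> 'b \<Rightarrow> 'a \<times> 'b \<Rightarrow> 'a \<times> 'b" where
  "pair_mult x y = (fst x \<otimes>\<^bsub>A\<^esub> fst y, snd x \<otimes>\<^bsub>B\<^esub> snd y)"

lemma pair_mult_D: "x \<in> D \<Longrightarrow> y \<in> D \<Longrightarrow> pair_mult x y \<in> D"
  by (auto simp: pair_mult_def)

lemma pairs_simps:
  "carrier P = {p. supp p \<subseteq> D}"
  "mult P = conv pair_mult" "one P = sgl (\<one>\<^bsub>A\<^esub>, \<one>\<^bsub>B\<^esub>) 1" "zero P = 0" "add P = (+)"
  "smult P = (\<lambda>q. Poly_Mapping.map ((*) q))"
  by (simp_all add: pairs_ring_def fun_eq_iff conv_def pair_mult_def case_prod_beta)

lemma homog_pairs: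
  "homog P k = {p. supp p \<subseteq> {(a, b). \<exists>i j. i + j = k \<and> a \<in> homog A i \<and> b \<in> homog B j}}"
  by (auto simp: pairs_ring_def)

lemma supp_scale: "supp (Poly_Mapping.map ((*) q) p) \<subseteq> supp p" for q :: rat
  by (auto simp: in_keys_iff Poly_Mapping.map.rep_eq when_def)

lemma coef_scale: "coef (Poly_Mapping.map ((*) q) p) x = q * coef p x" for q :: rat
  by (auto simp: Poly_Mapping.map.rep_eq when_def)

lemma scale_add: "Poly_Mapping.map ((*) q) (p + p') = Poly_Mapping.map ((*) q) p + Poly_Mapping.map ((*) q) p'"
  for q :: rat
  by (rule poly_mapping_eqI) (simp add: coef_scale lookup_add distrib_left)

lemma conv_scale: "conv f (Poly_Mapping.map ((*) q) p) p' = Poly_Mapping.map ((*) q) (conv f p p')"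
proof (induction p rule: free_induct_UNIV)
  case (single x c)
  show ?case
    by (induction p' rule: free_induct_UNIV) (simp_all add: conv_single conv_add_right scale_add mult.assoc)
qed (simp add: conv_add_left scale_add)

text \<open>The ring axioms involving products are multilinear and are checked on single
  pairs.\<close>

lemma rat_algebra_pairs: "rat_algebra P"
proof (rule rat_algebra.intro)
  have cl: "conv pair_mult p q \<in> carrier P" if "p \<in> carrier P" "q \<in> carrier P" for p q
    using that supp_conv[of p D q pair_mult] pair_mult_D by (auto simp: pairs_simps)
  show "cring P"
  proof (intro cringI abelian_groupI comm_monoidI)
    fix p q r assume pqr: "p \<in> carrier P" "q \<in> carrier P" "r \<in> carrier P"
    note D = pqr[unfolded pairs_simps mem_Collect_eq]
    show "p \<otimes>\<^bsub>P\<^esub> q \<otimes>\<^bsub>P\<^esub> r = p \<otimes>\<^bsub>P\<^esub> (q \<otimes>\<^bsub>P\<^esub> r)"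
      unfolding pairs_simps using D(1)
    proof (induction rule: free_induct)
      case (single x a)
      show ?case
        using D(2)
      proof (induction rule: free_induct)
        case (single y b)
        show ?case
          using D(3)
        proof (induction rule: free_induct)
          case (single z c)
          show ?case using \<open>x \<in> D\<close> \<open>y \<in> D\<close> \<open>z \<in> D\<close>
            by (simp add: conv_single mult.assoc) (auto simp: pair_mult_def A.m_assoc B.m_assoc)
        qed (simp_all add: conv_add_right)
      qed (simp_all add: conv_add_right conv_add_left)
    qed (simp_all add: conv_add_left)
  next
    fix p q assume pq: "p \<in> carrier P" "q \<in> carrier P"
    note D = pq[unfolded pairs_simps mem_Collect_eq]
    show "p \<oplus>\<^bsub>P\<^esub> q \<in> carrier P"
      using D Poly_Mapping.keys_add[of p q] by (auto simp: pairs_simps)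
    show "p \<otimes>\<^bsub>P\<^esub> q \<in> carrier P" using cl[OF pq] by (simp add: pairs_simps)
    show "p \<otimes>\<^bsub>P\<^esub> q = q \<otimes>\<^bsub>P\<^esub> p"
      unfolding pairs_simps using D(1)
    proof (induction rule: free_induct)
      case (single x a)
      show ?case
        using D(2)
      proof (induction rule: free_induct)
        case (single y b)
        show ?case using \<open>x \<in> D\<close> \<open>y \<in> D\<close>
          by (simp add: conv_single mult.commute) (auto simp: pair_mult_def A.m_comm B.m_comm)
      qed (simp_all add: conv_add_right conv_add_left)
    qed (simp_all add: conv_add_left conv_add_right)
    show "\<one>\<^bsub>P\<^esub> \<otimes>\<^bsub>P\<^esub> p = p"
      unfolding pairs_simps using D(1)
    proof (induction rule: free_induct)
      case (single x a)
      then show ?case by (auto simp: conv_single pair_mult_def)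
    qed (simp_all add: conv_add_right)
    show "\<exists>q\<in>carrier P. q \<oplus>\<^bsub>P\<^esub> p = \<zero>\<^bsub>P\<^esub>"
      using D by (intro bexI[of _ "- p"]) (auto simp: pairs_simps in_keys_iff)
  qed (auto simp: pairs_simps conv_add_left algebra_simps)
  show "rat_algebra_axioms P"
  proof (intro rat_algebra_axioms.intro)
    fix p and q :: rat assume "p \<in> carrier P"
    then show "q \<odot>\<^bsub>P\<^esub> p \<in> carrier P" using supp_scale[of q p] by (auto simp: pairs_simps)
  qed (auto simp: pairs_simps conv_scale scale_add coef_scale lookup_add algebra_simps intro!: poly_mapping_eqI)
qed

lemma rels_carrier: "bilinear_rels A B \<subseteq> carrier P"
proof -
  have s: "supp (p - q) \<subseteq> D" if "supp p \<subseteq> D" "supp q \<subseteq> D" for p q :: "'a \<times> 'b \<Rightarrow>\<^sub>0 rat"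
    using that Poly_Mapping.keys_diff[of p q] by blast
  show ?thesis
  proof
    fix x assume "x \<in> bilinear_rels A B"
    then have "supp x \<subseteq> D"
      unfolding bilinear_rels_def by (elim UnE CollectE exE conjE; hypsubst; intro s; simp)
    then show "x \<in> carrier P" by (simp add: pairs_simps)
  qed
qed

sublocale T: quotient_alg P "tensor_ideal A B"
  unfolding tensor_ideal_def
  by (rule rat_algebra.quotient_alg_genideal[OF rat_algebra_pairs rels_carrier])

lemma tensor_eq: "tensor A B = T.Q"
  by (simp add: tensor_def)

lemma rat_algebra_tensor: "rat_algebra (tensor A B)"
  unfolding tensor_eq by (rule T.Q.rat_algebra_axioms)

lemma tens_eq: "tens A B a b = T.cls (sgl (a, b) 1)"
  by (simp add: tens_def)

lemma sgl_carrier: "a \<in> carrier A \<Longrightarrow> b \<in> carrier B \<Longrightarrow> sgl (a, b) c \<in> carrier P"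
  by (auto simp: pairs_simps)

interpretation c: alg_hom P "tensor A B" T.cls
  unfolding tensor_eq by (rule T.cls_alg_hom)

lemma cls_rel:
  assumes "p - q \<in> bilinear_rels A B" "p \<in> carrier P" "q \<in> carrier P"
  shows "T.cls p = T.cls q"
proof -
  have "p \<ominus>\<^bsub>P\<^esub> q = p - q"
  proof -
    have "- q \<in> carrier P" using assms(3) by (auto simp: pairs_simps in_keys_iff)
    then have "\<ominus>\<^bsub>P\<^esub> q = - q" using assms(3) by (intro T.P.minus_equality) (simp_all add: pairs_simps)
    then show ?thesis by (simp add: a_minus_def pairs_simps)
  qed
  then show ?thesis
    using assms T.cls_eq_iff[OF assms(2,3)] T.P.genideal_self[OF rels_carrier] unfolding tensor_ideal_def by auto
qed

lemma tens_closed [simp]: "a \<in> carrier A \<Longrightarrow> b \<in> carrier B \<Longrightarrow> tens A B a b \<in> carrier (tensor A B)"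
  unfolding tens_eq by (intro c.closed sgl_carrier)

lemma tens_add_left:
  assumes "a \<in> carrier A" "a' \<in> carrier A" "b \<in> carrier B"
  shows "tens A B (a \<oplus>\<^bsub>A\<^esub> a') b = tens A B a b \<oplus>\<^bsub>tensor A B\<^esub> tens A B a' b"
proof -
  have "sgl (a \<oplus>\<^bsub>A\<^esub> a', b) 1 - (sgl (a, b) 1 + sgl (a', b) 1) \<in> bilinear_rels A B"
    unfolding bilinear_rels_def diff_diff_eq[symmetric] using assms by blast
  then have "T.cls (sgl (a \<oplus>\<^bsub>A\<^esub> a', b) 1) = T.cls (sgl (a, b) 1 \<oplus>\<^bsub>P\<^esub> sgl (a', b) 1)"
    using assms by (intro cls_rel T.P.a_closed sgl_carrier) (simp_all add: pairs_simps(5))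
  then show ?thesis using assms by (simp add: tens_eq sgl_carrier)
qed

lemma tens_add_right:
  assumes "a \<in> carrier A" "b \<in> carrier B" "b' \<in> carrier B"
  shows "tens A B a (b \<oplus>\<^bsub>B\<^esub> b') = tens A B a b \<oplus>\<^bsub>tensor A B\<^esub> tens A B a b'"
proof -
  have "sgl (a, b \<oplus>\<^bsub>B\<^esub> b') 1 - (sgl (a, b) 1 + sgl (a, b') 1) \<in> bilinear_rels A B"
    unfolding bilinear_rels_def diff_diff_eq[symmetric] using assms by blast
  then have "T.cls (sgl (a, b \<oplus>\<^bsub>B\<^esub> b') 1) = T.cls (sgl (a, b) 1 \<oplus>\<^bsub>P\<^esub> sgl (a, b') 1)"
    using assms by (intro cls_rel T.P.a_closed sgl_carrier) (simp_all add: pairs_simps(5))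
  then show ?thesis using assms by (simp add: tens_eq sgl_carrier)
qed

lemma cls_sgl:
  assumes "a \<in> carrier A" "b \<in> carrier B"
  shows "T.cls (sgl (a, b) q) = q \<odot>\<^bsub>tensor A B\<^esub> tens A B a b"
proof -
  have "sgl (a, b) q = q \<odot>\<^bsub>P\<^esub> sgl (a, b) 1" by (simp add: pairs_simps)
  then show ?thesis using assms by (simp add: tens_eq sgl_carrier)
qed

lemma tens_smult_left:
  assumes "a \<in> carrier A" "b \<in> carrier B"
  shows "tens A B (q \<odot>\<^bsub>A\<^esub> a) b = q \<odot>\<^bsub>tensor A B\<^esub> tens A B a b"
proof -
  have "T.cls (sgl (q \<odot>\<^bsub>A\<^esub> a, b) 1) = T.cls (sgl (a, b) q)"
    using assms by (intro cls_rel) (auto simp: bilinear_rels_def sgl_carrier)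
  then show ?thesis by (simp only: tens_eq[of "q \<odot>\<^bsub>A\<^esub> a" b] cls_sgl[OF assms])
qed

lemma tens_smult_right:
  assumes "a \<in> carrier A" "b \<in> carrier B"
  shows "tens A B a (q \<odot>\<^bsub>B\<^esub> b) = q \<odot>\<^bsub>tensor A B\<^esub> tens A B a b"
proof -
  have "T.cls (sgl (a, q \<odot>\<^bsub>B\<^esub> b) 1) = T.cls (sgl (a, b) q)"
    using assms by (intro cls_rel) (auto simp: bilinear_rels_def sgl_carrier)
  then show ?thesis by (simp only: tens_eq[of a "q \<odot>\<^bsub>B\<^esub> b"] cls_sgl[OF assms])
qed

lemma tens_mult:
  assumes "a \<in> carrier A" "b \<in> carrier B" "a' \<in> carrier A" "b' \<in> carrier B"
  shows "tens A B a b \<otimes>\<^bsub>tensor A B\<^esub> tens A B a' b' = tens A B (a \<otimes>\<^bsub>A\<^esub> a') (b \<otimes>\<^bsub>B\<^esub> b')"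
proof -
  have "sgl (a, b) 1 \<otimes>\<^bsub>P\<^esub> sgl (a', b') 1 = sgl (a \<otimes>\<^bsub>A\<^esub> a', b \<otimes>\<^bsub>B\<^esub> b') 1"
    by (simp add: pairs_simps conv_single pair_mult_def)
  then show ?thesis using assms by (simp add: tens_eq sgl_carrier flip: c.mult)
qed

lemma tens_one [simp]: "tens A B \<one>\<^bsub>A\<^esub> \<one>\<^bsub>B\<^esub> = \<one>\<^bsub>tensor A B\<^esub>"
  using c.one by (simp add: tens_eq pairs_simps)

lemma alg_hom_tens_left: "alg_hom A (tensor A B) (\<lambda>a. tens A B a \<one>\<^bsub>B\<^esub>)"
  by (rule alg_homI)
    (auto intro: A.rat_algebra_axioms rat_algebra_tensor simp: tens_add_left tens_smult_left tens_mult)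

lemma alg_hom_tens_right: "alg_hom B (tensor A B) (\<lambda>b. tens A B \<one>\<^bsub>A\<^esub> b)"
  by (rule alg_homI)
    (auto intro: B.rat_algebra_axioms rat_algebra_tensor simp: tens_add_right tens_smult_right tens_mult)

lemma tens_split:
  "a \<in> carrier A \<Longrightarrow> b \<in> carrier B \<Longrightarrow>
    tens A B a b = tens A B a \<one>\<^bsub>B\<^esub> \<otimes>\<^bsub>tensor A B\<^esub> tens A B \<one>\<^bsub>A\<^esub> b"
  by (simp add: tens_mult)

text \<open>There is no case for scalar multiples, because a scalar can be moved into the left
  factor of a pure tensor.\<close>

lemma tensor_induct [consumes 1, case_names tens add]:
  assumes "X \<in> carrier (tensor A B)"
    and "\<And>a b. a \<in> carrier A \<Longrightarrow> b \<in> carrier B \<Longrightarrow> Q (tens A B a b)"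
    and "\<And>X Y. X \<in> carrier (tensor A B) \<Longrightarrow> Y \<in> carrier (tensor A B) \<Longrightarrow> Q X \<Longrightarrow> Q Y \<Longrightarrow> Q (X \<oplus>\<^bsub>tensor A B\<^esub> Y)"
  shows "Q X"
proof -
  obtain p where p: "X = T.cls p" "p \<in> carrier P"
    using assms(1) unfolding tensor_eq T.carrier_Q by auto
  from p(2) have "supp p \<subseteq> D" by (simp add: pairs_simps)
  then have "Q (T.cls p)"
  proof (induction rule: free_induct)
    case zero
    \<comment> \<open>Zero is itself a pure tensor, so the induction rule needs no separate case for
      it.\<close>
    have "T.cls 0 = tens A B (0 \<odot>\<^bsub>A\<^esub> \<one>\<^bsub>A\<^esub>) \<one>\<^bsub>B\<^esub>"
      using c.zero rat_algebra.smult_zero_left[OF rat_algebra_tensor]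
      by (subst tens_smult_left) (simp_all add: pairs_simps)
    then show ?case using assms(2) by simp
  next
    case (single x q)
    then have "T.cls (sgl x q) = tens A B (q \<odot>\<^bsub>A\<^esub> fst x) (snd x)"
      using cls_sgl[of "fst x" "snd x" q] tens_smult_left[of "fst x" "snd x" q] by auto
    then show ?case using single assms(2) by auto
  next
    case (add p q)
    then show ?case using assms(3)[of "T.cls p" "T.cls q"] c.add[of p q] c.closed[of p] c.closed[of q]
      by (simp add: pairs_simps)
  qed
  then show ?thesis by (simp add: p)
qed

text \<open>On the free space the map is the linear extension of (a, b) -> h a k b. It is
  multiplicative since the target is commutative, and it kills the bilinearity relations since h and
  k are linear.\<close>

lemma tensor_lift:
  assumes "alg_hom A C h" "alg_hom B C k"
  shows alg_hom_tensor_lift: "alg_hom (tensor A B) C (tensor_lift C h k)"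
    and tensor_lift_tens:
      "\<And>a b. a \<in> carrier A \<Longrightarrow> b \<in> carrier B \<Longrightarrow> tensor_lift C h k (tens A B a b) = h a \<otimes>\<^bsub>C\<^esub> k b"
proof -
  interpret h: alg_hom A C h by fact
  interpret k: alg_hom B C k by fact
  let ?\<phi> = "\<lambda>x. h (fst x) \<otimes>\<^bsub>C\<^esub> k (snd x)"
  let ?\<theta> = "lin_ext C ?\<phi>"
  have lift: "tensor_lift C h k = (\<lambda>X. the_elem (?\<theta> ` X))"
    by (simp add: tensor_lift_def lin_ext_def fun_eq_iff)
  have phi: "?\<phi> \<in> D \<rightarrow> carrier C" by auto
  have phi': "?\<phi> \<in> supp p \<rightarrow> carrier C" if "p \<in> carrier P" for p
    using that phi by (auto simp: pairs_simps Pi_def)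
  have th: "alg_hom P C ?\<theta>"
  proof (rule alg_homI)
    fix p q assume pq: "p \<in> carrier P" "q \<in> carrier P"
    show "?\<theta> (p \<oplus>\<^bsub>P\<^esub> q) = ?\<theta> p \<oplus>\<^bsub>C\<^esub> ?\<theta> q"
      using pq[THEN phi'] by (simp add: pairs_simps h.B.lin_ext_add)
    show "?\<theta> (p \<otimes>\<^bsub>P\<^esub> q) = ?\<theta> p \<otimes>\<^bsub>C\<^esub> ?\<theta> q"
      unfolding pairs_simps
      by (rule h.B.lin_ext_conv[OF phi])
        (use pq pair_mult_D in \<open>auto simp: pairs_simps pair_mult_def h.B.m_ac\<close>)
  next
    fix p q assume p: "p \<in> carrier P"
    show "?\<theta> p \<in> carrier C" using phi'[OF p] by (rule h.B.lin_ext_closed)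
    show "?\<theta> (q \<odot>\<^bsub>P\<^esub> p) = q \<odot>\<^bsub>C\<^esub> ?\<theta> p"
      using h.B.lin_ext_scale[OF phi'[OF p]] by (simp add: pairs_simps)
  next
    show "?\<theta> \<one>\<^bsub>P\<^esub> = \<one>\<^bsub>C\<^esub>" by (simp add: pairs_simps h.B.lin_ext_single)
  qed (rule rat_algebra_pairs h.B.rat_algebra_axioms)+
  interpret th: alg_hom P C ?\<theta> by (rule th)
  have sg: "?\<theta> (sgl (a, b) q) = q \<odot>\<^bsub>C\<^esub> (h a \<otimes>\<^bsub>C\<^esub> k b)" if "a \<in> carrier A" "b \<in> carrier B" for a b q
    using that by (simp add: h.B.lin_ext_single)
  have sub: "?\<theta> (p - q) = ?\<theta> p \<ominus>\<^bsub>C\<^esub> ?\<theta> q" if "p \<in> carrier P" "q \<in> carrier P" for p q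
  proof -
    have "p - q \<in> carrier P" using that Poly_Mapping.keys_diff[of p q] unfolding pairs_simps by blast
    then have "?\<theta> p = ?\<theta> (p - q) \<oplus>\<^bsub>C\<^esub> ?\<theta> q"
      using th.add[of "p - q" q] that by (simp add: pairs_simps(5))
    then show ?thesis using that \<open>p - q \<in> carrier P\<close> th.closed
      by (simp add: a_minus_def h.B.a_assoc h.B.r_neg)
  qed
  have pm: "p - q \<in> carrier P" if "p \<in> carrier P" "q \<in> carrier P" for p q
    using that Poly_Mapping.keys_diff[of p q] unfolding pairs_simps by blast
  have kill: "?\<theta> x = \<zero>\<^bsub>C\<^esub>" if "x \<in> tensor_ideal A B" for x
    using that unfolding tensor_ideal_def
  proof (rule alg_hom_kill_genideal[OF th rels_carrier, rotated])
    fix x assume "x \<in> bilinear_rels A B"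
    then show "?\<theta> x = \<zero>\<^bsub>C\<^esub>"
      unfolding bilinear_rels_def
      by (auto simp: sub pm sg sgl_carrier h.B.l_distr h.B.r_distr h.B.smult_mult h.B.mult_smult a_minus_def
          h.B.r_neg h.B.minus_add h.B.a_ac)
        (simp_all add: h.B.a_assoc[symmetric] h.B.r_neg h.B.l_neg h.B.a_comm)
  qed
  show "alg_hom (tensor A B) C (tensor_lift C h k)"
    unfolding lift tensor_eq by (rule T.lift(1)[OF th kill])
  show "tensor_lift C h k (tens A B a b) = h a \<otimes>\<^bsub>C\<^esub> k b" if "a \<in> carrier A" "b \<in> carrier B" for a b
    unfolding lift tens_eq using that T.lift(2)[OF th kill sgl_carrier[OF that]] sg[OF that, of 1] by simp
qed

lemma tensor_map:
  assumes h: "alg_hom A C h" and k: "alg_hom B D' k"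
  shows alg_hom_tensor_map: "alg_hom (tensor A B) (tensor C D') (tensor_map C D' h k)"
    and tensor_map_tens: "\<And>a b. a \<in> carrier A \<Longrightarrow> b \<in> carrier B \<Longrightarrow>
      tensor_map C D' h k (tens A B a b) = tens C D' (h a) (k b)"
proof -
  interpret h: alg_hom A C h by fact
  interpret k: alg_hom B D' k by fact
  interpret CD: alg_pair C D' by unfold_locales
  have 1: "alg_hom A (tensor C D') (\<lambda>a. tens C D' (h a) \<one>\<^bsub>D'\<^esub>)"
    using alg_hom_comp[OF h CD.alg_hom_tens_left] by (simp add: o_def)
  have 2: "alg_hom B (tensor C D') (\<lambda>b. tens C D' \<one>\<^bsub>C\<^esub> (k b))"
    using alg_hom_comp[OF k CD.alg_hom_tens_right] by (simp add: o_def)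
  show "alg_hom (tensor A B) (tensor C D') (tensor_map C D' h k)"
    unfolding tensor_map_def by (rule alg_hom_tensor_lift[OF 1 2])
  show "tensor_map C D' h k (tens A B a b) = tens C D' (h a) (k b)"
    if "a \<in> carrier A" "b \<in> carrier B" for a b
    unfolding tensor_map_def using that by (simp add: tensor_lift_tens[OF 1 2] CD.tens_mult)
qed

end

section \<open>Presentations of tensor products and of Chow rings\<close>

text \<open>Connects the inductive ideals with those of the algebra library, so that quotients by
  \<open>idl S\<close> can be formed.\<close>

lemma idl_ideal: "ideal (idl S) (poly_ring UNIV)"
proof -
  interpret rat_algebra "poly_ring UNIV :: (rat, 'a rat_poly) graded" by (rule rat_algebra_poly_ring)
  show ?thesis
  proof (rule idealI[OF ring_axioms])
    show "subgroup (idl S) (add_monoid (poly_ring UNIV))"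
    proof (rule subgroup.intro)
      fix x assume "x \<in> idl S"
      have "\<ominus>\<^bsub>poly_ring UNIV\<^esub> x = - x" by (rule minus_equality) (simp_all add: poly_ring_simps)
      then show "inv\<^bsub>add_monoid (poly_ring UNIV)\<^esub> x \<in> idl S"
        using \<open>x \<in> idl S\<close> by (simp add: a_inv_def idl_uminus)
    qed (auto simp: poly_ring_simps intro: idl_add)
  qed (auto simp: poly_ring_simps intro: idl_mult idl_mult_right)
qed

lemma quotient_alg_idl: "quotient_alg (poly_ring UNIV) (idl S)"
  by (intro quotient_alg.intro rat_algebra_poly_ring idl_ideal)

context pres
begin

text \<open>A polynomial representing the argument is chosen; the choice is immaterial when
  \<open>g\<close> kills the relations.\<close>

definition lift :: "('v rat_poly \<Rightarrow> 'd) \<Rightarrow> 'c \<Rightarrow> 'd" where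
  "lift g x = g (SOME p. h p = x)"

lemma lift_eval:
  assumes "poly_hom D g" "\<And>s. s \<in> S \<Longrightarrow> g s = \<zero>\<^bsub>D\<^esub>"
  shows "lift g (h p) = g p"
proof -
  interpret g: poly_alg_hom D g by (rule poly_alg_hom.intro) fact
  define q where "q = (SOME q. h q = h p)"
  have "h q = h p" unfolding q_def by (rule someI_ex) blast
  then have "q - p \<in> idl S" by (simp only: eq_iff)
  then have "g (q - p) = \<zero>\<^bsub>D\<^esub>" by (rule g.idl_kill[OF _ assms(2)])
  then have "g q \<ominus>\<^bsub>D\<^esub> g p = \<zero>\<^bsub>D\<^esub>" by simp
  then have "g q = g p" by (rule g.B.minus_eq_zeroD) simp_all
  then show ?thesis by (simp add: lift_def q_def)
qed

lemma lift_hom: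
  assumes "poly_hom D g" "\<And>s. s \<in> S \<Longrightarrow> g s = \<zero>\<^bsub>D\<^esub>"
  shows "alg_hom C D (lift g)"
proof -
  interpret g: poly_alg_hom D g by (rule poly_alg_hom.intro) fact
  note ev = lift_eval[OF assms]
  show ?thesis
  proof (rule alg_homI)
    fix x y q assume "x \<in> carrier C" "y \<in> carrier C"
    then obtain p r where pr: "x = h p" "y = h r" by (auto simp: surj)
    show "lift g x \<in> carrier D" by (simp add: pr ev)
    show "lift g (x \<oplus>\<^bsub>C\<^esub> y) = lift g x \<oplus>\<^bsub>D\<^esub> lift g y"
      using ev[of "p + r"] by (simp add: pr ev)
    show "lift g (x \<otimes>\<^bsub>C\<^esub> y) = lift g x \<otimes>\<^bsub>D\<^esub> lift g y"
      using ev[of "p * r"] by (simp add: pr ev)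
    show "lift g (q \<odot>\<^bsub>C\<^esub> x) = q \<odot>\<^bsub>D\<^esub> lift g x"
      using ev[of "Const q * p"] unfolding p_smult g.p_smult by (simp add: pr ev)
  next
    show "lift g \<one>\<^bsub>C\<^esub> = \<one>\<^bsub>D\<^esub>" using ev[of 1] by simp
  qed (rule B.rat_algebra_axioms g.B.rat_algebra_axioms)+
qed

text \<open>A Tietze transformation: \<open>\<sigma>\<close> and \<open>\<sigma>'\<close> are
  inverse to each other modulo the relations. A polynomial p in the new kernel lies in
  \<open>idl S'\<close> because its image under \<open>\<sigma>\<close> followed by
  \<open>\<sigma>'\<close> does, and because p differs from that image by an element of
  \<open>idl S'\<close>.\<close>

lemma change_presentation:
  fixes \<sigma> :: "'w \<Rightarrow> 'v rat_poly" and \<sigma>' :: "'v \<Rightarrow> 'w rat_poly"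
  assumes hom: "\<And>w. \<sigma> w \<in> homp 1" "\<And>v. \<sigma>' v \<in> homp 1" "\<And>s. s \<in> S' \<Longrightarrow> \<exists>k. s \<in> homp k"
    and kill: "\<And>s. s \<in> S' \<Longrightarrow> h (subst \<sigma> s) = \<zero>\<^bsub>C\<^esub>"
    and bk: "\<And>s. s \<in> S \<Longrightarrow> subst \<sigma>' s \<in> idl S'"
    and inv1: "\<And>w. Var w - subst \<sigma>' (\<sigma> w) \<in> idl S'"
    and inv2: "\<And>v. h (subst \<sigma> (\<sigma>' v)) = h (Var v)"
  shows "pres C (h \<circ> subst \<sigma>) S'"
proof -
  have hs: "poly_hom C (h \<circ> subst \<sigma>)" by (rule alg_hom_comp[OF subst_hom alg_hom_axioms])
  interpret hs: poly_alg_hom C "h \<circ> subst \<sigma>" by (rule poly_alg_hom.intro[OF hs])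
  have hh: "h (subst \<sigma> (subst \<sigma>' p)) = h p" for p
    using poly_hom_eqI[OF alg_hom_comp[OF subst_hom hs] alg_hom_axioms, of \<sigma>' p] inv2 by simp
  show ?thesis
  proof (intro pres.intro pres_axioms.intro hs.poly_alg_hom_axioms)
    have "h p \<in> range (h \<circ> subst \<sigma>)" for p
      using hh[of p] by (metis comp_apply rangeI)
    moreover have "(h \<circ> subst \<sigma>) p \<in> range h" for p by simp
    ultimately show "carrier C = range (h \<circ> subst \<sigma>)" unfolding surj by blast
    show "homog C k = (h \<circ> subst \<sigma>) ` homp k" for k
    proof
      show "homog C k \<subseteq> (h \<circ> subst \<sigma>) ` homp k"
      proof
        fix x assume "x \<in> homog C k"
        then obtain p where p: "x = h p" "p \<in> homp k" unfolding homog_eq by blast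
        then have "x = (h \<circ> subst \<sigma>) (subst \<sigma>' p)" by (simp add: hh)
        then show "x \<in> (h \<circ> subst \<sigma>) ` homp k" using subst_homp[of \<sigma>', OF hom(2) p(2)] by blast
      qed
      show "(h \<circ> subst \<sigma>) ` homp k \<subseteq> homog C k"
        unfolding homog_eq image_comp[symmetric] using subst_homp[of \<sigma>, OF hom(1)] by blast
    qed
    show "(h \<circ> subst \<sigma>) p = \<zero>\<^bsub>C\<^esub> \<longleftrightarrow> p \<in> idl S'" for p
    proof
      assume "(h \<circ> subst \<sigma>) p = \<zero>\<^bsub>C\<^esub>"
      then have "subst \<sigma> p \<in> idl S" by (simp add: kernel)
      then have 1: "subst \<sigma>' (subst \<sigma> p) \<in> idl S'" by (rule idl_subst[OF _ bk])
      have "1 * (subst Var p - subst (\<lambda>w. subst \<sigma>' (\<sigma> w)) p) \<in> idl S'"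
        by (rule subst_cong_idl) (simp add: inv1)
      then have "p - subst \<sigma>' (subst \<sigma> p) \<in> idl S'" by (simp add: subst_subst subst_ident)
      from idl_add[OF this 1] show "p \<in> idl S'" by simp
    next
      assume "p \<in> idl S'"
      then show "(h \<circ> subst \<sigma>) p = \<zero>\<^bsub>C\<^esub>" by (rule hs.idl_kill) (simp add: kill)
    qed
  qed (use hom in blast)
qed

end

abbreviation inl :: "'v rat_poly \<Rightarrow> ('v + 'w) rat_poly" where "inl \<equiv> subst (\<lambda>v. Var (Inl v))"
abbreviation inr :: "'w rat_poly \<Rightarrow> ('v + 'w) rat_poly" where "inr \<equiv> subst (\<lambda>w. Var (Inr w))"

definition tensor_eval ::
  "(rat, 'a) graded \<Rightarrow> (rat, 'b) graded \<Rightarrow> ('v rat_poly \<Rightarrow> 'a) \<Rightarrow> ('w rat_poly \<Rightarrow> 'b) \<Rightarrow>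
    ('v + 'w) rat_poly \<Rightarrow> ('a, 'b) tens" where
  "tensor_eval A B h k = poly_eval (tensor A B)
    (case_sum (\<lambda>v. tens A B (h (Var v)) \<one>\<^bsub>B\<^esub>) (\<lambda>w. tens A B \<one>\<^bsub>A\<^esub> (k (Var w))))"

locale pres_pair = A: pres A h S + B: pres B k T
  for A :: "(rat, 'a) graded" and h :: "'v rat_poly \<Rightarrow> 'a" and S
    and B :: "(rat, 'b) graded" and k :: "'w rat_poly \<Rightarrow> 'b" and T
begin

sublocale AB: alg_pair A B by unfold_locales

abbreviation "H \<equiv> tensor_eval A B h k"

lemma poly_hom_H: "poly_hom (tensor A B) H"
  unfolding tensor_eval_def
  by (rule rat_algebra.alg_hom_poly_eval[OF AB.rat_algebra_tensor]) (auto split: sum.splits)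

sublocale H: poly_alg_hom "tensor A B" H
  by (rule poly_alg_hom.intro) (rule poly_hom_H)

lemma H_Inl: "H (Var (Inl v)) = tens A B (h (Var v)) \<one>\<^bsub>B\<^esub>"
  unfolding tensor_eval_def by (subst rat_algebra.poly_eval_Var[OF AB.rat_algebra_tensor]) simp_all

lemma H_Inr: "H (Var (Inr w)) = tens A B \<one>\<^bsub>A\<^esub> (k (Var w))"
  unfolding tensor_eval_def by (subst rat_algebra.poly_eval_Var[OF AB.rat_algebra_tensor]) simp_all

lemma H_inl: "H (inl p) = tens A B (h p) \<one>\<^bsub>B\<^esub>"
  using poly_hom_eqI[OF alg_hom_comp[OF subst_hom poly_hom_H] alg_hom_comp[OF A.alg_hom_axioms AB.alg_hom_tens_left],
      of "\<lambda>v. Var (Inl v)" p]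
  by (simp add: H_Inl)

lemma H_inr: "H (inr p) = tens A B \<one>\<^bsub>A\<^esub> (k p)"
  using poly_hom_eqI[OF alg_hom_comp[OF subst_hom poly_hom_H] alg_hom_comp[OF B.alg_hom_axioms AB.alg_hom_tens_right],
      of "\<lambda>v. Var (Inr v)" p]
  by (simp add: H_Inr)

lemma H_mult: "H (inl p * inr q) = tens A B (h p) (k q)"
  unfolding H.p_mult H_inl H_inr by (rule AB.tens_split[symmetric]) simp_all

text \<open>Each variable belongs to one of the factors, so a monomial becomes a pure tensor whose
  two degrees add up to that of the monomial. This is what relates the degree of polynomials to the
  grading of the tensor product.\<close>

lemma H_monom: "\<exists>p q i j. H (sgl m 1) = tens A B (h p) (k q) \<and> p \<in> homp i \<and> q \<in> homp j \<and> i + j = mdeg m"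
proof (induction "mdeg m" arbitrary: m rule: less_induct)
  case less
  show ?case
  proof (cases "m = 0")
    case True
    have "H (sgl m 1) = tens A B (h 1) (k 1)" using True by simp
    then show ?thesis
      using True by (intro exI[of _ "1 :: 'v rat_poly"] exI[of _ "1 :: 'w rat_poly"] exI[of _ 0]) simp
  next
    case False
    then obtain v m' where m: "m = Poly_Mapping.single v 1 + m'" by (rule monom_factor)
    obtain p q i j where pq: "H (sgl m' 1) = tens A B (h p) (k q)" "p \<in> homp i" "q \<in> homp j" "i + j = mdeg m'"
      using less[of m'] m by auto
    have mm: "sgl m 1 = Var v * sgl m' (1::rat)" by (simp add: Var_def mult_single m)
    show ?thesis
    proof (cases v)
      case (Inl a)
      have "H (sgl m 1) = tens A B (h (Var a * p)) (k q)"
        unfolding mm H.p_mult pq Inl H_Inl by (subst AB.tens_mult) simp_all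
      then show ?thesis using pq homp_mult[OF homp_Var pq(2), of a] m by fastforce
    next
      case (Inr b)
      have "H (sgl m 1) = tens A B (h p) (k (Var b * q))"
        unfolding mm H.p_mult pq Inr H_Inr by (subst AB.tens_mult) simp_all
      then show ?thesis using pq homp_mult[OF homp_Var pq(3), of b] m by fastforce
    qed
  qed
qed

text \<open>Surjectivity and grading are read off pure tensors. For the kernel, the universal
  property supplies a map from the tensor product back to the quotient of the polynomial
  ring.\<close>

lemma pres_tensor: "pres (tensor A B) H (inl ` S \<union> inr ` T)"
proof (intro pres.intro pres_axioms.intro H.poly_alg_hom_axioms)
  show "carrier (tensor A B) = range H"
  proof
    show "range H \<subseteq> carrier (tensor A B)" using H.p_closed by blast
    show "carrier (tensor A B) \<subseteq> range H"
    proof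
      fix X assume "X \<in> carrier (tensor A B)"
      then show "X \<in> range H"
      proof (induction rule: AB.tensor_induct)
        case (tens a b)
        then obtain p q where "a = h p" "b = k q" by (auto simp: A.surj B.surj)
        then show ?case using H_mult[of p q] by (metis rangeI)
      next
        case (add X Y)
        then obtain p q where "X = H p" "Y = H q" by blast
        then have "X \<oplus>\<^bsub>tensor A B\<^esub> Y = H (p + q)" by simp
        then show ?case by blast
      qed
    qed
  qed
next
  fix d
  let ?D = "{(a, b). \<exists>i j. i + j = d \<and> a \<in> homog A i \<and> b \<in> homog B j}"
  have D: "?D \<subseteq> AB.D" by (auto simp: A.homog_eq B.homog_eq)
  have hom: "homog (tensor A B) d = AB.T.cls ` {p. supp p \<subseteq> ?D}"
    unfolding AB.homog_pairs[symmetric] tensor_def quotient_graded_def graded.simps ..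
  interpret c: alg_hom AB.P "tensor A B" AB.T.cls
    unfolding AB.tensor_eq by (rule AB.T.cls_alg_hom)
  have cl: "p \<in> carrier AB.P" if "supp p \<subseteq> ?D" for p
    using that D unfolding AB.pairs_simps by blast
  have c_add: "AB.T.cls (p + q) = AB.T.cls p \<oplus>\<^bsub>tensor A B\<^esub> AB.T.cls q" if "supp p \<subseteq> ?D" "supp q \<subseteq> ?D" for p q
    using c.add[OF cl[OF that(1)] cl[OF that(2)]] by (simp add: AB.pairs_simps(5))
  show "homog (tensor A B) d = H ` homp d"
  proof
    show "homog (tensor A B) d \<subseteq> H ` homp d"
    proof
      fix X assume "X \<in> homog (tensor A B) d"
      then obtain p where p: "X = AB.T.cls p" "supp p \<subseteq> ?D" by (auto simp: hom)
      from p(2) have "AB.T.cls p \<in> H ` homp d"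
      proof (induction rule: free_induct)
        case zero
        have "AB.T.cls 0 = H 0" using c.zero by (simp add: AB.pairs_simps)
        then show ?case using homp_zero by blast
      next
        case (single x c)
        then obtain i j where "i + j = d" "fst x \<in> homog A i" "snd x \<in> homog B j" by auto
        then obtain p q where pq: "fst x = h p" "snd x = k q" "p \<in> homp i" "q \<in> homp j" "i + j = d"
          unfolding A.homog_eq B.homog_eq by blast
        have x: "x = (h p, k q)" using pq by (simp add: prod_eq_iff)
        have "AB.T.cls (sgl x c) = c \<odot>\<^bsub>tensor A B\<^esub> tens A B (h p) (k q)"
          unfolding x by (rule AB.cls_sgl) simp_all
        also have "\<dots> = H (Const c * (inl p * inr q))"
          unfolding H.p_smult H_mult ..
        finally have "AB.T.cls (sgl x c) = H (Const c * (inl p * inr q))" .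
        moreover have "inl p * inr q \<in> homp (i + j)"
          using pq by (intro homp_mult subst_homp) simp_all
        then have "Const c * (inl p * inr q) \<in> homp d" using pq(5) by (intro homp_scale) simp
        ultimately show ?case by blast
      next
        case (add p q)
        then obtain p' q' where "AB.T.cls p = H p'" "AB.T.cls q = H q'" "p' \<in> homp d" "q' \<in> homp d" by blast
        moreover from this have "AB.T.cls (p + q) = H (p' + q')" by (simp add: c_add[OF add.hyps(1,2)])
        ultimately show ?case using homp_add by blast
      qed
      then show "X \<in> H ` homp d" by (simp add: p)
    qed
    show "H ` homp d \<subseteq> homog (tensor A B) d"
    proof
      fix X assume "X \<in> H ` homp d"
      then obtain u where u: "X = H u" "u \<in> homp d" by blast
      have "supp u \<subseteq> {m. mdeg m = d}" using u(2) by (auto simp: homp_def)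
      then have "H u \<in> homog (tensor A B) d"
        unfolding hom
      proof (induction rule: free_induct)
        case zero
        have "H 0 = AB.T.cls 0" using c.zero by (simp add: AB.pairs_simps)
        then show ?case by force
      next
        case (single m c)
        obtain p q i j where pq: "H (sgl m 1) = tens A B (h p) (k q)" "p \<in> homp i" "q \<in> homp j" "i + j = mdeg m"
          using H_monom by blast
        have "sgl m c = Const c * sgl m 1" by (simp add: mult_single)
        then have "H (sgl m c) = AB.T.cls (sgl (h p, k q) c)"
          using H.p_smult[of c "sgl m 1"] pq(1) AB.cls_sgl[of "h p" "k q" c] by simp
        moreover have "supp (sgl (h p, k q) c) \<subseteq> ?D"
          using pq single by (auto simp: A.homog_eq B.homog_eq)
        ultimately show ?case by blast
      next
        case (add p q)
        then obtain p' q' where pq: "H p = AB.T.cls p'" "H q = AB.T.cls q'" "supp p' \<subseteq> ?D" "supp q' \<subseteq> ?D"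
          by blast
        then have "H (p + q) = AB.T.cls (p' + q')" unfolding c_add[OF pq(3,4)] by simp
        then show ?case using pq Poly_Mapping.keys_add[of p' q'] by blast
      qed
      then show "X \<in> homog (tensor A B) d" by (simp add: u)
    qed
  qed
next
  fix p
  let ?I = "idl (inl ` S \<union> inr ` T)"
  interpret q: quotient_alg "poly_ring UNIV" ?I by (rule quotient_alg_idl)
  interpret c: poly_alg_hom q.Q q.cls by (rule poly_alg_hom.intro) (rule q.cls_alg_hom)
  have z: "q.cls x = \<zero>\<^bsub>q.Q\<^esub> \<longleftrightarrow> x \<in> ?I" for x by (rule q.cls_zero_iff) simp
  have 1: "poly_hom q.Q (q.cls \<circ> inl)" "poly_hom q.Q (q.cls \<circ> inr)"
    by (rule alg_hom_comp[OF subst_hom q.cls_alg_hom])+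
  have 2: "(q.cls \<circ> inl) s = \<zero>\<^bsub>q.Q\<^esub>" if "s \<in> S" for s
    using that by (simp add: z idl_gen)
  have 3: "(q.cls \<circ> inr) s = \<zero>\<^bsub>q.Q\<^esub>" if "s \<in> T" for s
    using that by (simp add: z idl_gen)
  \<comment> \<open>This map is a left inverse of \<open>H\<close> up to passing to the quotient, so
    anything killed by \<open>H\<close> is zero in the quotient.\<close>
  let ?f = "tensor_lift q.Q (A.lift (q.cls \<circ> inl)) (B.lift (q.cls \<circ> inr))"
  have homs: "alg_hom A q.Q (A.lift (q.cls \<circ> inl))" "alg_hom B q.Q (B.lift (q.cls \<circ> inr))"
    by (rule A.lift_hom[OF 1(1)], erule 2) (rule B.lift_hom[OF 1(2)], erule 3)
  have ev: "A.lift (q.cls \<circ> inl) (h p) = q.cls (inl p)" "B.lift (q.cls \<circ> inr) (k q) = q.cls (inr q)" for p q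
    using A.lift_eval[OF 1(1) 2, of p] B.lift_eval[OF 1(2) 3, of q] unfolding comp_apply by blast+
  note hom = AB.alg_hom_tensor_lift[OF homs]
  have tl: "?f (tens A B (h p) (k q)) = q.cls (inl p * inr q)" for p q
    unfolding AB.tensor_lift_tens[OF homs A.p_closed B.p_closed] ev by simp
  have "?f (H p) = q.cls p" for p
  proof -
    have "(?f \<circ> H) (Var v) = q.cls (Var v)" for v
      using tl[of "Var (projl v)" 1] tl[of 1 "Var (projr v)"]
      by (cases v) (simp_all add: H_Inl H_Inr)
    from poly_hom_eqI[OF alg_hom_comp[OF poly_hom_H hom] q.cls_alg_hom this]
    show ?thesis unfolding comp_apply[of ?f H] .
  qed
  then have "p \<in> ?I" if "H p = \<zero>\<^bsub>tensor A B\<^esub>"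
    using that alg_hom.zero[OF hom] z by metis
  moreover have "H s = \<zero>\<^bsub>tensor A B\<^esub>" if s: "s \<in> inl ` S \<union> inr ` T" for s
  proof -
    from s consider t where "s = inl t" "t \<in> S" | t where "s = inr t" "t \<in> T" by blast
    then show ?thesis
    proof cases
      case 1
      then have "h t = \<zero>\<^bsub>A\<^esub>" by (simp add: A.kernel idl_gen)
      then show ?thesis using alg_hom.zero[OF AB.alg_hom_tens_left] by (simp add: 1 H_inl)
    next
      case 2
      then have "k t = \<zero>\<^bsub>B\<^esub>" by (simp add: B.kernel idl_gen)
      then show ?thesis using alg_hom.zero[OF AB.alg_hom_tens_right] by (simp add: 2 H_inr)
    qed
  qed
  ultimately show "H p = \<zero>\<^bsub>tensor A B\<^esub> \<longleftrightarrow> p \<in> ?I" using H.idl_kill by blast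
next
  fix s assume "s \<in> inl ` S \<union> inr ` T"
  then show "\<exists>k. s \<in> homp k"
    using A.gens_homp B.gens_homp by (auto intro!: subst_homp) (meson homp_Var subst_homp)+
qed

end

text \<open>These conditions pass directly to restrictions, contractions and direct sums, so one
  presentation theorem covers every Chow ring in the decomposition.\<close>

locale flat_system =
  fixes M :: "'a matroid"
  assumes finite_ground: "finite (ground M)"
    and flats_subset: "flats M \<subseteq> Pow (ground M)"
    and ground_flat: "ground M \<in> flats M"
    and empty_flat: "{} \<in> flats M"
begin

lemma finite_flats: "finite (flats M)"
  using finite_ground flats_subset by (meson finite_Pow_iff finite_subset)

lemma finite_proper_flats: "finite (proper_flats M)"
  using finite_flats by (simp add: proper_flats_def)

abbreviation "V \<equiv> proper_flats M"
abbreviation "PV \<equiv> poly_ring V"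

lemma rels_carrier: "linear_rels M \<union> incomparable_rels M \<subseteq> carrier PV"
proof -
  interpret rat_algebra PV by (rule rat_algebra_poly_ring)
  have v: "Var F \<in> carrier PV" if "F \<in> V" for F using that by (simp add: poly_ring_simps Var_def)
  have s: "(\<Sum>F\<in>K. Var F) \<in> carrier PV" if "K \<subseteq> V" for K
    using finite_subset[OF that finite_proper_flats] that
  proof (induction K rule: finite_induct)
    case (insert F K)
    then show ?case using a_closed[OF v[of F], of "\<Sum>F\<in>K. Var F"] by (simp add: poly_ring_simps(5))
  qed (simp add: poly_ring_simps)
  have m: "p - q \<in> carrier PV" if "p \<in> carrier PV" "q \<in> carrier PV" for p q
    using that Poly_Mapping.keys_diff[of p q] by (auto simp: poly_ring_simps)
  show ?thesis
    unfolding linear_rels_def incomparable_rels_def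
    by (auto intro!: m s poly_ring_mult_closed v)
qed

sublocale Q: quotient_alg PV "chow_ideal M"
  unfolding chow_ideal_def
  by (rule rat_algebra.quotient_alg_genideal[OF rat_algebra_poly_ring rels_carrier])

lemma CH_eq: "CH M = Q.Q"
  by (simp add: CH_def)

lemma rat_algebra_CH: "rat_algebra (CH M)"
  unfolding CH_eq by (rule Q.Q.rat_algebra_axioms)

lemma cls_alg_hom: "alg_hom PV (CH M) Q.cls"
  unfolding CH_eq by (rule Q.cls_alg_hom)

lemma xgen_closed [simp]: "F \<in> V \<Longrightarrow> xgen M F \<in> carrier (CH M)"
  unfolding xgen_def by (intro alg_hom.closed[OF cls_alg_hom]) (simp add: poly_ring_simps Var_def)

lemma gens_in_ideal: "p \<in> linear_rels M \<union> incomparable_rels M \<Longrightarrow> p \<in> chow_ideal M"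
  unfolding chow_ideal_def using Q.P.genideal_self[OF rels_carrier] by blast

text \<open>Variables that are not proper flats are set to 0 before passing to the quotient, which
  extends the projection to polynomials in all sets.\<close>

definition std_eval :: "'a set rat_poly \<Rightarrow> 'a chow" where
  "std_eval p = Q.cls (subst (\<lambda>F. if F \<in> V then Var F else 0) p)"

abbreviation "std_rels \<equiv> {Var F | F. F \<notin> V} \<union> linear_rels M \<union> incomparable_rels M"

lemma subst_proper_closed: "subst (\<lambda>F. if F \<in> V then Var F else 0) p \<in> carrier PV"
  by (rule subst_closed) (simp add: poly_ring_simps Var_def)

lemma subst_proper_ident:
  assumes "p \<in> carrier PV"
  shows "subst (\<lambda>F. if F \<in> V then Var F else 0) p = p"
  using assms by (induction rule: poly_induct_on) simp_all

lemma std_eval_hom: "poly_hom (CH M) std_eval"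
proof -
  have "alg_hom (poly_ring UNIV) PV (subst (\<lambda>F. if F \<in> V then Var F else 0))"
    by (rule alg_homI[OF rat_algebra_poly_ring rat_algebra_poly_ring])
      (use subst_proper_closed in \<open>simp_all add: poly_ring_simps\<close>)
  from alg_hom_comp[OF this cls_alg_hom] show ?thesis by (simp add: std_eval_def[abs_def] o_def)
qed

sublocale std: poly_alg_hom "CH M" std_eval
  by (rule poly_alg_hom.intro) (rule std_eval_hom)

lemma std_eval_Var: "std_eval (Var F) = (if F \<in> V then xgen M F else \<zero>\<^bsub>CH M\<^esub>)"
  using alg_hom.zero[OF cls_alg_hom] by (simp add: std_eval_def xgen_def poly_ring_simps)

text \<open>Deleting the foreign variables changes a polynomial by multiples of these variables,
  which are relations of \<open>std_rels\<close>; what remains lies in \<open>poly_ring V\<close>,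
  where the ideal is \<open>chow_ideal M\<close>.\<close>

lemma std_eval_kernel: "std_eval p = \<zero>\<^bsub>CH M\<^esub> \<longleftrightarrow> p \<in> idl std_rels"
proof
  let ?\<kappa> = "\<lambda>F. if F \<in> V then Var F else 0"
  interpret q: quotient_alg "poly_ring UNIV" "idl std_rels" by (rule quotient_alg_idl)
  have z: "q.cls x = \<zero>\<^bsub>q.Q\<^esub> \<longleftrightarrow> x \<in> idl std_rels" for x by (rule q.cls_zero_iff) simp
  have "alg_hom PV (poly_ring UNIV) id"
    by (rule alg_homI[OF rat_algebra_poly_ring rat_algebra_poly_ring]) (simp_all add: poly_ring_simps)
  from alg_hom_comp[OF this q.cls_alg_hom] have cls: "alg_hom PV q.Q q.cls" by simp
  assume "std_eval p = \<zero>\<^bsub>CH M\<^esub>"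
  then have "subst ?\<kappa> p \<in> chow_ideal M"
    using Q.cls_zero_iff[OF subst_proper_closed] by (simp add: std_eval_def CH_eq)
  then have "q.cls (subst ?\<kappa> p) = \<zero>\<^bsub>q.Q\<^esub>"
    unfolding chow_ideal_def
    by (rule alg_hom_kill_genideal[OF cls rels_carrier, rotated]) (simp only: z, blast intro: idl_gen)
  then have 1: "subst ?\<kappa> p \<in> idl std_rels" by (simp only: z)
  have "1 * (subst Var p - subst ?\<kappa> p) \<in> idl std_rels"
    by (rule subst_cong_idl) (auto intro: idl_gen)
  then have "p - subst ?\<kappa> p \<in> idl std_rels" by (simp add: subst_ident)
  from idl_add[OF this 1] show "p \<in> idl std_rels" by simp
next
  assume "p \<in> idl std_rels"
  then show "std_eval p = \<zero>\<^bsub>CH M\<^esub>"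
  proof (rule std.idl_kill)
    fix s assume "s \<in> std_rels"
    then consider F where "s = Var F" "F \<notin> V" | "s \<in> linear_rels M \<union> incomparable_rels M" by blast
    then show "std_eval s = \<zero>\<^bsub>CH M\<^esub>"
    proof cases
      case 2
      then have "s \<in> carrier PV" using rels_carrier by blast
      then show ?thesis using Q.cls_zero_iff gens_in_ideal[OF 2]
        by (simp add: std_eval_def subst_proper_ident CH_eq)
    qed (simp add: std_eval_Var)
  qed
qed

lemma pres_std: "pres (CH M) std_eval std_rels"
proof (intro pres.intro pres_axioms.intro std.poly_alg_hom_axioms std_eval_kernel)
  have *: "Q.cls p = std_eval p" if "p \<in> carrier PV" for p
    using that by (simp add: std_eval_def subst_proper_ident)
  show "carrier (CH M) = range std_eval"
  proof
    show "carrier (CH M) \<subseteq> range std_eval"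
      unfolding CH_eq Q.carrier_Q using * by blast
  qed (use std.p_closed in blast)
  show "homog (CH M) k = std_eval ` homp k" for k
  proof
    show "homog (CH M) k \<subseteq> std_eval ` homp k"
      using * by (auto simp: CH_def quotient_graded_def homog_poly_ring)
    show "std_eval ` homp k \<subseteq> homog (CH M) k"
    proof
      fix x assume "x \<in> std_eval ` homp k"
      then obtain p where p: "x = std_eval p" "p \<in> homp k" by blast
      have "subst (\<lambda>F. if F \<in> V then Var F else 0) p \<in> homp k"
        using p(2) by (rule subst_homp[rotated]) simp
      then show "x \<in> homog (CH M) k"
        using subst_proper_closed[of p] p(1)
        by (auto simp: CH_def quotient_graded_def homog_poly_ring std_eval_def)
    qed
  qed
  fix s assume "s \<in> std_rels"
  then consider "s \<in> {Var F | F. F \<notin> V}" | "s \<in> linear_rels M" | "s \<in> incomparable_rels M" by blast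
  then show "\<exists>k. s \<in> homp k"
  proof cases
    case 1
    then have "s \<in> homp 1" by auto
    then show ?thesis by blast
  next
    case 2
    then have "s \<in> homp 1" unfolding linear_rels_def by (auto intro!: homp_minus homp_sum)
    then show ?thesis by blast
  next
    case 3
    then obtain F F' where "s = Var F * Var F'" unfolding incomparable_rels_def by blast
    then show ?thesis by (metis homp_mult homp_Var)
  qed
qed

lemma chow_lift:
  assumes C: "rat_algebra C" and a: "a \<in> V \<rightarrow> carrier C"
    and lin: "\<And>i j. i \<in> ground M \<Longrightarrow> j \<in> ground M \<Longrightarrow>
      (\<Oplus>\<^bsub>C\<^esub>F\<in>{F \<in> V. i \<notin> F}. a F) = (\<Oplus>\<^bsub>C\<^esub>F\<in>{F \<in> V. j \<notin> F}. a F)"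
    and inc: "\<And>F F'. F \<in> V \<Longrightarrow> F' \<in> V \<Longrightarrow> \<not> F \<subseteq> F' \<Longrightarrow> \<not> F' \<subseteq> F \<Longrightarrow> a F \<otimes>\<^bsub>C\<^esub> a F' = \<zero>\<^bsub>C\<^esub>"
  shows alg_hom_chow_lift: "alg_hom (CH M) C (chow_lift C a)"
    and chow_lift_xgen: "\<And>F. F \<in> V \<Longrightarrow> chow_lift C a (xgen M F) = a F"
proof -
  interpret C: rat_algebra C by fact
  \<comment> \<open>Extension by zero gives a homomorphism on all polynomials that agrees with the
    given one on those in \<open>V\<close>.\<close>
  let ?b = "\<lambda>F. if F \<in> V then a F else \<zero>\<^bsub>C\<^esub>"
  have b: "poly_hom C (poly_eval C ?b)"
    by (rule C.alg_hom_poly_eval) (use a in auto)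
  interpret b: poly_alg_hom C "poly_eval C ?b" by (rule poly_alg_hom.intro) (rule b)
  have bV: "poly_eval C ?b (Var F) = ?b F" for F using a by (intro C.poly_eval_Var) auto
  have eq: "poly_eval C a p = poly_eval C ?b p" if "p \<in> carrier PV" for p
    by (rule poly_eval_cong[OF _ that C a]) simp
  have ev: "alg_hom PV C (poly_eval C a)" by (rule C.alg_hom_poly_eval[OF a])
  have kill: "poly_eval C a x = \<zero>\<^bsub>C\<^esub>" if "x \<in> chow_ideal M" for x
    using that unfolding chow_ideal_def
  proof (rule alg_hom_kill_genideal[OF ev rels_carrier, rotated])
    fix s assume s: "s \<in> linear_rels M \<union> incomparable_rels M"
    then have sc: "s \<in> carrier PV" using rels_carrier by blast
    have sm: "(\<Oplus>\<^bsub>C\<^esub>F\<in>{F \<in> V. i \<notin> F}. ?b F) = (\<Oplus>\<^bsub>C\<^esub>F\<in>{F \<in> V. i \<notin> F}. a F)" for i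
      using a by (intro C.finsum_cong') auto
    have cl: "(\<Oplus>\<^bsub>C\<^esub>F\<in>{F \<in> V. i \<notin> F}. a F) \<in> carrier C" for i
      using a by (intro C.finsum_closed) auto
    show "poly_eval C a s = \<zero>\<^bsub>C\<^esub>"
      unfolding eq[OF sc] using s
    proof
      assume "s \<in> linear_rels M"
      then obtain i j where ij: "i \<in> ground M" "j \<in> ground M"
        and s: "s = (\<Sum>F\<in>{F \<in> V. i \<notin> F}. Var F) - (\<Sum>F\<in>{F \<in> V. j \<notin> F}. Var F)"
        unfolding linear_rels_def by blast
      show "poly_eval C ?b s = \<zero>\<^bsub>C\<^esub>"
        unfolding s b.p_minus b.p_sum bV sm lin[OF ij] using cl[of j] by (simp add: a_minus_def C.r_neg)
    next
      assume "s \<in> incomparable_rels M"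
      then obtain F F' where F: "F \<in> V" "F' \<in> V" "\<not> F \<subseteq> F'" "\<not> F' \<subseteq> F" and s: "s = Var F * Var F'"
        unfolding incomparable_rels_def by blast
      show "poly_eval C ?b s = \<zero>\<^bsub>C\<^esub>"
        unfolding s b.p_mult bV using F inc[OF F] by simp
    qed
  qed
  have l: "chow_lift C a = (\<lambda>X. the_elem (poly_eval C a ` X))"
    by (simp add: chow_lift_def fun_eq_iff)
  show "alg_hom (CH M) C (chow_lift C a)"
    unfolding l CH_eq by (rule Q.lift(1)[OF ev kill])
  fix F assume F: "F \<in> V"
  then have "Var F \<in> carrier PV" by (simp add: poly_ring_simps Var_def)
  from Q.lift(2)[OF ev kill this] show "chow_lift C a (xgen M F) = a F"
    unfolding l xgen_def using F eq[OF \<open>Var F \<in> carrier PV\<close>] bV[of F] by simp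
qed

text \<open>It is convenient to have a generator for the empty flat as well: with
  \<open>x\<^sub>\<emptyset> = - (\<Sum>F \<noteq> {}, i \<notin> F. x\<^sub>F)\<close> the linear relations become \<open>(\<Sum>F. i \<notin> F. x\<^sub>F) = 0\<close>
  for every \<open>i\<close>, the sum running over all flats other than the ground set.\<close>

definition xfl :: "'a set \<Rightarrow> 'a chow" where
  "xfl F = (if F \<in> V then xgen M F
    else if F = {} \<and> ground M \<noteq> {} then \<ominus>\<^bsub>CH M\<^esub> (\<Oplus>\<^bsub>CH M\<^esub>F\<in>{F \<in> V. (SOME i. i \<in> ground M) \<notin> F}. xgen M F)
    else \<zero>\<^bsub>CH M\<^esub>)"

lemma xgen_sum_indep:
  assumes "i \<in> ground M" "j \<in> ground M"
  shows "(\<Oplus>\<^bsub>CH M\<^esub>F\<in>{F \<in> V. i \<notin> F}. xgen M F) = (\<Oplus>\<^bsub>CH M\<^esub>F\<in>{F \<in> V. j \<notin> F}. xgen M F)"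
proof -
  have s: "std_eval (\<Sum>F\<in>{F \<in> V. i \<notin> F}. Var F) = (\<Oplus>\<^bsub>CH M\<^esub>F\<in>{F \<in> V. i \<notin> F}. xgen M F)" for i
    unfolding std.p_sum by (intro std.B.finsum_cong') (auto simp: std_eval_Var)
  have "(\<Sum>F\<in>{F \<in> V. i \<notin> F}. Var F) - (\<Sum>F\<in>{F \<in> V. j \<notin> F}. Var F) \<in> idl std_rels"
    using assms by (intro idl_gen) (auto simp: linear_rels_def)
  then have "std_eval (\<Sum>F\<in>{F \<in> V. i \<notin> F}. Var F) = std_eval (\<Sum>F\<in>{F \<in> V. j \<notin> F}. Var F)"
    by (simp only: pres.eq_iff[OF pres_std])
  then show ?thesis by (simp only: s)
qed

lemma xgen_incomparable:
  assumes "F \<in> V" "F' \<in> V" "\<not> F \<subseteq> F'" "\<not> F' \<subseteq> F"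
  shows "xgen M F \<otimes>\<^bsub>CH M\<^esub> xgen M F' = \<zero>\<^bsub>CH M\<^esub>"
proof -
  have "Var F * Var F' \<in> idl std_rels"
    using assms by (intro idl_gen) (auto simp: incomparable_rels_def)
  then have "std_eval (Var F * Var F') = \<zero>\<^bsub>CH M\<^esub>" by (simp only: std_eval_kernel)
  then show ?thesis using assms by (simp add: std_eval_Var)
qed

lemma xfl_proper: "F \<in> V \<Longrightarrow> xfl F = xgen M F"
  by (simp add: xfl_def)

lemma xfl_empty:
  assumes "i \<in> ground M"
  shows "xfl {} = \<ominus>\<^bsub>CH M\<^esub> (\<Oplus>\<^bsub>CH M\<^esub>F\<in>{F \<in> V. i \<notin> F}. xgen M F)"
proof -
  have "(SOME i. i \<in> ground M) \<in> ground M" using assms by (rule someI)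
  from xgen_sum_indep[OF this assms] show ?thesis using assms by (auto simp: xfl_def proper_flats_def)
qed

lemma xfl_closed [simp]: "xfl F \<in> carrier (CH M)"
  unfolding xfl_def by (auto intro!: std.B.finsum_closed)

lemma alg_hom_xfl_empty:
  assumes "alg_hom (CH M) B f" "i \<in> ground M"
  shows "f (xfl {}) = \<ominus>\<^bsub>B\<^esub> (\<Oplus>\<^bsub>B\<^esub>F\<in>{F \<in> V. i \<notin> F}. f (xgen M F))"
proof -
  interpret f: alg_hom "CH M" B f by fact
  show ?thesis
    unfolding xfl_empty[OF assms(2)]
    by (subst f.uminus) (auto intro!: std.B.finsum_closed simp: f.sum)
qed

end

text \<open>The presentation with the additional generator, for generators labelled by \<open>r\<close>.\<close>

locale labelled_flats = flat_system M for M :: "'a matroid" +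
  fixes D :: "'w set" and r :: "'w \<Rightarrow> 'a set"
  assumes bij: "bij_betw r D (flats M - {ground M})"
begin

definition ch_eval :: "'w rat_poly \<Rightarrow> 'a chow" where
  "ch_eval = poly_eval (CH M) (\<lambda>w. if w \<in> D then xfl (r w) else \<zero>\<^bsub>CH M\<^esub>)"

text \<open>With the generator for the empty flat there is one linear relation for each element
  instead of one for each pair. If the ground set is empty, so is \<open>D\<close>, and killing all
  variables leaves the rationals.\<close>

definition ch_rels :: "'w rat_poly set" where
  "ch_rels = {Var w | w. w \<notin> D} \<union> {(\<Sum>w\<in>{w \<in> D. i \<notin> r w}. Var w) | i. i \<in> ground M} \<union>
     {Var w * Var w' | w w'. w \<in> D \<and> w' \<in> D \<and> \<not> r w \<subseteq> r w' \<and> \<not> r w' \<subseteq> r w}"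

lemma poly_hom_ch_eval: "poly_hom (CH M) ch_eval"
  unfolding ch_eval_def
  by (rule rat_algebra.alg_hom_poly_eval[OF rat_algebra_CH]) (auto intro: ring.ring_simprules std.B.ring_axioms)

lemma ch_eval_Var: "ch_eval (Var w) = (if w \<in> D then xfl (r w) else \<zero>\<^bsub>CH M\<^esub>)"
  unfolding ch_eval_def by (subst rat_algebra.poly_eval_Var[OF rat_algebra_CH]) auto

lemma finite_D: "finite D"
  using bij finite_flats bij_betw_finite by blast

lemma r_inj: "w \<in> D \<Longrightarrow> w' \<in> D \<Longrightarrow> r w = r w' \<longleftrightarrow> w = w'"
  using bij by (auto simp: bij_betw_def inj_on_def)

lemma r_flat: "w \<in> D \<Longrightarrow> r w \<in> flats M \<and> r w \<noteq> ground M"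
  using bij by (auto simp: bij_betw_def)

lemma bij_proper: "bij_betw r {w \<in> D. r w \<noteq> {} \<and> i \<notin> r w} {F \<in> V. i \<notin> F}"
proof -
  have img: "r ` D = flats M - {ground M}" and inj: "inj_on r D"
    using bij by (simp_all add: bij_betw_def)
  have "r ` {w \<in> D. r w \<noteq> {} \<and> i \<notin> r w} = {F \<in> r ` D. F \<noteq> {} \<and> i \<notin> F}" by blast
  also have "\<dots> = {F \<in> V. i \<notin> F}" unfolding img proper_flats_def by blast
  finally show ?thesis
    using inj_on_subset[OF inj, of "{w \<in> D. r w \<noteq> {} \<and> i \<notin> r w}"] by (simp add: bij_betw_def)
qed

text \<open>The adjoined generator is eliminated by \<open>\<sigma>\<close>, which writes it as a
  polynomial in the standard generators, and \<open>\<sigma>'\<close> returns each proper flat to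
  its label.\<close>

lemma pres_CH: "pres (CH M) ch_eval ch_rels"
proof -
  define i0 where "i0 = (SOME i. i \<in> ground M)"
  \<comment> \<open>The element \<open>i0\<close> is the one chosen in \<open>xfl\<close>, so that
    the composite evaluation is \<open>ch_eval\<close>.\<close>
  define \<sigma> where "\<sigma> w = (if w \<in> D then if r w = {} then - (\<Sum>F\<in>{F \<in> V. i0 \<notin> F}. Var F) else Var (r w) else 0)" for w
  define \<sigma>' where "\<sigma>' F = (if F \<in> V then Var (inv_into D r F) else 0)" for F
  have img: "r ` D = flats M - {ground M}" and inj: "inj_on r D"
    using bij by (simp_all add: bij_betw_def)
  have inv: "inv_into D r (r w) = w" if "w \<in> D" for w
    by (rule inv_into_f_f[OF inj that])
  have inv': "inv_into D r F \<in> D" "r (inv_into D r F) = F" if "F \<in> V" for F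
  proof -
    have "F \<in> r ` D" unfolding img using that by (simp add: proper_flats_def)
    then show "inv_into D r F \<in> D" "r (inv_into D r F) = F" by (rule inv_into_into, rule f_inv_into_f)
  qed
  have empty: "\<exists>w\<in>D. r w = {}" if "ground M \<noteq> {}"
  proof -
    have "{} \<in> r ` D" unfolding img using that empty_flat by blast
    then show ?thesis by (metis imageE)
  qed
  have i0: "i0 \<in> ground M" if "ground M \<noteq> {}"
    unfolding i0_def using that by (simp add: some_in_eq)
  have rV: "r w \<in> V" if "w \<in> D" "r w \<noteq> {}" for w
    using that r_flat by (simp add: proper_flats_def)
  have sum': "(\<Sum>F\<in>{F \<in> V. i \<notin> F}. \<sigma>' F) = (\<Sum>w\<in>{w \<in> D. r w \<noteq> {} \<and> i \<notin> r w}. Var w)" for i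
  proof -
    have "(\<Sum>w\<in>{w \<in> D. r w \<noteq> {} \<and> i \<notin> r w}. \<sigma>' (r w)) = (\<Sum>w\<in>{w \<in> D. r w \<noteq> {} \<and> i \<notin> r w}. Var w)"
      by (intro sum.cong) (simp_all add: \<sigma>'_def inv rV)
    then show ?thesis using sum.reindex_bij_betw[OF bij_proper, of \<sigma>' i] by simp
  qed
  have sum: "(\<Sum>w\<in>{w \<in> D. i \<notin> r w}. f w) = f w0 + (\<Sum>w\<in>{w \<in> D. r w \<noteq> {} \<and> i \<notin> r w}. f w)"
    if "w0 \<in> D" "r w0 = {}" for i w0 and f :: "'w \<Rightarrow> 'z::comm_monoid_add"
  proof -
    have "w = w0" if "w \<in> D" "r w = {}" for w
      using that r_inj[of w w0] \<open>w0 \<in> D\<close> \<open>r w0 = {}\<close> by simp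
    then have "{w \<in> D. i \<notin> r w} = insert w0 {w \<in> D. r w \<noteq> {} \<and> i \<notin> r w}"
      using that by blast
    then show ?thesis using that finite_D by simp
  qed
  have lin: "(\<Sum>F\<in>{F \<in> V. i \<notin> F}. Var F) - (\<Sum>F\<in>{F \<in> V. j \<notin> F}. Var F) \<in> idl std_rels"
    if "i \<in> ground M" "j \<in> ground M" for i j
    using that by (intro idl_gen) (auto simp: linear_rels_def)
  have "pres (CH M) (std_eval \<circ> subst \<sigma>) ch_rels"
  proof (rule pres.change_presentation[OF pres_std, of \<sigma> \<sigma>'])
    show "\<sigma> w \<in> homp 1" for w by (auto simp: \<sigma>_def intro!: homp_uminus homp_sum)
    show "\<sigma>' F \<in> homp 1" for F by (auto simp: \<sigma>'_def)
    show "\<exists>k. s \<in> homp k" if "s \<in> ch_rels" for s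
    proof -
      from that consider w where "s = Var w" | i where "s = (\<Sum>w\<in>{w \<in> D. i \<notin> r w}. Var w)"
        | w w' where "s = Var w * Var w'"
        unfolding ch_rels_def by blast
      then show ?thesis
      proof cases
        case 1
        then show ?thesis by (metis homp_Var)
      next
        case 2
        then have "s \<in> homp 1" by (auto intro: homp_sum)
        then show ?thesis by blast
      next
        case 3
        then show ?thesis by (metis homp_mult homp_Var)
      qed
    qed
    show "std_eval (subst \<sigma> s) = \<zero>\<^bsub>CH M\<^esub>" if "s \<in> ch_rels" for s
    proof -
      from that consider w where "s = Var w" "w \<notin> D"
        | i where "s = (\<Sum>w\<in>{w \<in> D. i \<notin> r w}. Var w)" "i \<in> ground M"
        | w w' where "s = Var w * Var w'" "w \<in> D" "w' \<in> D" "\<not> r w \<subseteq> r w'" "\<not> r w' \<subseteq> r w"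
        unfolding ch_rels_def by blast
      then show ?thesis
      proof cases
        case 1
        then show ?thesis by (simp add: \<sigma>_def)
      next
        case 2
        then obtain w0 where w0: "w0 \<in> D" "r w0 = {}" using empty by blast
        have "(\<Sum>w\<in>{w \<in> D. r w \<noteq> {} \<and> i \<notin> r w}. \<sigma> w) = (\<Sum>F\<in>{F \<in> V. i \<notin> F}. Var F)"
        proof -
          have "(\<Sum>w\<in>{w \<in> D. r w \<noteq> {} \<and> i \<notin> r w}. \<sigma> w) = (\<Sum>w\<in>{w \<in> D. r w \<noteq> {} \<and> i \<notin> r w}. Var (r w))"
            by (intro sum.cong) (simp_all add: \<sigma>_def)
          then show ?thesis using sum.reindex_bij_betw[OF bij_proper, of Var i] by simp
        qed
        then have "subst \<sigma> s = (\<Sum>F\<in>{F \<in> V. i \<notin> F}. Var F) - (\<Sum>F\<in>{F \<in> V. i0 \<notin> F}. Var F)"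
          using w0 by (simp add: 2 sum[OF w0]) (simp add: \<sigma>_def)
        then show ?thesis using lin[of i i0] i0 2(2) unfolding std_eval_kernel by auto
      next
        case 3
        then have "r w \<noteq> {}" "r w' \<noteq> {}" by auto
        then show ?thesis using 3 xgen_incomparable[of "r w" "r w'"] rV
          by (simp add: \<sigma>_def std_eval_Var)
      qed
    qed
    show "subst \<sigma>' s \<in> idl ch_rels" if "s \<in> std_rels" for s
    proof -
      from that consider F where "s = Var F" "F \<notin> V"
        | i j where "s = (\<Sum>F\<in>{F \<in> V. i \<notin> F}. Var F) - (\<Sum>F\<in>{F \<in> V. j \<notin> F}. Var F)" "i \<in> ground M" "j \<in> ground M"
        | F F' where "s = Var F * Var F'" "F \<in> V" "F' \<in> V" "\<not> F \<subseteq> F'" "\<not> F' \<subseteq> F"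
        unfolding linear_rels_def incomparable_rels_def by blast
      then show ?thesis
      proof cases
        case 1
        then show ?thesis by (simp add: \<sigma>'_def)
      next
        case 2
        then obtain w0 where w0: "w0 \<in> D" "r w0 = {}" using empty by blast
        \<comment> \<open>Both sums acquire the same term for the empty flat, which cancels in the
          difference.\<close>
        have "subst \<sigma>' s = (\<Sum>w\<in>{w \<in> D. i \<notin> r w}. Var w) - (\<Sum>w\<in>{w \<in> D. j \<notin> r w}. Var w)"
          unfolding 2(1) by (simp add: sum' sum[OF w0])
        also have "\<dots> \<in> idl ch_rels"
          using 2 by (intro idl_minus idl_gen) (auto simp: ch_rels_def)
        finally show ?thesis .
      next
        case 3
        then have "Var (inv_into D r F) * Var (inv_into D r F') \<in> ch_rels"
          using inv' unfolding ch_rels_def by blast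
        then show ?thesis using 3 by (simp add: \<sigma>'_def idl_gen)
      qed
    qed
    show "Var w - subst \<sigma>' (\<sigma> w) \<in> idl ch_rels" for w
    proof (cases "w \<in> D")
      case False
      then show ?thesis by (auto simp: \<sigma>_def ch_rels_def intro!: idl_gen)
    next
      case True
      show ?thesis
      proof (cases "r w = {}")
        case False
        then show ?thesis using True by (simp add: \<sigma>_def \<sigma>'_def rV inv)
      next
        case e: True
        then have "i0 \<in> ground M" using r_flat[OF True] i0 by auto
        moreover have "Var w - subst \<sigma>' (\<sigma> w) = (\<Sum>w\<in>{w \<in> D. i0 \<notin> r w}. Var w)"
          using True e by (simp add: \<sigma>_def sum' sum[OF True e])
        ultimately show ?thesis by (auto simp: ch_rels_def intro!: idl_gen)
      qed
    qed
    show "std_eval (subst \<sigma> (\<sigma>' F)) = std_eval (Var F)" for F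
    proof (cases "F \<in> V")
      case True
      then show ?thesis using inv'[OF True] by (auto simp: \<sigma>'_def \<sigma>_def proper_flats_def)
    qed (simp add: \<sigma>'_def std_eval_Var)
  qed
  moreover have "std_eval \<circ> subst \<sigma> = ch_eval"
  proof
    fix p
    show "(std_eval \<circ> subst \<sigma>) p = ch_eval p"
    proof (rule poly_hom_eqI[OF alg_hom_comp[OF subst_hom std_eval_hom] poly_hom_ch_eval])
      fix w
      have "std_eval (- (\<Sum>F\<in>{F \<in> V. i0 \<notin> F}. Var F)) = \<ominus>\<^bsub>CH M\<^esub> (\<Oplus>\<^bsub>CH M\<^esub>F\<in>{F \<in> V. i0 \<notin> F}. xgen M F)"
        unfolding std.p_uminus std.p_sum
        by (intro arg_cong[of _ _ "a_inv (CH M)"] std.B.finsum_cong') (auto simp: std_eval_Var)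
      then show "(std_eval \<circ> subst \<sigma>) (Var w) = ch_eval (Var w)"
        using r_flat[of w] rV[of w] xfl_empty[of i0] i0
        by (auto simp: ch_eval_Var \<sigma>_def std_eval_Var xfl_proper)
    qed
  qed
  ultimately show ?thesis by simp
qed

end

section \<open>Monomials on chains\<close>

abbreviation vprod :: "('x \<Rightarrow> 'r) \<Rightarrow> 'x multiset \<Rightarrow> 'r::comm_monoid_mult" where
  "vprod f M \<equiv> prod_mset (image_mset f M)"

definition chainm :: "'x::order multiset \<Rightarrow> bool" where
  "chainm M \<longleftrightarrow> (\<forall>x\<in>#M. \<forall>y\<in>#M. x \<le> y \<or> y \<le> x)"

text \<open>Monomials are identified with multisets of variables, so that lying on a chain is a
  property of a multiset.\<close>

definition mexp :: "'v multiset \<Rightarrow> 'v \<Rightarrow>\<^sub>0 nat" where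
  "mexp M = (\<Sum>x\<in>#M. Poly_Mapping.single x 1)"

lemma mexp_simps [simp]: "mexp {#} = 0" "mexp (add_mset x M) = Poly_Mapping.single x 1 + mexp M"
  by (simp_all add: mexp_def)

lemma coef_mexp: "coef (mexp M) x = count M x"
  by (induction M) (simp_all add: lookup_add lookup_single when_def)

lemma supp_mexp: "supp (mexp M) = set_mset M"
  by (auto simp: in_keys_iff coef_mexp count_eq_zero_iff)

lemma mexp_inj: "mexp M = mexp N \<longleftrightarrow> M = N"
  by (metis coef_mexp multiset_eqI)

lemma mdeg_mexp [simp]: "mdeg (mexp M) = size M"
  by (induction M) simp_all

lemma mexp_surj: "\<exists>M. m = mexp M"
proof (induction "mdeg m" arbitrary: m rule: less_induct)
  case less
  show ?case
  proof (cases "m = 0")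
    case True
    then show ?thesis by (intro exI[of _ "{#}"]) simp
  next
    case False
    then obtain v m' where m: "m = Poly_Mapping.single v 1 + m'" by (rule monom_factor)
    then obtain M where "m' = mexp M" using less[of m'] by auto
    then show ?thesis by (intro exI[of _ "add_mset v M"]) (simp add: m)
  qed
qed

lemma vprod_Var: "vprod Var M = sgl (mexp M) 1"
  by (induction M) (simp_all add: Var_def mult_single)

lemma vprod_homp: "(\<And>x. x \<in># M \<Longrightarrow> f x \<in> homp 1) \<Longrightarrow> vprod f M \<in> homp (size M)"
proof (induction M)
  case (add x M)
  then show ?case using homp_mult[of "f x" 1 "vprod f M" "size M"] by simp
qed simp

lemma subst_vprod: "subst a (vprod f M) = vprod (\<lambda>x. subst a (f x)) M"
  by (induction M) simp_all

lemma vprod_idl: "x \<in># M \<Longrightarrow> f x \<in> idl S \<Longrightarrow> vprod f M \<in> idl S"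
  by (induction M) (auto intro: idl_mult idl_mult_right)

lemma vprod_idl2:
  assumes "x \<in># M" "y \<in># M" "x \<noteq> y" "f x * f y \<in> idl S"
  shows "vprod f M \<in> idl S"
proof -
  obtain N where "M = add_mset x (add_mset y N)"
    using assms(1-3) by (metis insert_noteq_member mset_add)
  then have "vprod f M = f x * f y * vprod f N" by (simp add: mult.assoc)
  then show ?thesis using assms(4) by (simp add: idl_mult_right)
qed

lemma not_chainm:
  assumes "\<not> chainm M"
  obtains x y where "x \<in># M" "y \<in># M" "\<not> x \<le> y" "\<not> y \<le> x" "x \<noteq> y"
  using assms unfolding chainm_def by blast

lemma chainm_add: "chainm (add_mset x M) \<longleftrightarrow> chainm M \<and> (\<forall>y\<in>#M. x \<le> y \<or> y \<le> x)"
  by (auto simp: chainm_def)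

lemma poly_monom_induct [case_names monom scale add]:
  assumes "\<And>M. Q (vprod Var M)" "\<And>c p. Q p \<Longrightarrow> Q (Const c * p)" "\<And>p q. Q p \<Longrightarrow> Q q \<Longrightarrow> Q (p + q)"
  shows "Q p"
proof (induction p rule: free_induct_UNIV)
  case (single m c)
  obtain M where "m = mexp M" using mexp_surj by blast
  then have "sgl m c = Const c * vprod Var M" by (simp add: vprod_Var mult_single)
  then show ?case using assms(1,2) by simp
qed (rule assms(3))

global_interpretation pvs: vector_space "\<lambda>c (p :: 'v rat_poly). Const c * p"
proof
  fix a b :: rat and x y :: "'v rat_poly"
  show "Const (a + b) * x = Const a * x + Const b * x" by (simp add: single_add distrib_right)
  show "Const a * (Const b * x) = Const (a * b) * x" by (simp add: mult.assoc[symmetric] mult_single)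
qed (simp_all add: distrib_left)

global_interpretation pvp: vector_space_pair "\<lambda>c (p :: 'v rat_poly). Const c * p" "\<lambda>c (p :: 'w rat_poly). Const c * p"
  ..

lemma filt_Const: "filt P (Const c * p) = Const c * filt P p"
proof (induction p rule: free_induct_UNIV)
  case (single m d)
  then show ?case by (simp add: mult_single filt_single)
qed (simp add: filt_add distrib_left)

lemma filt_mult_monom_zero:
  assumes "\<And>m. \<not> P (m + n)"
  shows "filt P (a * sgl n 1) = 0"
  by (induction a rule: free_induct_UNIV) (simp_all add: mult_single filt_single assms distrib_right filt_add)

lemma monom_inj: "sgl m (1 :: rat) = sgl n 1 \<longleftrightarrow> m = n"
  by (metis lookup_single_eq lookup_single_not_eq zero_neq_one)

lemma independent_monoms: "pvs.independent ((\<lambda>m. sgl m 1) ` K)"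
proof
  assume "pvs.dependent ((\<lambda>m. sgl m (1::rat)) ` K)"
  then obtain T u where T: "finite T" "T \<subseteq> (\<lambda>m. sgl m 1) ` K" "(\<Sum>v\<in>T. Const (u v) * v) = 0"
    and v: "\<exists>v\<in>T. u v \<noteq> 0"
    unfolding pvs.dependent_explicit by blast
  then obtain m where m: "sgl m 1 \<in> T" "u (sgl m 1) \<noteq> 0" by blast
  have "coef (Const (u v) * v) m = (if v = sgl m 1 then u (sgl m 1) else 0)" if vT: "v \<in> T" for v
  proof -
    obtain n where "v = sgl n 1" using T(2) vT by blast
    then show ?thesis by (auto simp: mult_single lookup_single when_def monom_inj)
  qed
  then have "coef (\<Sum>v\<in>T. Const (u v) * v) m = (\<Sum>v\<in>T. if v = sgl m 1 then u (sgl m 1) else 0)"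
    by (simp add: lookup_sum)
  then have "u (sgl m 1) = 0" using T m by simp
  then show False using m by simp
qed

section \<open>Counting multichains in a product\<close>

lemma chainm_sorted: "chainm M \<Longrightarrow> \<exists>xs. mset xs = M \<and> sorted_wrt (\<le>) xs"
proof (induction M)
  case (add x M)
  then obtain xs where xs: "mset xs = M" "sorted_wrt (\<le>) xs" by (auto simp: chainm_add)
  have cmp: "\<forall>y\<in>set xs. x \<le> y \<or> y \<le> x" using add.prems xs by (auto simp: chainm_add)
  have "\<exists>ys. mset ys = add_mset x (mset xs) \<and> sorted_wrt (\<le>) ys"
    using xs(2) cmp
  proof (induction xs)
    case Nil
    then show ?case by (intro exI[of _ "[x]"]) simp
  next
    case (Cons z xs)
    show ?case
    proof (cases "x \<le> z")
      case True
      then have "sorted_wrt (\<le>) (x # z # xs)" using Cons.prems by auto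
      then show ?thesis by (intro exI[of _ "x # z # xs"]) simp
    next
      case False
      then have "z \<le> x" using Cons.prems by auto
      obtain ys where ys: "mset ys = add_mset x (mset xs)" "sorted_wrt (\<le>) ys"
        using Cons by auto
      have "set ys = insert x (set xs)" using ys(1) by (metis set_mset_add_mset_insert set_mset_mset)
      then have "sorted_wrt (\<le>) (z # ys)" using ys \<open>z \<le> x\<close> Cons.prems by auto
      then show ?thesis using ys by (intro exI[of _ "z # ys"]) simp
    qed
  qed
  then show ?case using xs by simp
qed simp

lemma sorted_wrt_unique:
  fixes xs ys :: "'x::order list"
  assumes "sorted_wrt (\<le>) xs" "sorted_wrt (\<le>) ys" "mset xs = mset ys"
  shows "xs = ys"
  using assms
proof (induction xs arbitrary: ys)
  case (Cons x xs)
  then obtain y ys' where y: "ys = y # ys'" by (cases ys) auto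
  have "x \<in> set ys" "y \<in> set (x # xs)" using Cons.prems(3) y by (metis list.set_intros(1) set_mset_mset)+
  then have "x = y" using Cons.prems(1,2) y by (auto intro: antisym)
  then show ?case using Cons y by simp
qed simp

definition srt :: "'x::order multiset \<Rightarrow> 'x list" where
  "srt M = (SOME xs. mset xs = M \<and> sorted_wrt (\<le>) xs)"

lemma srt: "chainm M \<Longrightarrow> mset (srt M) = M \<and> sorted_wrt (\<le>) (srt M)"
  unfolding srt_def by (rule someI_ex) (rule chainm_sorted)

lemma set_srt: "chainm M \<Longrightarrow> set (srt M) = set_mset M"
  using srt by (metis set_mset_mset)

definition dup :: "'x list \<Rightarrow> 'x list" where
  "dup zs = concat (map (\<lambda>z. [z, z]) zs)"

lemma dup_simps [simp]: "dup [] = []" "dup (z # zs) = z # z # dup zs" "dup (zs @ zs') = dup zs @ dup zs'"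
  by (simp_all add: dup_def)

text \<open>The last entry of \<open>A\<close> does not occur earlier in \<open>A\<close>, so
  \<open>A\<close> never ends in a doubled entry. Stripping equal pairs from the end therefore stops
  exactly where \<open>A\<close> ends.\<close>

lemma dup_cancel:
  assumes "A @ dup zs = A' @ dup zs'"
    and "A \<noteq> [] \<Longrightarrow> last A \<notin> set (butlast A)" "A' \<noteq> [] \<Longrightarrow> last A' \<notin> set (butlast A')"
  shows "A = A' \<and> zs = zs'"
  using assms(1)
proof (induction zs arbitrary: zs' rule: rev_induct)
  case Nil
  show ?case
  proof (cases zs' rule: rev_cases)
    case (snoc ys z)
    then have "A = (A' @ dup ys @ [z]) @ [z]" using Nil by simp
    then show ?thesis using assms(2) by (auto simp: butlast_append)
  qed (use Nil in simp)
next
  case (snoc y ys)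
  show ?case
  proof (cases zs' rule: rev_cases)
    case Nil
    then have "A' = (A @ dup ys @ [y]) @ [y]" using snoc by simp
    then show ?thesis using assms(3) by (auto simp: butlast_append)
  next
    case (snoc ys' z)
    then have "A @ dup ys = A' @ dup ys' \<and> y = z" using snoc.prems by simp
    then show ?thesis using snoc snoc.IH by blast
  qed
qed

text \<open>A multichain in the product is encoded by a pair of multichains: matching entries are
  paired and repeated twice, the entries left over are paired with the top element.\<close>

fun zipm :: "'p \<Rightarrow> 'q \<Rightarrow> 'p list \<Rightarrow> 'q list \<Rightarrow> ('p \<times> 'q) list" where
  "zipm tp tq [] gs = map (Pair tp) gs"
| "zipm tp tq fs [] = map (\<lambda>f. (f, tq)) fs"
| "zipm tp tq (f # fs) (g # gs) = (f, g) # (f, g) # zipm tp tq fs gs"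

lemma length_zipm: "length (zipm tp tq fs gs) = length fs + length gs"
  by (induction tp tq fs gs rule: zipm.induct) simp_all

lemma set_zipm: "set (zipm tp tq fs gs) \<subseteq> insert tp (set fs) \<times> insert tq (set gs)"
  by (induction tp tq fs gs rule: zipm.induct) auto

lemma zipm_top: "tp \<notin> set fs \<Longrightarrow> tq \<notin> set gs \<Longrightarrow> (tp, tq) \<notin> set (zipm tp tq fs gs)"
  by (induction tp tq fs gs rule: zipm.induct) auto

lemma sorted_zipm:
  fixes fs :: "'p::order list" and gs :: "'q::order list"
  assumes "sorted_wrt (\<le>) fs" "sorted_wrt (\<le>) gs" "\<And>f. f \<in> set fs \<Longrightarrow> f \<le> tp" "\<And>g. g \<in> set gs \<Longrightarrow> g \<le> tq"
  shows "sorted_wrt (\<le>) (zipm tp tq fs gs)"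
  using assms
proof (induction tp tq fs gs rule: zipm.induct)
  case (3 tp tq f fs g gs)
  have "(f, g) \<le> z" if "z \<in> set (zipm tp tq fs gs)" for z
    using that set_zipm[of tp tq fs gs] 3 by fastforce
  then show ?case using 3 by simp
qed (simp_all add: sorted_wrt_map)

definition goodp :: "'p \<Rightarrow> 'q \<Rightarrow> 'p \<times> 'q \<Rightarrow> bool" where
  "goodp tp tq H \<longleftrightarrow> fst H \<noteq> tp \<and> snd H \<noteq> tq"

text \<open>An entry with neither coordinate at the top comes from a matched pair. Every other entry
  has one coordinate at the top and carries a member of one unmatched tail in the other.\<close>

lemma filter_zipm:
  assumes "tp \<notin> set fs" "tq \<notin> set gs"
  shows "filter (goodp tp tq) (zipm tp tq fs gs) = dup (zip fs gs)"
    and "map fst (zip fs gs) @ map fst (filter (\<lambda>z. fst z \<noteq> tp) (filter (\<lambda>z. \<not> goodp tp tq z) (zipm tp tq fs gs))) = fs"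
    and "map snd (zip fs gs) @ map snd (filter (\<lambda>z. snd z \<noteq> tq) (filter (\<lambda>z. \<not> goodp tp tq z) (zipm tp tq fs gs))) = gs"
  using assms
  by (induction tp tq fs gs rule: zipm.induct) (auto simp: goodp_def filter_empty_conv filter_map o_def intro!: filter_True map_idI)

text \<open>The entries with no coordinate at the top form \<open>A\<close> followed by doubled
  matches, and the doubling shows where \<open>A\<close> stops. The remaining entries determine the
  tails.\<close>

lemma zipm_cancel:
  assumes eq: "A @ zipm tp tq fs gs = A' @ zipm tp tq fs' gs'"
    and A: "\<And>z. z \<in> set A \<Longrightarrow> goodp tp tq z" "A \<noteq> [] \<Longrightarrow> last A \<notin> set (butlast A)"
    and A': "\<And>z. z \<in> set A' \<Longrightarrow> goodp tp tq z" "A' \<noteq> [] \<Longrightarrow> last A' \<notin> set (butlast A')"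
    and top: "tp \<notin> set fs" "tq \<notin> set gs" "tp \<notin> set fs'" "tq \<notin> set gs'"
  shows "A = A' \<and> fs = fs' \<and> gs = gs'"
proof -
  have "filter (goodp tp tq) (A @ zipm tp tq fs gs) = filter (goodp tp tq) (A' @ zipm tp tq fs' gs')"
    using eq by simp
  moreover have "filter (goodp tp tq) A = A" "filter (goodp tp tq) A' = A'"
    using A A' by (simp_all add: filter_True)
  ultimately have 1: "A = A' \<and> zip fs gs = zip fs' gs'"
    using dup_cancel[of A "zip fs gs" A' "zip fs' gs'"] A(2) A'(2) top by (simp add: filter_zipm(1))
  then have "zipm tp tq fs gs = zipm tp tq fs' gs'" using eq by simp
  then show ?thesis using 1 filter_zipm(2,3)[OF top(1,2)] filter_zipm(2,3)[OF top(3,4)] by metis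
qed

section \<open>A basis of the Stanley--Reisner ring of a product\<close>

lemma add_mset_left_cancel: "add_mset x M = add_mset y M \<longleftrightarrow> x = y"
  by (metis add_mset_add_single add_left_cancel single_eq_single)

lemma sum_compare:
  fixes x :: "'x::order" and f :: "'x \<Rightarrow> 'z::comm_monoid_add"
  assumes "finite A" "x \<in> A"
  shows "sum f A = sum f {y \<in> A. y < x} + f x + sum f {y \<in> A. x < y} + sum f {y \<in> A. \<not> x \<le> y \<and> \<not> y \<le> x}"
proof -
  have "sum f {y \<in> A. y < x} + sum f {y \<in> A. y = x} + sum f {y \<in> A. x < y} + sum f {y \<in> A. \<not> x \<le> y \<and> \<not> y \<le> x} = sum f A"
    unfolding sum.inter_filter[OF assms(1)] sum.distrib[symmetric]
    by (intro sum.cong) (auto simp: less_le)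
  moreover have "{y \<in> A. y = x} = {x}" using assms(2) by auto
  ultimately show ?thesis by simp
qed

type_synonym ('p, 'q) label = "('p \<times> 'q) option"
type_synonym ('p, 'q) index = "('p, 'q) label \<times> ('p \<times> 'q) multiset \<times> 'p multiset \<times> 'q multiset"

text \<open>The instances are the flats of two matroids ordered by inclusion, with the ground sets
  on top.\<close>

locale poset_pair =
  fixes LP :: "'p::order set" and tp :: 'p and LQ :: "'q::order set" and tq :: 'q
  assumes finite_LP: "finite LP" and finite_LQ: "finite LQ"
    and tp: "tp \<in> LP" and tq: "tq \<in> LQ"
    and le_tp: "F \<in> LP \<Longrightarrow> F \<le> tp" and le_tq: "G \<in> LQ \<Longrightarrow> G \<le> tq"
begin

abbreviation "P' \<equiv> LP - {tp}"
abbreviation "Q' \<equiv> LQ - {tq}"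
abbreviation "PQ \<equiv> LP \<times> LQ - {(tp, tq)}"
abbreviation "good \<equiv> P' \<times> Q'"
abbreviation "labels \<equiv> insert None (Some ` good)"

definition sr :: "('p \<times> 'q) rat_poly set" where
  "sr = {Var K | K. K \<notin> PQ} \<union> {Var K * Var K' | K K'. K \<in> PQ \<and> K' \<in> PQ \<and> \<not> K \<le> K' \<and> \<not> K' \<le> K}"

text \<open>The value outside \<open>P'\<close> is 0 because the ground set has no generator. For F
  in \<open>P'\<close> all pairs (F, G) lie in \<open>PQ\<close>, including the one with G =
  \<open>tq\<close>.\<close>

definition X :: "'p \<Rightarrow> ('p \<times> 'q) rat_poly" where
  "X F = (if F \<in> P' then \<Sum>G\<in>LQ. Var (F, G) else 0)"

definition Y :: "'q \<Rightarrow> ('p \<times> 'q) rat_poly" where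
  "Y G = (if G \<in> Q' then \<Sum>F\<in>LP. Var (F, G) else 0)"

fun below :: "('p, 'q) label \<Rightarrow> 'p \<times> 'q \<Rightarrow> bool" where
  "below None K \<longleftrightarrow> False"
| "below (Some H) K \<longleftrightarrow> K \<in> PQ \<and> K < H"

fun lowP :: "('p, 'q) label \<Rightarrow> 'p \<Rightarrow> bool" where
  "lowP None F \<longleftrightarrow> True"
| "lowP (Some H) F \<longleftrightarrow> fst H \<le> F"

fun lowQ :: "('p, 'q) label \<Rightarrow> 'q \<Rightarrow> bool" where
  "lowQ None G \<longleftrightarrow> True"
| "lowQ (Some H) G \<longleftrightarrow> snd H \<le> G"

fun base :: "('p, 'q) label \<Rightarrow> ('p \<times> 'q) rat_poly" where
  "base None = 1"
| "base (Some H) = Var H"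

text \<open>The label \<open>None\<close> stands for the part of the Stanley--Reisner ring generated by the \<open>X F\<close>
  and \<open>Y G\<close>, the label \<open>Some H\<close> for the part generated over it by \<open>x\<^sub>H\<close> and the \<open>x\<^sub>K\<close> with
  \<open>K < H\<close>. An element of either part is written as a polynomial in formal variables for the
  \<open>x\<^sub>K\<close>, \<open>X F\<close> and \<open>Y G\<close>.\<close>

definition gsub :: "('p, 'q) label \<Rightarrow> ('p \<times> 'q) + ('p + 'q) \<Rightarrow> ('p \<times> 'q) rat_poly" where
  "gsub h = case_sum (\<lambda>K. if below h K then Var K else 0) (case_sum X Y)"

definition gmap :: "('p, 'q) label \<Rightarrow> (('p \<times> 'q) + ('p + 'q)) rat_poly \<Rightarrow> ('p \<times> 'q) rat_poly" where
  "gmap h u = base h * subst (gsub h) u"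

abbreviation KV :: "'p \<times> 'q \<Rightarrow> (('p \<times> 'q) + ('p + 'q)) rat_poly" where "KV K \<equiv> Var (Inl K)"
abbreviation FV :: "'p \<Rightarrow> (('p \<times> 'q) + ('p + 'q)) rat_poly" where "FV F \<equiv> Var (Inr (Inl F))"
abbreviation GV :: "'q \<Rightarrow> (('p \<times> 'q) + ('p + 'q)) rat_poly" where "GV G \<equiv> Var (Inr (Inr G))"

text \<open>The relations that hold in the Stanley--Reisner ring after multiplication by \<open>x\<^sub>H\<close>.\<close>

fun extra_rels :: "('p, 'q) label \<Rightarrow> (('p \<times> 'q) + ('p + 'q)) rat_poly set" where
  "extra_rels None = {}"
| "extra_rels (Some H) =
    {FV F | F. F \<in> P' \<and> \<not> fst H \<le> F \<and> \<not> F \<le> fst H} \<union>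
    {GV G | G. G \<in> Q' \<and> \<not> snd H \<le> G \<and> \<not> G \<le> snd H} \<union>
    {FV F - (\<Sum>G\<in>{G \<in> LQ. G \<le> snd H}. KV (F, G)) | F. F \<in> P' \<and> F < fst H} \<union>
    {GV G - (\<Sum>F\<in>{F \<in> LP. F \<le> fst H}. KV (F, G)) | G. G \<in> Q' \<and> G < snd H}"

definition rels :: "('p, 'q) label \<Rightarrow> (('p \<times> 'q) + ('p + 'q)) rat_poly set" where
  "rels h = {KV K | K. \<not> below h K} \<union> {FV F | F. F \<notin> P'} \<union> {GV G | G. G \<notin> Q'} \<union>
    {KV K * KV K' | K K'. below h K \<and> below h K' \<and> \<not> K \<le> K' \<and> \<not> K' \<le> K} \<union>
    {FV F * FV F' | F F'. F \<in> P' \<and> F' \<in> P' \<and> \<not> F \<le> F' \<and> \<not> F' \<le> F} \<union>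
    {GV G * GV G' | G G'. G \<in> Q' \<and> G' \<in> Q' \<and> \<not> G \<le> G' \<and> \<not> G' \<le> G} \<union> extra_rels h"

definition Bas :: "('p, 'q) index set" where
  "Bas = {(h, ms, fs, gs). h \<in> labels \<and> chainm ms \<and> chainm fs \<and> chainm gs \<and> (\<forall>K\<in>#ms. below h K) \<and>
    (\<forall>F\<in>#fs. F \<in> P' \<and> lowP h F) \<and> (\<forall>G\<in>#gs. G \<in> Q' \<and> lowQ h G)}"

fun deg :: "('p, 'q) index \<Rightarrow> nat" where
  "deg (h, ms, fs, gs) = (if h = None then 0 else 1) + size ms + size fs + size gs"

text \<open>The formal counterpart of \<open>gm\<close> without the factor \<open>base h\<close>.
  These monomials are the coordinates of the basis elements, and \<open>gmap\<close> realizes them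
  again.\<close>

fun um :: "('p, 'q) index \<Rightarrow> (('p \<times> 'q) + ('p + 'q)) rat_poly" where
  "um (h, ms, fs, gs) = vprod KV ms * vprod FV fs * vprod GV gs"

fun gm :: "('p, 'q) index \<Rightarrow> ('p \<times> 'q) rat_poly" where
  "gm (h, ms, fs, gs) = base h * vprod Var ms * vprod X fs * vprod Y gs"

lemma gm_eq_gmap:
  assumes "(h, ms, fs, gs) \<in> Bas"
  shows "gm (h, ms, fs, gs) = gmap h (um (h, ms, fs, gs))"
proof -
  have "vprod (\<lambda>K. if below h K then Var K else 0) ms = vprod Var ms"
    using assms by (intro arg_cong[of _ _ prod_mset] image_mset_cong) (auto simp: Bas_def)
  then show ?thesis by (simp add: gmap_def subst_vprod gsub_def mult.assoc)
qed

lemma gmap_simps: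
  "gmap h (u + v) = gmap h u + gmap h v" "gmap h (Const c * u) = Const c * gmap h u"
  "gmap h (FV F * u) = X F * gmap h u" "gmap h (GV G * u) = Y G * gmap h u"
  "gmap h (u - v) = gmap h u - gmap h v" "gmap h 0 = 0"
  by (simp_all add: gmap_def gsub_def algebra_simps)

lemma X_homp: "X F \<in> homp 1"
  unfolding X_def by (auto intro: homp_sum)

lemma Y_homp: "Y G \<in> homp 1"
  unfolding Y_def by (auto intro: homp_sum)

lemma gsub_homp: "gsub h v \<in> homp 1"
  using X_homp Y_homp by (auto simp: gsub_def split: sum.splits)

lemma sr_incomparable: "\<not> K \<le> K' \<Longrightarrow> \<not> K' \<le> K \<Longrightarrow> Var K * Var K' \<in> idl sr"
proof -
  assume K: "\<not> K \<le> K'" "\<not> K' \<le> K"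
  show ?thesis
  proof (cases "K \<in> PQ \<and> K' \<in> PQ")
    case True
    then have "Var K * Var K' \<in> sr" using K unfolding sr_def by blast
    then show ?thesis by (rule idl_gen)
  next
    case False
    then have "Var K \<in> sr \<or> Var K' \<in> sr" unfolding sr_def by blast
    then show ?thesis by (auto intro: idl_mult idl_mult_right idl_gen)
  qed
qed

lemma sum_mult_idl:
  assumes "\<And>a b. a \<in> A \<Longrightarrow> b \<in> B \<Longrightarrow> f a * g b \<in> idl S"
  shows "(\<Sum>a\<in>A. f a) * (\<Sum>b\<in>B. g b) \<in> idl S"
  unfolding sum_product using assms by (intro idl_sum) auto

lemma X_incomparable: "\<not> F \<le> F' \<Longrightarrow> \<not> F' \<le> F \<Longrightarrow> X F * X F' \<in> idl sr"
  unfolding X_def by (auto intro!: sum_mult_idl sr_incomparable)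

lemma Y_incomparable: "\<not> G \<le> G' \<Longrightarrow> \<not> G' \<le> G \<Longrightarrow> Y G * Y G' \<in> idl sr"
  unfolding Y_def by (auto intro!: sum_mult_idl sr_incomparable)

lemma X_Var_incomparable: "\<not> F \<le> fst H \<Longrightarrow> \<not> fst H \<le> F \<Longrightarrow> X F * Var H \<in> idl sr"
  unfolding X_def by (cases H) (auto simp: sum_distrib_right intro!: idl_sum sr_incomparable)

lemma Y_Var_incomparable: "\<not> G \<le> snd H \<Longrightarrow> \<not> snd H \<le> G \<Longrightarrow> Y G * Var H \<in> idl sr"
  unfolding Y_def by (cases H) (auto simp: sum_distrib_right intro!: idl_sum sr_incomparable)

text \<open>If F < fst H and G is not below snd H, then (F, G) and H are incomparable, so only the
  terms with G <= snd H survive multiplication by x_H.\<close>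

lemma X_Var_below:
  assumes "F \<in> P'" "F < fst H"
  shows "X F * Var H - (\<Sum>G\<in>{G \<in> LQ. G \<le> snd H}. Var (F, G)) * Var H \<in> idl sr"
proof -
  have "(\<Sum>G\<in>LQ. Var (F, G)) = (\<Sum>G\<in>{G \<in> LQ. G \<le> snd H}. Var (F, G)) + (\<Sum>G\<in>{G \<in> LQ. \<not> G \<le> snd H}. Var (F, G))"
    using finite_LQ by (subst sum.union_disjoint[symmetric]) (auto intro!: sum.cong)
  then have "X F * Var H - (\<Sum>G\<in>{G \<in> LQ. G \<le> snd H}. Var (F, G)) * Var H = (\<Sum>G\<in>{G \<in> LQ. \<not> G \<le> snd H}. Var (F, G)) * Var H"
    using assms by (simp add: X_def algebra_simps)
  also have "\<dots> \<in> idl sr"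
    unfolding sum_distrib_right using assms by (cases H) (auto intro!: idl_sum sr_incomparable)
  finally show ?thesis .
qed

lemma Y_Var_below:
  assumes "G \<in> Q'" "G < snd H"
  shows "Y G * Var H - (\<Sum>F\<in>{F \<in> LP. F \<le> fst H}. Var (F, G)) * Var H \<in> idl sr"
proof -
  have "(\<Sum>F\<in>LP. Var (F, G)) = (\<Sum>F\<in>{F \<in> LP. F \<le> fst H}. Var (F, G)) + (\<Sum>F\<in>{F \<in> LP. \<not> F \<le> fst H}. Var (F, G))"
    using finite_LP by (subst sum.union_disjoint[symmetric]) (auto intro!: sum.cong)
  then have "Y G * Var H - (\<Sum>F\<in>{F \<in> LP. F \<le> fst H}. Var (F, G)) * Var H = (\<Sum>F\<in>{F \<in> LP. \<not> F \<le> fst H}. Var (F, G)) * Var H"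
    using assms by (simp add: Y_def algebra_simps)
  also have "\<dots> \<in> idl sr"
    unfolding sum_distrib_right using assms by (cases H) (auto intro!: idl_sum sr_incomparable)
  finally show ?thesis .
qed

text \<open>The relation behind the spanning argument: \<open>x\<^sub>H\<^sup>2\<close> can be eliminated, at the price of
  \<open>X\<^sub>F Y\<^sub>G\<close> and of terms that are smaller in a suitable order.\<close>

lemma Var_square:
  assumes "F \<in> P'" "G \<in> Q'"
  defines "LG \<equiv> \<Sum>G'\<in>{G' \<in> LQ. G' < G}. Var (F, G')" and "LF \<equiv> \<Sum>F'\<in>{F' \<in> LP. F' < F}. Var (F', G)"
  shows "Var (F, G) * Var (F, G) - (LG * Y G + LF * X F + Var (F, G) * Y G + Var (F, G) * X F
    - X F * Y G - Var (F, G) * LF - Var (F, G) * LG) \<in> idl sr"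
proof -
  define UG where "UG = (\<Sum>G'\<in>{G' \<in> LQ. G < G'}. Var (F, G'))"
  define UF where "UF = (\<Sum>F'\<in>{F' \<in> LP. F < F'}. Var (F', G))"
  define NG where "NG = (\<Sum>G'\<in>{G' \<in> LQ. \<not> G \<le> G' \<and> \<not> G' \<le> G}. Var (F, G'))"
  define NF where "NF = (\<Sum>F'\<in>{F' \<in> LP. \<not> F \<le> F' \<and> \<not> F' \<le> F}. Var (F', G))"
  have XF: "X F = LG + Var (F, G) + UG + NG"
    unfolding LG_def UG_def NG_def using sum_compare[OF finite_LQ, of G] assms(1,2) by (simp add: X_def)
  have YG: "Y G = LF + Var (F, G) + UF + NF"
    unfolding LF_def UF_def NF_def using sum_compare[OF finite_LP, of F] assms(1,2) by (simp add: Y_def)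
  \<comment> \<open>Each product combines pairs (F, G') and (F', G) whose coordinates compare in
    opposite directions or, in one of them, not at all. Hence all its terms are
    incomparable.\<close>
  have "UG * UF \<in> idl sr" "UG * NF \<in> idl sr" "NG * UF \<in> idl sr" "NG * NF \<in> idl sr" "LF * LG \<in> idl sr"
    unfolding UG_def UF_def NG_def NF_def LF_def LG_def
    by (intro sum_mult_idl sr_incomparable; force simp: less_le)+
  then have "UG * UF + UG * NF + NG * UF + NG * NF - LF * LG \<in> idl sr"
    by (intro idl_add idl_minus)
  moreover have "Var (F, G) * Var (F, G) - (LG * Y G + LF * X F + Var (F, G) * Y G + Var (F, G) * X F
    - X F * Y G - Var (F, G) * LF - Var (F, G) * LG) = UG * UF + UG * NF + NG * UF + NG * NF - LF * LG"
    unfolding XF YG by (simp add: algebra_simps)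
  ultimately show ?thesis by (simp only:)
qed

lemma Bas_none: "(None, {#}, {#}, {#}) \<in> Bas"
  by (simp add: Bas_def chainm_def)

text \<open>One index set describes both the product with X_F in the Stanley-Reisner ring and,
  modulo \<open>rels\<close>, the product of the formal monomial with \<open>FV F\<close>; the label
  does not change. This parallel is the source of the linearity of the coordinates.\<close>

lemma X_step:
  assumes b: "b \<in> Bas" and F: "F \<in> P'"
  shows "\<exists>\<Gamma>. finite \<Gamma> \<and> \<Gamma> \<subseteq> {c \<in> Bas. deg c = Suc (deg b) \<and> fst c = fst b} \<and>
    X F * gm b - (\<Sum>c\<in>\<Gamma>. gm c) \<in> idl sr \<and> FV F * um b - (\<Sum>c\<in>\<Gamma>. um c) \<in> idl (rels (fst b))"
proof -
  obtain h ms fs gs where b_eq: "b = (h, ms, fs, gs)" by (metis prod_cases4)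
  note B = b[unfolded b_eq Bas_def, simplified]
  have empty: ?thesis if "X F * gm b \<in> idl sr" "FV F * um b \<in> idl (rels h)"
    using that by (intro exI[of _ "{}"]) (simp add: b_eq)
  consider (chain) "lowP h F" "chainm (add_mset F fs)"
    | (nochain) F' where "F' \<in># fs" "\<not> F \<le> F'" "\<not> F' \<le> F"
    | (incomp) H where "h = Some H" "\<not> fst H \<le> F" "\<not> F \<le> fst H"
    | (below) H where "h = Some H" "F < fst H"
    using B by (cases h) (auto simp: chainm_add less_le)
  then show ?thesis
  proof cases
    case chain
    let ?c = "(h, ms, add_mset F fs, gs)"
    have "?c \<in> Bas" using B chain F by (auto simp: Bas_def)
    then show ?thesis by (intro exI[of _ "{?c}"]) (simp add: b_eq mult_ac)
  next
    case nochain
    then have "F' \<in> P'" using B by auto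
    obtain fs' where fs: "fs = add_mset F' fs'" using nochain by (metis mset_add)
    show ?thesis
    proof (rule empty)
      have "X F * gm b = (X F * X F') * (base h * vprod Var ms * vprod X fs' * vprod Y gs)"
        by (simp add: b_eq fs mult_ac)
      then show "X F * gm b \<in> idl sr" using X_incomparable nochain by (simp add: idl_mult_right)
      have "FV F * FV F' \<in> idl (rels h)"
        using nochain F \<open>F' \<in> P'\<close> by (intro idl_gen) (auto simp: rels_def)
      moreover have "FV F * um b = (FV F * FV F') * (vprod KV ms * vprod FV fs' * vprod GV gs)"
        by (simp add: b_eq fs mult_ac)
      ultimately show "FV F * um b \<in> idl (rels h)" by (simp add: idl_mult_right)
    qed
  next
    case incomp
    show ?thesis
    proof (rule empty)
      have "X F * gm b = (X F * Var H) * (vprod Var ms * vprod X fs * vprod Y gs)"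
        by (simp add: b_eq incomp mult_ac)
      then show "X F * gm b \<in> idl sr" using X_Var_incomparable incomp by (simp add: idl_mult_right)
      have "FV F \<in> extra_rels h" using incomp F unfolding incomp(1) extra_rels.simps by blast
      then have "FV F \<in> idl (rels h)" unfolding rels_def by (blast intro: idl_gen)
      then show "FV F * um b \<in> idl (rels h)" by (simp add: idl_mult_right)
    qed
  next
    case below
    \<comment> \<open>By \<open>X_Var_below\<close>, X_F x_H reduces to the terms with G in
      \<open>?D\<close>. Those in \<open>?C\<close> extend the chain \<open>ms\<close> to a new
      basis element; the others are incomparable to a member of \<open>ms\<close> and vanish modulo
      the relations.\<close>
    let ?D = "{G \<in> LQ. G \<le> snd H}"
    let ?C = "{G \<in> ?D. \<forall>K\<in>#ms. (F, G) \<le> K \<or> K \<le> (F, G)}"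
    let ?c = "\<lambda>G. (h, add_mset (F, G) ms, fs, gs)"
    have fin: "finite ?D" using finite_LQ by simp
    have bel: "below h (F, G)" if "G \<in> ?D" for G
      using that below F by (cases H) (auto simp: less_le)
    have inj: "inj_on ?c ?C" by (rule inj_onI) (simp add: add_mset_left_cancel)
    have c: "?c G \<in> {c \<in> Bas. deg c = Suc (deg b) \<and> fst c = fst b}" if "G \<in> ?C" for G
      using that B bel[of G] by (auto simp: Bas_def b_eq chainm_add)
    have split: "(\<Sum>G\<in>?D. f G) = (\<Sum>G\<in>?C. f G) + (\<Sum>G\<in>?D - ?C. f G)" for f :: "'q \<Rightarrow> 'z::comm_monoid_add"
      using fin by (subst sum.subset_diff[of ?C ?D]) (auto simp: add.commute)
    let ?r = "vprod Var ms * vprod X fs * vprod Y gs" and ?s = "vprod KV ms * vprod FV fs * vprod GV gs"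
    have 1: "X F * gm b - (\<Sum>c\<in>?c ` ?C. gm c) \<in> idl sr"
    proof -
      have "X F * gm b - (\<Sum>c\<in>?c ` ?C. gm c) =
        (X F * Var H - (\<Sum>G\<in>?D. Var (F, G)) * Var H) * ?r + (\<Sum>G\<in>?D - ?C. Var (F, G) * (Var H * ?r))"
        unfolding sum.reindex[OF inj] split[of "\<lambda>G. Var (F, G)"]
        by (simp add: b_eq below o_def algebra_simps sum_distrib_left sum_distrib_right)
      also have "\<dots> \<in> idl sr"
      proof (rule idl_add[OF idl_mult_right idl_sum])
        show "X F * Var H - (\<Sum>G\<in>?D. Var (F, G)) * Var H \<in> idl sr" using X_Var_below F below by blast
        fix G assume "G \<in> ?D - ?C"
        then obtain K where K: "K \<in># ms" "\<not> (F, G) \<le> K" "\<not> K \<le> (F, G)" by blast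
        obtain ms' where "ms = add_mset K ms'" using K by (metis mset_add)
        then have "Var (F, G) * (Var H * ?r) = (Var (F, G) * Var K) * (Var H * vprod Var ms' * vprod X fs * vprod Y gs)"
          by (simp add: mult_ac)
        then show "Var (F, G) * (Var H * ?r) \<in> idl sr" using sr_incomparable K by (simp add: idl_mult_right)
      qed
      finally show ?thesis .
    qed
    have 2: "FV F * um b - (\<Sum>c\<in>?c ` ?C. um c) \<in> idl (rels h)"
    proof -
      have "FV F * um b - (\<Sum>c\<in>?c ` ?C. um c) =
        (FV F - (\<Sum>G\<in>?D. KV (F, G))) * ?s + (\<Sum>G\<in>?D - ?C. KV (F, G) * ?s)"
        unfolding sum.reindex[OF inj] split[of "\<lambda>G. KV (F, G)"]
        by (simp add: b_eq below o_def algebra_simps sum_distrib_left sum_distrib_right)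
      also have "\<dots> \<in> idl (rels h)"
      proof (rule idl_add[OF idl_mult_right idl_sum])
        have "FV F - (\<Sum>G\<in>?D. KV (F, G)) \<in> extra_rels h"
          using F below unfolding below(1) extra_rels.simps by blast
        then show "FV F - (\<Sum>G\<in>?D. KV (F, G)) \<in> idl (rels h)"
          unfolding rels_def by (blast intro: idl_gen)
        fix G assume G: "G \<in> ?D - ?C"
        then obtain K where K: "K \<in># ms" "\<not> (F, G) \<le> K" "\<not> K \<le> (F, G)" by blast
        obtain ms' where "ms = add_mset K ms'" using K by (metis mset_add)
        then have "KV (F, G) * ?s = (KV (F, G) * KV K) * (vprod KV ms' * vprod FV fs * vprod GV gs)"
          by (simp add: mult_ac)
        moreover have "below h (F, G)" "below h K" using bel[of G] G K(1) B by auto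
        then have "KV (F, G) * KV K \<in> rels h" using K(2,3) unfolding rels_def by blast
        then have "KV (F, G) * KV K \<in> idl (rels h)" by (rule idl_gen)
        ultimately show "KV (F, G) * ?s \<in> idl (rels h)" by (simp add: idl_mult_right)
      qed
      finally show ?thesis .
    qed
    have "fst b = h" by (simp add: b_eq)
    moreover have "finite (?c ` ?C)" using finite_subset[OF _ fin, of ?C] by blast
    moreover have "?c ` ?C \<subseteq> {c \<in> Bas. deg c = Suc (deg b) \<and> fst c = fst b}" using c by blast
    ultimately show ?thesis using 1 2 by (intro exI[of _ "?c ` ?C"]) simp
  qed
qed

text \<open>\<open>X_step\<close> with the two posets exchanged.\<close>

lemma Y_step:
  assumes b: "b \<in> Bas" and G: "G \<in> Q'"
  shows "\<exists>\<Gamma>. finite \<Gamma> \<and> \<Gamma> \<subseteq> {c \<in> Bas. deg c = Suc (deg b) \<and> fst c = fst b} \<and>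
    Y G * gm b - (\<Sum>c\<in>\<Gamma>. gm c) \<in> idl sr \<and> GV G * um b - (\<Sum>c\<in>\<Gamma>. um c) \<in> idl (rels (fst b))"
proof -
  obtain h ms fs gs where b_eq: "b = (h, ms, fs, gs)" by (metis prod_cases4)
  note B = b[unfolded b_eq Bas_def, simplified]
  have empty: ?thesis if "Y G * gm b \<in> idl sr" "GV G * um b \<in> idl (rels h)"
    using that by (intro exI[of _ "{}"]) (simp add: b_eq)
  consider (chain) "lowQ h G" "chainm (add_mset G gs)"
    | (nochain) G' where "G' \<in># gs" "\<not> G \<le> G'" "\<not> G' \<le> G"
    | (incomp) H where "h = Some H" "\<not> snd H \<le> G" "\<not> G \<le> snd H"
    | (below) H where "h = Some H" "G < snd H"
    using B by (cases h) (auto simp: chainm_add less_le)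
  then show ?thesis
  proof cases
    case chain
    let ?c = "(h, ms, fs, add_mset G gs)"
    have "?c \<in> Bas" using B chain G by (auto simp: Bas_def)
    then show ?thesis by (intro exI[of _ "{?c}"]) (simp add: b_eq mult_ac)
  next
    case nochain
    then have "G' \<in> Q'" using B by auto
    obtain gs' where gs: "gs = add_mset G' gs'" using nochain by (metis mset_add)
    show ?thesis
    proof (rule empty)
      have "Y G * gm b = (Y G * Y G') * (base h * vprod Var ms * vprod Y gs' * vprod X fs)"
        by (simp add: b_eq gs mult_ac)
      then show "Y G * gm b \<in> idl sr" using Y_incomparable nochain by (simp add: idl_mult_right)
      have "GV G * GV G' \<in> idl (rels h)"
        using nochain G \<open>G' \<in> Q'\<close> by (intro idl_gen) (auto simp: rels_def)
      moreover have "GV G * um b = (GV G * GV G') * (vprod KV ms * vprod GV gs' * vprod FV fs)"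
        by (simp add: b_eq gs mult_ac)
      ultimately show "GV G * um b \<in> idl (rels h)" by (simp add: idl_mult_right)
    qed
  next
    case incomp
    show ?thesis
    proof (rule empty)
      have "Y G * gm b = (Y G * Var H) * (vprod Var ms * vprod Y gs * vprod X fs)"
        by (simp add: b_eq incomp mult_ac)
      then show "Y G * gm b \<in> idl sr" using Y_Var_incomparable incomp by (simp add: idl_mult_right)
      have "GV G \<in> extra_rels h" using incomp G unfolding incomp(1) extra_rels.simps by blast
      then have "GV G \<in> idl (rels h)" unfolding rels_def by (blast intro: idl_gen)
      then show "GV G * um b \<in> idl (rels h)" by (simp add: idl_mult_right)
    qed
  next
    case below
    let ?D = "{F \<in> LP. F \<le> fst H}"
    let ?C = "{F \<in> ?D. \<forall>K\<in>#ms. (F, G) \<le> K \<or> K \<le> (F, G)}"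
    let ?c = "\<lambda>F. (h, add_mset (F, G) ms, fs, gs)"
    have fin: "finite ?D" using finite_LP by simp
    have bel: "below h (F, G)" if "F \<in> ?D" for F
      using that below G by (cases H) (auto simp: less_le)
    have inj: "inj_on ?c ?C" by (rule inj_onI) (simp add: add_mset_left_cancel)
    have c: "?c F \<in> {c \<in> Bas. deg c = Suc (deg b) \<and> fst c = fst b}" if "F \<in> ?C" for F
      using that B bel[of F] by (auto simp: Bas_def b_eq chainm_add)
    have split: "(\<Sum>F\<in>?D. f F) = (\<Sum>F\<in>?C. f F) + (\<Sum>F\<in>?D - ?C. f F)" for f :: "'p \<Rightarrow> 'z::comm_monoid_add"
      using fin by (subst sum.subset_diff[of ?C ?D]) (auto simp: add.commute)
    let ?r = "vprod Var ms * vprod Y gs * vprod X fs" and ?s = "vprod KV ms * vprod GV gs * vprod FV fs"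
    have 1: "Y G * gm b - (\<Sum>c\<in>?c ` ?C. gm c) \<in> idl sr"
    proof -
      have "Y G * gm b - (\<Sum>c\<in>?c ` ?C. gm c) =
        (Y G * Var H - (\<Sum>F\<in>?D. Var (F, G)) * Var H) * ?r + (\<Sum>F\<in>?D - ?C. Var (F, G) * (Var H * ?r))"
        unfolding sum.reindex[OF inj] split[of "\<lambda>F. Var (F, G)"]
        by (simp add: b_eq below o_def algebra_simps sum_distrib_left sum_distrib_right)
      also have "\<dots> \<in> idl sr"
      proof (rule idl_add[OF idl_mult_right idl_sum])
        show "Y G * Var H - (\<Sum>F\<in>?D. Var (F, G)) * Var H \<in> idl sr" using Y_Var_below G below by blast
        fix F assume "F \<in> ?D - ?C"
        then obtain K where K: "K \<in># ms" "\<not> (F, G) \<le> K" "\<not> K \<le> (F, G)" by blast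
        obtain ms' where "ms = add_mset K ms'" using K by (metis mset_add)
        then have "Var (F, G) * (Var H * ?r) = (Var (F, G) * Var K) * (Var H * vprod Var ms' * vprod Y gs * vprod X fs)"
          by (simp add: mult_ac)
        then show "Var (F, G) * (Var H * ?r) \<in> idl sr" using sr_incomparable K by (simp add: idl_mult_right)
      qed
      finally show ?thesis .
    qed
    have 2: "GV G * um b - (\<Sum>c\<in>?c ` ?C. um c) \<in> idl (rels h)"
    proof -
      have "GV G * um b - (\<Sum>c\<in>?c ` ?C. um c) =
        (GV G - (\<Sum>F\<in>?D. KV (F, G))) * ?s + (\<Sum>F\<in>?D - ?C. KV (F, G) * ?s)"
        unfolding sum.reindex[OF inj] split[of "\<lambda>F. KV (F, G)"]
        by (simp add: b_eq below o_def algebra_simps sum_distrib_left sum_distrib_right)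
      also have "\<dots> \<in> idl (rels h)"
      proof (rule idl_add[OF idl_mult_right idl_sum])
        have "GV G - (\<Sum>F\<in>?D. KV (F, G)) \<in> extra_rels h"
          using G below unfolding below(1) extra_rels.simps by blast
        then show "GV G - (\<Sum>F\<in>?D. KV (F, G)) \<in> idl (rels h)"
          unfolding rels_def by (blast intro: idl_gen)
        fix F assume F: "F \<in> ?D - ?C"
        then obtain K where K: "K \<in># ms" "\<not> (F, G) \<le> K" "\<not> K \<le> (F, G)" by blast
        obtain ms' where "ms = add_mset K ms'" using K by (metis mset_add)
        then have "KV (F, G) * ?s = (KV (F, G) * KV K) * (vprod KV ms' * vprod GV gs * vprod FV fs)"
          by (simp add: mult_ac)
        moreover have "below h (F, G)" "below h K" using bel[of F] F K(1) B by auto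
        then have "KV (F, G) * KV K \<in> rels h" using K(2,3) unfolding rels_def by blast
        then have "KV (F, G) * KV K \<in> idl (rels h)" by (rule idl_gen)
        ultimately show "KV (F, G) * ?s \<in> idl (rels h)" by (simp add: idl_mult_right)
      qed
      finally show ?thesis .
    qed
    have "fst b = h" by (simp add: b_eq)
    moreover have "finite (?c ` ?C)" using finite_subset[OF _ fin, of ?C] by blast
    moreover have "?c ` ?C \<subseteq> {c \<in> Bas. deg c = Suc (deg b) \<and> fst c = fst b}" using c by blast
    ultimately show ?thesis using 1 2 by (intro exI[of _ "?c ` ?C"]) simp
  qed
qed

end

section \<open>Spanning by the basis products\<close>

context poset_pair
begin

text \<open>The degree is recorded because independence is a count in bounded degree and because the
  coordinates have to respect the grading.\<close>

definition W :: "nat \<Rightarrow> ('p \<times> 'q) rat_poly set" where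
  "W d = {p. \<exists>q\<in>pvs.span (gm ` {b \<in> Bas. deg b = d}). p - q \<in> idl sr}"

lemma W_gm: "b \<in> Bas \<Longrightarrow> deg b = d \<Longrightarrow> gm b \<in> W d"
  unfolding W_def by (intro CollectI bexI[of _ "gm b"]) (auto intro: pvs.span_base)

lemma W_cong: "p \<in> W d \<Longrightarrow> q - p \<in> idl sr \<Longrightarrow> q \<in> W d"
  unfolding W_def by (auto intro: idl_trans)

lemma W_idl: "p \<in> idl sr \<Longrightarrow> p \<in> W d"
  unfolding W_def by (auto intro!: bexI[of _ 0] pvs.span_zero)

lemma W_add: "p \<in> W d \<Longrightarrow> q \<in> W d \<Longrightarrow> p + q \<in> W d"
proof -
  assume "p \<in> W d" "q \<in> W d"
  then obtain p' q' where "p' \<in> pvs.span (gm ` {b \<in> Bas. deg b = d})" "q' \<in> pvs.span (gm ` {b \<in> Bas. deg b = d})"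
    "p - p' \<in> idl sr" "q - q' \<in> idl sr" unfolding W_def by blast
  then show ?thesis
    unfolding W_def using idl_add[of "p - p'" sr "q - q'"]
    by (auto intro!: bexI[of _ "p' + q'"] pvs.span_add simp: algebra_simps)
qed

lemma W_scale: "p \<in> W d \<Longrightarrow> Const c * p \<in> W d"
proof -
  assume "p \<in> W d"
  then obtain p' where "p' \<in> pvs.span (gm ` {b \<in> Bas. deg b = d})" "p - p' \<in> idl sr" unfolding W_def by blast
  then show ?thesis
    unfolding W_def using idl_mult[of "p - p'" sr "Const c"]
    by (auto intro!: bexI[of _ "Const c * p'"] pvs.span_scale simp: algebra_simps)
qed

lemma W_uminus: "p \<in> W d \<Longrightarrow> - p \<in> W d"
  using W_scale[of p d "-1"] by (simp add: single_uminus)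

lemma W_minus: "p \<in> W d \<Longrightarrow> q \<in> W d \<Longrightarrow> p - q \<in> W d"
  using W_add[of p d "- q"] W_uminus[of q d] by simp

lemma W_sum: "(\<And>k. k \<in> K \<Longrightarrow> f k \<in> W d) \<Longrightarrow> (\<Sum>k\<in>K. f k) \<in> W d"
  by (induction K rule: infinite_finite_induct) (auto intro: W_add W_idl)

lemma W_induct [consumes 1, case_names gm cong add scale]:
  assumes "p \<in> W d" and "\<And>b. b \<in> Bas \<Longrightarrow> deg b = d \<Longrightarrow> R (gm b)"
    and "\<And>p q. R p \<Longrightarrow> q - p \<in> idl sr \<Longrightarrow> R q"
    and "\<And>p q. R p \<Longrightarrow> R q \<Longrightarrow> R (p + q)" "\<And>c p. R p \<Longrightarrow> R (Const c * p)" "R 0"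
  shows "R p"
proof -
  obtain q where q: "q \<in> pvs.span (gm ` {b \<in> Bas. deg b = d})" "p - q \<in> idl sr"
    using assms(1) unfolding W_def by blast
  from q(1) have "R q"
  proof (induction rule: pvs.span_induct_alt)
    case base
    show ?case by (rule assms(6))
  next
    case (step c x y)
    then show ?case using assms(2,4,5) by blast
  qed
  then show ?thesis using assms(3) q(2) by blast
qed

lemma W_mult_X:
  assumes "p \<in> W d"
  shows "X F * p \<in> W (Suc d)"
proof (cases "F \<in> P'")
  case True
  from assms show ?thesis
  proof (induction rule: W_induct)
    case (gm b)
    obtain \<Gamma> where \<Gamma>: "\<Gamma> \<subseteq> {c \<in> Bas. deg c = Suc (deg b) \<and> fst c = fst b}" "X F * gm b - (\<Sum>c\<in>\<Gamma>. gm c) \<in> idl sr"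
      using X_step[OF gm(1) True] by blast
    have "(\<Sum>c\<in>\<Gamma>. gm c) \<in> W (Suc d)" using \<Gamma>(1) gm(2) by (intro W_sum W_gm) auto
    then show ?case using \<Gamma>(2) by (rule W_cong)
  next
    case (cong p q)
    then show ?case using idl_mult[OF cong(2), of "X F"] by (auto intro: W_cong simp: algebra_simps)
  next
    case (scale c p)
    then show ?case using W_scale[of "X F * p" "Suc d" c] by (simp add: algebra_simps)
  qed (auto simp: distrib_left intro: W_add W_idl)
next
  case False
  then have "X F = 0" unfolding X_def by (rule if_not_P)
  then show ?thesis by (simp add: W_idl)
qed

lemma W_mult_Y:
  assumes "p \<in> W d"
  shows "Y G * p \<in> W (Suc d)"
proof (cases "G \<in> Q'")
  case True
  from assms show ?thesis
  proof (induction rule: W_induct)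
    case (gm b)
    obtain \<Gamma> where \<Gamma>: "\<Gamma> \<subseteq> {c \<in> Bas. deg c = Suc (deg b) \<and> fst c = fst b}" "Y G * gm b - (\<Sum>c\<in>\<Gamma>. gm c) \<in> idl sr"
      using Y_step[OF gm(1) True] by blast
    have "(\<Sum>c\<in>\<Gamma>. gm c) \<in> W (Suc d)" using \<Gamma>(1) gm(2) by (intro W_sum W_gm) auto
    then show ?case using \<Gamma>(2) by (rule W_cong)
  next
    case (cong p q)
    then show ?case using idl_mult[OF cong(2), of "Y G"] by (auto intro: W_cong simp: algebra_simps)
  next
    case (scale c p)
    then show ?case using W_scale[of "Y G * p" "Suc d" c] by (simp add: algebra_simps)
  qed (auto simp: distrib_left intro: W_add W_idl)
next
  case False
  then have "Y G = 0" unfolding Y_def by (rule if_not_P)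
  then show ?thesis by (simp add: W_idl)
qed

text \<open>A strictly monotone measure on pairs, used for termination when one pair is replaced by
  a smaller one.\<close>

definition rank :: "'p \<times> 'q \<Rightarrow> nat" where
  "rank K = card {K' \<in> LP \<times> LQ. K' < K}"

lemma rank_mono: "K \<in> LP \<times> LQ \<Longrightarrow> K < K' \<Longrightarrow> rank K < rank K'"
  unfolding rank_def using finite_LP finite_LQ
  by (intro psubset_card_mono) (auto dest: less_trans)

text \<open>Induction on the number of variables and then on the sum of their ranks. The largest
  pair H of a chain either occurs once, and the monomial is a basis element with label H, or it
  occurs twice, and \<open>Var_square\<close> applies.\<close>

lemma good_span: "set_mset M \<subseteq> good \<Longrightarrow> vprod Var M \<in> W (size M)"
proof (induction "(size M, \<Sum>K\<in>#M. rank K)" arbitrary: M rule: wf_induct_rule[OF wf_lex_prod[OF wf_less_than wf_less_than]])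
  case (1 M)
  have IH: "vprod Var N \<in> W (size N)"
    if "set_mset N \<subseteq> good" "size N < size M \<or> size N = size M \<and> (\<Sum>K\<in>#N. rank K) < (\<Sum>K\<in>#M. rank K)" for N
    using that by (intro 1(1)) auto
  show ?case
  proof (cases "chainm M \<and> M \<noteq> {#}")
    case False
    then consider "M = {#}" | "\<not> chainm M" by blast
    then show ?thesis
    proof cases
      case 1
      then show ?thesis using W_gm[OF Bas_none] by simp
    next
      case 2
      then obtain x y where "x \<in># M" "y \<in># M" "\<not> x \<le> y" "\<not> y \<le> x" "x \<noteq> y" by (rule not_chainm)
      then show ?thesis by (intro W_idl vprod_idl2[of x M y] sr_incomparable)
    qed
  next
    case True
    then obtain xs where xs: "mset xs = M" "sorted_wrt (\<le>) xs" using chainm_sorted by blast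
    then obtain ys H where "xs = ys @ [H]" using True by (cases xs rule: rev_cases) auto
    then obtain N where M: "M = add_mset H N" and top: "\<And>K. K \<in># N \<Longrightarrow> K \<le> H"
      using xs by (intro that[of "mset ys"]) (auto simp: sorted_wrt_append)
    have good: "H \<in> good" "set_mset N \<subseteq> good" using 1(2) M by auto
    show ?thesis
    proof (cases "H \<in># N")
      case False
      then have "below (Some H) K" if "K \<in># N" for K using that top[of K] good(2) by (auto simp: less_le)
      then have "(Some H, N, {#}, {#}) \<in> Bas"
        using True good M by (auto simp: Bas_def chainm_add) (simp_all add: chainm_def)
      from W_gm[OF this refl] show ?thesis by (simp add: M)
    next
      case H: True
      then obtain N' where N: "N = add_mset H N'" by (metis mset_add)
      obtain F G where FG: "H = (F, G)" "F \<in> P'" "G \<in> Q'" using good by blast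
      let ?LG = "{G' \<in> LQ. G' < G}" and ?LF = "{F' \<in> LP. F' < F}"
      have gG: "(F, G') \<in> good" "rank (F, G') < rank H" if "G' \<in> ?LG" for G'
      proof -
        have "G' \<noteq> tq" using that FG le_tq[of G] by (auto dest: leD)
        then show "(F, G') \<in> good" using that FG by auto
        show "rank (F, G') < rank H" using that FG by (intro rank_mono) (auto simp: less_le_not_le)
      qed
      have gF: "(F', G) \<in> good" "rank (F', G) < rank H" if "F' \<in> ?LF" for F'
      proof -
        have "F' \<noteq> tp" using that FG le_tp[of F] by (auto dest: leD)
        then show "(F', G) \<in> good" using that FG by auto
        show "rank (F', G) < rank H" using that FG by (intro rank_mono) (auto simp: less_le_not_le)
      qed
      have sz: "size M = Suc (Suc (size N'))" by (simp add: M N)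
      let ?v = "vprod Var N'"
      have N'g: "set_mset N' \<subseteq> good" using good N by auto
      have v: "?v \<in> W (size N')" using IH[OF N'g] by (simp add: sz)
      have one: "Var K * ?v \<in> W (Suc (size N'))" if "K \<in> good" for K
        using IH[of "add_mset K N'"] that N'g by (simp add: sz)
      have two: "Var H * (Var K * ?v) \<in> W (size M)" if "K \<in> good" "rank K < rank H" for K
        using IH[of "add_mset H (add_mset K N')"] that N'g good by (simp add: sz M N)
      let ?SG = "\<Sum>G'\<in>?LG. Var (F, G')" and ?SF = "\<Sum>F'\<in>?LF. Var (F', G)"
      let ?R = "?SG * Y G + ?SF * X F + Var (F, G) * Y G + Var (F, G) * X F
        - X F * Y G - Var (F, G) * ?SF - Var (F, G) * ?SG"
      \<comment> \<open>The terms with a factor X or Y contain fewer x-variables. The last two sums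
        have as many as before, but one copy of H has been replaced by a pair of smaller
        rank.\<close>
      have "?R * ?v = Y G * (\<Sum>G'\<in>?LG. Var (F, G') * ?v) + X F * (\<Sum>F'\<in>?LF. Var (F', G) * ?v) +
        Y G * (Var H * ?v) + X F * (Var H * ?v) - X F * (Y G * ?v) -
        (\<Sum>F'\<in>?LF. Var H * (Var (F', G) * ?v)) - (\<Sum>G'\<in>?LG. Var H * (Var (F, G') * ?v))"
        by (simp add: FG algebra_simps sum_distrib_left sum_distrib_right)
      also have "\<dots> \<in> W (size M)"
        using gF gG good(1) v unfolding sz
        by (intro W_minus W_add W_mult_X W_mult_Y W_sum one two[unfolded sz]) auto
      finally have R: "?R * ?v \<in> W (size M)" .
      have "vprod Var M - ?R * ?v = (Var (F, G) * Var (F, G) - ?R) * ?v"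
        by (simp add: M N FG algebra_simps)
      also have "\<dots> \<in> idl sr" by (intro idl_mult_right Var_square FG)
      finally show ?thesis by (rule W_cong[OF R])
    qed
  qed
qed

text \<open>All x-variables of a basis element sit at good pairs. Together with the new one they are
  expanded by \<open>good_span\<close>, and the factors X and Y are then multiplied back.\<close>

lemma W_mult_good:
  assumes "H \<in> good" "p \<in> W d"
  shows "Var H * p \<in> W (Suc d)"
  using assms(2)
proof (induction rule: W_induct)
  case (gm b)
  obtain h ms fs gs where b: "b = (h, ms, fs, gs)" by (metis prod_cases4)
  have mX: "vprod X fs * p \<in> W (d + size fs)" if "p \<in> W d" for p d fs
    using that by (induction fs) (use W_mult_X in \<open>auto simp: mult.assoc\<close>)
  have mY: "vprod Y gs * p \<in> W (d + size gs)" if "p \<in> W d" for p d gs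
    using that by (induction gs) (use W_mult_Y in \<open>auto simp: mult.assoc\<close>)
  have good: "set_mset ms \<subseteq> good"
  proof
    fix K assume "K \<in># ms"
    then have "below h K" using gm by (auto simp: b Bas_def)
    then obtain H' where "h = Some H'" "K \<in> PQ" "K < H'" by (cases h) auto
    moreover have "H' \<in> good" using gm \<open>h = Some H'\<close> by (auto simp: b Bas_def)
    ultimately show "K \<in> good" using le_tp le_tq by (cases K; cases H') (fastforce simp: less_le)
  qed
  define N where "N = add_mset H (case h of None \<Rightarrow> ms | Some H' \<Rightarrow> add_mset H' ms)"
  have "set_mset N \<subseteq> good" using good gm assms(1) by (auto simp: N_def b Bas_def split: option.splits)
  then have "vprod Var N \<in> W (size N)" by (rule good_span)
  then have "vprod X fs * (vprod Y gs * vprod Var N) \<in> W (size N + size gs + size fs)" by (intro mX mY)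
  moreover have "vprod X fs * (vprod Y gs * vprod Var N) = Var H * gm b"
    by (cases h) (simp_all add: N_def b mult_ac)
  moreover have "size N + size gs + size fs = Suc d"
    using gm(2) by (cases h) (simp_all add: N_def b)
  ultimately show ?case by simp
next
  case (cong p q)
  then show ?case using idl_mult[OF cong(2), of "Var H"] by (auto intro: W_cong simp: algebra_simps)
next
  case (scale c p)
  then show ?case using W_scale[of "Var H * p" "Suc d" c] by (simp add: algebra_simps)
qed (auto simp: distrib_left intro: W_add W_idl)

text \<open>A pair in \<open>PQ\<close> with one coordinate at the top is not good, but its variable
  equals X_F or Y_G minus variables of good pairs.\<close>

lemma W_mult_Var:
  assumes "p \<in> W d"
  shows "Var K * p \<in> W (Suc d)"
proof -
  obtain F G where K: "K = (F, G)" by (cases K)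
  consider "K \<notin> PQ" | "K \<in> good" | "F \<in> P'" "G = tq" | "F = tp" "G \<in> Q'"
    using K by auto
  then show ?thesis
  proof cases
    case 1
    then have "Var K \<in> sr" unfolding sr_def by blast
    then show ?thesis by (intro W_idl idl_mult_right idl_gen)
  next
    case 2
    then show ?thesis using W_mult_good assms by blast
  next
    case 3
    have "X F = Var K + (\<Sum>G\<in>Q'. Var (F, G))"
      using 3 finite_LQ tq by (simp add: X_def K sum.remove)
    then have "Var K * p = X F * p - (\<Sum>G\<in>Q'. Var (F, G) * p)"
      by (simp add: algebra_simps sum_distrib_left sum_distrib_right)
    also have "\<dots> \<in> W (Suc d)" using 3 assms by (intro W_minus W_mult_X W_sum W_mult_good) auto
    finally show ?thesis .
  next
    case 4
    have "Y G = Var K + (\<Sum>F\<in>P'. Var (F, G))"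
      using 4 finite_LP tp by (simp add: Y_def K sum.remove)
    then have "Var K * p = Y G * p - (\<Sum>F\<in>P'. Var (F, G) * p)"
      by (simp add: algebra_simps sum_distrib_left sum_distrib_right)
    also have "\<dots> \<in> W (Suc d)" using 4 assms by (intro W_minus W_mult_Y W_sum W_mult_good) auto
    finally show ?thesis .
  qed
qed

lemma W_monom: "vprod Var M \<in> W (size M)"
  by (induction M) (use W_gm[OF Bas_none] in \<open>auto intro: W_mult_Var\<close>)

lemma homp_W:
  assumes "p \<in> homp d"
  shows "p \<in> W d"
proof -
  have "supp p \<subseteq> {m. mdeg m = d}" using assms by (auto simp: homp_def)
  then show ?thesis
  proof (induction rule: free_induct)
    case (single m c)
    obtain M where m: "m = mexp M" using mexp_surj by blast
    have "sgl m c = Const c * vprod Var M" by (simp add: vprod_Var mult_single m)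
    then show ?case using W_scale[OF W_monom[of M], of c] single m by simp
  qed (auto intro: W_add W_idl)
qed

lemma basis_induct [case_names gm cong add scale zero]:
  assumes "\<And>b. b \<in> Bas \<Longrightarrow> R (gm b)"
    and "\<And>p q. R p \<Longrightarrow> q - p \<in> idl sr \<Longrightarrow> R q"
    and "\<And>p q. R p \<Longrightarrow> R q \<Longrightarrow> R (p + q)" "\<And>c p. R p \<Longrightarrow> R (Const c * p)" "R 0"
  shows "R p"
proof -
  have part: "R (part k p)" for k
  proof (rule W_induct[OF homp_W[OF part_homp[of k p]]])
    show "R (gm b)" if "b \<in> Bas" "deg b = k" for b using that by (intro assms(1))
  qed (fact assms(2-5))+
  have "R (\<Sum>k\<in>K. part k p)" if "finite K" for K
    using that by (induction K rule: finite_induct) (simp_all add: assms(3,5) part)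
  from this[of "mdeg ` supp p"] show ?thesis by (simp add: sum_parts)
qed

end

section \<open>Independence of the basis products, and coordinates\<close>

context poset_pair
begin

text \<open>The code of a basis element is a multichain whose length is the degree of the element.
  Independence follows from its injectivity by counting.\<close>

fun code :: "('p, 'q) index \<Rightarrow> ('p \<times> 'q) list" where
  "code (h, ms, fs, gs) = (case h of None \<Rightarrow> [] | Some H \<Rightarrow> srt ms @ [H]) @ zipm tp tq (srt fs) (srt gs)"

lemma BasD:
  assumes "(h, ms, fs, gs) \<in> Bas"
  shows "h \<in> labels" "chainm ms" "chainm fs" "chainm gs" "\<And>K. K \<in># ms \<Longrightarrow> below h K"
    "\<And>F. F \<in># fs \<Longrightarrow> F \<in> P' \<and> lowP h F" "\<And>G. G \<in># gs \<Longrightarrow> G \<in> Q' \<and> lowQ h G"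
  using assms by (auto simp: Bas_def)

lemma Bas_none_ms: "(None, ms, fs, gs) \<in> Bas \<Longrightarrow> ms = {#}"
  using BasD(5)[of None ms fs gs] by (cases ms) auto

lemma length_srt: "chainm M \<Longrightarrow> length (srt M) = size M"
  using srt by (metis size_mset)

lemma length_code: "b \<in> Bas \<Longrightarrow> length (code b) = deg b"
proof (cases b)
  case (fields h ms fs gs)
  assume "b \<in> Bas"
  then have B: "(h, ms, fs, gs) \<in> Bas" by (simp add: fields)
  show ?thesis
    using BasD(2-4)[OF B] Bas_none_ms[of ms fs gs] B
    by (cases h) (auto simp: fields length_zipm length_srt)
qed

lemma below_good: "Some H \<in> labels \<Longrightarrow> below (Some H) K \<Longrightarrow> K \<in> good"
  using le_tp le_tq by (cases K; cases H) (fastforce simp: less_le)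

lemma zipm_props:
  assumes "(h, ms, fs, gs) \<in> Bas"
  shows "sorted_wrt (\<le>) (zipm tp tq (srt fs) (srt gs))"
    and "set (zipm tp tq (srt fs) (srt gs)) \<subseteq> PQ"
    and "h = Some H \<Longrightarrow> z \<in> set (zipm tp tq (srt fs) (srt gs)) \<Longrightarrow> H \<le> z"
proof -
  note B = BasD[OF assms]
  have f: "set (srt fs) = set_mset fs" "set (srt gs) = set_mset gs" using B by (simp_all add: set_srt)
  show "sorted_wrt (\<le>) (zipm tp tq (srt fs) (srt gs))"
    using srt[OF B(3)] srt[OF B(4)] B(6,7) le_tp le_tq by (intro sorted_zipm) (auto simp: f)
  have "tp \<notin> set (srt fs)" "tq \<notin> set (srt gs)" using f B(6)[of tp] B(7)[of tq] by blast+
  from zipm_top[OF this] show "set (zipm tp tq (srt fs) (srt gs)) \<subseteq> PQ"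
    using set_zipm[of tp tq "srt fs" "srt gs"] f B(6,7) tp tq by auto
  show "H \<le> z" if "h = Some H" "z \<in> set (zipm tp tq (srt fs) (srt gs))"
  proof -
    have "z \<in> insert tp (set_mset fs) \<times> insert tq (set_mset gs)"
      using that(2) set_zipm[of tp tq "srt fs" "srt gs"] unfolding f by blast
    moreover have "fst H \<le> F" if "F \<in> insert tp (set_mset fs)" for F
      using that \<open>h = Some H\<close> B(1,6) le_tp by auto
    moreover have "snd H \<le> G" if "G \<in> insert tq (set_mset gs)" for G
      using that \<open>h = Some H\<close> B(1,7) le_tq by auto
    ultimately show ?thesis by (cases H; cases z) auto
  qed
qed

lemma sorted_code: "b \<in> Bas \<Longrightarrow> sorted_wrt (\<le>) (code b)"
proof (cases b)
  case (fields h ms fs gs)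
  assume "b \<in> Bas"
  then have B: "(h, ms, fs, gs) \<in> Bas" by (simp add: fields)
  note Z = zipm_props[OF B]
  show ?thesis
  proof (cases h)
    case None
    then show ?thesis using Z(1) by (simp add: fields)
  next
    case (Some H)
    have "K \<le> H" if "K \<in># ms" for K using BasD(5)[OF B that] Some by (simp add: order.strict_implies_order)
    then have 1: "\<forall>x\<in>set (srt ms). x \<le> H" using set_srt[OF BasD(2)[OF B]] by simp
    have 2: "\<forall>z\<in>set (zipm tp tq (srt fs) (srt gs)). H \<le> z" using Z(3)[OF Some] by blast
    have 3: "\<forall>x\<in>set (srt ms). \<forall>z\<in>set (zipm tp tq (srt fs) (srt gs)). x \<le> z"
      using 1 2 order_trans by blast
    show ?thesis
      unfolding fields Some code.simps option.case sorted_wrt_append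
      using 1 2 3 Z(1) srt[OF BasD(2)[OF B]] by (simp del: split_paired_All)
  qed
qed

lemma set_code: "b \<in> Bas \<Longrightarrow> set (code b) \<subseteq> PQ"
proof (cases b)
  case (fields h ms fs gs)
  assume "b \<in> Bas"
  then have B: "(h, ms, fs, gs) \<in> Bas" by (simp add: fields)
  note Z = zipm_props[OF B]
  show ?thesis
  proof (cases h)
    case None
    then show ?thesis using Z(2) by (simp add: fields)
  next
    case (Some H)
    have "H \<in> PQ" using BasD(1)[OF B] Some by auto
    moreover have "K \<in> PQ" if "K \<in># ms" for K using BasD(5)[OF B that] Some by simp
    ultimately show ?thesis using Z(2) set_srt[OF BasD(2)[OF B]] by (auto simp: fields Some)
  qed
qed

text \<open>The initial part of a code is the sorted \<open>ms\<close> followed by H. Since H lies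
  strictly above \<open>ms\<close>, its last entry is not repeated, as \<open>zipm_cancel\<close>
  requires.\<close>

lemma inj_code: "inj_on code Bas"
proof (rule inj_onI)
  fix b b' assume b: "b \<in> Bas" "b' \<in> Bas" "code b = code b'"
  obtain h ms fs gs where be: "b = (h, ms, fs, gs)" by (metis prod_cases4)
  obtain h' ms' fs' gs' where be': "b' = (h', ms', fs', gs')" by (metis prod_cases4)
  have B: "(h, ms, fs, gs) \<in> Bas" "(h', ms', fs', gs') \<in> Bas" using b be be' by auto
  define A where "A h ms = (case h of None \<Rightarrow> [] | Some H \<Rightarrow> srt ms @ [H])" for h :: "('p, 'q) label" and ms
  have A: "\<And>z. z \<in> set (A h ms) \<Longrightarrow> goodp tp tq z" "A h ms \<noteq> [] \<Longrightarrow> last (A h ms) \<notin> set (butlast (A h ms))"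
    "tp \<notin> set (srt fs)" "tq \<notin> set (srt gs)"
    if B: "(h, ms, fs, gs) \<in> Bas" for h ms fs gs
  proof -
    note D = BasD[OF B]
    show "goodp tp tq z" if "z \<in> set (A h ms)" for z
    proof (cases h)
      case (Some H)
      then have "z = H \<or> z \<in># ms" using that set_srt[OF D(2)] by (auto simp: A_def)
      then have "z = H \<or> below (Some H) z" using D(5)[of z] Some by blast
      then have "z \<in> good" using below_good[of H z] D(1) Some by auto
      then show ?thesis by (auto simp: goodp_def)
    qed (use that in \<open>simp add: A_def\<close>)
    show "last (A h ms) \<notin> set (butlast (A h ms))" if "A h ms \<noteq> []"
    proof (cases h)
      case (Some H)
      then have "H \<notin># ms" using D(5)[of H] by auto
      then show ?thesis using Some set_srt[OF D(2)] by (simp add: A_def butlast_append)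
    qed (use that in \<open>simp add: A_def\<close>)
    show "tp \<notin> set (srt fs)" "tq \<notin> set (srt gs)" using D by (auto simp: set_srt)
  qed
  have "A h ms @ zipm tp tq (srt fs) (srt gs) = A h' ms' @ zipm tp tq (srt fs') (srt gs')"
    using b(3) by (simp add: be be' A_def)
  then have eq: "A h ms = A h' ms'" "srt fs = srt fs'" "srt gs = srt gs'"
    using zipm_cancel[OF _ A(1)[OF B(1)] A(2)[OF B(1)] A(1)[OF B(2)] A(2)[OF B(2)]
        A(3)[OF B(1)] A(4)[OF B(1)] A(3)[OF B(2)] A(4)[OF B(2)]] by blast+
  have fg: "fs = fs'" "gs = gs'"
    using eq(2,3) srt[OF BasD(3)[OF B(1)]] srt[OF BasD(3)[OF B(2)]]
      srt[OF BasD(4)[OF B(1)]] srt[OF BasD(4)[OF B(2)]] by metis+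
  have "h = h' \<and> (h \<noteq> None \<longrightarrow> srt ms = srt ms')"
    using eq(1) by (cases h; cases h') (auto simp: A_def)
  then have "h = h' \<and> ms = ms'"
    using Bas_none_ms B srt[OF BasD(2)[OF B(1)]] srt[OF BasD(2)[OF B(2)]] by (cases h) metis+
  then show "b = b'" using fg by (simp add: be be')
qed

definition chm :: "('p \<times> 'q \<Rightarrow>\<^sub>0 nat) \<Rightarrow> bool" where
  "chm m \<longleftrightarrow> (\<exists>M. m = mexp M \<and> chainm M \<and> set_mset M \<subseteq> PQ)"

abbreviation nf :: "('p \<times> 'q) rat_poly \<Rightarrow> ('p \<times> 'q) rat_poly" where "nf \<equiv> filt chm"

text \<open>The ideal is generated by monomials, and no multiple of a generator contains a monomial
  on a chain in \<open>PQ\<close>. Thus \<open>nf\<close> gives normal forms modulo the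
  ideal.\<close>

lemma nf_idl: "p \<in> idl sr \<Longrightarrow> nf p = 0"
proof (induction rule: idl.induct)
  case (step s p a)
  from step(1) consider K where "s = Var K" "K \<notin> PQ" | K K' where "s = Var K * Var K'" "\<not> K \<le> K'" "\<not> K' \<le> K"
    unfolding sr_def by blast
  then have "nf (a * s) = 0"
  proof cases
    case 1
    have "\<not> chm (m + Poly_Mapping.single K 1)" for m
    proof
      assume "chm (m + Poly_Mapping.single K 1)"
      then obtain M where M: "m + Poly_Mapping.single K 1 = mexp M" "set_mset M \<subseteq> PQ" by (auto simp: chm_def)
      have "K \<in> supp (m + Poly_Mapping.single K 1)" by (simp add: supp_add_nat)
      then show False using M 1 by (auto simp: supp_mexp)
    qed
    then show ?thesis unfolding 1 Var_def by (rule filt_mult_monom_zero)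
  next
    case 2
    have e: "s = sgl (Poly_Mapping.single K 1 + Poly_Mapping.single K' 1) 1" by (simp add: 2 Var_def mult_single)
    have "\<not> chm (m + (Poly_Mapping.single K 1 + Poly_Mapping.single K' 1))" for m
    proof
      assume "chm (m + (Poly_Mapping.single K 1 + Poly_Mapping.single K' 1))"
      then obtain M where M: "m + (Poly_Mapping.single K 1 + Poly_Mapping.single K' 1) = mexp M" "chainm M"
        by (auto simp: chm_def)
      have "{K, K'} \<subseteq> supp (m + (Poly_Mapping.single K 1 + Poly_Mapping.single K' 1))" by (simp add: supp_add_nat)
      then show False using M 2 by (auto simp: supp_mexp chainm_def)
    qed
    then show ?thesis unfolding e by (rule filt_mult_monom_zero)
  qed
  then show ?case using step by (simp add: filt_add)
qed simp

lemma nf_vprod: "chainm M \<Longrightarrow> set_mset M \<subseteq> PQ \<Longrightarrow> nf (vprod Var M) = vprod Var M"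
  by (auto simp: vprod_Var filt_single chm_def)

lemma nf_W:
  assumes "p \<in> W d"
  shows "nf p \<in> pvs.span ((\<lambda>b. nf (gm b)) ` {b \<in> Bas. deg b = d})"
  using assms
proof (induction rule: W_induct)
  case (gm b)
  then show ?case by (auto intro: pvs.span_base)
next
  case (cong p q)
  then have "nf q = nf p" using nf_idl[of "q - p"] by (simp add: filt_minus)
  then show ?case using cong by simp
qed (auto simp: filt_add filt_Const intro: pvs.span_add pvs.span_scale pvs.span_zero)

text \<open>The codes show that there are at most as many basis products as chain monomials of
  degree up to n. The chain monomials are independent and lie in the span of the normal forms of the
  products, so the two numbers agree, and a spanning family of minimal size is injective and
  independent.\<close>

lemma independent_upto:
  fixes n :: nat
  defines "Bn \<equiv> {b \<in> Bas. deg b \<le> n}"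
  shows "inj_on (\<lambda>b. nf (gm b)) Bn \<and> pvs.independent ((\<lambda>b. nf (gm b)) ` Bn)"
proof -
  define Mn where "Mn = {M. chainm M \<and> set_mset M \<subseteq> PQ \<and> size M \<le> n}"
  let ?g = "\<lambda>b. nf (gm b)" and ?v = "vprod Var :: ('p \<times> 'q) multiset \<Rightarrow> _"
  have "Mn \<subseteq> mset ` {xs. set xs \<subseteq> PQ \<and> length xs \<le> n}"
  proof
    fix M assume "M \<in> Mn"
    moreover obtain xs where "mset xs = M" using ex_mset by blast
    ultimately show "M \<in> mset ` {xs. set xs \<subseteq> PQ \<and> length xs \<le> n}" by (auto simp: Mn_def)
  qed
  then have fin: "finite Mn"
    by (rule finite_subset) (use finite_LP finite_LQ in \<open>auto intro!: finite_imageI finite_lists_length_le\<close>)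
  have inj: "inj_on (mset \<circ> code) Bn"
  proof (rule inj_onI)
    fix b b' assume b: "b \<in> Bn" "b' \<in> Bn" "(mset \<circ> code) b = (mset \<circ> code) b'"
    then have "code b = code b'"
      by (intro sorted_wrt_unique sorted_code) (auto simp: Bn_def)
    then show "b = b'" using inj_onD[OF inj_code] b by (auto simp: Bn_def)
  qed
  have chain: "chainm (mset xs)" if "sorted_wrt (\<le>) xs" for xs :: "('p \<times> 'q) list"
    using that by (induction xs) (auto simp: chainm_add, simp add: chainm_def)
  have img: "(mset \<circ> code) ` Bn \<subseteq> Mn"
  proof (intro image_subsetI)
    fix b assume "b \<in> Bn"
    then have b: "b \<in> Bas" "deg b \<le> n" by (simp_all add: Bn_def)
    show "(mset \<circ> code) b \<in> Mn"
      using chain[OF sorted_code[OF b(1)]] set_code[OF b(1)] length_code[OF b(1)] b(2)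
      by (simp add: Mn_def del: code.simps)
  qed
  have card: "card Bn \<le> card Mn" by (rule card_inj_on_le[OF inj img fin])
  have finB: "finite Bn" using finite_imageD[OF finite_subset[OF img fin] inj] .
  have v: "?v ` Mn = (\<lambda>m. sgl m 1) ` (mexp ` Mn)" by (simp add: image_image vprod_Var)
  have ind: "pvs.independent (?v ` Mn)" unfolding v by (rule independent_monoms)
  have cardv: "card (?v ` Mn) = card Mn"
    by (intro card_image inj_onI) (simp add: vprod_Var monom_inj mexp_inj)
  have span: "?v ` Mn \<subseteq> pvs.span (?g ` Bn)"
  proof
    fix p assume "p \<in> ?v ` Mn"
    then obtain M where M: "M \<in> Mn" "p = ?v M" by blast
    then have p: "nf p = p" using nf_vprod[of M] by (simp add: Mn_def)
    have "?g ` {b \<in> Bas. deg b = size M} \<subseteq> ?g ` Bn" using M by (auto simp: Bn_def Mn_def)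
    moreover have "nf p \<in> pvs.span (?g ` {b \<in> Bas. deg b = size M})"
      unfolding M(2) by (rule nf_W[OF W_monom])
    ultimately have "nf p \<in> pvs.span (?g ` Bn)" by (rule subsetD[OF pvs.span_mono])
    then show "p \<in> pvs.span (?g ` Bn)" unfolding p .
  qed
  have le: "card Mn \<le> card T" if "finite T" "?v ` Mn \<subseteq> pvs.span T" for T
    using pvs.independent_span_bound[OF that(1) ind that(2)] cardv by simp
  have "card Mn \<le> card (?g ` Bn)" using le[OF _ span] finB by simp
  moreover have "card (?g ` Bn) \<le> card Bn" by (rule card_image_le[OF finB])
  ultimately have eq: "card (?g ` Bn) = card Bn" "card (?g ` Bn) = card Mn" using card by auto
  \<comment> \<open>A redundant vector could be dropped, leaving a spanning set smaller than the
    number of independent chain monomials.\<close>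
  have "pvs.independent (?g ` Bn)"
  proof
    assume "pvs.dependent (?g ` Bn)"
    then obtain a where a: "a \<in> ?g ` Bn" "a \<in> pvs.span (?g ` Bn - {a})" unfolding pvs.dependent_def by blast
    then have "pvs.span (?g ` Bn) = pvs.span (?g ` Bn - {a})"
      using pvs.span_redundant[OF a(2)] by (simp add: insert_absorb)
    then have "card Mn \<le> card (?g ` Bn - {a})" using le[of "?g ` Bn - {a}"] span finB by simp
    moreover have "card (?g ` Bn - {a}) < card (?g ` Bn)" using a finB by (intro card_Diff1_less) auto
    ultimately show False using eq by simp
  qed
  then show ?thesis using eq_card_imp_inj_on[OF finB eq(1)] by blast
qed

lemma inj_basis: "inj_on (\<lambda>b. nf (gm b)) Bas"
proof (rule inj_onI)
  fix b b' assume "b \<in> Bas" "b' \<in> Bas" "nf (gm b) = nf (gm b')"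
  then show "b = b'"
    using independent_upto[of "max (deg b) (deg b')"] by (auto dest: inj_onD)
qed

text \<open>A dependence involves finitely many basis elements, hence bounded degree.\<close>

lemma independent_basis: "pvs.independent ((\<lambda>b. nf (gm b)) ` Bas)"
proof
  let ?g = "\<lambda>b. nf (gm b)"
  assume "pvs.dependent (?g ` Bas)"
  then obtain T u where T: "finite T" "T \<subseteq> ?g ` Bas" "(\<Sum>v\<in>T. Const (u v) * v) = 0" "\<exists>v\<in>T. u v \<noteq> 0"
    unfolding pvs.dependent_explicit by blast
  then have dep: "pvs.dependent T" unfolding pvs.dependent_explicit by blast
  obtain B where B: "B \<subseteq> Bas" "finite B" "T = ?g ` B" using finite_subset_image[OF T(1,2)] by blast
  have "B \<subseteq> {b \<in> Bas. deg b \<le> Max (deg ` B)}" using B(1,2) Max_ge[OF finite_imageI[OF B(2)] imageI] by blast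
  then have "T \<subseteq> ?g ` {b \<in> Bas. deg b \<le> Max (deg ` B)}" unfolding B(3) by (rule image_mono)
  then have "pvs.dependent (?g ` {b \<in> Bas. deg b \<le> Max (deg ` B)})" using dep pvs.dependent_mono by blast
  then show False using independent_upto by blast
qed

text \<open>The coordinates of p in the part with label h, as a polynomial in the formal variables:
  basis elements with label h go to their formal monomials, all others to 0. Passing to
  \<open>nf\<close> first makes the map well defined modulo \<open>sr\<close>.\<close>

definition Phi :: "('p, 'q) label \<Rightarrow> ('p \<times> 'q) rat_poly \<Rightarrow> (('p \<times> 'q) + ('p + 'q)) rat_poly" where
  "Phi h p = pvp.construct ((\<lambda>b. nf (gm b)) ` Bas)
     (\<lambda>x. let b = inv_into Bas (\<lambda>b. nf (gm b)) x in if fst b = h then um b else 0) (nf p)"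

lemma Phi_add: "Phi h (p + q) = Phi h p + Phi h q"
  and Phi_scale: "Phi h (Const c * p) = Const c * Phi h p"
  using pvp.linear_construct[OF independent_basis, of "\<lambda>x. let b = inv_into Bas (\<lambda>b. nf (gm b)) x in if fst b = h then um b else 0"]
  unfolding Phi_def filt_add filt_Const Vector_Spaces.linear_iff by blast+

lemma Phi_zero [simp]: "Phi h 0 = 0"
  using Phi_add[of h 0 0] by simp

lemma Phi_minus: "Phi h (p - q) = Phi h p - Phi h q"
  using Phi_add[of h "p - q" q] by simp

lemma Phi_sum: "Phi h (\<Sum>k\<in>K. f k) = (\<Sum>k\<in>K. Phi h (f k))"
  by (induction K rule: infinite_finite_induct) (simp_all add: Phi_add)

lemma Phi_idl: "p \<in> idl sr \<Longrightarrow> Phi h p = 0"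
  using Phi_zero[of h] unfolding Phi_def by (simp add: nf_idl)

lemma Phi_cong: "p - q \<in> idl sr \<Longrightarrow> Phi h p = Phi h q"
  using Phi_idl[of "p - q" h] by (simp add: Phi_minus)

lemma Phi_gm:
  assumes "b \<in> Bas"
  shows "Phi h (gm b) = (if fst b = h then um b else 0)"
proof -
  have "inv_into Bas (\<lambda>b. nf (gm b)) (nf (gm b)) = b"
    using inv_into_f_f[OF inj_basis assms] by simp
  then show ?thesis
    unfolding Phi_def using assms by (subst pvp.construct_basis[OF independent_basis]) auto
qed

text \<open>On a basis element, \<open>X_step\<close> gives the expansion of X_F times the element,
  and the same expansion for the formal monomial modulo the relations; the rest is
  linearity.\<close>

lemma Phi_X: "Phi h (X F * p) - FV F * Phi h p \<in> idl (rels h)"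
proof (cases "F \<in> P'")
  case False
  then have "FV F \<in> idl (rels h)" unfolding rels_def by (blast intro: idl_gen)
  moreover have "X F = 0" unfolding X_def using False by (rule if_not_P)
  ultimately show ?thesis by (simp add: idl_mult_right idl_uminus)
next
  case True
  show ?thesis
  proof (induction p rule: basis_induct)
    case (gm b)
    obtain \<Gamma> where \<Gamma>: "\<Gamma> \<subseteq> {c \<in> Bas. deg c = Suc (deg b) \<and> fst c = fst b}"
      "X F * gm b - (\<Sum>c\<in>\<Gamma>. gm c) \<in> idl sr" "FV F * um b - (\<Sum>c\<in>\<Gamma>. um c) \<in> idl (rels (fst b))"
      using X_step[OF gm True] by blast
    have "Phi h (X F * gm b) = (\<Sum>c\<in>\<Gamma>. Phi h (gm c))"
      using Phi_cong[OF \<Gamma>(2)] by (simp add: Phi_sum)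
    also have "\<dots> = (\<Sum>c\<in>\<Gamma>. if fst b = h then um c else 0)"
    proof (rule sum.cong[OF refl])
      fix c assume "c \<in> \<Gamma>"
      then have "c \<in> Bas" "fst c = fst b" using \<Gamma>(1) by blast+
      then show "Phi h (gm c) = (if fst b = h then um c else 0)" by (simp only: Phi_gm)
    qed
    finally show ?case
      using idl_sym[OF \<Gamma>(3)] by (cases "fst b = h") (auto simp: Phi_gm[OF gm])
  next
    case (cong p q)
    have "X F * q - X F * p \<in> idl sr" using idl_mult[OF cong(2), of "X F"] by (simp add: algebra_simps)
    then show ?case using Phi_cong cong by metis
  next
    case (add p q)
    then show ?case using idl_add[OF add] by (simp add: Phi_add algebra_simps)
  next
    case (scale c p)
    have "Phi h (X F * (Const c * p)) - FV F * Phi h (Const c * p) = Const c * (Phi h (X F * p) - FV F * Phi h p)"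
      by (simp only: mult.left_commute[of "X F"] mult.left_commute[of "FV F"] Phi_scale right_diff_distrib)
    then show ?case using idl_mult[OF scale, of "Const c"] by (simp only:)
  qed simp
qed

lemma Phi_Y: "Phi h (Y G * p) - GV G * Phi h p \<in> idl (rels h)"
proof (cases "G \<in> Q'")
  case False
  then have "GV G \<in> idl (rels h)" unfolding rels_def by (blast intro: idl_gen)
  moreover have "Y G = 0" unfolding Y_def using False by (rule if_not_P)
  ultimately show ?thesis by (simp add: idl_mult_right idl_uminus)
next
  case True
  show ?thesis
  proof (induction p rule: basis_induct)
    case (gm b)
    obtain \<Gamma> where \<Gamma>: "\<Gamma> \<subseteq> {c \<in> Bas. deg c = Suc (deg b) \<and> fst c = fst b}"
      "Y G * gm b - (\<Sum>c\<in>\<Gamma>. gm c) \<in> idl sr" "GV G * um b - (\<Sum>c\<in>\<Gamma>. um c) \<in> idl (rels (fst b))"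
      using Y_step[OF gm True] by blast
    have "Phi h (Y G * gm b) = (\<Sum>c\<in>\<Gamma>. Phi h (gm c))"
      using Phi_cong[OF \<Gamma>(2)] by (simp add: Phi_sum)
    also have "\<dots> = (\<Sum>c\<in>\<Gamma>. if fst b = h then um c else 0)"
    proof (rule sum.cong[OF refl])
      fix c assume "c \<in> \<Gamma>"
      then have "c \<in> Bas" "fst c = fst b" using \<Gamma>(1) by blast+
      then show "Phi h (gm c) = (if fst b = h then um c else 0)" by (simp only: Phi_gm)
    qed
    finally show ?case
      using idl_sym[OF \<Gamma>(3)] by (cases "fst b = h") (auto simp: Phi_gm[OF gm])
  next
    case (cong p q)
    have "Y G * q - Y G * p \<in> idl sr" using idl_mult[OF cong(2), of "Y G"] by (simp add: algebra_simps)
    then show ?case using Phi_cong cong by metis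
  next
    case (add p q)
    then show ?case using idl_add[OF add] by (simp add: Phi_add algebra_simps)
  next
    case (scale c p)
    have "Phi h (Y G * (Const c * p)) - GV G * Phi h (Const c * p) = Const c * (Phi h (Y G * p) - GV G * Phi h p)"
      by (simp only: mult.left_commute[of "Y G"] mult.left_commute[of "GV G"] Phi_scale right_diff_distrib)
    then show ?case using idl_mult[OF scale, of "Const c"] by (simp only:)
  qed simp
qed

lemma finite_labels: "finite labels"
  using finite_LP finite_LQ by simp

text \<open>On a basis element only its own label contributes, and \<open>gmap\<close> restores the
  factor x_H that \<open>um\<close> omits. This is the injectivity part of the
  decomposition.\<close>

lemma Phi_recon: "p - (\<Sum>h\<in>labels. gmap h (Phi h p)) \<in> idl sr"
proof (induction p rule: basis_induct)
  case (gm b)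
  obtain h ms fs gs where b: "b = (h, ms, fs, gs)" by (metis prod_cases4)
  have "(\<Sum>k\<in>labels. gmap k (Phi k (gm b))) = (\<Sum>k\<in>labels. if h = k then gm b else 0)"
  proof (rule sum.cong[OF refl])
    fix k
    show "gmap k (Phi k (gm b)) = (if h = k then gm b else 0)"
      unfolding Phi_gm[OF gm] using gm_eq_gmap[of h ms fs gs] gm by (auto simp: b gmap_simps)
  qed
  also have "\<dots> = gm b"
    using gm finite_labels by (simp add: b Bas_def)
  finally show ?case by simp
next
  case (cong p q)
  have "(\<Sum>h\<in>labels. gmap h (Phi h q)) = (\<Sum>h\<in>labels. gmap h (Phi h p))"
    using Phi_cong[OF cong(2)] by simp
  then show ?case using idl_trans[OF cong(2) cong(1)] by (simp only:)
next
  case (add p q)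
  then show ?case using idl_add[OF add] by (simp add: Phi_add gmap_simps sum.distrib algebra_simps)
next
  case (scale c p)
  have "Const c * p - (\<Sum>h\<in>labels. gmap h (Phi h (Const c * p))) = Const c * (p - (\<Sum>h\<in>labels. gmap h (Phi h p)))"
    by (simp add: Phi_scale gmap_simps sum_distrib_left right_diff_distrib)
  then show ?case using idl_mult[OF scale, of "Const c"] by (simp only:)
qed (simp add: gmap_simps)

lemma um_homp: "um (h, ms, fs, gs) \<in> homp (size ms + size fs + size gs)"
  unfolding um.simps by (intro homp_mult vprod_homp) simp_all

text \<open>Coordinates with label H omit the factor x_H, so their degree drops by one. In degree 0
  no basis element has such a label.\<close>

lemma Phi_homp:
  assumes "p \<in> homp d"
  shows "Phi None p \<in> homp d" and "d > 0 \<Longrightarrow> Phi (Some H) p \<in> homp (d - 1)" and "d = 0 \<Longrightarrow> Phi (Some H) p = 0"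
proof -
  let ?R = "\<lambda>p. Phi None p \<in> homp d \<and> (d > 0 \<longrightarrow> Phi (Some H) p \<in> homp (d - 1)) \<and> (d = 0 \<longrightarrow> Phi (Some H) p = 0)"
  have "?R p"
    using homp_W[OF assms]
  proof (induction rule: W_induct)
    case (gm b)
    obtain h ms fs gs where b: "b = (h, ms, fs, gs)" by (metis prod_cases4)
    have u: "um b \<in> homp (size ms + size fs + size gs)" unfolding b by (rule um_homp)
    show ?case
      using u gm(2) unfolding Phi_gm[OF gm(1)] by (cases h) (auto simp: b)
  next
    case (cong p q)
    then show ?case using Phi_cong[OF cong(2)] by simp
  next
    case (add p q)
    then show ?case by (simp add: Phi_add homp_add)
  next
    case (scale c p)
    then show ?case by (simp add: Phi_scale homp_scale)
  qed simp
  then show "Phi None p \<in> homp d" "d > 0 \<Longrightarrow> Phi (Some H) p \<in> homp (d - 1)" "d = 0 \<Longrightarrow> Phi (Some H) p = 0"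
    by auto
qed

text \<open>The converse of \<open>Phi_recon\<close>: a formal polynomial is recovered from its
  realization, and distinct labels do not interact. Variables \<open>FV\<close> and
  \<open>GV\<close> are peeled off by linearity; the remaining monomial in the \<open>KV\<close> is
  a basis element or vanishes on both sides modulo the relations.\<close>

lemma Phi_gmap:
  assumes k: "k \<in> labels"
  shows "Phi h (gmap k u) - (if h = k then u else 0) \<in> idl (rels h)"
proof -
  \<comment> \<open>The monomial is split in two so that the induction on \<open>M\<close> can
    collect the variables \<open>KV\<close> in \<open>ms\<close>.\<close>
  have mono: "Phi h (gmap k (vprod KV ms * vprod Var M)) - (if h = k then vprod KV ms * vprod Var M else 0) \<in> idl (rels h)"
    for ms M
  proof (induction M arbitrary: ms)
    case empty
    consider "\<forall>K\<in>#ms. below k K" "chainm ms" | K where "K \<in># ms" "\<not> below k K"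
      | "\<forall>K\<in>#ms. below k K" "\<not> chainm ms" by blast
    then show ?case
    proof cases
      case 1
      then have "(k, ms, {#}, {#}) \<in> Bas" using k by (simp add: Bas_def chainm_def)
      from Phi_gm[OF this, of h] gm_eq_gmap[OF this] show ?thesis by auto
    next
      case 2
      have "KV K \<in> rels k" using 2 unfolding rels_def by blast
      then have "vprod KV ms \<in> idl (rels k)" using 2 by (intro vprod_idl[of K]) (auto intro: idl_gen)
      moreover have "subst (gsub k) (vprod KV ms) = 0"
      proof -
        obtain ms' where "ms = add_mset K ms'" using 2 by (metis mset_add)
        then show ?thesis using 2 by (simp add: gsub_def)
      qed
      ultimately show ?thesis by (auto simp: gmap_def idl_uminus)
    next
      case 3
      obtain K K' where K: "K \<in># ms" "K' \<in># ms" "\<not> K \<le> K'" "\<not> K' \<le> K" "K \<noteq> K'" using 3(2) by (rule not_chainm)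
      then have "KV K * KV K' \<in> rels k" using 3(1) unfolding rels_def by blast
      then have "vprod KV ms \<in> idl (rels k)" using K by (intro vprod_idl2[of K ms K']) (auto intro: idl_gen)
      moreover have "subst (gsub k) (vprod KV ms) \<in> idl sr"
        unfolding subst_vprod using K 3(1) by (intro vprod_idl2[of K ms K']) (auto simp: gsub_def sr_incomparable)
      then have "gmap k (vprod KV ms) \<in> idl sr" unfolding gmap_def by (rule idl_mult)
      ultimately show ?thesis by (auto simp: Phi_idl idl_uminus)
    qed
  next
    case (add x M)
    let ?u = "vprod KV ms * vprod Var M"
    show ?case
    proof (cases x)
      case (Inl K)
      have e: "vprod KV ms * vprod Var (add_mset x M) = vprod KV (add_mset K ms) * vprod Var M"
        by (simp add: Inl mult_ac)
      show ?thesis unfolding e by (rule add)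
    next
      case (Inr y)
      show ?thesis
      proof (cases y)
        case (Inl F)
        have e: "vprod KV ms * vprod Var (add_mset x M) = FV F * ?u" using Inr Inl by (simp add: mult_ac)
        have "Phi h (gmap k (FV F * ?u)) - FV F * Phi h (gmap k ?u) \<in> idl (rels h)"
          unfolding gmap_simps by (rule Phi_X)
        from idl_add[OF this idl_mult[OF add[of ms], of "FV F"]]
        show ?thesis unfolding e by (simp add: algebra_simps if_distrib[of "(*) (FV F)"] cong: if_cong)
      next
        case (Inr G)
        have e: "vprod KV ms * vprod Var (add_mset x M) = GV G * ?u" using \<open>x = Inr y\<close> Inr by (simp add: mult_ac)
        have "Phi h (gmap k (GV G * ?u)) - GV G * Phi h (gmap k ?u) \<in> idl (rels h)"
          unfolding gmap_simps by (rule Phi_Y)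
        from idl_add[OF this idl_mult[OF add[of ms], of "GV G"]]
        show ?thesis unfolding e by (simp add: algebra_simps if_distrib[of "(*) (GV G)"] cong: if_cong)
      qed
    qed
  qed
  show ?thesis
  proof (induction u rule: poly_monom_induct)
    case (monom M)
    have "vprod KV {#} * vprod Var M = vprod Var M" by simp
    then show ?case using mono[of "{#}" M] by (simp only:)
  next
    case (scale c p)
    have "Phi h (gmap k (Const c * p)) - (if h = k then Const c * p else 0) =
      Const c * (Phi h (gmap k p) - (if h = k then p else 0))"
      by (simp add: gmap_simps Phi_scale right_diff_distrib)
    then show ?case using idl_mult[OF scale, of "Const c"] by (simp only:)
  next
    case (add p q)
    then show ?case using idl_add[OF add] by (cases "h = k") (simp_all add: gmap_simps Phi_add algebra_simps)
  qed
qed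

end

section \<open>The maps between Chow rings\<close>

abbreviation "chev \<equiv> labelled_flats.ch_eval"
abbreviation "chrel \<equiv> labelled_flats.ch_rels"

context flat_system
begin

abbreviation "L \<equiv> flats M - {ground M}"

lemma labelled_id: "labelled_flats M L (\<lambda>K. K)"
  by unfold_locales (simp add: bij_betw_def)

text \<open>\<open>chow_lift\<close> prescribes values at the proper flats only. The value at the
  adjoined generator is forced by a linear relation, so the map is given by any polynomial
  homomorphism that kills \<open>ch_rels\<close> and has these values.\<close>

lemma chow_lift_pres:
  assumes g: "poly_hom T g" and kill: "\<And>s. s \<in> chrel M L (\<lambda>K. K) \<Longrightarrow> g s = \<zero>\<^bsub>T\<^esub>"
    and a: "\<And>K. K \<in> V \<Longrightarrow> a K = g (Var K)"
  shows "alg_hom (CH M) T (chow_lift T a)" and "chow_lift T a (chev M L (\<lambda>K. K) p) = g p"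
proof -
  interpret g: poly_alg_hom T g by (rule poly_alg_hom.intro) (rule g)
  interpret l: labelled_flats M L "\<lambda>K. K" by (rule labelled_id)
  have aV: "a \<in> V \<rightarrow> carrier T" using a by simp
  have lin: "(\<Oplus>\<^bsub>T\<^esub>F\<in>{F \<in> V. i \<notin> F}. a F) = \<ominus>\<^bsub>T\<^esub> g (Var {})" if i: "i \<in> ground M" for i
  proof -
    have "{w \<in> L. i \<notin> w} = insert {} {F \<in> V. i \<notin> F}"
      using i empty_flat by (auto simp: proper_flats_def)
    moreover have "{} \<notin> {F \<in> V. i \<notin> F}" by (simp add: proper_flats_def)
    moreover have "finite {F \<in> V. i \<notin> F}" by (rule finite_subset[OF _ finite_proper_flats]) blast
    ultimately have "(\<Sum>w\<in>{w \<in> L. i \<notin> w}. Var w) = (\<Sum>F\<in>{F \<in> V. i \<notin> F}. Var F) + Var {}"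
      by (simp add: add.commute)
    moreover have "g (\<Sum>w\<in>{w \<in> L. i \<notin> w}. Var w) = \<zero>\<^bsub>T\<^esub>"
      using i by (intro kill) (auto simp: l.ch_rels_def)
    ultimately have "g (\<Sum>F\<in>{F \<in> V. i \<notin> F}. Var F) \<oplus>\<^bsub>T\<^esub> g (Var {}) = \<zero>\<^bsub>T\<^esub>" by (simp only: g.p_add)
    then have "g (\<Sum>F\<in>{F \<in> V. i \<notin> F}. Var F) = \<ominus>\<^bsub>T\<^esub> g (Var {})"
      using g.B.minus_equality by simp
    moreover have "g (\<Sum>F\<in>{F \<in> V. i \<notin> F}. Var F) = (\<Oplus>\<^bsub>T\<^esub>F\<in>{F \<in> V. i \<notin> F}. a F)"
      unfolding g.p_sum using a by (intro g.B.finsum_cong') auto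
    ultimately show ?thesis by simp
  qed
  have inc: "a F \<otimes>\<^bsub>T\<^esub> a F' = \<zero>\<^bsub>T\<^esub>" if F: "F \<in> V" "F' \<in> V" "\<not> F \<subseteq> F'" "\<not> F' \<subseteq> F" for F F'
  proof -
    have "F \<in> L" "F' \<in> L" using F by (simp_all add: proper_flats_def)
    then have "Var F * Var F' \<in> chrel M L (\<lambda>K. K)" using F unfolding l.ch_rels_def by blast
    then have "g (Var F * Var F') = \<zero>\<^bsub>T\<^esub>" by (rule kill)
    then show ?thesis using a F by simp
  qed
  have lin': "(\<Oplus>\<^bsub>T\<^esub>F\<in>{F \<in> V. i \<notin> F}. a F) = (\<Oplus>\<^bsub>T\<^esub>F\<in>{F \<in> V. j \<notin> F}. a F)"
    if "i \<in> ground M" "j \<in> ground M" for i j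
    using that lin by simp
  note cl = chow_lift[OF g.B.rat_algebra_axioms aV lin' inc]
  show hom: "alg_hom (CH M) T (chow_lift T a)" by (rule cl(1)) auto
  have val: "chow_lift T a (xgen M F) = a F" if "F \<in> V" for F by (rule cl(2)) (use that in auto)
  have "(chow_lift T a \<circ> chev M L (\<lambda>K. K)) (Var K) = g (Var K)" for K
  proof -
    consider "K \<notin> L" | "K \<in> V" | "K = {}" "ground M \<noteq> {}" "{} \<in> L"
      using empty_flat by (auto simp: proper_flats_def)
    then show ?thesis
    proof cases
      case 1
      then have "Var K \<in> chrel M L (\<lambda>K. K)" unfolding l.ch_rels_def by blast
      then have "g (Var K) = \<zero>\<^bsub>T\<^esub>" by (rule kill)
      moreover have "chow_lift T a \<zero>\<^bsub>CH M\<^esub> = \<zero>\<^bsub>T\<^esub>" by (rule alg_hom.zero[OF hom])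
      ultimately show ?thesis unfolding comp_apply l.ch_eval_Var if_not_P[OF 1] by simp
    next
      case 2
      then have "K \<in> L" by (simp add: proper_flats_def)
      then show ?thesis unfolding comp_apply l.ch_eval_Var using val[OF 2] a[OF 2] by (simp add: xfl_proper[OF 2])
    next
      case 3
      then obtain i where i: "i \<in> ground M" by blast
      have "chow_lift T a (xfl {}) = \<ominus>\<^bsub>T\<^esub> (\<Oplus>\<^bsub>T\<^esub>F\<in>{F \<in> V. i \<notin> F}. chow_lift T a (xgen M F))"
        by (rule alg_hom_xfl_empty[OF hom i])
      also have "(\<Oplus>\<^bsub>T\<^esub>F\<in>{F \<in> V. i \<notin> F}. chow_lift T a (xgen M F)) = (\<Oplus>\<^bsub>T\<^esub>F\<in>{F \<in> V. i \<notin> F}. a F)"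
        using aV by (intro g.B.finsum_cong') (auto simp: val)
      also have "\<ominus>\<^bsub>T\<^esub> (\<Oplus>\<^bsub>T\<^esub>F\<in>{F \<in> V. i \<notin> F}. a F) = g (Var {})" unfolding lin[OF i] by simp
      finally show ?thesis unfolding comp_apply l.ch_eval_Var using 3 by simp
    qed
  qed
  from poly_hom_eqI[OF alg_hom_comp[OF l.poly_hom_ch_eval hom] g this]
  show "chow_lift T a (chev M L (\<lambda>K. K) p) = g p" unfolding comp_apply .
qed

end

section \<open>The Chow ring of a direct sum and the map iota\<close>

lemma Plus_subset_iff: "F <+> G \<subseteq> F' <+> G' \<longleftrightarrow> F \<subseteq> F' \<and> G \<subseteq> G'"
  by (auto simp: Plus_def)

lemma Plus_eq_iff: "F <+> G = F' <+> G' \<longleftrightarrow> F = F' \<and> G = G'"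
  unfolding set_eq_subset Plus_subset_iff by blast

abbreviation lab :: "'a set \<times> 'b set \<Rightarrow> ('a + 'b) set" where
  "lab \<equiv> \<lambda>(F, G). F <+> G"

lemma lab_subset: "lab K \<subseteq> lab K' \<longleftrightarrow> K \<le> K'"
  by (cases K; cases K') (simp add: Plus_subset_iff)

locale two_systems = M: flat_system M + N: flat_system N
  for M :: "'a matroid" and N :: "'b matroid"
begin

sublocale PP: poset_pair "flats M" "ground M" "flats N" "ground N"
  using M.finite_flats N.finite_flats M.ground_flat N.ground_flat M.flats_subset N.flats_subset
  by unfold_locales auto

abbreviation "S \<equiv> matroid_sum M N"

lemma S_simps: "ground S = ground M <+> ground N" "flats S = (\<lambda>(F, G). F <+> G) ` (flats M \<times> flats N)"
  by (auto simp: matroid_sum_def)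

lemma flat_system_S: "flat_system S"
proof
  show "finite (ground S)" using M.finite_ground N.finite_ground by (simp add: S_simps)
  show "flats S \<subseteq> Pow (ground S)" using M.flats_subset N.flats_subset by (auto simp: S_simps)
  show "ground S \<in> flats S" using M.ground_flat N.ground_flat by (auto simp: S_simps)
  show "{} \<in> flats S" using M.empty_flat N.empty_flat by (auto simp: S_simps intro!: image_eqI[of _ _ "({}, {})"])
qed

lemma labelled_S: "labelled_flats S PP.PQ lab"
proof (intro labelled_flats.intro flat_system_S labelled_flats_axioms.intro)
  have inj: "inj (lab :: 'a set \<times> 'b set \<Rightarrow> ('a + 'b) set)"
  proof (rule injI)
    fix K K' :: "'a set \<times> 'b set" assume "lab K = lab K'"
    then show "K = K'" by (cases K; cases K') (simp add: Plus_eq_iff)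
  qed
  have "lab ` PP.PQ = flats S - {ground S}"
    using image_set_diff[OF inj, of "flats M \<times> flats N" "{(ground M, ground N)}"] by (simp add: S_simps)
  then show "bij_betw lab PP.PQ (flats S - {ground S})"
    using inj_on_subset[OF inj] by (simp add: bij_betw_def)
qed

abbreviation "chS \<equiv> chev S PP.PQ lab"
abbreviation "relS \<equiv> chrel S PP.PQ lab"

lemma pres_S: "pres (CH S) chS relS"
  by (rule labelled_flats.pres_CH[OF labelled_S])

text \<open>A flat \<open>F <+> G\<close> of the sum avoids an element i of M exactly when F does,
  so G is unrestricted; such an F differs from the ground set, so \<open>X F\<close> is the full
  inner sum.\<close>

lemma sum_X:
  assumes "i \<in> ground M"
  shows "(\<Sum>w\<in>{w \<in> PP.PQ. Inl i \<notin> lab w}. Var w) = (\<Sum>F\<in>{F \<in> flats M. i \<notin> F}. PP.X F)"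
proof -
  have "{w \<in> PP.PQ. Inl i \<notin> lab w} = {F \<in> flats M. i \<notin> F} \<times> flats N"
    using assms by (auto simp: Plus_def)
  then have "(\<Sum>w\<in>{w \<in> PP.PQ. Inl i \<notin> lab w}. Var w) = (\<Sum>F\<in>{F \<in> flats M. i \<notin> F}. \<Sum>G\<in>flats N. Var (F, G))"
    by (simp add: sum.cartesian_product)
  also have "\<dots> = (\<Sum>F\<in>{F \<in> flats M. i \<notin> F}. PP.X F)"
    using assms by (intro sum.cong) (auto simp: PP.X_def)
  finally show ?thesis .
qed

lemma sum_Y:
  assumes "j \<in> ground N"
  shows "(\<Sum>w\<in>{w \<in> PP.PQ. Inr j \<notin> lab w}. Var w) = (\<Sum>G\<in>{G \<in> flats N. j \<notin> G}. PP.Y G)"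
proof -
  have "{w \<in> PP.PQ. Inr j \<notin> lab w} = flats M \<times> {G \<in> flats N. j \<notin> G}"
    using assms by (auto simp: Plus_def)
  then have "(\<Sum>w\<in>{w \<in> PP.PQ. Inr j \<notin> lab w}. Var w) = (\<Sum>F\<in>flats M. \<Sum>G\<in>{G \<in> flats N. j \<notin> G}. Var (F, G))"
    by (simp add: sum.cartesian_product)
  also have "\<dots> = (\<Sum>G\<in>{G \<in> flats N. j \<notin> G}. \<Sum>F\<in>flats M. Var (F, G))" by (rule sum.swap)
  also have "\<dots> = (\<Sum>G\<in>{G \<in> flats N. j \<notin> G}. PP.Y G)"
    using assms by (intro sum.cong) (auto simp: PP.Y_def)
  finally show ?thesis .
qed

lemma relS_eq: "relS = PP.sr \<union> {\<Sum>w\<in>{w \<in> PP.PQ. i \<notin> lab w}. Var w | i. i \<in> ground S}"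
  unfolding labelled_flats.ch_rels_def[OF labelled_S] PP.sr_def lab_subset by blast

lemma sr_relS: "p \<in> idl PP.sr \<Longrightarrow> p \<in> idl relS"
  by (rule idl_mono[of PP.sr]) (simp_all add: relS_eq)

lemma X_relS: "i \<in> ground M \<Longrightarrow> (\<Sum>F\<in>{F \<in> flats M. i \<notin> F}. PP.X F) \<in> relS"
  unfolding relS_eq sum_X[symmetric] S_simps by blast

lemma Y_relS: "j \<in> ground N \<Longrightarrow> (\<Sum>G\<in>{G \<in> flats N. j \<notin> G}. PP.Y G) \<in> relS"
  unfolding relS_eq sum_Y[symmetric] S_simps by blast

lemma relS_cases:
  assumes "s \<in> relS"
  obtains "s \<in> PP.sr" | i where "i \<in> ground M" "s = (\<Sum>F\<in>{F \<in> flats M. i \<notin> F}. PP.X F)"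
  | j where "j \<in> ground N" "s = (\<Sum>G\<in>{G \<in> flats N. j \<notin> G}. PP.Y G)"
  using assms sum_X sum_Y unfolding relS_eq S_simps by blast

abbreviation "chM \<equiv> chev M M.L (\<lambda>K. K)"
abbreviation "chN \<equiv> chev N N.L (\<lambda>K. K)"
abbreviation "relM \<equiv> chrel M M.L (\<lambda>K. K)"
abbreviation "relN \<equiv> chrel N N.L (\<lambda>K. K)"
abbreviation "A \<equiv> tensor (CH M) (CH N)"
abbreviation "chA \<equiv> tensor_eval (CH M) (CH N) chM chN"
abbreviation "relA \<equiv> inl ` relM \<union> inr ` relN"

lemma pres_M: "pres (CH M) chM relM"
  by (rule labelled_flats.pres_CH[OF M.labelled_id])

lemma pres_N: "pres (CH N) chN relN"
  by (rule labelled_flats.pres_CH[OF N.labelled_id])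

lemma pres_pair_A: "pres_pair (CH M) chM relM (CH N) chN relN"
  by (rule pres_pair.intro[OF pres_M pres_N])

lemma pres_A: "pres A chA relA"
  by (rule pres_pair.pres_tensor[OF pres_pair_A])

lemma relM_eq: "relM = {Var K | K. K \<notin> M.L} \<union> {\<Sum>w\<in>{w \<in> M.L. i \<notin> w}. Var w | i. i \<in> ground M} \<union>
    {Var K * Var K' | K K'. K \<in> M.L \<and> K' \<in> M.L \<and> \<not> K \<subseteq> K' \<and> \<not> K' \<subseteq> K}"
  unfolding labelled_flats.ch_rels_def[OF M.labelled_id] ..

lemma relN_eq: "relN = {Var K | K. K \<notin> N.L} \<union> {\<Sum>w\<in>{w \<in> N.L. i \<notin> w}. Var w | i. i \<in> ground N} \<union>
    {Var K * Var K' | K K'. K \<in> N.L \<and> K' \<in> N.L \<and> \<not> K \<subseteq> K' \<and> \<not> K' \<subseteq> K}"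
  unfolding labelled_flats.ch_rels_def[OF N.labelled_id] ..

lemma subst_X_rel:
  assumes "s \<in> relM"
  shows "subst PP.X s \<in> idl relS"
proof -
  from assms consider K where "s = Var K" "K \<notin> M.L" | i where "s = (\<Sum>w\<in>{w \<in> M.L. i \<notin> w}. Var w)" "i \<in> ground M"
    | K K' where "s = Var K * Var K'" "\<not> K \<subseteq> K'" "\<not> K' \<subseteq> K"
    unfolding relM_eq by blast
  then show ?thesis
  proof cases
    case 1
    then have "PP.X K = 0" unfolding PP.X_def by (intro if_not_P)
    then show ?thesis by (simp add: 1)
  next
    case 2
    have "{w \<in> M.L. i \<notin> w} = {F \<in> flats M. i \<notin> F}" using 2 by blast
    then show ?thesis using X_relS[OF 2(2)] by (simp add: 2 idl_gen)
  next
    case 3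
    then show ?thesis by (simp add: sr_relS PP.X_incomparable)
  qed
qed

lemma subst_Y_rel:
  assumes "s \<in> relN"
  shows "subst PP.Y s \<in> idl relS"
proof -
  from assms consider K where "s = Var K" "K \<notin> N.L" | i where "s = (\<Sum>w\<in>{w \<in> N.L. i \<notin> w}. Var w)" "i \<in> ground N"
    | K K' where "s = Var K * Var K'" "\<not> K \<subseteq> K'" "\<not> K' \<subseteq> K"
    unfolding relN_eq by blast
  then show ?thesis
  proof cases
    case 1
    then have "PP.Y K = 0" unfolding PP.Y_def by (intro if_not_P)
    then show ?thesis by (simp add: 1)
  next
    case 2
    have "{w \<in> N.L. i \<notin> w} = {G \<in> flats N. i \<notin> G}" using 2 by blast
    then show ?thesis using Y_relS[OF 2(2)] by (simp add: 2 idl_gen)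
  next
    case 3
    then show ?thesis by (simp add: sr_relS PP.Y_incomparable)
  qed
qed

lemma xgen_S_proper:
  assumes "F \<in> flats M" "G \<in> flats N" "F \<noteq> {} \<or> G \<noteq> {}" "F \<noteq> ground M \<or> G \<noteq> ground N"
  shows "chS (Var (F, G)) = xgen S (F <+> G)"
proof -
  interpret S: labelled_flats S PP.PQ lab by (rule labelled_S)
  have "F <+> G \<in> S.V"
    using assms by (auto simp: proper_flats_def S_simps Plus_eq_iff)
  moreover have "(F, G) \<in> PP.PQ" using assms by auto
  ultimately show ?thesis by (simp add: S.ch_eval_Var S.xfl_proper)
qed

text \<open>In the presentations iota is the substitution of X and Y for the variables. This
  includes the adjoined generators: the generator for the empty flat of M goes to X at the empty
  flat, a sum that contains the adjoined generator of the direct sum.\<close>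

lemma iota: "alg_hom A (CH S) (iota M N)"
  and iota_eval: "iota M N (chA p) = chS (subst (case_sum PP.X PP.Y) p)"
  and iota_tens_left: "iota M N (tens (CH M) (CH N) (chM q) \<one>\<^bsub>CH N\<^esub>) = chS (subst PP.X q)"
  and iota_tens_right: "iota M N (tens (CH M) (CH N) \<one>\<^bsub>CH M\<^esub> (chN r)) = chS (subst PP.Y r)"
proof -
  interpret S: pres "CH S" chS relS by (rule pres_S)
  interpret AA: pres_pair "CH M" chM relM "CH N" chN relN by (rule pres_pair_A)
  let ?a = "\<lambda>F. \<Oplus>\<^bsub>CH S\<^esub>G'\<in>flats N. xgen S (F <+> G')" and ?b = "\<lambda>G. \<Oplus>\<^bsub>CH S\<^esub>F'\<in>flats M. xgen S (F' <+> G)"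
  have a: "?a F = (chS \<circ> subst PP.X) (Var F)" if "F \<in> M.V" for F
  proof -
    have F: "F \<in> flats M" "F \<noteq> {}" "F \<noteq> ground M" using that by (simp_all add: proper_flats_def)
    have "chS (PP.X F) = (\<Oplus>\<^bsub>CH S\<^esub>G'\<in>flats N. chS (Var (F, G')))"
      using F by (simp add: PP.X_def S.p_sum)
    also have "\<dots> = ?a F"
    proof (rule S.B.finsum_cong'[OF refl])
      have e: "chS (Var (F, G')) = xgen S (F <+> G')" if "G' \<in> flats N" for G'
        using that F by (intro xgen_S_proper) simp_all
      then show "\<And>G'. G' \<in> flats N \<Longrightarrow> chS (Var (F, G')) = xgen S (F <+> G')" .
      show "(\<lambda>G'. xgen S (F <+> G')) \<in> flats N \<rightarrow> carrier (CH S)"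
      proof (rule funcsetI)
        fix G' assume "G' \<in> flats N"
        then show "xgen S (F <+> G') \<in> carrier (CH S)" using S.p_closed[of "Var (F, G')"] e[of G'] by simp
      qed
    qed
    finally show ?thesis by simp
  qed
  have b: "?b G = (chS \<circ> subst PP.Y) (Var G)" if "G \<in> N.V" for G
  proof -
    have G: "G \<in> flats N" "G \<noteq> {}" "G \<noteq> ground N" using that by (simp_all add: proper_flats_def)
    have "chS (PP.Y G) = (\<Oplus>\<^bsub>CH S\<^esub>F'\<in>flats M. chS (Var (F', G)))"
      using G by (simp add: PP.Y_def S.p_sum)
    also have "\<dots> = ?b G"
    proof (rule S.B.finsum_cong'[OF refl])
      have e: "chS (Var (F', G)) = xgen S (F' <+> G)" if "F' \<in> flats M" for F'
        using that G by (intro xgen_S_proper) simp_all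
      then show "\<And>F'. F' \<in> flats M \<Longrightarrow> chS (Var (F', G)) = xgen S (F' <+> G)" .
      show "(\<lambda>F'. xgen S (F' <+> G)) \<in> flats M \<rightarrow> carrier (CH S)"
      proof (rule funcsetI)
        fix F' assume "F' \<in> flats M"
        then show "xgen S (F' <+> G) \<in> carrier (CH S)" using S.p_closed[of "Var (F', G)"] e[of F'] by simp
      qed
    qed
    finally show ?thesis by simp
  qed
  have homs: "poly_hom (CH S) (chS \<circ> subst PP.X)" "poly_hom (CH S) (chS \<circ> subst PP.Y)"
    by (rule alg_hom_comp[OF subst_hom S.alg_hom_axioms])+
  have killX: "(chS \<circ> subst PP.X) s = \<zero>\<^bsub>CH S\<^esub>" if "s \<in> relM" for s
    unfolding comp_apply S.kernel by (rule subst_X_rel[OF that])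
  have killY: "(chS \<circ> subst PP.Y) s = \<zero>\<^bsub>CH S\<^esub>" if "s \<in> relN" for s
    unfolding comp_apply S.kernel by (rule subst_Y_rel[OF that])
  note cM = M.chow_lift_pres[OF homs(1) killX a] and cN = N.chow_lift_pres[OF homs(2) killY b]
  have hM: "alg_hom (CH M) (CH S) (chow_lift (CH S) ?a)" by (rule cM(1))
  have hN: "alg_hom (CH N) (CH S) (chow_lift (CH S) ?b)" by (rule cN(1))
  have eM: "chow_lift (CH S) ?a (chM q) = chS (subst PP.X q)" for q using cM(2)[of q] unfolding comp_apply .
  have eN: "chow_lift (CH S) ?b (chN r) = chS (subst PP.Y r)" for r using cN(2)[of r] unfolding comp_apply .
  have i: "iota M N = tensor_lift (CH S) (chow_lift (CH S) ?a) (chow_lift (CH S) ?b)"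
    by (simp add: iota_def Let_def)
  show hom: "alg_hom A (CH S) (iota M N)" unfolding i by (rule AA.AB.alg_hom_tensor_lift[OF hM hN])
  have tens: "iota M N (tens (CH M) (CH N) (chM q) (chN r)) = chS (subst PP.X q) \<otimes>\<^bsub>CH S\<^esub> chS (subst PP.Y r)" for q r
    unfolding i by (subst AA.AB.tensor_lift_tens[OF hM hN]) (simp_all add: eM eN)
  show L: "iota M N (tens (CH M) (CH N) (chM q) \<one>\<^bsub>CH N\<^esub>) = chS (subst PP.X q)" for q
    using tens[of q 1] by simp
  show R: "iota M N (tens (CH M) (CH N) \<one>\<^bsub>CH M\<^esub> (chN r)) = chS (subst PP.Y r)" for r
    using tens[of 1 r] by simp
  have "(iota M N \<circ> chA) (Var v) = (chS \<circ> subst (case_sum PP.X PP.Y)) (Var v)" for v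
    by (cases v) (simp_all add: AA.H_Inl AA.H_Inr L R)
  from poly_hom_eqI[OF alg_hom_comp[OF AA.poly_hom_H hom] alg_hom_comp[OF subst_hom S.alg_hom_axioms] this]
  show "iota M N (chA p) = chS (subst (case_sum PP.X PP.Y) p)" unfolding comp_apply .
qed

end

lemma tensor_perm:
  assumes "rat_algebra A" "rat_algebra B" "rat_algebra C" "rat_algebra D"
  shows alg_hom_tensor_perm: "alg_hom (tensor (tensor A B) (tensor C D)) (tensor (tensor B D) (tensor A C)) (tensor_perm A B C D)"
    and tensor_perm_tens: "\<And>a b c d. a \<in> carrier A \<Longrightarrow> b \<in> carrier B \<Longrightarrow> c \<in> carrier C \<Longrightarrow> d \<in> carrier D \<Longrightarrow>
      tensor_perm A B C D (tens (tensor A B) (tensor C D) (tens A B a b) (tens C D c d)) =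
      tens (tensor B D) (tensor A C) (tens B D b d) (tens A C a c)"
proof -
  interpret AB: alg_pair A B by (intro alg_pair.intro assms)
  interpret CD: alg_pair C D by (intro alg_pair.intro assms)
  interpret BD: alg_pair B D by (intro alg_pair.intro assms)
  interpret AC: alg_pair A C by (intro alg_pair.intro assms)
  interpret S: alg_pair "tensor A B" "tensor C D" by (intro alg_pair.intro AB.rat_algebra_tensor CD.rat_algebra_tensor)
  interpret T: alg_pair "tensor B D" "tensor A C" by (intro alg_pair.intro BD.rat_algebra_tensor AC.rat_algebra_tensor)
  let ?X = "tensor B D" and ?Y = "tensor A C"
  let ?T = "tensor ?X ?Y"
  let ?a = "\<lambda>a. tens ?X ?Y \<one>\<^bsub>?X\<^esub> (tens A C a \<one>\<^bsub>C\<^esub>)" and ?b = "\<lambda>b. tens ?X ?Y (tens B D b \<one>\<^bsub>D\<^esub>) \<one>\<^bsub>?Y\<^esub>"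
  let ?c = "\<lambda>c. tens ?X ?Y \<one>\<^bsub>?X\<^esub> (tens A C \<one>\<^bsub>A\<^esub> c)" and ?d = "\<lambda>d. tens ?X ?Y (tens B D \<one>\<^bsub>B\<^esub> d) \<one>\<^bsub>?Y\<^esub>"
  have a: "alg_hom A ?T ?a" using alg_hom_comp[OF AC.alg_hom_tens_left T.alg_hom_tens_right] by (simp add: o_def)
  have b: "alg_hom B ?T ?b" using alg_hom_comp[OF BD.alg_hom_tens_left T.alg_hom_tens_left] by (simp add: o_def)
  have c: "alg_hom C ?T ?c" using alg_hom_comp[OF AC.alg_hom_tens_right T.alg_hom_tens_right] by (simp add: o_def)
  have d: "alg_hom D ?T ?d" using alg_hom_comp[OF BD.alg_hom_tens_right T.alg_hom_tens_left] by (simp add: o_def)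
  note ab = AB.alg_hom_tensor_lift[OF a b] and cd = CD.alg_hom_tensor_lift[OF c d]
  have p: "tensor_perm A B C D = tensor_lift ?T (tensor_lift ?T ?a ?b) (tensor_lift ?T ?c ?d)"
    by (simp add: tensor_perm_def Let_def)
  show "alg_hom (tensor (tensor A B) (tensor C D)) ?T (tensor_perm A B C D)"
    unfolding p by (rule S.alg_hom_tensor_lift[OF ab cd])
  fix x y z w assume "x \<in> carrier A" "y \<in> carrier B" "z \<in> carrier C" "w \<in> carrier D"
  then show "tensor_perm A B C D (tens (tensor A B) (tensor C D) (tens A B x y) (tens C D z w)) =
      tens ?X ?Y (tens B D y w) (tens A C x z)"
    unfolding p
    by (simp add: S.tensor_lift_tens[OF ab cd] AB.tensor_lift_tens[OF a b] CD.tensor_lift_tens[OF c d]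
        T.tens_mult BD.tens_mult AC.tens_mult)
qed

section \<open>Restriction, contraction and the pullback along one flat\<close>

locale one_flat = flat_system M for M :: "'a matroid" +
  fixes F :: "'a set"
  assumes F_flat: "F \<in> flats M" and F_ne: "F \<noteq> ground M"
begin

abbreviation "R \<equiv> restriction M F"
abbreviation "C \<equiv> contraction M F"
abbreviation "LR \<equiv> flats R - {ground R}"
abbreviation "LC \<equiv> {K \<in> L. F \<subseteq> K}"

lemma F_sub: "F \<subseteq> ground M"
  using F_flat flats_subset by blast

lemma LR_eq: "LR = {K \<in> flats M. K \<subset> F}"
  by (auto simp: restriction_def)

lemma ground_simps: "ground R = F" "ground C = ground M - F" "flats R = {K \<in> flats M. K \<subseteq> F}"
  by (simp_all add: restriction_def contraction_def)

lemma flat_system_R: "flat_system R"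
  using finite_subset[OF F_sub finite_ground] F_flat empty_flat by unfold_locales (auto simp: ground_simps)

lemma flat_system_C: "flat_system C"
proof
  show "finite (ground C)" using finite_ground by (simp add: ground_simps)
  show "flats C \<subseteq> Pow (ground C)" using flats_subset by (auto simp: contraction_def)
  show "ground C \<in> flats C" using ground_flat F_sub by (auto simp: contraction_def)
  show "{} \<in> flats C" using F_flat by (auto simp: contraction_def)
qed

text \<open>The contraction is labelled by the flats of M that contain F, so its generators and
  those of M share their indices; F itself labels the empty flat.\<close>

lemma labelled_C: "labelled_flats C LC (\<lambda>K. K - F)"
proof (intro labelled_flats.intro flat_system_C labelled_flats_axioms.intro)
  have "inj_on (\<lambda>K. K - F) LC" by (rule inj_onI) blast
  moreover have "(\<lambda>K. K - F) ` LC = flats C - {ground C}"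
  proof
    show "(\<lambda>K. K - F) ` LC \<subseteq> flats C - {ground C}"
      using flats_subset F_sub by (auto simp: contraction_def)
    show "flats C - {ground C} \<subseteq> (\<lambda>K. K - F) ` LC" by (auto simp: contraction_def)
  qed
  ultimately show "bij_betw (\<lambda>K. K - F) LC (flats C - {ground C})" by (simp add: bij_betw_def)
qed

abbreviation "chM \<equiv> chev M L (\<lambda>K. K)"
abbreviation "chR \<equiv> chev R LR (\<lambda>K. K)"
abbreviation "chC \<equiv> chev C LC (\<lambda>K. K - F)"
abbreviation "relM \<equiv> chrel M L (\<lambda>K. K)"
abbreviation "relR \<equiv> chrel R LR (\<lambda>K. K)"
abbreviation "relC \<equiv> chrel C LC (\<lambda>K. K - F)"
abbreviation "T \<equiv> tensor (CH C) (CH R)"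
abbreviation "chT \<equiv> tensor_eval (CH C) (CH R) chC chR"
abbreviation "relT \<equiv> inl ` relC \<union> inr ` relR"

lemma pres_M: "pres (CH M) chM relM"
  by (rule labelled_flats.pres_CH[OF labelled_id])

lemma pres_R: "pres (CH R) chR relR"
  by (rule labelled_flats.pres_CH[OF flat_system.labelled_id[OF flat_system_R]])

lemma pres_C: "pres (CH C) chC relC"
  by (rule labelled_flats.pres_CH[OF labelled_C])

lemma pres_pair_T: "pres_pair (CH C) chC relC (CH R) chR relR"
  by (rule pres_pair.intro[OF pres_C pres_R])

text \<open>The same choice as in \<open>pullback\<close>. For F = {} it is arbitrary, but then
  \<open>Ztop\<close> is an empty sum.\<close>

definition i0 :: 'a where "i0 = (SOME i. i \<in> F)"

lemma i0: "F \<noteq> {} \<Longrightarrow> i0 \<in> F"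
  unfolding i0_def by (simp add: some_in_eq)

abbreviation "Ztop \<equiv> \<Sum>K\<in>{K \<in> LR. i0 \<in> K}. Var (Inr K) :: ('a set + 'a set) rat_poly"

text \<open>The pullback on generators, including \<open>x\<^sub>\<emptyset>\<close>. Here \<open>Inl K\<close> stands for the generator
  of the contraction with index \<open>K - F\<close>, so that \<open>Inl F\<close> is its \<open>x\<^sub>\<emptyset>\<close>.\<close>

definition pb :: "'a set \<Rightarrow> ('a set + 'a set) rat_poly" where
  "pb K = (if K \<in> L then if K \<subset> F then Var (Inr K) else if F \<subset> K then Var (Inl K)
     else if K = F then Var (Inl F) - Ztop else 0 else 0)"

lemma pb_zero: "\<not> K \<subset> F \<Longrightarrow> \<not> F \<subset> K \<Longrightarrow> K \<noteq> F \<Longrightarrow> pb K = 0"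
  by (simp add: pb_def)

lemma relM_eq: "relM = {Var K | K. K \<notin> L} \<union> {\<Sum>w\<in>{w \<in> L. i \<notin> w}. Var w | i. i \<in> ground M} \<union>
    {Var K * Var K' | K K'. K \<in> L \<and> K' \<in> L \<and> \<not> K \<subseteq> K' \<and> \<not> K' \<subseteq> K}"
  unfolding labelled_flats.ch_rels_def[OF labelled_id] ..

lemma relR_eq: "relR = {Var K | K. K \<notin> LR} \<union> {\<Sum>w\<in>{w \<in> LR. i \<notin> w}. Var w | i. i \<in> F} \<union>
    {Var K * Var K' | K K'. K \<in> LR \<and> K' \<in> LR \<and> \<not> K \<subseteq> K' \<and> \<not> K' \<subseteq> K}"
  unfolding labelled_flats.ch_rels_def[OF flat_system.labelled_id[OF flat_system_R]]
  unfolding ground_simps(1) ..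

lemma relC_eq: "relC = {Var K | K. K \<notin> LC} \<union> {\<Sum>w\<in>{w \<in> LC. i \<notin> w - F}. Var w | i. i \<in> ground M - F} \<union>
    {Var K * Var K' | K K'. K \<in> LC \<and> K' \<in> LC \<and> \<not> K - F \<subseteq> K' - F \<and> \<not> K' - F \<subseteq> K - F}"
  unfolding labelled_flats.ch_rels_def[OF labelled_C]
  unfolding ground_simps(2) ..

lemma F_L: "F \<in> L"
  using F_flat F_ne by blast

lemma LR_L: "K \<in> LR \<Longrightarrow> K \<in> L \<and> K \<subset> F"
  unfolding LR_eq using F_sub by blast

lemma finite_L: "finite L"
  using finite_flats by simp

text \<open>The flat F contributes twice: to the second sum, where it is the empty flat of the
  contraction, and to the correction by \<open>Ztop\<close>.\<close>

lemma pb_sum: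
  "(\<Sum>K\<in>{K \<in> L. i \<notin> K}. pb K) = (\<Sum>K\<in>{K \<in> LR. i \<notin> K}. Var (Inr K)) +
    (\<Sum>K\<in>{K \<in> LC. i \<notin> K}. Var (Inl K)) - (if i \<notin> F then Ztop else 0)"
proof -
  let ?A = "{K \<in> L. i \<notin> K}"
  have fin: "finite ?A" using finite_L by simp
  have "(\<Sum>K\<in>?A. pb K) = (\<Sum>K\<in>?A. (if K \<in> LR then Var (Inr K) else 0) + (if F \<subseteq> K then Var (Inl K) else 0)
    - (if K = F then Ztop else 0))"
  proof (rule sum.cong[OF refl])
    fix K assume "K \<in> ?A"
    then have "K \<in> L" by blast
    then have LRK: "K \<in> LR \<longleftrightarrow> K \<subset> F" by (simp add: LR_eq)
    then show "pb K = (if K \<in> LR then Var (Inr K) else 0) + (if F \<subseteq> K then Var (Inl K) else 0) - (if K = F then Ztop else 0)"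
      unfolding LRK using \<open>K \<in> L\<close> by (cases "K \<subset> F"; cases "F \<subset> K"; cases "K = F") (simp_all add: pb_def psubset_eq)
  qed
  also have "\<dots> = (\<Sum>K\<in>{K \<in> ?A. K \<in> LR}. Var (Inr K)) + (\<Sum>K\<in>{K \<in> ?A. F \<subseteq> K}. Var (Inl K)) - (\<Sum>K\<in>{K \<in> ?A. K = F}. Ztop)"
    unfolding sum_subtractf sum.distrib sum.inter_filter[OF fin] ..
  also have "{K \<in> ?A. K \<in> LR} = {K \<in> LR. i \<notin> K}" using LR_L by blast
  also have "{K \<in> ?A. F \<subseteq> K} = {K \<in> LC. i \<notin> K}" by blast
  also have "{K \<in> ?A. K = F} = (if i \<notin> F then {F} else {})" using F_L by auto
  finally show ?thesis by simp
qed

text \<open>For i in F no flat containing F avoids i, and a linear relation of the restriction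
  remains. For i outside F, the flats containing F give a relation of the contraction, its empty
  flat being supplied by x_F, while \<open>- Ztop\<close> reduces the sum over \<open>LR\<close> to
  the relation for \<open>i0\<close>. Incomparable flats comparable to F lie on the same side of
  it.\<close>

lemma pb_rel:
  assumes "s \<in> relM"
  shows "subst pb s \<in> idl relT"
proof -
  have R: "inr s \<in> idl relT" if "s \<in> relR" for s using that by (intro idl_gen) blast
  have C: "inl s \<in> idl relT" if "s \<in> relC" for s using that by (intro idl_gen) blast
  have lR: "(\<Sum>K\<in>{K \<in> LR. i \<notin> K}. Var (Inr K)) \<in> idl relT" if "i \<in> F" for i
  proof -
    have "(\<Sum>w\<in>{w \<in> LR. i \<notin> w}. Var w) \<in> relR" unfolding relR_eq using that by blast
    from R[OF this] show ?thesis by simp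
  qed
  have lC: "(\<Sum>K\<in>{K \<in> LC. i \<notin> K}. Var (Inl K)) \<in> idl relT" if "i \<in> ground M - F" for i
  proof -
    have "(\<Sum>w\<in>{w \<in> LC. i \<notin> w - F}. Var w) \<in> relC" unfolding relC_eq using that by blast
    moreover have "{w \<in> LC. i \<notin> w - F} = {K \<in> LC. i \<notin> K}" using that by blast
    ultimately have "(\<Sum>K\<in>{K \<in> LC. i \<notin> K}. Var K) \<in> relC" by (simp only:)
    from C[OF this] show ?thesis by simp
  qed
  from assms consider K where "s = Var K" "K \<notin> L" | i where "s = (\<Sum>w\<in>{w \<in> L. i \<notin> w}. Var w)" "i \<in> ground M"
    | K K' where "s = Var K * Var K'" "K \<in> L" "K' \<in> L" "\<not> K \<subseteq> K'" "\<not> K' \<subseteq> K"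
    unfolding relM_eq by blast
  then show ?thesis
  proof cases
    case 1
    then have "pb K = 0" unfolding pb_def by (intro if_not_P)
    then show ?thesis by (simp add: 1)
  next
    case 2
    then have e: "subst pb s = (\<Sum>K\<in>{K \<in> L. i \<notin> K}. pb K)" by simp
    show ?thesis
    proof (cases "i \<in> F")
      case True
      then have LC: "{K \<in> LC. i \<notin> K} = {}" by blast
      show ?thesis unfolding e pb_sum LC using lR[OF True] True by simp
    next
      case False
      then have i: "{K \<in> LR. i \<notin> K} = LR" using LR_L by blast
      have fin: "finite LR" using finite_flats LR_eq by simp
      have z: "(\<Sum>K\<in>LR. Var (Inr K)) - Ztop \<in> idl relT"
      proof (cases "F = {}")
        case True
        then have LR: "LR = {}" unfolding LR_eq by blast
        show ?thesis unfolding LR by simp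
      next
        case False
        have "(\<Sum>K\<in>LR. Var (Inr K)) = Ztop + (\<Sum>K\<in>{K \<in> LR. i0 \<notin> K}. Var (Inr K))"
          using sum.inter_filter[OF fin, of "\<lambda>K. Var (Inr K)"] fin
          by (subst sum.union_disjoint[symmetric]) (auto intro!: sum.cong)
        then show ?thesis using lR[OF i0[OF False]] by simp
      qed
      have "subst pb s = ((\<Sum>K\<in>LR. Var (Inr K)) - Ztop) + (\<Sum>K\<in>{K \<in> LC. i \<notin> K}. Var (Inl K))"
        unfolding e pb_sum i using False by simp
      moreover have "(\<Sum>K\<in>{K \<in> LC. i \<notin> K}. Var (Inl K)) \<in> idl relT" using lC False 2(2) by blast
      ultimately show ?thesis using idl_add[OF z] by (simp only:)
    qed
  next
    case 3
    show ?thesis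
    proof (cases "pb K = 0 \<or> pb K' = 0")
      case True
      then show ?thesis by (auto simp: 3)
    next
      case False
      have cmp: "K \<subset> F \<or> F \<subset> K" "K' \<subset> F \<or> F \<subset> K'"
      proof -
        have c: "K \<subset> F \<or> F \<subset> K \<or> K = F" "K' \<subset> F \<or> F \<subset> K' \<or> K' = F"
          using False pb_zero[of K] pb_zero[of K'] by argo+
        then have "K \<noteq> F" "K' \<noteq> F" using 3(4,5) by auto
        then show "K \<subset> F \<or> F \<subset> K" "K' \<subset> F \<or> F \<subset> K'" using c by simp_all
      qed
      consider "K \<subset> F" "K' \<subset> F" | "F \<subset> K" "F \<subset> K'"
      proof -
        have "\<not> (K \<subset> F \<and> F \<subset> K')" "\<not> (F \<subset> K \<and> K' \<subset> F)"
          using 3(4,5) by (metis psubsetE subset_trans)+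
        then show ?thesis using cmp that by argo
      qed
      then show ?thesis
      proof cases
        case 1
        then have "K \<in> LR" "K' \<in> LR" unfolding LR_eq using 3(2,3) by simp_all
        then have "Var K * Var K' \<in> relR"
          unfolding relR_eq using 3(4,5)
          by - (rule UnI2, rule CollectI, rule exI[of _ K], rule exI[of _ K'], intro conjI refl)
        from R[OF this] show ?thesis using 1 3 by (simp add: pb_def)
      next
        case 2
        have n: "\<not> K - F \<subseteq> K' - F" "\<not> K' - F \<subseteq> K - F" using 2 3(4,5) by blast+
        have "K \<in> LC" "K' \<in> LC" using 2 3(2,3) by simp_all
        then have "Var K * Var K' \<in> relC"
          unfolding relC_eq using n
          by - (rule UnI2, rule CollectI, rule exI[of _ K], rule exI[of _ K'], intro conjI refl)
        from C[OF this] have "Var (Inl K) * Var (Inl K') \<in> idl relT" by simp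
        moreover have "\<not> K \<subset> F" "\<not> K' \<subset> F" using 2 by blast+
        then have "pb K = Var (Inl K)" "pb K' = Var (Inl K')" using 2 3(2,3) by (simp_all add: pb_def)
        ultimately show ?thesis by (simp only: 3(1) subst_simps subst_Var)
      qed
    qed
  qed
qed

lemma pullback: "alg_hom (CH M) T (pullback M F)"
  and pullback_eval: "pullback M F (chM p) = chT (subst pb p)"
proof -
  interpret TT: pres_pair "CH C" chC relC "CH R" chR relR by (rule pres_pair_T)
  interpret RR: labelled_flats R LR "\<lambda>K. K" by (rule flat_system.labelled_id[OF flat_system_R])
  interpret CC: labelled_flats C LC "\<lambda>K. K - F" by (rule labelled_C)
  have presT: "pres T chT relT" by (rule TT.pres_tensor)
  let ?i = "SOME i. i \<in> F" and ?j = "SOME j. j \<in> ground M - F"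
  let ?sR = "\<Oplus>\<^bsub>CH R\<^esub>K'\<in>{K' \<in> proper_flats R. ?i \<in> K'}. xgen R K'"
  let ?sC = "\<Oplus>\<^bsub>CH C\<^esub>L\<in>{L \<in> proper_flats C. ?j \<notin> L}. xgen C L"
  let ?tl = "\<lambda>x. tens (CH C) (CH R) x \<one>\<^bsub>CH R\<^esub>" and ?tr = "\<lambda>x. tens (CH C) (CH R) \<one>\<^bsub>CH C\<^esub> x"
  let ?a = "\<lambda>K. if K \<subset> F then ?tr (xgen R K) else if F \<subset> K then ?tl (xgen C (K - F))
        else if K = F then (\<ominus>\<^bsub>T\<^esub> ?tr ?sR) \<ominus>\<^bsub>T\<^esub> ?tl ?sC else \<zero>\<^bsub>T\<^esub>"
  have pb: "pullback M F = chow_lift T ?a"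
    unfolding pullback_def Let_def ..
  have g: "poly_hom T (chT \<circ> subst pb)" by (rule alg_hom_comp[OF subst_hom TT.poly_hom_H])
  have kill: "(chT \<circ> subst pb) s = \<zero>\<^bsub>T\<^esub>" if "s \<in> relM" for s
    unfolding comp_apply pres.kernel[OF presT] by (rule pb_rel[OF that])
  have a: "?a K = (chT \<circ> subst pb) (Var K)" if K: "K \<in> V" for K
  proof -
    have KL: "K \<in> L" "K \<noteq> {}" using K by (auto simp: proper_flats_def)
    consider "K \<subset> F" | "F \<subset> K" | "K = F" | "\<not> K \<subseteq> F" "\<not> F \<subseteq> K" by blast
    then show ?thesis
    proof cases
      case 1
      then have "K \<in> LR" "K \<in> RR.V" using KL by (auto simp: LR_eq proper_flats_def ground_simps)
      then have "chR (Var K) = xgen R K" using RR.ch_eval_Var RR.xfl_proper by simp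
      moreover have "pb K = Var (Inr K)" using 1 KL by (simp add: pb_def)
      moreover have "?a K = ?tr (xgen R K)" using 1 by simp
      ultimately show ?thesis unfolding comp_apply subst_Var by (simp only: TT.H_Inr)
    next
      case 2
      then have "K \<in> LC" using KL by blast
      moreover have "K - F \<in> CC.V"
        using CC.r_flat[OF \<open>K \<in> LC\<close>] 2 by (auto simp: proper_flats_def)
      ultimately have "chC (Var K) = xgen C (K - F)" using CC.ch_eval_Var CC.xfl_proper by simp
      moreover have "\<not> K \<subset> F" using 2 by blast
      then have "pb K = Var (Inl K)" "?a K = ?tl (xgen C (K - F))" using 2 KL by (simp_all add: pb_def)
      ultimately show ?thesis unfolding comp_apply subst_Var by (simp only: TT.H_Inl)
    next
      case 3
      have jC: "?j \<in> ground C"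
        using F_sub F_ne someI_ex[of "\<lambda>j. j \<in> ground M - F"] by (auto simp: ground_simps)
      \<comment> \<open>The term in j of the pullback at x_F is the generator of the contraction for
        its empty flat, written out with \<open>?j\<close>.\<close>
      have "F \<in> LC" using F_L by blast
      then have "chC (Var F) = CC.xfl {}" using CC.ch_eval_Var[of F] by simp
      also have "\<dots> = \<ominus>\<^bsub>CH C\<^esub> ?sC" by (rule CC.xfl_empty[OF jC])
      finally have c: "chC (Var F) = \<ominus>\<^bsub>CH C\<^esub> ?sC" .
      have sC: "?sC \<in> carrier (CH C)" by (auto intro!: TT.A.B.finsum_closed)
      have "{K \<in> LR. i0 \<in> K} = {K' \<in> proper_flats R. ?i \<in> K'}"
        unfolding i0_def by (auto simp: proper_flats_def)
      then have r: "chR (\<Sum>K\<in>{K \<in> LR. i0 \<in> K}. Var K) = ?sR"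
        unfolding TT.B.p_sum using RR.ch_eval_Var RR.xfl_proper
        by (intro TT.B.B.finsum_cong') (auto simp: proper_flats_def)
      have "chT Ztop = chT (inr (\<Sum>K\<in>{K \<in> LR. i0 \<in> K}. Var K))" by simp
      then have z: "chT Ztop = ?tr ?sR" unfolding TT.H_inr r .
      have "(chT \<circ> subst pb) (Var K) = ?tl (\<ominus>\<^bsub>CH C\<^esub> ?sC) \<ominus>\<^bsub>T\<^esub> ?tr ?sR"
      proof -
        have "pb K = Var (Inl F) - Ztop" using 3 F_L by (simp add: pb_def)
        then show ?thesis unfolding comp_apply subst_Var by (simp only: TT.H.p_minus TT.H_Inl z c)
      qed
      also have "?tl (\<ominus>\<^bsub>CH C\<^esub> ?sC) = \<ominus>\<^bsub>T\<^esub> ?tl ?sC"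
        by (rule alg_hom.uminus[OF TT.AB.alg_hom_tens_left sC])
      also have "(\<ominus>\<^bsub>T\<^esub> ?tl ?sC) \<ominus>\<^bsub>T\<^esub> ?tr ?sR = (\<ominus>\<^bsub>T\<^esub> ?tr ?sR) \<ominus>\<^bsub>T\<^esub> ?tl ?sC"
      proof -
        have "?tl ?sC \<in> carrier T" by (rule alg_hom.closed[OF TT.AB.alg_hom_tens_left sC])
        moreover have "?tr ?sR \<in> carrier T"
          unfolding r[symmetric] by (rule alg_hom.closed[OF TT.AB.alg_hom_tens_right TT.B.p_closed])
        ultimately show ?thesis unfolding a_minus_def by (intro TT.H.B.a_comm TT.H.B.a_inv_closed)
      qed
      finally show ?thesis using 3 by simp
    next
      case 4
      then have "\<not> K \<subset> F" "\<not> F \<subset> K" "K \<noteq> F" by auto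
      then have "pb K = 0" "?a K = \<zero>\<^bsub>T\<^esub>" by (simp_all add: pb_zero)
      then show ?thesis unfolding comp_apply subst_Var by (simp only: TT.H.p_zero)
    qed
  qed
  show "alg_hom (CH M) T (pullback M F)" unfolding pb by (rule chow_lift_pres(1)[OF g kill a])
  show "pullback M F (chM p) = chT (subst pb p)"
  proof -
    have "chow_lift T ?a (chM p) = (chT \<circ> subst pb) p" by (rule chow_lift_pres(2)[OF g kill a])
    then show ?thesis unfolding pb comp_apply .
  qed
qed

end

section \<open>The summands\<close>

lemma (in pres) unit_closed: "\<one>\<^bsub>C\<^esub> \<in> carrier C"
  by (rule B.one_closed)

locale two_flats = MF: one_flat M F + NG: one_flat N G
  for M :: "'a matroid" and N :: "'b matroid" and F :: "'a set" and G :: "'b set"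
begin

sublocale MN: two_systems M N
  by unfold_locales

sublocale RR: two_systems "restriction M F" "restriction N G"
  by (intro two_systems.intro MF.flat_system_R NG.flat_system_R)

abbreviation "H \<equiv> (F, G)"
abbreviation "CC \<equiv> tensor (CH (contraction M F)) (CH (contraction N G))"
abbreviation "chCC \<equiv> tensor_eval (CH (contraction M F)) (CH (contraction N G)) MF.chC NG.chC"
abbreviation "relCC \<equiv> inl ` MF.relC \<union> inr ` NG.relC"
abbreviation "W \<equiv> tensor (CH RR.S) CC"
abbreviation "chW \<equiv> tensor_eval (CH RR.S) CC RR.chS chCC"
abbreviation "relW \<equiv> inl ` RR.relS \<union> inr ` relCC"
abbreviation "act \<equiv> summand_action M N F G"

lemma W_eq: "summand_ring M N F G = W"
  by (simp add: summand_ring_def)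

text \<open>The labels for the restricted sum are the pairs below H, so the same variables x_K serve
  for both rings.\<close>

lemma PQ_R: "RR.PP.PQ = {K. MN.PP.below (Some H) K}"
proof -
  have "K \<in> RR.PP.PQ \<longleftrightarrow> MN.PP.below (Some H) K" for K
    using MF.F_sub NG.F_sub MF.F_ne NG.F_ne
    by (cases K) (auto simp: MF.ground_simps NG.ground_simps less_le)
  then show ?thesis by blast
qed

lemma pres_pair_CC: "pres_pair (CH (contraction M F)) MF.chC MF.relC (CH (contraction N G)) NG.chC NG.relC"
  by (rule pres_pair.intro[OF MF.pres_C NG.pres_C])

lemma pres_pair_W: "pres_pair (CH RR.S) RR.chS RR.relS CC chCC relCC"
  by (rule pres_pair.intro[OF RR.pres_S pres_pair.pres_tensor[OF pres_pair_CC]])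

lemma pres_W: "pres W chW relW"
  by (rule pres_pair.pres_tensor[OF pres_pair_W])

text \<open>\<open>tau\<close> lifts the action of the generators of \<open>CH(M) \<otimes> CH(N)\<close> on the summand to
  polynomials. In its values, \<open>Inl (K, L)\<close> is a generator for \<open>M\<^sup>F \<oplus> N\<^sup>G\<close>, while \<open>Inr (Inl K)\<close>
  and \<open>Inr (Inr K)\<close> are the generators of \<open>CH(M\<^sub>F)\<close> and \<open>CH(N\<^sub>G)\<close> with index \<open>K - F\<close> and
  \<open>K - G\<close>.\<close>

definition gamM :: "'a set + 'a set \<Rightarrow> (('a set \<times> 'b set) + ('a set + 'b set)) rat_poly" where
  "gamM = case_sum (\<lambda>K. Var (Inr (Inl K))) (\<lambda>K. inl (RR.PP.X K))"

definition gamN :: "'b set + 'b set \<Rightarrow> (('a set \<times> 'b set) + ('a set + 'b set)) rat_poly" where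
  "gamN = case_sum (\<lambda>K. Var (Inr (Inr K))) (\<lambda>K. inl (RR.PP.Y K))"

definition tau :: "('a set \<times> 'b set) + ('a set + 'b set) \<Rightarrow> (('a set \<times> 'b set) + ('a set + 'b set)) rat_poly" where
  "tau = case_sum (\<lambda>K. Var (Inl K)) (case_sum (\<lambda>K. subst gamM (MF.pb K)) (\<lambda>K. subst gamN (NG.pb K)))"

text \<open>The action is a composite of homomorphisms, so it suffices to follow the generators of
  each factor through pullback, permutation and iota.\<close>

lemma act: "alg_hom MN.A W act"
  and act_eval: "act (MN.chA p) = chW (subst tau (inr p))"
proof -
  interpret A: pres_pair "CH M" MN.chM MN.relM "CH N" MN.chN MN.relN by (rule MN.pres_pair_A)
  interpret TM: pres_pair "CH (contraction M F)" MF.chC MF.relC "CH (restriction M F)" MF.chR MF.relR by (rule MF.pres_pair_T)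
  interpret TN: pres_pair "CH (contraction N G)" NG.chC NG.relC "CH (restriction N G)" NG.chR NG.relR by (rule NG.pres_pair_T)
  interpret RA: pres_pair "CH (restriction M F)" MF.chR MF.relR "CH (restriction N G)" NG.chR NG.relR
    by (rule RR.pres_pair_A)
  interpret CA: pres_pair "CH (contraction M F)" MF.chC MF.relC "CH (contraction N G)" NG.chC NG.relC
    by (rule pres_pair_CC)
  interpret WW: pres_pair "CH RR.S" RR.chS RR.relS CC chCC relCC by (rule pres_pair_W)
  interpret TMN: alg_pair MF.T NG.T
    by (intro alg_pair.intro TM.AB.rat_algebra_tensor TN.AB.rat_algebra_tensor)
  interpret BD: alg_pair RR.A CC
    by (intro alg_pair.intro RA.AB.rat_algebra_tensor CA.AB.rat_algebra_tensor)
  let ?t1 = "tensor_map MF.T NG.T (pullback M F) (pullback N G)"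
  let ?t2 = "tensor_perm (CH (contraction M F)) (CH (restriction M F)) (CH (contraction N G)) (CH (restriction N G))"
  let ?t3 = "tensor_map (CH RR.S) CC (iota (restriction M F) (restriction N G)) id"
  have act_def: "act = ?t3 \<circ> ?t2 \<circ> ?t1"
    by (simp add: summand_action_def Let_def)
  note t1 = A.AB.tensor_map[OF MF.pullback NG.pullback]
  note t2 = tensor_perm[OF flat_system.rat_algebra_CH[OF MF.flat_system_C] flat_system.rat_algebra_CH[OF MF.flat_system_R]
      flat_system.rat_algebra_CH[OF NG.flat_system_C] flat_system.rat_algebra_CH[OF NG.flat_system_R]]
  have one: "\<one>\<^bsub>CH (contraction M F)\<^esub> \<in> carrier (CH (contraction M F))" "\<one>\<^bsub>CH (contraction N G)\<^esub> \<in> carrier (CH (contraction N G))"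
    "\<one>\<^bsub>CH (restriction M F)\<^esub> \<in> carrier (CH (restriction M F))" "\<one>\<^bsub>CH (restriction N G)\<^esub> \<in> carrier (CH (restriction N G))"
    "\<one>\<^bsub>CH M\<^esub> \<in> carrier (CH M)" "\<one>\<^bsub>CH N\<^esub> \<in> carrier (CH N)"
    by (rule pres.unit_closed, rule MF.pres_C NG.pres_C MF.pres_R NG.pres_R MN.pres_M MN.pres_N)+
  have cl: "MF.chC p1 \<in> carrier (CH (contraction M F))" "NG.chC p2 \<in> carrier (CH (contraction N G))"
    "MF.chR p3 \<in> carrier (CH (restriction M F))" "NG.chR p4 \<in> carrier (CH (restriction N G))"
    "MN.chM p5 \<in> carrier (CH M)" "MN.chN p6 \<in> carrier (CH N)" for p1 p2 p3 p4 p5 p6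
    by (rule poly_alg_hom.p_closed[OF pres.axioms(1)], rule MF.pres_C NG.pres_C MF.pres_R NG.pres_R MN.pres_M MN.pres_N)+
  have idhom: "alg_hom CC CC id" by (rule alg_hom_id[OF CA.AB.rat_algebra_tensor])
  note t3 = BD.tensor_map[OF RR.iota idhom]
  have hom23: "alg_hom (tensor MF.T NG.T) W (?t3 \<circ> ?t2)" by (rule alg_hom_comp[OF t2(1) t3(1)])
  show hom: "alg_hom MN.A W act" unfolding act_def by (rule alg_hom_comp[OF t1(1) hom23])
  \<comment> \<open>The homomorphisms that carry the targets of the two pullbacks into the
    summand.\<close>
  let ?JM = "(?t3 \<circ> ?t2) \<circ> (\<lambda>t. tens MF.T NG.T t \<one>\<^bsub>NG.T\<^esub>)" and ?JN = "(?t3 \<circ> ?t2) \<circ> (\<lambda>t. tens MF.T NG.T \<one>\<^bsub>MF.T\<^esub> t)"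
  have JM: "alg_hom MF.T W ?JM" by (rule alg_hom_comp[OF TMN.alg_hom_tens_left hom23])
  have JN: "alg_hom NG.T W ?JN" by (rule alg_hom_comp[OF TMN.alg_hom_tens_right hom23])
  have tM: "?JM (tens (CH (contraction M F)) (CH (restriction M F)) a b) =
      tens (CH RR.S) CC (iota (restriction M F) (restriction N G) (tens (CH (restriction M F)) (CH (restriction N G)) b \<one>\<^bsub>CH (restriction N G)\<^esub>))
        (tens (CH (contraction M F)) (CH (contraction N G)) a \<one>\<^bsub>CH (contraction N G)\<^esub>)"
    if "a \<in> carrier (CH (contraction M F))" "b \<in> carrier (CH (restriction M F))" for a b
    unfolding comp_apply TN.AB.tens_one[symmetric] t2(2)[OF that one(2) one(4)]
      t3(2)[OF RA.AB.tens_closed[OF that(2) one(4)] CA.AB.tens_closed[OF that(1) one(2)]] id_apply ..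

  have tN: "?JN (tens (CH (contraction N G)) (CH (restriction N G)) a b) =
      tens (CH RR.S) CC (iota (restriction M F) (restriction N G) (tens (CH (restriction M F)) (CH (restriction N G)) \<one>\<^bsub>CH (restriction M F)\<^esub> b))
        (tens (CH (contraction M F)) (CH (contraction N G)) \<one>\<^bsub>CH (contraction M F)\<^esub> a)"
    if "a \<in> carrier (CH (contraction N G))" "b \<in> carrier (CH (restriction N G))" for a b
    unfolding comp_apply TM.AB.tens_one[symmetric] t2(2)[OF one(1) one(3) that]
      t3(2)[OF RA.AB.tens_closed[OF one(3) that(2)] CA.AB.tens_closed[OF one(1) that(1)]] id_apply ..

  have i1: "iota (restriction M F) (restriction N G) \<one>\<^bsub>RR.A\<^esub> = \<one>\<^bsub>CH RR.S\<^esub>"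
    by (rule alg_hom.one[OF RR.iota])
  have wM: "chW (inl p) = tens (CH RR.S) CC (RR.chS p) \<one>\<^bsub>CC\<^esub>" for p by (rule WW.H_inl)
  have wR: "chW (inr p) = tens (CH RR.S) CC \<one>\<^bsub>CH RR.S\<^esub> (chCC p)" for p by (rule WW.H_inr)
  have evM: "?JM (MF.chT p) = chW (subst gamM p)" for p
  proof -
    have "(?JM \<circ> MF.chT) (Var v) = (chW \<circ> subst gamM) (Var v)" for v
    proof (cases v)
      case (Inl K)
      have "(?JM \<circ> MF.chT) (Var v) = ?JM (tens (CH (contraction M F)) (CH (restriction M F)) (MF.chC (Var K)) \<one>\<^bsub>CH (restriction M F)\<^esub>)"
        unfolding Inl comp_apply TM.H_Inl ..
      also have "\<dots> = tens (CH RR.S) CC \<one>\<^bsub>CH RR.S\<^esub> (tens (CH (contraction M F)) (CH (contraction N G)) (MF.chC (Var K)) \<one>\<^bsub>CH (contraction N G)\<^esub>)"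
        by (subst tM) (simp_all only: cl one RA.AB.tens_one i1)
      also have "\<dots> = chW (inr (Var (Inl K)))" unfolding wR CA.H_Inl ..
      finally show ?thesis by (simp only: Inl comp_apply subst_Var gamM_def sum.case)
    next
      case (Inr K)
      have "(?JM \<circ> MF.chT) (Var v) = ?JM (tens (CH (contraction M F)) (CH (restriction M F)) \<one>\<^bsub>CH (contraction M F)\<^esub> (MF.chR (Var K)))"
        unfolding Inr comp_apply TM.H_Inr ..
      also have "\<dots> = tens (CH RR.S) CC (RR.chS (subst RR.PP.X (Var K))) \<one>\<^bsub>CC\<^esub>"
        by (subst tM) (simp_all only: cl one CA.AB.tens_one RR.iota_tens_left)
      also have "\<dots> = chW (inl (RR.PP.X K))" unfolding wM subst_Var ..
      finally show ?thesis by (simp only: Inr comp_apply subst_Var gamM_def sum.case)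
    qed
    from poly_hom_eqI[OF alg_hom_comp[OF TM.poly_hom_H JM] alg_hom_comp[OF subst_hom WW.poly_hom_H] this]
    show ?thesis unfolding comp_apply .
  qed
  have evN: "?JN (NG.chT p) = chW (subst gamN p)" for p
  proof -
    have "(?JN \<circ> NG.chT) (Var v) = (chW \<circ> subst gamN) (Var v)" for v
    proof (cases v)
      case (Inl K)
      have "(?JN \<circ> NG.chT) (Var v) = ?JN (tens (CH (contraction N G)) (CH (restriction N G)) (NG.chC (Var K)) \<one>\<^bsub>CH (restriction N G)\<^esub>)"
        unfolding Inl comp_apply TN.H_Inl ..
      also have "\<dots> = tens (CH RR.S) CC \<one>\<^bsub>CH RR.S\<^esub> (tens (CH (contraction M F)) (CH (contraction N G)) \<one>\<^bsub>CH (contraction M F)\<^esub> (NG.chC (Var K)))"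
        by (subst tN) (simp_all only: cl one RA.AB.tens_one i1)
      also have "\<dots> = chW (inr (Var (Inr K)))" unfolding wR CA.H_Inr ..
      finally show ?thesis by (simp only: Inl comp_apply subst_Var gamN_def sum.case)
    next
      case (Inr K)
      have "(?JN \<circ> NG.chT) (Var v) = ?JN (tens (CH (contraction N G)) (CH (restriction N G)) \<one>\<^bsub>CH (contraction N G)\<^esub> (NG.chR (Var K)))"
        unfolding Inr comp_apply TN.H_Inr ..
      also have "\<dots> = tens (CH RR.S) CC (RR.chS (subst RR.PP.Y (Var K))) \<one>\<^bsub>CC\<^esub>"
        by (subst tN) (simp_all only: cl one CA.AB.tens_one RR.iota_tens_right)
      also have "\<dots> = chW (inl (RR.PP.Y K))" unfolding wM subst_Var ..
      finally show ?thesis by (simp only: Inr comp_apply subst_Var gamN_def sum.case)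
    qed
    from poly_hom_eqI[OF alg_hom_comp[OF TN.poly_hom_H JN] alg_hom_comp[OF subst_hom WW.poly_hom_H] this]
    show ?thesis unfolding comp_apply .
  qed
  have "(act \<circ> MN.chA) (Var v) = (chW \<circ> subst tau \<circ> inr) (Var v)" for v
  proof (cases v)
    case (Inl K)
    have "(act \<circ> MN.chA) (Var v) = (?t3 \<circ> ?t2) (?t1 (tens (CH M) (CH N) (MN.chM (Var K)) \<one>\<^bsub>CH N\<^esub>))"
      unfolding Inl act_def comp_apply A.H_Inl ..
    also have "?t1 (tens (CH M) (CH N) (MN.chM (Var K)) \<one>\<^bsub>CH N\<^esub>) = tens MF.T NG.T (MF.chT (subst MF.pb (Var K))) \<one>\<^bsub>NG.T\<^esub>"
      by (subst t1(2)) (simp_all only: cl one MF.pullback_eval alg_hom.one[OF NG.pullback])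
    also have "(?t3 \<circ> ?t2) \<dots> = ?JM (MF.chT (MF.pb K))" unfolding comp_apply subst_Var ..
    also have "\<dots> = chW (subst gamM (MF.pb K))" by (rule evM)
    finally show ?thesis by (simp only: Inl comp_apply subst_Var tau_def sum.case)
  next
    case (Inr K)
    have "(act \<circ> MN.chA) (Var v) = (?t3 \<circ> ?t2) (?t1 (tens (CH M) (CH N) \<one>\<^bsub>CH M\<^esub> (MN.chN (Var K))))"
      unfolding Inr act_def comp_apply A.H_Inr ..
    also have "?t1 (tens (CH M) (CH N) \<one>\<^bsub>CH M\<^esub> (MN.chN (Var K))) = tens MF.T NG.T \<one>\<^bsub>MF.T\<^esub> (NG.chT (subst NG.pb (Var K)))"
      by (subst t1(2)) (simp_all only: cl one NG.pullback_eval alg_hom.one[OF MF.pullback])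
    also have "(?t3 \<circ> ?t2) \<dots> = ?JN (NG.chT (NG.pb K))" unfolding comp_apply subst_Var ..
    also have "\<dots> = chW (subst gamN (NG.pb K))" by (rule evN)
    finally show ?thesis by (simp only: Inr comp_apply subst_Var tau_def sum.case)
  qed
  from poly_hom_eqI[OF alg_hom_comp[OF A.poly_hom_H hom] alg_hom_comp[OF subst_hom alg_hom_comp[OF subst_hom WW.poly_hom_H]]
      this]
  show "act (MN.chA p) = chW (subst tau (inr p))" unfolding comp_apply .
qed

end

lemma (in poset_pair) rels_Some_cases:
  assumes "s \<in> rels (Some (F, G))"
  obtains K where "s = KV K" "\<not> below (Some (F, G)) K" | K where "s = FV K" "K \<notin> P'" | K where "s = GV K" "K \<notin> Q'"
    | K K' where "s = KV K * KV K'" "\<not> K \<le> K'" "\<not> K' \<le> K"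
    | K K' where "s = FV K * FV K'" "K \<in> P'" "K' \<in> P'" "\<not> K \<le> K'" "\<not> K' \<le> K"
    | K K' where "s = GV K * GV K'" "K \<in> Q'" "K' \<in> Q'" "\<not> K \<le> K'" "\<not> K' \<le> K"
    | K where "s = FV K" "K \<in> P'" "\<not> F \<le> K" "\<not> K \<le> F"
    | K where "s = GV K" "K \<in> Q'" "\<not> G \<le> K" "\<not> K \<le> G"
    | K where "s = FV K - (\<Sum>G'\<in>{G' \<in> LQ. G' \<le> G}. KV (K, G'))" "K \<in> P'" "K < F"
    | K where "s = GV K - (\<Sum>F'\<in>{F' \<in> LP. F' \<le> F}. KV (F', K))" "K \<in> Q'" "K < G"
  using assms unfolding rels_def extra_rels.simps fst_conv snd_conv Un_iff mem_Collect_eq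
  by - (elim disjE exE conjE; (rule that; assumption))

section \<open>Identifying the part with label H with its summand\<close>

context two_flats
begin

abbreviation "KV K \<equiv> Var (Inl K) :: (('a set \<times> 'b set) + ('a set + 'b set)) rat_poly"
abbreviation "FV K \<equiv> Var (Inr (Inl K)) :: (('a set \<times> 'b set) + ('a set + 'b set)) rat_poly"
abbreviation "GV K \<equiv> Var (Inr (Inr K)) :: (('a set \<times> 'b set) + ('a set + 'b set)) rat_poly"

text \<open>The sum \<open>Ztop\<close> from the pullback of M, pushed by iota into the Chow ring of
  the restricted sum.\<close>

definition ZM :: "(('a set \<times> 'b set) + ('a set + 'b set)) rat_poly" where
  "ZM = (\<Sum>K\<in>{K \<in> MF.LR. MF.i0 \<in> K}. inl (RR.PP.X K))"

definition ZN :: "(('a set \<times> 'b set) + ('a set + 'b set)) rat_poly" where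
  "ZN = (\<Sum>K\<in>{K \<in> NG.LR. NG.i0 \<in> K}. inl (RR.PP.Y K))"

text \<open>\<open>tau'\<close> inverts \<open>tau\<close> modulo the relations of the summand. Multiplied by \<open>x\<^sub>H\<close>, the
  substitution \<open>sig\<close> maps the summand back to \<open>CH(M \<oplus> N)\<close>.\<close>

definition tau' :: "('a set \<times> 'b set) + ('a set + 'b set) \<Rightarrow> (('a set \<times> 'b set) + ('a set + 'b set)) rat_poly" where
  "tau' = case_sum (\<lambda>K. KV K) (case_sum
    (\<lambda>L. if L \<in> MF.LC then if L = F then FV F + ZM else FV L else 0)
    (\<lambda>L. if L \<in> NG.LC then if L = G then GV G + ZN else GV L else 0))"

definition sig :: "('a set \<times> 'b set) + ('a set + 'b set) \<Rightarrow> ('a set \<times> 'b set) rat_poly" where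
  "sig v = subst (MN.PP.gsub (Some H)) (tau' v)"

lemma gsub_Inl: "MN.PP.gsub (Some H) (Inl K) = (if MN.PP.below (Some H) K then Var K else 0)"
  and gsub_X: "MN.PP.gsub (Some H) (Inr (Inl K')) = MN.PP.X K'"
  and gsub_Y: "MN.PP.gsub (Some H) (Inr (Inr K'')) = MN.PP.Y K''"
  by (simp_all only: MN.PP.gsub_def sum.case)

lemma sig_Inl: "sig (Inl K) = (if MN.PP.below (Some H) K then Var K else 0)"
  by (simp only: sig_def tau'_def sum.case subst_Var gsub_Inl)

text \<open>The linear relation of i multiplied by x_H: the X_K with K incomparable to F drop out,
  and the others lie strictly below F or contain it.\<close>

lemma X_split:
  assumes i: "i \<in> ground M"
  shows "Var H * ((\<Sum>K\<in>{K \<in> MF.LR. i \<notin> K}. MN.PP.X K) + (\<Sum>K\<in>{K \<in> MF.LC. i \<notin> K}. MN.PP.X K)) \<in> idl MN.relS"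
proof -
  let ?A = "{K \<in> flats M. i \<notin> K}"
  let ?B = "{K \<in> MF.LR. i \<notin> K}" and ?C = "{K \<in> MF.LC. i \<notin> K}" and ?D = "{K \<in> flats M. i \<notin> K \<and> \<not> K \<subseteq> F \<and> \<not> F \<subseteq> K}"
  have A: "?A = ?B \<union> ?C \<union> ?D" unfolding MF.LR_eq using i by blast
  have fin: "finite ?A" using MF.finite_flats by simp
  then have f: "finite (?B \<union> ?C)" "finite ?D" "finite ?B" "finite ?C" unfolding A by (simp_all only: finite_Un)
  have d: "(?B \<union> ?C) \<inter> ?D = {}" "?B \<inter> ?C = {}" unfolding MF.LR_eq by blast+
  have e: "(\<Sum>K\<in>?A. MN.PP.X K) = (\<Sum>K\<in>?B. MN.PP.X K) + (\<Sum>K\<in>?C. MN.PP.X K) + (\<Sum>K\<in>?D. MN.PP.X K)"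
    unfolding A sum.union_disjoint[OF f(1,2) d(1)] sum.union_disjoint[OF f(3,4) d(2)] ..
  have "(\<Sum>K\<in>?D. MN.PP.X K * Var H) \<in> idl MN.relS"
  proof (rule idl_sum)
    fix K assume "K \<in> ?D"
    then show "MN.PP.X K * Var H \<in> idl MN.relS" by (intro MN.sr_relS MN.PP.X_Var_incomparable) simp_all
  qed
  from idl_minus[OF idl_mult[OF idl_gen[OF MN.X_relS[OF i]], of "Var H"] this]
  show ?thesis unfolding e by (simp add: algebra_simps sum_distrib_left)
qed

lemma X_low:
  assumes i: "i \<in> F"
  shows "Var H * (\<Sum>K\<in>{K \<in> MF.LR. i \<notin> K}. MN.PP.X K) \<in> idl MN.relS"
proof -
  have "{K \<in> MF.LC. i \<notin> K} = {}" using i by blast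
  moreover have "i \<in> ground M" using i MF.F_sub by blast
  ultimately show ?thesis using X_split[of i] by (simp only: sum.empty add_0_right)
qed

lemma sig_low_X:
  assumes "K \<in> MF.LR"
  shows "subst sig (inl (RR.PP.X K)) = (\<Sum>G'\<in>{G' \<in> flats N. G' \<subseteq> G}. Var (K, G'))"
proof -
  have K: "K \<in> flats M" "K \<subset> F" using assms unfolding MF.LR_eq by blast+
  have "MN.PP.below (Some H) (K, G')" if "G' \<in> flats N" "G' \<subseteq> G" for G'
    using that K MF.F_sub by (auto simp: less_le)
  then have b: "sig (Inl (K, G')) = Var (K, G')" if "G' \<in> flats N" "G' \<subseteq> G" for G'
    using that by (simp only: sig_def sum.case subst_Var gsub_Inl if_True tau'_def)
  have "K \<in> flats (restriction M F) - {ground (restriction M F)}" by (rule assms)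
  then have "RR.PP.X K = (\<Sum>G'\<in>flats (restriction N G). Var (K, G'))"
    unfolding RR.PP.X_def by (rule if_P)
  then have "subst sig (inl (RR.PP.X K)) = (\<Sum>G'\<in>flats (restriction N G). sig (Inl (K, G')))"
    by (simp only: subst_sum subst_Var)
  also have "\<dots> = (\<Sum>G'\<in>{G' \<in> flats N. G' \<subseteq> G}. Var (K, G'))"
    unfolding NG.ground_simps(3) by (rule sum.cong[OF refl]) (use b in blast)
  finally show ?thesis .
qed

text \<open>After multiplication by x_H, the sum X_K of the restricted direct sum and that of the
  full one agree, by \<open>X_Var_below\<close>.\<close>

lemma Var_sig_low_X:
  assumes "K \<in> MF.LR"
  shows "Var H * (subst sig (inl (RR.PP.X K)) - MN.PP.X K) \<in> idl MN.relS"
proof -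
  have "K \<in> flats M - {ground M}" "K < fst H" using MF.LR_L[OF assms] unfolding fst_conv snd_conv by argo+
  from MN.sr_relS[OF MN.PP.X_Var_below[OF this]]
  have "MN.PP.X K * Var H - (\<Sum>G'\<in>{G' \<in> flats N. G' \<subseteq> G}. Var (K, G')) * Var H \<in> idl MN.relS" by (simp only: fst_conv snd_conv)
  from idl_uminus[OF this]
  show ?thesis unfolding sig_low_X[OF assms] minus_diff_eq by (simp only: right_diff_distrib mult.commute)
qed

text \<open>The polynomial \<open>ZM\<close> involves only variables \<open>KV\<close>, which
  \<open>tau'\<close> fixes, so its two substitutions agree.\<close>

lemma sig_X: "L \<in> MF.LC \<Longrightarrow> sig (Inr (Inl L)) = MN.PP.X L + (if L = F then subst sig ZM else 0)"
proof -
  assume L: "L \<in> MF.LC"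
  have "subst sig ZM = subst (MN.PP.gsub (Some H)) ZM" by (simp add: subst_subst sig_def[abs_def] tau'_def ZM_def)
  then show ?thesis using L by (simp only: sig_def tau'_def sum.case if_True subst_simps subst_Var gsub_X split: if_split) simp
qed

lemma sig_X_zero: "L \<notin> MF.LC \<Longrightarrow> sig (Inr (Inl L)) = 0"
  by (simp only: sig_def tau'_def sum.case if_False subst_simps)

lemma tau_X: "subst tau (FV K) = (if K \<in> MF.L then if K \<subset> F then inl (RR.PP.X K) else if F \<subset> K then FV K
    else if K = F then FV F - ZM else 0 else 0)"
  by (simp add: tau_def MF.pb_def gamM_def ZM_def)

text \<open>Multiplied by x_H, \<open>sig\<close> undoes \<open>tau\<close>. At K = F,
  \<open>sig\<close> adds back what \<open>tau\<close> subtracts; for K incomparable to F both terms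
  vanish modulo the relations.\<close>

lemma Var_sig_tau_X: "Var H * (subst sig (tau (Inr (Inl K))) - MN.PP.X K) \<in> idl MN.relS"
proof -
  have t: "tau (Inr (Inl K)) = subst tau (FV K)" by simp
  consider "K \<notin> MF.L" | "K \<in> MF.L" "K \<subset> F" | "K \<in> MF.L" "F \<subset> K" | "K = F" "K \<in> MF.L"
    | "K \<in> MF.L" "\<not> K \<subseteq> F" "\<not> F \<subseteq> K" by blast
  then show ?thesis
  proof cases
    case 1
    then have "MN.PP.X K = 0" unfolding MN.PP.X_def by (rule if_not_P)
    then show ?thesis unfolding t tau_X if_not_P[OF 1] by simp
  next
    case 2
    then have "K \<in> MF.LR" unfolding MF.LR_eq by blast
    from Var_sig_low_X[OF this] show ?thesis unfolding t tau_X if_P[OF 2(1)] if_P[OF 2(2)] .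
  next
    case 3
    then have "K \<in> MF.LC" "K \<noteq> F" by blast+
    then have "sig (Inr (Inl K)) = MN.PP.X K" using sig_X by simp
    moreover have "\<not> K \<subset> F" using 3 by blast
    ultimately show ?thesis unfolding t tau_X if_P[OF 3(1)] if_P[OF 3(2)] by (simp only: subst_Var if_False) simp
  next
    case 4
    then have "K \<in> MF.LC" by blast
    then have "sig (Inr (Inl K)) = MN.PP.X K + subst sig ZM" using sig_X 4 by simp
    then have "subst sig (FV F - ZM) = MN.PP.X K" using 4 by simp
    moreover have "subst tau (FV K) = FV F - ZM" unfolding tau_X if_P[OF 4(2)] using 4(1) by simp
    ultimately show ?thesis unfolding t by simp
  next
    case 5
    then have "subst tau (FV K) = 0" unfolding tau_X by auto
    moreover have "MN.PP.X K * Var H \<in> idl MN.relS"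
      using 5 by (intro MN.sr_relS MN.PP.X_Var_incomparable) simp_all
    ultimately show ?thesis unfolding t using idl_uminus[of "MN.PP.X K * Var H"] by (simp add: mult.commute)
  qed
qed

text \<open>The linear relation for j outside F contains the generator labelled F, whose image
  brings in \<open>ZM\<close>. After multiplication by x_H, \<open>ZM\<close> may be replaced by the
  sum of all X_K with K strictly below F, and this completes the linear relation of the direct sum
  for j.\<close>

lemma Var_sig_relC_X:
  assumes "r \<in> MF.relC"
  shows "Var H * subst sig (inr (inl r)) \<in> idl MN.relS"
proof -
  from assms consider L where "r = Var L" "L \<notin> MF.LC"
    | j where "r = (\<Sum>L\<in>{L \<in> MF.LC. j \<notin> L - F}. Var L)" "j \<in> ground M - F"
    | L L' where "r = Var L * Var L'" "L \<in> MF.LC" "L' \<in> MF.LC" "\<not> L - F \<subseteq> L' - F" "\<not> L' - F \<subseteq> L - F"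
    unfolding MF.relC_eq by blast
  then show ?thesis
  proof cases
    case 1
    then show ?thesis using sig_X_zero[OF 1(2)] by (simp only: 1(1) subst_Var) simp
  next
    case 2
    let ?C = "{L \<in> MF.LC. j \<notin> L}" and ?I = "{K \<in> MF.LR. MF.i0 \<in> K}"
    have C: "{L \<in> MF.LC. j \<notin> L - F} = ?C" using 2(2) by blast
    have fC: "finite ?C" using MF.finite_flats by simp
    have FC: "F \<in> ?C" using MF.F_L 2(2) by blast
    have "subst sig (inr (inl r)) = (\<Sum>L\<in>?C. sig (Inr (Inl L)))"
      unfolding 2(1) C by (simp only: subst_sum subst_Var)
    also have "\<dots> = (\<Sum>L\<in>?C. MN.PP.X L + (if L = F then subst sig ZM else 0))"
      by (rule sum.cong[OF refl], rule sig_X) blast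
    also have "\<dots> = (\<Sum>L\<in>?C. MN.PP.X L) + subst sig ZM"
      unfolding sum.distrib sum.delta[OF fC] if_P[OF FC] ..
    finally have e: "subst sig (inr (inl r)) = (\<Sum>L\<in>?C. MN.PP.X L) + subst sig ZM" .
    have z: "Var H * (subst sig ZM - (\<Sum>K\<in>?I. MN.PP.X K)) \<in> idl MN.relS"
    proof -
      have "Var H * (subst sig ZM - (\<Sum>K\<in>?I. MN.PP.X K)) = (\<Sum>K\<in>?I. Var H * (subst sig (inl (RR.PP.X K)) - MN.PP.X K))"
        unfolding ZM_def subst_sum sum_subtractf[symmetric] sum_distrib_left ..
      also have "\<dots> \<in> idl MN.relS" by (rule idl_sum, rule Var_sig_low_X) blast
      finally show ?thesis .
    qed
    have jLR: "{K \<in> MF.LR. j \<notin> K} = MF.LR" using 2(2) MF.LR_L by blast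
    have s: "Var H * ((\<Sum>K\<in>MF.LR. MN.PP.X K) + (\<Sum>L\<in>?C. MN.PP.X L)) \<in> idl MN.relS"
      using X_split[of j] 2(2) unfolding jLR by blast
    \<comment> \<open>The flats below F that avoid \<open>i0\<close> sum to zero after
      multiplication by x_H, by the linear relation for an element of F.\<close>
    have i: "Var H * ((\<Sum>K\<in>MF.LR. MN.PP.X K) - (\<Sum>K\<in>?I. MN.PP.X K)) \<in> idl MN.relS"
    proof (cases "F = {}")
      case True
      then have LR: "MF.LR = {}" unfolding MF.LR_eq by blast
      show ?thesis unfolding LR by simp
    next
      case False
      have fin: "finite MF.LR" using MF.finite_flats unfolding MF.LR_eq by simp
      have LR: "MF.LR = ?I \<union> {K \<in> MF.LR. MF.i0 \<notin> K}" by blast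
      have "finite ?I" "finite {K \<in> MF.LR. MF.i0 \<notin> K}" by (rule finite_subset[OF _ fin]; blast)+
      then have "(\<Sum>K\<in>?I \<union> {K \<in> MF.LR. MF.i0 \<notin> K}. MN.PP.X K) = (\<Sum>K\<in>?I. MN.PP.X K) + (\<Sum>K\<in>{K \<in> MF.LR. MF.i0 \<notin> K}. MN.PP.X K)"
        by (rule sum.union_disjoint) blast
      then have "(\<Sum>K\<in>MF.LR. MN.PP.X K) - (\<Sum>K\<in>?I. MN.PP.X K) = (\<Sum>K\<in>{K \<in> MF.LR. MF.i0 \<notin> K}. MN.PP.X K)"
        unfolding LR[symmetric] by (simp only: add_diff_cancel_left')
      then show ?thesis using X_low[OF MF.i0[OF False]] by (simp only:)
    qed
    have alg: "h * (c + z) = h * (r + c) + h * (z - y) - h * (r - y)" for h c z r y :: "('a set \<times> 'b set) rat_poly"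
      by (simp add: algebra_simps)
    have "Var H * subst sig (inr (inl r)) = Var H * ((\<Sum>K\<in>MF.LR. MN.PP.X K) + (\<Sum>L\<in>?C. MN.PP.X L))
      + Var H * (subst sig ZM - (\<Sum>K\<in>?I. MN.PP.X K)) - Var H * ((\<Sum>K\<in>MF.LR. MN.PP.X K) - (\<Sum>K\<in>?I. MN.PP.X K))"
      unfolding e by (rule alg)
    then show ?thesis using idl_minus[OF idl_add[OF s z] i] by (simp only:)
  next
    case 3
    have "L \<noteq> F" "L' \<noteq> F" using 3 by blast+
    then have e: "sig (Inr (Inl L)) = MN.PP.X L" "sig (Inr (Inl L')) = MN.PP.X L'" using sig_X 3(2,3) by simp_all
    have "\<not> L \<le> L'" "\<not> L' \<le> L" using 3(4,5) by blast+
    from idl_mult[OF MN.sr_relS[OF MN.PP.X_incomparable[OF this]]]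
    show ?thesis unfolding 3(1) by (simp only: subst_simps subst_Var e)
  qed
qed

lemma Var_sig_lin_X:
  assumes i: "i \<in> F"
  shows "Var H * subst sig (inl (\<Sum>K\<in>{K \<in> flats (restriction M F). i \<notin> K}. RR.PP.X K)) \<in> idl MN.relS"
proof -
  let ?B = "{K \<in> MF.LR. i \<notin> K}"
  have B: "{K \<in> flats (restriction M F). i \<notin> K} = ?B" using i unfolding MF.ground_simps by blast
  have "Var H * subst sig (inl (\<Sum>K\<in>?B. RR.PP.X K)) = (\<Sum>K\<in>?B. Var H * (subst sig (inl (RR.PP.X K)) - MN.PP.X K))
      + Var H * (\<Sum>K\<in>?B. MN.PP.X K)"
    unfolding subst_sum by (simp only: sum_distrib_left right_diff_distrib sum_subtractf diff_add_cancel)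
  moreover have "(\<Sum>K\<in>?B. Var H * (subst sig (inl (RR.PP.X K)) - MN.PP.X K)) \<in> idl MN.relS"
    by (rule idl_sum, rule Var_sig_low_X) blast
  ultimately show ?thesis unfolding B using idl_add[OF _ X_low[OF i]] by (simp only:)
qed

lemma tau_tau'_X: "subst tau (tau' (Inr (Inl L))) - FV L \<in> idl relW"
proof (cases "L \<in> MF.LC")
  case False
  then have "Var L \<in> MF.relC" unfolding MF.relC_eq by blast
  then have "inr (inl (Var L)) \<in> idl relW" by (intro idl_gen) blast
  then have "FV L \<in> idl relW" by (simp only: subst_Var)
  then show ?thesis using idl_uminus by (simp only: tau'_def sum.case if_not_P[OF False] subst_simps) (simp add: idl_uminus)
next
  case True
  then have L: "L \<in> MF.L" "F \<subseteq> L" by blast+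
  show ?thesis
  proof (cases "L = F")
    case True
    have "subst tau ZM = ZM" by (simp add: ZM_def subst_subst tau_def)
    moreover have "subst tau (FV F) = FV F - ZM" unfolding tau_X if_P[OF MF.F_L] by simp
    moreover have "tau' (Inr (Inl L)) = FV F + ZM"
      unfolding tau'_def sum.case if_P[OF \<open>L \<in> MF.LC\<close>] if_P[OF True] by (rule refl)
    ultimately have "subst tau (tau' (Inr (Inl L))) = FV L" using True by (simp only: subst_simps diff_add_cancel)
    then show ?thesis by simp
  next
    case False
    then have "tau' (Inr (Inl L)) = FV L"
      using \<open>L \<in> MF.LC\<close> by (simp only: tau'_def sum.case if_True if_False)
    moreover have "F \<subset> L" "\<not> L \<subset> F" using False L by blast+
    then have "subst tau (FV L) = FV L" unfolding tau_X if_P[OF L(1)] by (simp only: if_True if_False)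
    ultimately show ?thesis by simp
  qed
qed

lemma tau_rels_X:
  assumes "F' \<in> MF.L"
  shows "F' \<subset> F \<Longrightarrow> subst tau (FV F') = (\<Sum>G'\<in>{G' \<in> flats N. G' \<subseteq> G}. Var (Inl (F', G')))"
    and "\<not> F' \<subseteq> F \<Longrightarrow> \<not> F \<subseteq> F' \<Longrightarrow> subst tau (FV F') = 0"
proof -
  assume "F' \<subset> F"
  then have "F' \<in> flats (restriction M F) - {ground (restriction M F)}" using assms unfolding MF.ground_simps by blast
  then have "RR.PP.X F' = (\<Sum>G'\<in>flats (restriction N G). Var (F', G'))"
    unfolding RR.PP.X_def by (rule if_P)
  then show "subst tau (FV F') = (\<Sum>G'\<in>{G' \<in> flats N. G' \<subseteq> G}. Var (Inl (F', G')))"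
    unfolding tau_X if_P[OF assms] if_P[OF \<open>F' \<subset> F\<close>] NG.ground_simps(3) by (simp only: subst_sum subst_Var)
next
  assume "\<not> F' \<subseteq> F" "\<not> F \<subseteq> F'"
  then show "subst tau (FV F') = 0" unfolding tau_X by auto
qed

section \<open>The same computations for the second factor\<close>

lemma Y_split:
  assumes i: "i \<in> ground N"
  shows "Var H * ((\<Sum>K\<in>{K \<in> NG.LR. i \<notin> K}. MN.PP.Y K) + (\<Sum>K\<in>{K \<in> NG.LC. i \<notin> K}. MN.PP.Y K)) \<in> idl MN.relS"
proof -
  let ?A = "{K \<in> flats N. i \<notin> K}"
  let ?B = "{K \<in> NG.LR. i \<notin> K}" and ?C = "{K \<in> NG.LC. i \<notin> K}" and ?D = "{K \<in> flats N. i \<notin> K \<and> \<not> K \<subseteq> G \<and> \<not> G \<subseteq> K}"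
  have A: "?A = ?B \<union> ?C \<union> ?D" unfolding NG.LR_eq using i by blast
  have fin: "finite ?A" using NG.finite_flats by simp
  then have f: "finite (?B \<union> ?C)" "finite ?D" "finite ?B" "finite ?C" unfolding A by (simp_all only: finite_Un)
  have d: "(?B \<union> ?C) \<inter> ?D = {}" "?B \<inter> ?C = {}" unfolding NG.LR_eq by blast+
  have e: "(\<Sum>K\<in>?A. MN.PP.Y K) = (\<Sum>K\<in>?B. MN.PP.Y K) + (\<Sum>K\<in>?C. MN.PP.Y K) + (\<Sum>K\<in>?D. MN.PP.Y K)"
    unfolding A sum.union_disjoint[OF f(1,2) d(1)] sum.union_disjoint[OF f(3,4) d(2)] ..
  have "(\<Sum>K\<in>?D. MN.PP.Y K * Var H) \<in> idl MN.relS"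
  proof (rule idl_sum)
    fix K assume "K \<in> ?D"
    then show "MN.PP.Y K * Var H \<in> idl MN.relS" by (intro MN.sr_relS MN.PP.Y_Var_incomparable) simp_all
  qed
  from idl_minus[OF idl_mult[OF idl_gen[OF MN.Y_relS[OF i]], of "Var H"] this]
  show ?thesis unfolding e by (simp add: algebra_simps sum_distrib_left)
qed

lemma Y_low:
  assumes i: "i \<in> G"
  shows "Var H * (\<Sum>K\<in>{K \<in> NG.LR. i \<notin> K}. MN.PP.Y K) \<in> idl MN.relS"
proof -
  have "{K \<in> NG.LC. i \<notin> K} = {}" using i by blast
  moreover have "i \<in> ground N" using i NG.F_sub by blast
  ultimately show ?thesis using Y_split[of i] by (simp only: sum.empty add_0_right)
qed

lemma sig_low_Y:
  assumes "K \<in> NG.LR"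
  shows "subst sig (inl (RR.PP.Y K)) = (\<Sum>F'\<in>{F' \<in> flats M. F' \<subseteq> F}. Var (F', K))"
proof -
  have K: "K \<in> flats N" "K \<subset> G" using assms unfolding NG.LR_eq by blast+
  have "MN.PP.below (Some H) (F', K)" if "F' \<in> flats M" "F' \<subseteq> F" for F'
    using that K NG.F_sub by (auto simp: less_le)
  then have b: "sig (Inl (F', K)) = Var (F', K)" if "F' \<in> flats M" "F' \<subseteq> F" for F'
    using that by (simp only: sig_def sum.case subst_Var gsub_Inl if_True tau'_def)
  have "K \<in> flats (restriction N G) - {ground (restriction N G)}" by (rule assms)
  then have "RR.PP.Y K = (\<Sum>F'\<in>flats (restriction M F). Var (F', K))"
    unfolding RR.PP.Y_def by (rule if_P)
  then have "subst sig (inl (RR.PP.Y K)) = (\<Sum>F'\<in>flats (restriction M F). sig (Inl (F', K)))"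
    by (simp only: subst_sum subst_Var)
  also have "\<dots> = (\<Sum>F'\<in>{F' \<in> flats M. F' \<subseteq> F}. Var (F', K))"
    unfolding MF.ground_simps(3) by (rule sum.cong[OF refl]) (use b in blast)
  finally show ?thesis .
qed

lemma Var_sig_low_Y:
  assumes "K \<in> NG.LR"
  shows "Var H * (subst sig (inl (RR.PP.Y K)) - MN.PP.Y K) \<in> idl MN.relS"
proof -
  have "K \<in> flats N - {ground N}" "K < snd H" using NG.LR_L[OF assms] unfolding fst_conv snd_conv by argo+
  from MN.sr_relS[OF MN.PP.Y_Var_below[OF this]]
  have "MN.PP.Y K * Var H - (\<Sum>F'\<in>{F' \<in> flats M. F' \<subseteq> F}. Var (F', K)) * Var H \<in> idl MN.relS" by (simp only: fst_conv snd_conv)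
  from idl_uminus[OF this]
  show ?thesis unfolding sig_low_Y[OF assms] minus_diff_eq by (simp only: right_diff_distrib mult.commute)
qed

lemma sig_Y: "L \<in> NG.LC \<Longrightarrow> sig (Inr (Inr L)) = MN.PP.Y L + (if L = G then subst sig ZN else 0)"
proof -
  assume L: "L \<in> NG.LC"
  have "subst sig ZN = subst (MN.PP.gsub (Some H)) ZN" by (simp add: subst_subst sig_def[abs_def] tau'_def ZN_def)
  then show ?thesis using L by (simp only: sig_def tau'_def sum.case if_True subst_simps subst_Var gsub_Y split: if_split) simp
qed

lemma sig_Y_zero: "L \<notin> NG.LC \<Longrightarrow> sig (Inr (Inr L)) = 0"
  by (simp only: sig_def tau'_def sum.case if_False subst_simps)

lemma tau_Y: "subst tau (GV K) = (if K \<in> NG.L then if K \<subset> G then inl (RR.PP.Y K) else if G \<subset> K then GV K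
    else if K = G then GV G - ZN else 0 else 0)"
  by (simp add: tau_def NG.pb_def gamN_def ZN_def)

lemma Var_sig_tau_Y: "Var H * (subst sig (tau (Inr (Inr K))) - MN.PP.Y K) \<in> idl MN.relS"
proof -
  have t: "tau (Inr (Inr K)) = subst tau (GV K)" by simp
  consider "K \<notin> NG.L" | "K \<in> NG.L" "K \<subset> G" | "K \<in> NG.L" "G \<subset> K" | "K = G" "K \<in> NG.L"
    | "K \<in> NG.L" "\<not> K \<subseteq> G" "\<not> G \<subseteq> K" by blast
  then show ?thesis
  proof cases
    case 1
    then have "MN.PP.Y K = 0" unfolding MN.PP.Y_def by (rule if_not_P)
    then show ?thesis unfolding t tau_Y if_not_P[OF 1] by simp
  next
    case 2
    then have "K \<in> NG.LR" unfolding NG.LR_eq by blast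
    from Var_sig_low_Y[OF this] show ?thesis unfolding t tau_Y if_P[OF 2(1)] if_P[OF 2(2)] .
  next
    case 3
    then have "K \<in> NG.LC" "K \<noteq> G" by blast+
    then have "sig (Inr (Inr K)) = MN.PP.Y K" using sig_Y by simp
    moreover have "\<not> K \<subset> G" using 3 by blast
    ultimately show ?thesis unfolding t tau_Y if_P[OF 3(1)] if_P[OF 3(2)] by (simp only: subst_Var if_False) simp
  next
    case 4
    then have "K \<in> NG.LC" by blast
    then have "sig (Inr (Inr K)) = MN.PP.Y K + subst sig ZN" using sig_Y 4 by simp
    then have "subst sig (GV G - ZN) = MN.PP.Y K" using 4 by simp
    moreover have "subst tau (GV K) = GV G - ZN" unfolding tau_Y if_P[OF 4(2)] using 4(1) by simp
    ultimately show ?thesis unfolding t by simp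
  next
    case 5
    then have "subst tau (GV K) = 0" unfolding tau_Y by auto
    moreover have "MN.PP.Y K * Var H \<in> idl MN.relS"
      using 5 by (intro MN.sr_relS MN.PP.Y_Var_incomparable) simp_all
    ultimately show ?thesis unfolding t using idl_uminus[of "MN.PP.Y K * Var H"] by (simp add: mult.commute)
  qed
qed

lemma Var_sig_relC_Y:
  assumes "r \<in> NG.relC"
  shows "Var H * subst sig (inr (inr r)) \<in> idl MN.relS"
proof -
  from assms consider L where "r = Var L" "L \<notin> NG.LC"
    | j where "r = (\<Sum>L\<in>{L \<in> NG.LC. j \<notin> L - G}. Var L)" "j \<in> ground N - G"
    | L L' where "r = Var L * Var L'" "L \<in> NG.LC" "L' \<in> NG.LC" "\<not> L - G \<subseteq> L' - G" "\<not> L' - G \<subseteq> L - G"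
    unfolding NG.relC_eq by blast
  then show ?thesis
  proof cases
    case 1
    then show ?thesis using sig_Y_zero[OF 1(2)] by (simp only: 1(1) subst_Var) simp
  next
    case 2
    let ?C = "{L \<in> NG.LC. j \<notin> L}" and ?I = "{K \<in> NG.LR. NG.i0 \<in> K}"
    have C: "{L \<in> NG.LC. j \<notin> L - G} = ?C" using 2(2) by blast
    have fC: "finite ?C" using NG.finite_flats by simp
    have FC: "G \<in> ?C" using NG.F_L 2(2) by blast
    have "subst sig (inr (inr r)) = (\<Sum>L\<in>?C. sig (Inr (Inr L)))"
      unfolding 2(1) C by (simp only: subst_sum subst_Var)
    also have "\<dots> = (\<Sum>L\<in>?C. MN.PP.Y L + (if L = G then subst sig ZN else 0))"
      by (rule sum.cong[OF refl], rule sig_Y) blast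
    also have "\<dots> = (\<Sum>L\<in>?C. MN.PP.Y L) + subst sig ZN"
      unfolding sum.distrib sum.delta[OF fC] if_P[OF FC] ..
    finally have e: "subst sig (inr (inr r)) = (\<Sum>L\<in>?C. MN.PP.Y L) + subst sig ZN" .
    have z: "Var H * (subst sig ZN - (\<Sum>K\<in>?I. MN.PP.Y K)) \<in> idl MN.relS"
    proof -
      have "Var H * (subst sig ZN - (\<Sum>K\<in>?I. MN.PP.Y K)) = (\<Sum>K\<in>?I. Var H * (subst sig (inl (RR.PP.Y K)) - MN.PP.Y K))"
        unfolding ZN_def subst_sum sum_subtractf[symmetric] sum_distrib_left ..
      also have "\<dots> \<in> idl MN.relS" by (rule idl_sum, rule Var_sig_low_Y) blast
      finally show ?thesis .
    qed
    have jLR: "{K \<in> NG.LR. j \<notin> K} = NG.LR" using 2(2) NG.LR_L by blast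
    have s: "Var H * ((\<Sum>K\<in>NG.LR. MN.PP.Y K) + (\<Sum>L\<in>?C. MN.PP.Y L)) \<in> idl MN.relS"
      using Y_split[of j] 2(2) unfolding jLR by blast
    have i: "Var H * ((\<Sum>K\<in>NG.LR. MN.PP.Y K) - (\<Sum>K\<in>?I. MN.PP.Y K)) \<in> idl MN.relS"
    proof (cases "G = {}")
      case True
      then have LR: "NG.LR = {}" unfolding NG.LR_eq by blast
      show ?thesis unfolding LR by simp
    next
      case False
      have fin: "finite NG.LR" using NG.finite_flats unfolding NG.LR_eq by simp
      have LR: "NG.LR = ?I \<union> {K \<in> NG.LR. NG.i0 \<notin> K}" by blast
      have "finite ?I" "finite {K \<in> NG.LR. NG.i0 \<notin> K}" by (rule finite_subset[OF _ fin]; blast)+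
      then have "(\<Sum>K\<in>?I \<union> {K \<in> NG.LR. NG.i0 \<notin> K}. MN.PP.Y K) = (\<Sum>K\<in>?I. MN.PP.Y K) + (\<Sum>K\<in>{K \<in> NG.LR. NG.i0 \<notin> K}. MN.PP.Y K)"
        by (rule sum.union_disjoint) blast
      then have "(\<Sum>K\<in>NG.LR. MN.PP.Y K) - (\<Sum>K\<in>?I. MN.PP.Y K) = (\<Sum>K\<in>{K \<in> NG.LR. NG.i0 \<notin> K}. MN.PP.Y K)"
        unfolding LR[symmetric] by (simp only: add_diff_cancel_left')
      then show ?thesis using Y_low[OF NG.i0[OF False]] by (simp only:)
    qed
    have alg: "h * (c + z) = h * (r + c) + h * (z - y) - h * (r - y)" for h c z r y :: "('a set \<times> 'b set) rat_poly"
      by (simp add: algebra_simps)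
    have "Var H * subst sig (inr (inr r)) = Var H * ((\<Sum>K\<in>NG.LR. MN.PP.Y K) + (\<Sum>L\<in>?C. MN.PP.Y L))
      + Var H * (subst sig ZN - (\<Sum>K\<in>?I. MN.PP.Y K)) - Var H * ((\<Sum>K\<in>NG.LR. MN.PP.Y K) - (\<Sum>K\<in>?I. MN.PP.Y K))"
      unfolding e by (rule alg)
    then show ?thesis using idl_minus[OF idl_add[OF s z] i] by (simp only:)
  next
    case 3
    have "L \<noteq> G" "L' \<noteq> G" using 3 by blast+
    then have e: "sig (Inr (Inr L)) = MN.PP.Y L" "sig (Inr (Inr L')) = MN.PP.Y L'" using sig_Y 3(2,3) by simp_all
    have "\<not> L \<le> L'" "\<not> L' \<le> L" using 3(4,5) by blast+
    from idl_mult[OF MN.sr_relS[OF MN.PP.Y_incomparable[OF this]]]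
    show ?thesis unfolding 3(1) by (simp only: subst_simps subst_Var e)
  qed
qed

lemma Var_sig_lin_Y:
  assumes i: "i \<in> G"
  shows "Var H * subst sig (inl (\<Sum>K\<in>{K \<in> flats (restriction N G). i \<notin> K}. RR.PP.Y K)) \<in> idl MN.relS"
proof -
  let ?B = "{K \<in> NG.LR. i \<notin> K}"
  have B: "{K \<in> flats (restriction N G). i \<notin> K} = ?B" using i unfolding NG.ground_simps by blast
  have "Var H * subst sig (inl (\<Sum>K\<in>?B. RR.PP.Y K)) = (\<Sum>K\<in>?B. Var H * (subst sig (inl (RR.PP.Y K)) - MN.PP.Y K))
      + Var H * (\<Sum>K\<in>?B. MN.PP.Y K)"
    unfolding subst_sum by (simp only: sum_distrib_left right_diff_distrib sum_subtractf diff_add_cancel)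
  moreover have "(\<Sum>K\<in>?B. Var H * (subst sig (inl (RR.PP.Y K)) - MN.PP.Y K)) \<in> idl MN.relS"
    by (rule idl_sum, rule Var_sig_low_Y) blast
  ultimately show ?thesis unfolding B using idl_add[OF _ Y_low[OF i]] by (simp only:)
qed

lemma tau_tau'_Y: "subst tau (tau' (Inr (Inr L))) - GV L \<in> idl relW"
proof (cases "L \<in> NG.LC")
  case False
  then have "Var L \<in> NG.relC" unfolding NG.relC_eq by blast
  then have "inr (inr (Var L)) \<in> idl relW" by (intro idl_gen) blast
  then have "GV L \<in> idl relW" by (simp only: subst_Var)
  then show ?thesis using idl_uminus by (simp only: tau'_def sum.case if_not_P[OF False] subst_simps) (simp add: idl_uminus)
next
  case True
  then have L: "L \<in> NG.L" "G \<subseteq> L" by blast+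
  show ?thesis
  proof (cases "L = G")
    case True
    have "subst tau ZN = ZN" by (simp add: ZN_def subst_subst tau_def)
    moreover have "subst tau (GV G) = GV G - ZN" unfolding tau_Y if_P[OF NG.F_L] by simp
    moreover have "tau' (Inr (Inr L)) = GV G + ZN"
      unfolding tau'_def sum.case if_P[OF \<open>L \<in> NG.LC\<close>] if_P[OF True] by (rule refl)
    ultimately have "subst tau (tau' (Inr (Inr L))) = GV L" using True by (simp only: subst_simps diff_add_cancel)
    then show ?thesis by simp
  next
    case False
    then have "tau' (Inr (Inr L)) = GV L"
      using \<open>L \<in> NG.LC\<close> by (simp only: tau'_def sum.case if_True if_False)
    moreover have "G \<subset> L" "\<not> L \<subset> G" using False L by blast+
    then have "subst tau (GV L) = GV L" unfolding tau_Y if_P[OF L(1)] by (simp only: if_True if_False)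
    ultimately show ?thesis by simp
  qed
qed

lemma tau_rels_Y:
  assumes "G' \<in> NG.L"
  shows "G' \<subset> G \<Longrightarrow> subst tau (GV G') = (\<Sum>F'\<in>{F' \<in> flats M. F' \<subseteq> F}. Var (Inl (F', G')))"
    and "\<not> G' \<subseteq> G \<Longrightarrow> \<not> G \<subseteq> G' \<Longrightarrow> subst tau (GV G') = 0"
proof -
  assume "G' \<subset> G"
  then have "G' \<in> flats (restriction N G) - {ground (restriction N G)}" using assms unfolding NG.ground_simps by blast
  then have "RR.PP.Y G' = (\<Sum>F'\<in>flats (restriction M F). Var (F', G'))"
    unfolding RR.PP.Y_def by (rule if_P)
  then show "subst tau (GV G') = (\<Sum>F'\<in>{F' \<in> flats M. F' \<subseteq> F}. Var (Inl (F', G')))"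
    unfolding tau_Y if_P[OF assms] if_P[OF \<open>G' \<subset> G\<close>] MF.ground_simps(3) by (simp only: subst_sum subst_Var)
next
  assume "\<not> G' \<subseteq> G" "\<not> G \<subseteq> G'"
  then show "subst tau (GV G') = 0" unfolding tau_Y by auto
qed

text \<open>Hence \<open>sig\<close> followed by multiplication by x_H gives a well-defined additive
  map from the summand to the Chow ring of the direct sum.\<close>

lemma Var_sig_relW:
  assumes "s \<in> relW"
  shows "Var H * subst sig s \<in> idl MN.relS"
proof -
  from assms consider r where "r \<in> RR.relS" "s = inl r" | r where "r \<in> MF.relC" "s = inr (inl r)"
    | r where "r \<in> NG.relC" "s = inr (inr r)" by blast
  then show ?thesis
  proof cases
    case 1
    have Inl: "subst sig (inl p) = subst (\<lambda>K. sig (Inl K)) p" for p by (simp only: subst_subst subst_Var)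
    from 1(1) show ?thesis
    proof (cases rule: RR.relS_cases)
      case a: 1
      then consider K where "r = Var K" "K \<notin> RR.PP.PQ" | K K' where "r = Var K * Var K'" "\<not> K \<le> K'" "\<not> K' \<le> K"
        unfolding RR.PP.sr_def by blast
      then show ?thesis
      proof cases
        case b: 1
        then have "\<not> MN.PP.below (Some H) K" unfolding PQ_R by simp
        then show ?thesis unfolding 1(2) Inl b(1) subst_Var sig_Inl by (simp only: if_False) simp
      next
        case b: 2
        have "Var K * Var K' \<in> idl MN.relS" by (rule MN.sr_relS[OF MN.PP.sr_incomparable[OF b(2,3)]])
        then have "Var H * (Var K * Var K') \<in> idl MN.relS" by (rule idl_mult)
        then show ?thesis unfolding 1(2) Inl b(1) subst_simps subst_Var sig_Inl
          by (cases "MN.PP.below (Some H) K"; cases "MN.PP.below (Some H) K'")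
            (simp_all only: if_True if_False mult_zero_left mult_zero_right idl.zero)
      qed
    next
      case (2 i)
      then have "i \<in> F" unfolding MF.ground_simps by blast
      from Var_sig_lin_X[OF this] show ?thesis unfolding 1(2) 2(2) .
    next
      case (3 j)
      then have "j \<in> G" unfolding NG.ground_simps by blast
      from Var_sig_lin_Y[OF this] show ?thesis unfolding 1(2) 3(2) .
    qed
  next
    case 2
    then show ?thesis using Var_sig_relC_X by blast
  next
    case 3
    then show ?thesis using Var_sig_relC_Y by blast
  qed
qed

text \<open>Injectivity on the part with label H: multiplied by x_H, \<open>sig\<close> after
  \<open>tau\<close> agrees with \<open>gsub\<close>, so mapping the summand back recovers
  \<open>gmap\<close>.\<close>

lemma gmap_kernel:
  assumes "chW (subst tau u) = \<zero>\<^bsub>W\<^esub>"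
  shows "MN.PP.gmap (Some H) u \<in> idl MN.relS"
proof -
  have "subst tau u \<in> idl relW" using assms unfolding pres.kernel[OF pres_W] .
  then have "Var H * subst sig (subst tau u) \<in> idl MN.relS" by (rule idl_mult_subst) (rule Var_sig_relW)
  then have 1: "Var H * subst (\<lambda>v. subst sig (tau v)) u \<in> idl MN.relS" unfolding subst_subst .
  have "Var H * (subst (\<lambda>v. subst sig (tau v)) u - subst (MN.PP.gsub (Some H)) u) \<in> idl MN.relS"
  proof (rule subst_cong_idl)
    fix v :: "('a set \<times> 'b set) + ('a set + 'b set)"
    consider K where "v = Inl K" | K where "v = Inr (Inl K)" | K where "v = Inr (Inr K)"
      by (metis sum.exhaust)
    then show "Var H * (subst (\<lambda>v. subst sig (tau v)) (Var v) - subst (MN.PP.gsub (Some H)) (Var v)) \<in> idl MN.relS"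
    proof cases
      case 1
      have "subst sig (tau v) = MN.PP.gsub (Some H) v" unfolding 1 gsub_Inl sig_Inl[symmetric] by (simp add: tau_def)
      then show ?thesis by (simp only: subst_Var diff_self mult_zero_right idl.zero)
    next
      case 2
      show ?thesis unfolding subst_Var 2 gsub_X by (rule Var_sig_tau_X)
    next
      case 3
      show ?thesis unfolding subst_Var 3 gsub_Y by (rule Var_sig_tau_Y)
    qed
  qed
  from idl_minus[OF 1 this] show ?thesis
    unfolding MN.PP.gmap_def MN.PP.base.simps by (simp only: right_diff_distrib) simp
qed

text \<open>Shows that the polynomials in the image of \<open>tau\<close> still reach every element
  of the summand: \<open>tau'\<close> adds \<open>ZM\<close> or \<open>ZN\<close> exactly where
  \<open>tau\<close> subtracts it.\<close>

lemma tau_tau': "chW (subst tau (subst tau' p)) = chW p"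
proof -
  have "1 * (subst (\<lambda>v. subst tau (tau' v)) p - subst Var p) \<in> idl relW"
  proof (rule subst_cong_idl)
    fix v :: "('a set \<times> 'b set) + ('a set + 'b set)"
    consider K where "v = Inl K" | K where "v = Inr (Inl K)" | K where "v = Inr (Inr K)"
      by (metis sum.exhaust)
    then show "1 * (subst (\<lambda>v. subst tau (tau' v)) (Var v) - subst Var (Var v)) \<in> idl relW"
    proof cases
      case 1
      have "subst tau (tau' v) = Var v" unfolding 1 by (simp add: tau_def tau'_def)
      then show ?thesis by (simp only: subst_Var diff_self mult_zero_right idl.zero)
    next
      case 2
      show ?thesis unfolding subst_Var 2 mult_1_left by (rule tau_tau'_X)
    next
      case 3
      show ?thesis unfolding subst_Var 3 mult_1_left by (rule tau_tau'_Y)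
    qed
  qed
  moreover have "subst Var p = p" by (rule subst_ident) (rule refl)
  ultimately have "subst tau (subst tau' p) - p \<in> idl relW" unfolding subst_subst mult_1_left by (simp only:)
  then show ?thesis unfolding pres.eq_iff[OF pres_W] .
qed

lemma tau'_homp: "tau' v \<in> homp 1"
proof -
  have R: "inl (RR.PP.X K) \<in> homp 1" "inl (RR.PP.Y K') \<in> homp 1" for K K'
    by (rule subst_homp[of "\<lambda>v. Var (Inl v)", OF homp_Var RR.PP.X_homp] subst_homp[of "\<lambda>v. Var (Inl v)", OF homp_Var RR.PP.Y_homp])+
  have Z: "ZM \<in> homp 1" "ZN \<in> homp 1" unfolding ZM_def ZN_def by (rule homp_sum, rule R)+
  consider K where "v = Inl K" | K where "v = Inr (Inl K)" | K where "v = Inr (Inr K)"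
    by (metis sum.exhaust)
  then show ?thesis
  proof cases
    case 1
    show ?thesis unfolding 1 tau'_def sum.case by (rule homp_Var)
  next
    case 2
    show ?thesis unfolding 2 tau'_def sum.case by (auto intro!: homp_add homp_Var Z homp_zero simp del: One_nat_def)
  next
    case 3
    show ?thesis unfolding 3 tau'_def sum.case by (auto intro!: homp_add homp_Var Z homp_zero simp del: One_nat_def)
  qed
qed

lemma tau_homp: "tau v \<in> homp 1"
proof -
  have R: "inl (RR.PP.X K) \<in> homp 1" "inl (RR.PP.Y K') \<in> homp 1" for K K'
    by (rule subst_homp[of "\<lambda>v. Var (Inl v)", OF homp_Var RR.PP.X_homp] subst_homp[of "\<lambda>v. Var (Inl v)", OF homp_Var RR.PP.Y_homp])+
  have Z: "ZM \<in> homp 1" "ZN \<in> homp 1" unfolding ZM_def ZN_def by (rule homp_sum, rule R)+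
  consider K where "v = Inl K" | K where "v = Inr (Inl K)" | K where "v = Inr (Inr K)"
    by (metis sum.exhaust)
  then show ?thesis
  proof cases
    case 1
    show ?thesis unfolding 1 tau_def sum.case by (rule homp_Var)
  next
    case 2
    have "tau v = subst tau (FV K)" unfolding 2 by (simp only: subst_Var)
    then show ?thesis unfolding tau_X by (auto intro!: homp_minus homp_Var Z homp_zero R simp del: One_nat_def)
  next
    case 3
    have "tau v = subst tau (GV K)" unfolding 3 by (simp only: subst_Var)
    then show ?thesis unfolding tau_Y by (auto intro!: homp_minus homp_Var Z homp_zero R simp del: One_nat_def)
  qed
qed

lemma tau_relA:
  assumes "s \<in> MN.relA"
  shows "subst tau (inr s) \<in> idl relW"
proof -
  have "MN.chA s = \<zero>\<^bsub>MN.A\<^esub>" unfolding pres.kernel[OF MN.pres_A] by (rule idl_gen[OF assms])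
  then have "chW (subst tau (inr s)) = \<zero>\<^bsub>W\<^esub>" using alg_hom.zero[OF act] act_eval[of s] by (simp only:)
  then show ?thesis unfolding pres.kernel[OF pres_W] .
qed

text \<open>Relations among the \<open>FV\<close> or among the \<open>GV\<close> follow from
  \<open>tau_relA\<close>, and those among the \<open>KV\<close> are relations of the restricted
  sum. The extra relations are mapped to 0 as polynomials.\<close>

lemma tau_rels:
  assumes "s \<in> MN.PP.rels (Some H)"
  shows "subst tau s \<in> idl relW"
proof -
  have R: "inl r \<in> idl relW" if "r \<in> idl RR.relS" for r
  proof (rule idl_subst[OF that])
    show "inl s \<in> idl relW" if "s \<in> RR.relS" for s using that by (intro idl_gen) blast
  qed
  have relM: "subst tau (inr (inl r)) \<in> idl relW" if "r \<in> MN.relM" for r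
    using tau_relA[of "inl r"] that by blast
  have relN: "subst tau (inr (inr r)) \<in> idl relW" if "r \<in> MN.relN" for r
    using tau_relA[of "inr r"] that by blast
  have Inl: "subst tau (Var (Inl K)) = inl (Var K)" for K by (simp add: tau_def)
  from assms show ?thesis
  proof (cases rule: MN.PP.rels_Some_cases)
    case (1 K)
    then have "K \<notin> RR.PP.PQ" unfolding PQ_R by simp
    then have "Var K \<in> RR.PP.sr" unfolding RR.PP.sr_def by (intro UnI1 CollectI exI[of _ K] conjI refl)
    then show ?thesis unfolding 1(1) Inl by (intro R RR.sr_relS idl_gen)
  next
    case (2 K)
    then have "Var K \<in> MN.relM" unfolding MN.relM_eq by blast
    from relM[OF this] show ?thesis unfolding 2(1) by (simp only: subst_Var)
  next
    case (3 K)
    then have "Var K \<in> MN.relN" unfolding MN.relN_eq by blast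
    from relN[OF this] show ?thesis unfolding 3(1) by (simp only: subst_Var)
  next
    case (4 K K')
    have "inl (Var K * Var K') \<in> idl relW" by (rule R[OF RR.sr_relS[OF RR.PP.sr_incomparable[OF 4(2,3)]]])
    then show ?thesis unfolding 4(1) subst_simps Inl .
  next
    case (5 K K')
    then have "Var K * Var K' \<in> MN.relM" unfolding MN.relM_eq by blast
    from relM[OF this] show ?thesis unfolding 5(1) by (simp only: subst_Var subst_simps)
  next
    case (6 K K')
    then have "Var K * Var K' \<in> MN.relN" unfolding MN.relN_eq by blast
    from relN[OF this] show ?thesis unfolding 6(1) by (simp only: subst_Var subst_simps)
  next
    case (7 K)
    show ?thesis unfolding 7(1) tau_rels_X(2)[OF 7(2,4,3)] by (rule idl.zero)
  next
    case (8 K)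
    show ?thesis unfolding 8(1) tau_rels_Y(2)[OF 8(2,4,3)] by (rule idl.zero)
  next
    case (9 K)
    show ?thesis unfolding 9(1) subst_minus tau_rels_X(1)[OF 9(2,3)] by (simp add: tau_def idl.zero)
  next
    case (10 K)
    show ?thesis unfolding 10(1) subst_minus tau_rels_Y(1)[OF 10(2,3)] by (simp add: tau_def idl.zero)
  qed
qed

end

section \<open>Transport of graded structures\<close>

text \<open>The preservation of zero is listed among the assumptions because the target is not yet
  known to be a group.\<close>

locale graded_transport = A: graded_group A
  for A :: "('r, 'm) graded" and B :: "('s, 'n) graded" and f :: "'m \<Rightarrow> 'n" +
  assumes bij: "bij_betw f (carrier A) (carrier B)"
    and map_add: "x \<in> carrier A \<Longrightarrow> y \<in> carrier A \<Longrightarrow> f (x \<oplus>\<^bsub>A\<^esub> y) = f x \<oplus>\<^bsub>B\<^esub> f y"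
    and map_zero: "f \<zero>\<^bsub>A\<^esub> = \<zero>\<^bsub>B\<^esub>"
    and map_homog: "f ` homog A k = homog B k"
begin

lemma image: "carrier B = f ` carrier A"
  using bij by (simp add: bij_betw_def)

lemma f_closed: "x \<in> carrier A \<Longrightarrow> f x \<in> carrier B"
  by (simp add: image)

lemma f_eq: "x \<in> carrier A \<Longrightarrow> y \<in> carrier A \<Longrightarrow> f x = f y \<longleftrightarrow> x = y"
  using bij by (auto simp: bij_betw_def dest: inj_onD)

lemma homog_closed: "x \<in> homog A k \<Longrightarrow> x \<in> carrier A"
  using additive_subgroup.a_subset[OF A.homog_subgroup] by blast

lemma abelian_group_B: "abelian_group B"
proof (rule abelian_groupI)
  show "\<zero>\<^bsub>B\<^esub> \<in> carrier B" using f_closed[OF A.zero_closed] by (simp only: map_zero)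
  fix x assume x: "x \<in> carrier B"
  then obtain u where u: "u \<in> carrier A" "x = f u" unfolding image by blast
  show "\<zero>\<^bsub>B\<^esub> \<oplus>\<^bsub>B\<^esub> x = x"
    unfolding u(2) map_zero[symmetric] map_add[OF A.zero_closed u(1), symmetric] A.l_zero[OF u(1)] ..
  have "f (\<ominus>\<^bsub>A\<^esub> u) \<oplus>\<^bsub>B\<^esub> x = \<zero>\<^bsub>B\<^esub>"
    unfolding u(2) map_add[OF A.a_inv_closed[OF u(1)] u(1), symmetric] A.l_neg[OF u(1)] map_zero ..
  then show "\<exists>y\<in>carrier B. y \<oplus>\<^bsub>B\<^esub> x = \<zero>\<^bsub>B\<^esub>" using f_closed[OF A.a_inv_closed[OF u(1)]] by blast
  fix y assume "y \<in> carrier B"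
  then obtain v where v: "v \<in> carrier A" "y = f v" unfolding image by blast
  show "x \<oplus>\<^bsub>B\<^esub> y \<in> carrier B"
    unfolding u(2) v(2) map_add[OF u(1) v(1), symmetric] by (rule f_closed[OF A.a_closed[OF u(1) v(1)]])
  show "x \<oplus>\<^bsub>B\<^esub> y = y \<oplus>\<^bsub>B\<^esub> x"
    unfolding u(2) v(2) map_add[OF u(1) v(1), symmetric] map_add[OF v(1) u(1), symmetric] A.a_comm[OF u(1) v(1)] ..
  fix z assume "z \<in> carrier B"
  then obtain w where w: "w \<in> carrier A" "z = f w" unfolding image by blast
  show "x \<oplus>\<^bsub>B\<^esub> y \<oplus>\<^bsub>B\<^esub> z = x \<oplus>\<^bsub>B\<^esub> (y \<oplus>\<^bsub>B\<^esub> z)"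
    unfolding u(2) v(2) w(2) map_add[OF u(1) v(1), symmetric] map_add[OF v(1) w(1), symmetric]
      map_add[OF A.a_closed[OF u(1) v(1)] w(1), symmetric] map_add[OF u(1) A.a_closed[OF v(1) w(1)], symmetric]
      A.a_assoc[OF u(1) v(1) w(1)] ..
qed

sublocale B: abelian_group B
  by (rule abelian_group_B)

lemma map_sum:
  assumes "finite K" "\<And>k. k \<in> K \<Longrightarrow> c k \<in> carrier A"
  shows "f (\<Oplus>\<^bsub>A\<^esub>k\<in>K. c k) = (\<Oplus>\<^bsub>B\<^esub>k\<in>K. f (c k))"
  using assms
proof (induction K rule: finite_induct)
  case empty
  then show ?case by (simp add: map_zero)
next
  case (insert k K)
  then have c: "c k \<in> carrier A" "c \<in> K \<rightarrow> carrier A" "(\<lambda>k. f (c k)) \<in> K \<rightarrow> carrier B"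
    using f_closed by auto
  then show ?case
    using insert f_closed[OF c(1)] map_add[OF c(1) A.finsum_closed[OF c(2)]]
    by (simp add: A.finsum_insert B.finsum_insert)
qed

lemma graded_group_B: "graded_group B"
proof (intro graded_group.intro graded_group_axioms.intro B.abelian_group_axioms)
  show "additive_subgroup (homog B k) B" for k
  proof (rule additive_subgroup.intro, rule subgroup.intro)
    interpret H: additive_subgroup "homog A k" A by (rule A.homog_subgroup)
    show "homog B k \<subseteq> carrier (add_monoid B)"
      unfolding map_homog[symmetric] using homog_closed f_closed by auto
    show "\<one>\<^bsub>add_monoid B\<^esub> \<in> homog B k"
      using imageI[OF H.zero_closed, of f] by (simp add: map_homog map_zero)
  next
    interpret H: additive_subgroup "homog A k" A by (rule A.homog_subgroup)
    fix x y assume "x \<in> homog B k" "y \<in> homog B k"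
    then obtain u v where u: "u \<in> homog A k" "x = f u" and v: "v \<in> homog A k" "y = f v"
      unfolding map_homog[symmetric] by blast
    have "x \<oplus>\<^bsub>B\<^esub> y = f (u \<oplus>\<^bsub>A\<^esub> v)" using u v homog_closed map_add by simp
    then show "x \<otimes>\<^bsub>add_monoid B\<^esub> y \<in> homog B k"
      using imageI[OF H.a_closed[OF u(1) v(1)], of f] by (simp add: map_homog)
  next
    interpret H: additive_subgroup "homog A k" A by (rule A.homog_subgroup)
    fix x assume "x \<in> homog B k"
    then obtain u where u: "u \<in> homog A k" "x = f u" unfolding map_homog[symmetric] by blast
    note uc = homog_closed[OF u(1)]
    have "f (\<ominus>\<^bsub>A\<^esub> u) \<oplus>\<^bsub>B\<^esub> x = \<zero>\<^bsub>B\<^esub>"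
      unfolding u(2) map_add[OF A.a_inv_closed[OF uc] uc, symmetric] A.l_neg[OF uc] map_zero ..
    then have "\<ominus>\<^bsub>B\<^esub> x = f (\<ominus>\<^bsub>A\<^esub> u)"
      using B.minus_equality f_closed[OF A.a_inv_closed[OF uc]] f_closed[OF uc] unfolding u(2) by blast
    then show "inv\<^bsub>add_monoid B\<^esub> x \<in> homog B k"
      using imageI[OF H.a_inv_closed[OF u(1)], of f] by (simp add: map_homog a_inv_def)
  qed
next
  fix x assume "x \<in> carrier B"
  then obtain y where y: "y \<in> carrier A" "x = f y" unfolding image by blast
  from A.homog_decomp[OF y(1)] obtain c where
    c: "\<And>k. c k \<in> homog A k" "finite {k. c k \<noteq> \<zero>\<^bsub>A\<^esub>}" "y = (\<Oplus>\<^bsub>A\<^esub>k\<in>{k. c k \<noteq> \<zero>\<^bsub>A\<^esub>}. c k)"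
    and uniq: "\<And>d. (\<forall>k. d k \<in> homog A k) \<and> finite {k. d k \<noteq> \<zero>\<^bsub>A\<^esub>} \<and> y = (\<Oplus>\<^bsub>A\<^esub>k\<in>{k. d k \<noteq> \<zero>\<^bsub>A\<^esub>}. d k) \<Longrightarrow> d = c"
    by (elim ex1E conjE) blast
  have supp: "{k. f (d k) \<noteq> \<zero>\<^bsub>B\<^esub>} = {k. d k \<noteq> \<zero>\<^bsub>A\<^esub>}" if "\<And>k. d k \<in> homog A k" for d
    using f_eq[OF homog_closed[OF that] A.zero_closed] by (simp only: map_zero)
  have sum: "f (\<Oplus>\<^bsub>A\<^esub>k\<in>{k. d k \<noteq> \<zero>\<^bsub>A\<^esub>}. d k) = (\<Oplus>\<^bsub>B\<^esub>k\<in>{k. f (d k) \<noteq> \<zero>\<^bsub>B\<^esub>}. f (d k))"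
    if "\<And>k. d k \<in> homog A k" "finite {k. d k \<noteq> \<zero>\<^bsub>A\<^esub>}" for d
    unfolding supp[OF that(1)] by (rule map_sum[OF that(2) homog_closed[OF that(1)]])
  show "\<exists>!c. (\<forall>k. c k \<in> homog B k) \<and> finite {k. c k \<noteq> \<zero>\<^bsub>B\<^esub>} \<and> x = (\<Oplus>\<^bsub>B\<^esub>k\<in>{k. c k \<noteq> \<zero>\<^bsub>B\<^esub>}. c k)"
  proof (rule ex1I[of _ "\<lambda>k. f (c k)"], intro conjI allI)
    show "f (c k) \<in> homog B k" for k unfolding map_homog[symmetric] by (rule imageI[OF c(1)])
    show "finite {k. f (c k) \<noteq> \<zero>\<^bsub>B\<^esub>}" unfolding supp[OF c(1)] by (rule c(2))
    show "x = (\<Oplus>\<^bsub>B\<^esub>k\<in>{k. f (c k) \<noteq> \<zero>\<^bsub>B\<^esub>}. f (c k))" unfolding sum[OF c(1,2), symmetric] y(2) using c(3) by simp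
  next
    fix c' assume c': "(\<forall>k. c' k \<in> homog B k) \<and> finite {k. c' k \<noteq> \<zero>\<^bsub>B\<^esub>} \<and> x = (\<Oplus>\<^bsub>B\<^esub>k\<in>{k. c' k \<noteq> \<zero>\<^bsub>B\<^esub>}. c' k)"
    then have "\<forall>k. \<exists>z. z \<in> homog A k \<and> c' k = f z" unfolding map_homog[symmetric] by blast
    then obtain d where d: "\<And>k. d k \<in> homog A k" "\<And>k. c' k = f (d k)" by metis
    have fin: "finite {k. d k \<noteq> \<zero>\<^bsub>A\<^esub>}" using c' unfolding d(2) supp[OF d(1)] by blast
    have cl: "(\<Oplus>\<^bsub>A\<^esub>k\<in>{k. d k \<noteq> \<zero>\<^bsub>A\<^esub>}. d k) \<in> carrier A"
      by (rule A.finsum_closed) (use homog_closed[OF d(1)] in blast)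
    have "f y = f (\<Oplus>\<^bsub>A\<^esub>k\<in>{k. d k \<noteq> \<zero>\<^bsub>A\<^esub>}. d k)"
      using c' unfolding d(2) sum[OF d(1) fin] y(2) by blast
    then have "y = (\<Oplus>\<^bsub>A\<^esub>k\<in>{k. d k \<noteq> \<zero>\<^bsub>A\<^esub>}. d k)" using f_eq[OF y(1) cl] by blast
    then have "d = c" using uniq[of d] d(1) fin by blast
    then show "c' = (\<lambda>k. f (c k))" using d(2) by blast
  qed
qed

end

text \<open>The target is not assumed to be a graded module: all its axioms are transported.\<close>

lemma graded_module_isoI:
  assumes A: "graded_module R A" and B: "graded_transport A B f"
    and smult: "\<And>a x. a \<in> carrier R \<Longrightarrow> x \<in> carrier A \<Longrightarrow> f (a \<odot>\<^bsub>A\<^esub> x) = a \<odot>\<^bsub>B\<^esub> f x"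
  shows "graded_module_iso R A B f"
proof -
  interpret A: graded_module R A by (rule A)
  interpret B: graded_transport A B f by (rule B)
  have "module R B"
  proof (rule moduleI[OF A.R.is_cring B.abelian_group_B])
    fix a x assume a: "a \<in> carrier R" and "x \<in> carrier B"
    then obtain u where u: "u \<in> carrier A" "x = f u" unfolding B.image by blast
    show "a \<odot>\<^bsub>B\<^esub> x \<in> carrier B"
      unfolding u(2) smult[OF a u(1), symmetric] by (rule B.f_closed[OF A.smult_closed[OF a u(1)]])
    fix b assume b: "b \<in> carrier R"
    show "(a \<oplus>\<^bsub>R\<^esub> b) \<odot>\<^bsub>B\<^esub> x = a \<odot>\<^bsub>B\<^esub> x \<oplus>\<^bsub>B\<^esub> b \<odot>\<^bsub>B\<^esub> x"
      unfolding u(2) smult[OF a u(1), symmetric] smult[OF b u(1), symmetric] smult[OF A.R.a_closed[OF a b] u(1), symmetric]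
        B.map_add[OF A.smult_closed[OF a u(1)] A.smult_closed[OF b u(1)], symmetric] A.smult_l_distr[OF a b u(1)] ..
    show "(a \<otimes>\<^bsub>R\<^esub> b) \<odot>\<^bsub>B\<^esub> x = a \<odot>\<^bsub>B\<^esub> (b \<odot>\<^bsub>B\<^esub> x)"
      unfolding u(2) smult[OF b u(1), symmetric] smult[OF A.R.m_closed[OF a b] u(1), symmetric]
        smult[OF a A.smult_closed[OF b u(1)], symmetric] A.smult_assoc1[OF a b u(1)] ..
  next
    fix x assume "x \<in> carrier B"
    then obtain u where u: "u \<in> carrier A" "x = f u" unfolding B.image by blast
    show "\<one>\<^bsub>R\<^esub> \<odot>\<^bsub>B\<^esub> x = x"
      unfolding u(2) smult[OF A.R.one_closed u(1), symmetric] A.smult_one[OF u(1)] ..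
  next
    fix a x y assume a: "a \<in> carrier R" and "x \<in> carrier B" "y \<in> carrier B"
    then obtain u v where u: "u \<in> carrier A" "x = f u" and v: "v \<in> carrier A" "y = f v" unfolding B.image by blast
    show "a \<odot>\<^bsub>B\<^esub> (x \<oplus>\<^bsub>B\<^esub> y) = a \<odot>\<^bsub>B\<^esub> x \<oplus>\<^bsub>B\<^esub> a \<odot>\<^bsub>B\<^esub> y"
      unfolding u(2) v(2) smult[OF a u(1), symmetric] smult[OF a v(1), symmetric] B.map_add[OF u(1) v(1), symmetric]
        smult[OF a A.M.a_closed[OF u(1) v(1)], symmetric]
        B.map_add[OF A.smult_closed[OF a u(1)] A.smult_closed[OF a v(1)], symmetric] A.smult_r_distr[OF a u(1) v(1)] ..
  qed
  moreover have "graded_module_axioms R B"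
  proof
    fix a i x j assume a: "a \<in> homog R i" and "x \<in> homog B j"
    then obtain u where u: "u \<in> homog A j" "x = f u" unfolding B.map_homog[symmetric] by blast
    have "a \<in> carrier R" using a additive_subgroup.a_subset[OF A.R.homog_subgroup] by blast
    then have "a \<odot>\<^bsub>B\<^esub> x = f (a \<odot>\<^bsub>A\<^esub> u)" using smult[OF _ B.homog_closed[OF u(1)]] u(2) by simp
    then show "a \<odot>\<^bsub>B\<^esub> x \<in> homog B (i + j)"
      using imageI[OF A.smult_homog[OF a u(1)], of f] by (simp only: B.map_homog)
  qed
  ultimately have "graded_module R B"
    by (intro graded_module.intro B.graded_group_B A.R.graded_ring_axioms)
  then show ?thesis
    using A B.bij B.map_add smult B.map_homog
    by (intro graded_module_iso.intro graded_module_iso_axioms.intro)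
qed

section \<open>The decomposition\<close>

context poset_pair
begin

text \<open>Extends \<open>Phi_X\<close> and \<open>Phi_Y\<close> from single variables to all
  polynomials in the X_F and Y_G.\<close>

lemma Phi_subst: "Phi h (subst (case_sum X Y) b * p) - inr b * Phi h p \<in> idl (rels h)"
proof (induction b arbitrary: p rule: poly_induct)
  case (Const c)
  then show ?case by (simp add: Phi_scale)
next
  case (Var v)
  show ?case
  proof (cases v)
    case (Inl F)
    show ?thesis unfolding Inl subst_Var sum.case by (rule Phi_X)
  next
    case (Inr G)
    show ?thesis unfolding Inr subst_Var sum.case by (rule Phi_Y)
  qed
next
  case (add b c)
  from idl_add[OF add.IH(1)[of p] add.IH(2)[of p]] show ?case
    by (simp add: Phi_add algebra_simps)
next
  case (mult b c)
  from idl_add[OF mult.IH(1)[of "subst (case_sum X Y) c * p"] idl_mult[OF mult.IH(2)[of p], of "inr b"]]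
  show ?case by (simp add: algebra_simps)
qed

lemma Phi_sum_gmap:
  assumes "h \<in> labels"
  shows "Phi h (\<Sum>k\<in>labels. gmap k (U k)) - U h \<in> idl (rels h)"
proof -
  have "(\<Sum>k\<in>labels. Phi h (gmap k (U k)) - (if h = k then U k else 0)) \<in> idl (rels h)"
    by (rule idl_sum, rule Phi_gmap)
  moreover have "(\<Sum>k\<in>labels. if h = k then U k else 0) = U h"
    using assms by (simp only: sum.delta'[OF finite_labels] if_True)
  ultimately show ?thesis unfolding Phi_sum sum_subtractf by (simp only:)
qed

lemma gmap_homp:
  shows "u \<in> homp d \<Longrightarrow> gmap None u \<in> homp d" and "u \<in> homp d \<Longrightarrow> gmap (Some H) u \<in> homp (Suc d)"
  using homp_mult[OF homp_Var[of H] subst_homp[of "gsub (Some H)", OF gsub_homp, of u d]]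
    subst_homp[of "gsub None", OF gsub_homp, of u d]
  by (simp_all add: gmap_def)

end

text \<open>The projection of \<open>CH(M \<oplus> N)\<close> to the summand with label \<open>h\<close>; here \<open>Q\<close> is the
  presentation of that summand.\<close>

locale projection = two_systems M N + Q: poly_alg_hom B Q
  for M :: "'a matroid" and N :: "'b matroid" and B :: "(rat, 'c) graded"
    and Q :: "(('a set \<times> 'b set) + ('a set + 'b set)) rat_poly \<Rightarrow> 'c" +
  fixes h :: "('a set, 'b set) label"
  assumes kill_rels: "s \<in> PP.rels h \<Longrightarrow> Q s = \<zero>\<^bsub>B\<^esub>"
    and kill_A: "r \<in> relA \<Longrightarrow> Q (inr r) = \<zero>\<^bsub>B\<^esub>"
    and kernel: "Q u = \<zero>\<^bsub>B\<^esub> \<Longrightarrow> PP.gmap h u \<in> idl relS"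
    and surj: "carrier B = range Q"
    and homog_eq: "homog B k = Q ` homp k"
begin

lemma Q_cong: "p - q \<in> idl (PP.rels h) \<Longrightarrow> Q p = Q q"
  using Q.idl_kill[of "p - q" "PP.rels h", OF _ kill_rels] Q.B.minus_eq_zeroD[of "Q p" "Q q"] by simp

lemma Q_Phi_subst: "Q (PP.Phi h (subst (case_sum PP.X PP.Y) b * p)) = Q (inr b) \<otimes>\<^bsub>B\<^esub> Q (PP.Phi h p)"
  using Q_cong[OF PP.Phi_subst] by simp

text \<open>Monomial relations already die under \<open>Phi\<close>. A linear relation is the
  substitution instance of an element of \<open>relA\<close>, so \<open>Q_Phi_subst\<close> splits
  off a factor that is zero in the summand. Thus the coordinates descend to the Chow ring.\<close>

lemma Q_Phi_zero:
  assumes "p \<in> idl relS"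
  shows "Q (PP.Phi h p) = \<zero>\<^bsub>B\<^esub>"
  using assms
proof (induction rule: idl.induct)
  case zero
  then show ?case by simp
next
  case (step s p a)
  have lin: "Q (PP.Phi h (a * subst (case_sum PP.X PP.Y) b)) = \<zero>\<^bsub>B\<^esub>" if "b \<in> relA" for b
    using Q_Phi_subst[of b a] kill_A[OF that] by (simp add: mult.commute)
  from step(1) have "Q (PP.Phi h (a * s)) = \<zero>\<^bsub>B\<^esub>"
  proof (cases rule: relS_cases)
    case 1
    then have "PP.Phi h (a * s) = 0" by (intro PP.Phi_idl idl_mult_gen)
    then show ?thesis by simp
  next
    case (2 i)
    let ?b = "inl (\<Sum>w\<in>{w \<in> M.L. i \<notin> w}. Var w)"
    have e: "{w \<in> M.L. i \<notin> w} = {F \<in> flats M. i \<notin> F}" using 2(1) by blast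
    have "(\<Sum>w\<in>{w \<in> M.L. i \<notin> w}. Var w) \<in> relM" unfolding relM_eq using 2(1) by blast
    then have b: "?b \<in> relA" by blast
    have "subst (case_sum PP.X PP.Y) ?b = s" unfolding e 2(2) by simp
    then show ?thesis using lin[OF b] by (simp only:)
  next
    case (3 j)
    let ?b = "inr (\<Sum>w\<in>{w \<in> N.L. j \<notin> w}. Var w)"
    have e: "{w \<in> N.L. j \<notin> w} = {F \<in> flats N. j \<notin> F}" using 3(1) by blast
    have "(\<Sum>w\<in>{w \<in> N.L. j \<notin> w}. Var w) \<in> relN" unfolding relN_eq using 3(1) by blast
    then have b: "?b \<in> relA" by blast
    have "subst (case_sum PP.X PP.Y) ?b = s" unfolding e 3(2) by simp
    then show ?thesis using lin[OF b] by (simp only:)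
  qed
  then show ?case using step(3) by (simp add: PP.Phi_add)
qed

end

definition (in two_systems) proj ::
  "((('a set \<times> 'b set) + ('a set + 'b set)) rat_poly \<Rightarrow> 'c) \<Rightarrow> ('a set, 'b set) label \<Rightarrow> ('a + 'b) chow \<Rightarrow> 'c" where
  "proj Q h x = Q (PP.Phi h (SOME p. chS p = x))"

lemma (in projection) proj_eval: "proj Q h (chS p) = Q (PP.Phi h p)"
proof -
  have "chS (SOME q. chS q = chS p) = chS p" by (rule someI) (rule refl)
  then have "Q (PP.Phi h ((SOME q. chS q = chS p) - p)) = \<zero>\<^bsub>B\<^esub>"
    unfolding pres.eq_iff[OF pres_S] by (rule Q_Phi_zero)
  then show ?thesis
    unfolding proj_def using Q.B.minus_eq_zeroD by (simp add: PP.Phi_minus)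
qed

text \<open>Here \<open>FV K\<close> stands for the action of x_K on the summand, whereas in
  \<open>chW\<close> it is a generator of the contraction; \<open>tau\<close> translates between the
  two.\<close>

definition (in two_flats) quo :: "(('a set \<times> 'b set) + ('a set + 'b set)) rat_poly \<Rightarrow> _" where
  "quo u = chW (subst tau u)"

lemma (in two_flats) projection_quo: "projection M N (summand_ring M N F G) quo (Some H)"
proof -
  interpret W: pres W chW relW by (rule pres_W)
  have q: "poly_hom W (chW \<circ> subst tau)" by (rule alg_hom_comp[OF subst_hom W.alg_hom_axioms])
  have quo: "quo = chW \<circ> subst tau" by (rule ext) (simp only: quo_def comp_apply)
  have carr: "chW p = quo (subst tau' p)" for p unfolding quo_def tau_tau' ..
  show ?thesis
  proof (intro projection.intro projection_axioms.intro MN.two_systems_axioms, unfold W_eq)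
    show "poly_alg_hom W quo" unfolding quo using q by (rule poly_alg_hom.intro)
    show "quo s = \<zero>\<^bsub>W\<^esub>" if "s \<in> MN.PP.rels (Some H)" for s
      unfolding quo_def W.kernel by (rule tau_rels[OF that])
    show "quo (inr s) = \<zero>\<^bsub>W\<^esub>" if "s \<in> MN.relA" for s
      unfolding quo_def W.kernel by (rule tau_relA[OF that])
    show "MN.PP.gmap (Some H) u \<in> idl MN.relS" if "quo u = \<zero>\<^bsub>W\<^esub>" for u
      using that unfolding quo_def by (rule gmap_kernel)
    show "carrier W = range quo"
      unfolding W.surj using carr by (auto simp: quo_def)
    show "homog W k = quo ` homp k" for k
      unfolding W.homog_eq
    proof
      show "chW ` homp k \<subseteq> quo ` homp k"
        unfolding carr using subst_homp[of tau', OF tau'_homp] by blast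
      show "quo ` homp k \<subseteq> chW ` homp k"
        unfolding quo_def using subst_homp[of tau, OF tau_homp] by blast
    qed
  qed
qed

context two_systems
begin

text \<open>No pair lies below the label \<open>None\<close>, so the variables \<open>KV\<close> are
  set to 0.\<close>

definition quo0 :: "(('a set \<times> 'b set) + ('a set + 'b set)) rat_poly \<Rightarrow> _" where
  "quo0 u = chA (subst (case_sum (\<lambda>K. 0) Var) u)"

lemma subst_drop_inr: "subst (case_sum (\<lambda>K. 0) Var) (inr p) = p"
  by (simp add: subst_subst subst_ident)

lemma projection_quo0: "projection M N A quo0 None"
proof -
  interpret A: pres A chA relA by (rule pres_A)
  let ?d = "case_sum (\<lambda>K. 0) Var :: ('a set \<times> 'b set) + ('a set + 'b set) \<Rightarrow> _"
  have q: "poly_hom A (chA \<circ> subst ?d)" by (rule alg_hom_comp[OF subst_hom A.alg_hom_axioms])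
  have quo0: "quo0 = chA \<circ> subst ?d" by (rule ext) (simp only: quo0_def comp_apply)
  have carr: "chA p = quo0 (inr p)" for p unfolding quo0_def subst_drop_inr ..
  have d: "?d v \<in> homp 1" for v by (cases v) (simp_all only: sum.case homp_zero homp_Var)
  have relA: "inl r \<in> idl relA" if "r \<in> relM" for r using that by (intro idl_gen) blast
  have relA': "inr r \<in> idl relA" if "r \<in> relN" for r using that by (intro idl_gen) blast
  show ?thesis
  proof (intro projection.intro projection_axioms.intro two_systems_axioms)
    show "poly_alg_hom A quo0" unfolding quo0 using q by (rule poly_alg_hom.intro)
    show "quo0 s = \<zero>\<^bsub>A\<^esub>" if "s \<in> PP.rels None" for s
      unfolding quo0_def A.kernel
    proof -
      from that consider K where "s = Var (Inl K)" | F where "s = Var (Inr (Inl F))" "F \<notin> M.L" | G where "s = Var (Inr (Inr G))" "G \<notin> N.L"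
        | K K' where "s = Var (Inl K) * Var (Inl K')"
        | K K' where "s = Var (Inr (Inl K)) * Var (Inr (Inl K'))" "K \<in> M.L" "K' \<in> M.L" "\<not> K \<le> K'" "\<not> K' \<le> K"
        | K K' where "s = Var (Inr (Inr K)) * Var (Inr (Inr K'))" "K \<in> N.L" "K' \<in> N.L" "\<not> K \<le> K'" "\<not> K' \<le> K"
        unfolding PP.rels_def PP.extra_rels.simps Un_iff mem_Collect_eq empty_iff
        by - (elim disjE exE conjE; (erule FalseE | (rule that; assumption)))
      then show "subst ?d s \<in> idl relA"
      proof cases
        case (2 F)
        then have "Var F \<in> relM" unfolding relM_eq by blast
        from relA[OF this] show ?thesis unfolding 2(1) by (simp only: subst_Var sum.case)
      next
        case (3 F)
        then have "Var F \<in> relN" unfolding relN_eq by blast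
        from relA'[OF this] show ?thesis unfolding 3(1) by (simp only: subst_Var sum.case)
      next
        case (5 K K')
        then have "Var K * Var K' \<in> relM" unfolding relM_eq by blast
        from relA[OF this] show ?thesis unfolding 5(1) by (simp only: subst_Var subst_simps sum.case)
      next
        case (6 K K')
        then have "Var K * Var K' \<in> relN" unfolding relN_eq by blast
        from relA'[OF this] show ?thesis unfolding 6(1) by (simp only: subst_Var subst_simps sum.case)
      qed (simp_all only: subst_Var subst_simps sum.case mult_zero_left idl.zero)
    qed
    show "quo0 (inr s) = \<zero>\<^bsub>A\<^esub>" if "s \<in> relA" for s
      unfolding carr[symmetric] A.kernel by (rule idl_gen[OF that])
    show "PP.gmap None u \<in> idl relS" if "quo0 u = \<zero>\<^bsub>A\<^esub>" for u
    proof -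
      have "subst ?d u \<in> idl relA" using that unfolding quo0_def A.kernel .
      then have "subst (case_sum PP.X PP.Y) (subst ?d u) \<in> idl relS"
      proof (rule idl_subst)
        fix s assume "s \<in> relA"
        then consider r where "r \<in> relM" "s = inl r" | r where "r \<in> relN" "s = inr r" by blast
        then show "subst (case_sum PP.X PP.Y) s \<in> idl relS"
        proof cases
          case 1
          show ?thesis using subst_X_rel[OF 1(1)] unfolding 1(2) by (simp only: subst_subst subst_Var sum.case)
        next
          case 2
          show ?thesis using subst_Y_rel[OF 2(1)] unfolding 2(2) by (simp only: subst_subst subst_Var sum.case)
        qed
      qed
      moreover have "subst (case_sum PP.X PP.Y) (?d v) = PP.gsub None v" for v
        unfolding PP.gsub_def by (cases v) (simp_all only: sum.case subst_simps subst_Var PP.below.simps if_False)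
      ultimately show ?thesis unfolding PP.gmap_def PP.base.simps mult_1_left subst_subst by (simp only:)
    qed
    show "carrier A = range quo0"
      unfolding A.surj using carr by (auto simp: quo0_def)
    show "homog A k = quo0 ` homp k" for k
      unfolding A.homog_eq
    proof
      have "inr p \<in> homp k" if "p \<in> homp k" for p :: "('a set + 'b set) rat_poly"
        by (rule subst_homp[OF homp_Var that])
      then show "chA ` homp k \<subseteq> quo0 ` homp k" unfolding carr by blast
      show "quo0 ` homp k \<subseteq> chA ` homp k"
        unfolding quo0_def using subst_homp[of ?d, OF d] by blast
    qed
  qed
qed

end

context projection
begin

lemma proj_closed: "proj Q h (chS p) \<in> carrier B"
  unfolding proj_eval by (rule Q.p_closed)

lemma proj_add: "proj Q h (chS (p + q)) = proj Q h (chS p) \<oplus>\<^bsub>B\<^esub> proj Q h (chS q)"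
  unfolding proj_eval PP.Phi_add by (rule Q.p_add)

lemma proj_mult: "proj Q h (chS (subst (case_sum PP.X PP.Y) b * p)) = Q (inr b) \<otimes>\<^bsub>B\<^esub> proj Q h (chS p)"
  unfolding proj_eval by (rule Q_Phi_subst)

lemma proj_eqD:
  assumes "proj Q h (chS p) = proj Q h (chS q)"
  shows "PP.gmap h (PP.Phi h (p - q)) \<in> idl relS"
proof (rule kernel)
  have "Q (PP.Phi h p) = Q (PP.Phi h q)" using assms unfolding proj_eval .
  then show "Q (PP.Phi h (p - q)) = \<zero>\<^bsub>B\<^esub>"
    unfolding PP.Phi_minus Q.p_minus by (simp add: a_minus_def Q.B.r_neg)
qed

lemma proj_gmap: "h \<in> PP.labels \<Longrightarrow> proj Q h (chS (\<Sum>k\<in>PP.labels. PP.gmap k (U k))) = Q (U h)"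
  unfolding proj_eval by (rule Q_cong[OF PP.Phi_sum_gmap])

end

section \<open>Assembling the projections into an isomorphism\<close>

context two_systems
begin

lemma two_flats:
  assumes "H \<in> PP.good"
  shows "two_flats M N (fst H) (snd H)"
proof -
  have "fst H \<in> flats M" "fst H \<noteq> ground M" "snd H \<in> flats N" "snd H \<noteq> ground N"
    using assms unfolding mem_Times_iff by blast+
  then show ?thesis
    by (intro two_flats.intro one_flat.intro one_flat_axioms.intro M.flat_system_axioms N.flat_system_axioms)
qed

abbreviation "sum_ring H \<equiv> summand_ring M N (fst H) (snd H)"
abbreviation "sum_quo H \<equiv> two_flats.quo M N (fst H) (snd H)"
abbreviation "sum_act H \<equiv> summand_action M N (fst H) (snd H)"
abbreviation "LHS \<equiv> restrict_scalars (iota M N) (CH S)"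
abbreviation "RHS \<equiv> sum_module (restrict_scalars id A) (big_sum_module PP.good (\<lambda>(F, G). summand M N F G))"

lemma LHS_simps:
  "carrier LHS = carrier (CH S)" "add LHS = add (CH S)" "zero LHS = zero (CH S)" "homog LHS = homog (CH S)"
  "smult LHS a x = iota M N a \<otimes>\<^bsub>CH S\<^esub> x"
  by (simp_all add: restrict_scalars_def)

lemma summand_simps:
  "carrier (summand M N F G) = carrier (summand_ring M N F G)" "add (summand M N F G) = add (summand_ring M N F G)"
  "zero (summand M N F G) = zero (summand_ring M N F G)"
  "smult (summand M N F G) r x = summand_action M N F G r \<otimes>\<^bsub>summand_ring M N F G\<^esub> x"
  "homog (summand M N F G) k = (if k = 0 then {\<zero>\<^bsub>summand_ring M N F G\<^esub>} else homog (summand_ring M N F G) (k - 1))"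
  by (simp_all add: summand_def shift_def restrict_scalars_def)

lemma RHS_simps:
  "carrier RHS = carrier A \<times> (\<Pi>\<^sub>E H\<in>PP.good. carrier (sum_ring H))"
  "add RHS (a, b) (a', b') = (a \<oplus>\<^bsub>A\<^esub> a', \<lambda>H\<in>PP.good. b H \<oplus>\<^bsub>sum_ring H\<^esub> b' H)"
  "zero RHS = (\<zero>\<^bsub>A\<^esub>, \<lambda>H\<in>PP.good. \<zero>\<^bsub>sum_ring H\<^esub>)"
  "homog RHS k = homog A k \<times> (\<Pi>\<^sub>E H\<in>PP.good. if k = 0 then {\<zero>\<^bsub>sum_ring H\<^esub>} else homog (sum_ring H) (k - 1))"
  "smult RHS r (a, b) = (r \<otimes>\<^bsub>A\<^esub> a, \<lambda>H\<in>PP.good. sum_act H r \<otimes>\<^bsub>sum_ring H\<^esub> b H)"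
  by (simp_all add: sum_module_def big_sum_module_def restrict_scalars_def summand_simps case_prod_unfold)

lemma graded_module_LHS: "graded_module A LHS"
proof -
  interpret S: pres "CH S" chS relS by (rule pres_S)
  interpret A: pres A chA relA by (rule pres_A)
  interpret I: alg_hom A "CH S" "iota M N" by (rule iota)
  have "graded_transport (CH S) LHS id"
    by (intro graded_transport.intro graded_transport_axioms.intro graded_ring.axioms(2)[OF S.graded_ring])
      (simp_all add: LHS_simps bij_betw_def)
  then have g: "graded_group LHS" by (rule graded_transport.graded_group_B)
  have "module A LHS"
  proof (rule moduleI[OF A.B.is_cring graded_group.axioms(1)[OF g]])
  qed (simp_all add: LHS_simps S.B.l_distr S.B.r_distr S.B.m_assoc)
  moreover have "graded_module_axioms A LHS"
  proof
    fix a i x j assume "a \<in> homog A i" and x: "x \<in> homog LHS j"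
    then obtain p where p: "p \<in> homp i" "a = chA p" unfolding A.homog_eq by blast
    obtain q where q: "q \<in> homp j" "x = chS q" using x unfolding LHS_simps S.homog_eq by blast
    have v: "case_sum PP.X PP.Y v \<in> homp 1" for v
      by (cases v) (simp_all only: sum.case PP.X_homp PP.Y_homp)
    have "a \<odot>\<^bsub>LHS\<^esub> x = chS (subst (case_sum PP.X PP.Y) p * q)"
      unfolding LHS_simps p(2) q(2) iota_eval S.p_mult ..
    then show "a \<odot>\<^bsub>LHS\<^esub> x \<in> homog LHS (i + j)"
      unfolding LHS_simps S.homog_eq
      using homp_mult[OF subst_homp[of "case_sum PP.X PP.Y", OF v p(1)] q(1)] by blast
  qed
  ultimately show ?thesis by (intro graded_module.intro A.graded_ring g)
qed

definition decompose :: "('a + 'b) chow \<Rightarrow> _" where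
  "decompose x = (proj quo0 None x, \<lambda>H\<in>PP.good. proj (sum_quo H) (Some H) x)"

lemma projection_sum_quo: "H \<in> PP.good \<Longrightarrow> projection M N (sum_ring H) (sum_quo H) (Some H)"
  using two_flats.projection_quo[OF two_flats, of H] by (simp only: prod.collapse)

text \<open>An element with prescribed components is the sum of the realizations of polynomials
  representing them.\<close>

lemma decompose_gmap:
  "decompose (chS (\<Sum>k\<in>PP.labels. PP.gmap k (U k))) = (quo0 (U None), \<lambda>H\<in>PP.good. sum_quo H (U (Some H)))"
  unfolding decompose_def
proof (rule arg_cong2[where f = Pair])
  show "proj quo0 None (chS (\<Sum>k\<in>PP.labels. PP.gmap k (U k))) = quo0 (U None)"
    by (rule projection.proj_gmap[OF projection_quo0 insertI1])
  show "(\<lambda>H\<in>PP.good. proj (sum_quo H) (Some H) (chS (\<Sum>k\<in>PP.labels. PP.gmap k (U k)))) =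
      (\<lambda>H\<in>PP.good. sum_quo H (U (Some H)))"
    by (rule restrict_ext, rule projection.proj_gmap[OF projection_sum_quo], assumption, rule insertI2, rule imageI)
qed

lemma PiE_eqI:
  assumes "b \<in> (\<Pi>\<^sub>E H\<in>I. X H)" "\<And>H. H \<in> I \<Longrightarrow> f H = b H"
  shows "(\<lambda>H\<in>I. f H) = b"
  using assms by (auto simp: fun_eq_iff restrict_def PiE_def extensional_def)

text \<open>Injectivity combines the kernel property of the projections with
  \<open>Phi_recon\<close>. Surjectivity, also degree by degree, comes from
  \<open>decompose_gmap\<close>.\<close>

lemma graded_transport_decompose: "graded_transport LHS RHS decompose"
proof -
  interpret S: pres "CH S" chS relS by (rule pres_S)
  interpret G: graded_module A LHS by (rule graded_module_LHS)
  interpret P0: projection M N A quo0 None by (rule projection_quo0)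
  note PH = projection_sum_quo
  have inj: "chS p = chS q" if eq: "decompose (chS p) = decompose (chS q)" for p q
  proof -
    have e0: "proj quo0 None (chS p) = proj quo0 None (chS q)"
      and eH: "(\<lambda>H\<in>PP.good. proj (sum_quo H) (Some H) (chS p)) = (\<lambda>H\<in>PP.good. proj (sum_quo H) (Some H) (chS q))"
      by (rule Pair_inject[OF eq[unfolded decompose_def]], assumption)+
    have "PP.gmap h (PP.Phi h (p - q)) \<in> idl relS" if h: "h \<in> PP.labels" for h
    proof (cases h)
      case None
      show ?thesis unfolding None by (rule P0.proj_eqD[OF e0])
    next
      case (Some H)
      then have H: "H \<in> PP.good" using h by blast
      have "proj (sum_quo H) (Some H) (chS p) = proj (sum_quo H) (Some H) (chS q)"
        using fun_cong[OF eH, of H] unfolding restrict_def if_P[OF H] .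
      then show ?thesis unfolding Some by (rule projection.proj_eqD[OF PH[OF H]])
    qed
    then have "(\<Sum>h\<in>PP.labels. PP.gmap h (PP.Phi h (p - q))) \<in> idl relS" by (rule idl_sum)
    from idl_add[OF sr_relS[OF PP.Phi_recon[of "p - q"]] this] have "p - q \<in> idl relS"
      by (simp only: diff_add_cancel)
    then show ?thesis unfolding S.eq_iff .
  qed
  have closed: "decompose (chS p) \<in> carrier RHS" for p
    unfolding decompose_def RHS_simps
    using P0.proj_closed projection.proj_closed[OF PH] by (intro SigmaI restrict_PiE_iff[THEN iffD2] ballI)
  have compose: "(a, b) = decompose (chS (\<Sum>k\<in>PP.labels. PP.gmap k (case_option u0 u k)))"
    if "a = quo0 u0" "b \<in> (\<Pi>\<^sub>E H\<in>PP.good. X H)" "\<And>H. H \<in> PP.good \<Longrightarrow> b H = sum_quo H (u H)" for a b u0 u X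
  proof -
    have "(\<lambda>H\<in>PP.good. sum_quo H (u H)) = b" by (rule PiE_eqI[OF that(2)]) (simp only: that(3))
    then show ?thesis unfolding decompose_gmap option.case that(1) by (simp only:)
  qed
  have surj: "y \<in> decompose ` carrier LHS" if "y \<in> carrier RHS" for y
  proof -
    obtain a b where y: "y = (a, b)" by (rule prod.exhaust)
    have a: "a \<in> carrier A" and b: "b \<in> (\<Pi>\<^sub>E H\<in>PP.good. carrier (sum_ring H))"
      using that unfolding RHS_simps y by (rule SigmaD1, rule SigmaD2)
    obtain u0 where u0: "a = quo0 u0" using a unfolding P0.surj by (rule imageE)
    have "\<forall>H\<in>PP.good. \<exists>v. b H = sum_quo H v"
    proof
      fix H assume H: "H \<in> PP.good"
      have "b H \<in> range (sum_quo H)" using PiE_mem[OF b H] unfolding projection.surj[OF PH[OF H]] .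
      then show "\<exists>v. b H = sum_quo H v" by (rule imageE) (rule exI)
    qed
    then obtain u where u: "\<forall>H\<in>PP.good. b H = sum_quo H (u H)" by (rule bchoice[THEN exE])
    have bu: "b H = sum_quo H (u H)" if "H \<in> PP.good" for H using u that by blast
    have "y = decompose (chS (\<Sum>k\<in>PP.labels. PP.gmap k (case_option u0 u k)))"
      unfolding y by (rule compose[OF u0 b]) (rule bu)
    then show ?thesis unfolding LHS_simps using S.p_closed by (rule image_eqI)
  qed
  have homog1: "decompose x \<in> homog RHS k" if x: "x \<in> homog LHS k" for x k
  proof -
    obtain p where p: "p \<in> homp k" "x = chS p" using x unfolding LHS_simps S.homog_eq by blast
    have "proj quo0 None (chS p) \<in> homog A k"
      unfolding P0.proj_eval P0.homog_eq by (rule imageI[OF PP.Phi_homp(1)[OF p(1)]])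
    moreover have "proj (sum_quo H) (Some H) (chS p) \<in> (if k = 0 then {\<zero>\<^bsub>sum_ring H\<^esub>} else homog (sum_ring H) (k - 1))"
      if "H \<in> PP.good" for H
    proof -
      interpret P: projection M N "sum_ring H" "sum_quo H" "Some H" by (rule PH[OF that])
      show ?thesis
      proof (cases "k = 0")
        case True
        then show ?thesis unfolding P.proj_eval PP.Phi_homp(3)[OF p(1) True] P.Q.p_zero by simp
      next
        case False
        then have "0 < k" by simp
        from imageI[OF PP.Phi_homp(2)[OF p(1) this], of "sum_quo H"]
        show ?thesis unfolding P.proj_eval if_not_P[OF False] P.homog_eq .
      qed
    qed
    ultimately show ?thesis unfolding p(2) decompose_def RHS_simps by (intro SigmaI restrict_PiE_iff[THEN iffD2] ballI)
  qed
  have homog2: "y \<in> decompose ` homog LHS k" if "y \<in> homog RHS k" for y k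
  proof -
    let ?X = "\<lambda>H. if k = 0 then {\<zero>\<^bsub>sum_ring H\<^esub>} else homog (sum_ring H) (k - 1)"
    obtain a b where y: "y = (a, b)" by (rule prod.exhaust)
    have a: "a \<in> homog A k" and b: "b \<in> (\<Pi>\<^sub>E H\<in>PP.good. ?X H)"
      using that unfolding RHS_simps y by (rule SigmaD1, rule SigmaD2)
    obtain u0 where u0: "a = quo0 u0" "u0 \<in> homp k" using a unfolding P0.homog_eq by (rule imageE)
    \<comment> \<open>Homogeneity is stated for the realization of v. This covers both k = 0, where
      v = 0, and k > 0, where x_H raises the degree from k - 1 to k.\<close>
    have "\<forall>H\<in>PP.good. \<exists>v. b H = sum_quo H v \<and> PP.gmap (Some H) v \<in> homp k"
    proof
      fix H assume H: "H \<in> PP.good"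
      interpret P: projection M N "sum_ring H" "sum_quo H" "Some H" by (rule PH[OF H])
      have bH: "b H \<in> ?X H" by (rule PiE_mem[OF b H])
      show "\<exists>v. b H = sum_quo H v \<and> PP.gmap (Some H) v \<in> homp k"
      proof (cases "k = 0")
        case True
        have "b H = sum_quo H 0" using bH unfolding if_P[OF True] P.Q.p_zero by (rule singletonD)
        then show ?thesis unfolding True by (intro exI[of _ 0]) (simp add: PP.gmap_simps)
      next
        case False
        then obtain v where v: "b H = sum_quo H v" "v \<in> homp (k - 1)"
          using bH unfolding if_not_P[OF False] P.homog_eq by (rule_tac imageE)
        have "Suc (k - 1) = k" using False by simp
        then show ?thesis using v PP.gmap_homp(2)[OF v(2), of H] by (intro exI[of _ v]) (simp only: simp_thms)
      qed
    qed
    then obtain u where u: "\<forall>H\<in>PP.good. b H = sum_quo H (u H) \<and> PP.gmap (Some H) (u H) \<in> homp k"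
      by (rule bchoice[THEN exE])
    have bu: "b H = sum_quo H (u H)" if "H \<in> PP.good" for H using u that by blast
    have "PP.gmap h (case_option u0 u h) \<in> homp k" if "h \<in> PP.labels" for h
      using that u PP.gmap_homp(1)[OF u0(2)] by (cases h) (simp_all only: option.case, blast)
    then have "(\<Sum>h\<in>PP.labels. PP.gmap h (case_option u0 u h)) \<in> homp k" by (rule homp_sum)
    then have "chS (\<Sum>h\<in>PP.labels. PP.gmap h (case_option u0 u h)) \<in> homog LHS k"
      unfolding LHS_simps S.homog_eq by (rule imageI)
    moreover have "y = decompose (chS (\<Sum>h\<in>PP.labels. PP.gmap h (case_option u0 u h)))"
      unfolding y by (rule compose[OF u0(1) b]) (rule bu)
    ultimately show ?thesis by (rule rev_image_eqI)
  qed
  have S: "\<exists>p. x = chS p" if "x \<in> carrier LHS" for x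
    using that unfolding LHS_simps S.surj by blast
  show ?thesis
  proof (intro graded_transport.intro graded_transport_axioms.intro G.graded_group_axioms)
    have "inj_on decompose (carrier LHS)"
    proof (rule inj_onI)
      fix x y assume "x \<in> carrier LHS" "y \<in> carrier LHS" and eq: "decompose x = decompose y"
      then obtain p q where "x = chS p" "y = chS q" using S by metis
      then show "x = y" using inj[of p q] eq by (simp only:)
    qed
    moreover have "decompose ` carrier LHS = carrier RHS"
    proof
      show "decompose ` carrier LHS \<subseteq> carrier RHS"
      proof (rule image_subsetI)
        fix x assume "x \<in> carrier LHS"
        then obtain p where "x = chS p" using S by metis
        then show "decompose x \<in> carrier RHS" using closed[of p] by (simp only:)
      qed
      show "carrier RHS \<subseteq> decompose ` carrier LHS" using surj by (rule subsetI)
    qed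
    ultimately show "bij_betw decompose (carrier LHS) (carrier RHS)" by (rule bij_betw_imageI)
    show "decompose (x \<oplus>\<^bsub>LHS\<^esub> y) = decompose x \<oplus>\<^bsub>RHS\<^esub> decompose y"
      if xy: "x \<in> carrier LHS" "y \<in> carrier LHS" for x y
    proof -
      obtain p q where pq: "x = chS p" "y = chS q" using S[OF xy(1)] S[OF xy(2)] by blast
      have x: "x \<oplus>\<^bsub>LHS\<^esub> y = chS (p + q)" unfolding pq LHS_simps S.p_add ..
      show ?thesis
        unfolding x unfolding pq decompose_def RHS_simps P0.proj_add
      proof (rule arg_cong2[where f = Pair, OF refl], rule restrict_ext)
        fix H assume H: "H \<in> PP.good"
        show "proj (sum_quo H) (Some H) (chS (p + q)) =
          (\<lambda>H\<in>PP.good. proj (sum_quo H) (Some H) (chS p)) H \<oplus>\<^bsub>sum_ring H\<^esub> (\<lambda>H\<in>PP.good. proj (sum_quo H) (Some H) (chS q)) H"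
          unfolding restrict_def if_P[OF H] by (rule projection.proj_add[OF PH[OF H]])
      qed
    qed
    have "(\<Sum>k\<in>PP.labels. PP.gmap k (case_option 0 (\<lambda>_. 0) k)) = 0"
      by (rule sum.neutral) (auto simp: PP.gmap_simps split: option.splits)
    then have "decompose (chS 0) = (quo0 0, \<lambda>H\<in>PP.good. sum_quo H 0)"
      using decompose_gmap[of "case_option 0 (\<lambda>_. 0)"] by (simp only: option.case)
    moreover have "(\<lambda>H\<in>PP.good. sum_quo H 0) = (\<lambda>H\<in>PP.good. \<zero>\<^bsub>sum_ring H\<^esub>)"
    proof (rule restrict_ext)
      fix H assume H: "H \<in> PP.good"
      interpret P: projection M N "sum_ring H" "sum_quo H" "Some H" by (rule PH[OF H])
      show "sum_quo H 0 = \<zero>\<^bsub>sum_ring H\<^esub>" by (rule P.Q.p_zero)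
    qed
    ultimately show "decompose \<zero>\<^bsub>LHS\<^esub> = \<zero>\<^bsub>RHS\<^esub>"
      unfolding LHS_simps RHS_simps S.p_zero P0.Q.p_zero by (simp only:)
    show "decompose ` homog LHS k = homog RHS k" for k
    proof
      show "decompose ` homog LHS k \<subseteq> homog RHS k" using homog1 by (rule image_subsetI)
      show "homog RHS k \<subseteq> decompose ` homog LHS k" using homog2 by (rule subsetI)
    qed
  qed
qed

text \<open>A scalar represented by the polynomial b acts on the left through the substitution of X
  and Y into b and on every summand through \<open>inr b\<close>; \<open>proj_mult\<close> says that
  the projections relate the two.\<close>

lemma graded_module_iso_decompose: "graded_module_iso A LHS RHS decompose"
proof (rule graded_module_isoI[OF graded_module_LHS graded_transport_decompose])
  interpret S: pres "CH S" chS relS by (rule pres_S)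
  interpret A: pres A chA relA by (rule pres_A)
  interpret P0: projection M N A quo0 None by (rule projection_quo0)
  fix a x assume "a \<in> carrier A" "x \<in> carrier LHS"
  then obtain b p where bp: "a = chA b" "x = chS p" unfolding LHS_simps A.surj S.surj by blast
  have ax: "a \<odot>\<^bsub>LHS\<^esub> x = chS (subst (case_sum PP.X PP.Y) b * p)"
    unfolding bp LHS_simps iota_eval S.p_mult ..
  have q0: "quo0 (inr b) = a" unfolding quo0_def subst_drop_inr bp ..
  show "decompose (a \<odot>\<^bsub>LHS\<^esub> x) = a \<odot>\<^bsub>RHS\<^esub> decompose x"
    unfolding ax unfolding bp(2) decompose_def RHS_simps P0.proj_mult q0
  proof (rule arg_cong2[where f = Pair, OF refl], rule restrict_ext)
    fix H assume H: "H \<in> PP.good"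
    have act: "sum_act H a = sum_quo H (inr b)"
      unfolding two_flats.quo_def[OF two_flats[OF H]] bp(1) by (rule two_flats.act_eval[OF two_flats[OF H]])
    show "proj (sum_quo H) (Some H) (chS (subst (case_sum PP.X PP.Y) b * p)) =
      sum_act H a \<otimes>\<^bsub>sum_ring H\<^esub> (\<lambda>H\<in>PP.good. proj (sum_quo H) (Some H) (chS p)) H"
      unfolding restrict_def if_P[OF H] act by (rule projection.proj_mult[OF projection_sum_quo[OF H]])
  qed
qed

end

lemma (in loopless_matroid) flat_system: "flat_system M"
  using finite_ground flats_subset ground_flat empty_flat by unfold_locales

theorem theorem1p3:
  fixes M :: "'a matroid" and N :: "'b matroid"
  assumes "loopless_matroid M" and "loopless_matroid N"
  shows "\<exists>f. graded_module_iso
    (tensor (CH M) (CH N))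
    (restrict_scalars (iota M N) (CH (matroid_sum M N)))
    (sum_module
      (restrict_scalars id (tensor (CH M) (CH N)))
      (big_sum_module
        {(F, G). F \<in> flats M \<and> F \<subset> ground M \<and> G \<in> flats N \<and> G \<subset> ground N}
        (\<lambda>(F, G). summand M N F G)))
    f"
proof -
  interpret M: loopless_matroid M by (rule assms)
  interpret N: loopless_matroid N by (rule assms)
  interpret two_systems M N by (intro two_systems.intro M.flat_system N.flat_system)
  have "{(F, G). F \<in> flats M \<and> F \<subset> ground M \<and> G \<in> flats N \<and> G \<subset> ground N} =
      (flats M - {ground M}) \<times> (flats N - {ground N})"
    using M.flats_subset N.flats_subset by blast
  then show ?thesis using graded_module_iso_decompose by (simp only:) (rule exI)
qed

end
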